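(* Let $k$ be a field of characteristic $p \geq 3$ and $A:= k[Y]$ the polynomial Hopf algebra. Then: (1) A Hopf algebra $E$ is isomorphic to a crossed product of Hopf algebras $A \# H_{4}$ if and only if $E \simeq A_{((\alpha_i)_{i \geq 0})}$, for some $(\alpha_{i})_{i\geq 0} \in k^{(\mathbb{N})}$, where $A_{((\alpha_i)_{i \geq 0})}$ is the infinite dimensional Hopf algebra generated by $Y$, $g$ and $x$, subject to the relations $$g^{2} = 1, \quad x^{2} = \sum_{i \geq 0} \alpha_{i}Y^{p^{i}}, \quad xg = - gx, \quad gY = Yg, \quad xY = Yx$$ and with the coalgebra structure given such that $Y$ is a primitive element, $g$ is a group-like element and $x$ is $(1, g)$-primitive. Furthermore, there are isomorphisms of groups $$\mathrm{Aut}_{\rm Hopf} \big( A \otimes H_{4} \big) \simeq k^* \times k^* \qquad \text{and} \qquad \mathrm{Aut}_{\rm Hopf} \big( A_{((\alpha_{i})_{i \geq 0})} \big) \simeq G \big( (\alpha_{i})_{i \geq 0} \big)$$ for all $(\alpha_{i})_{i \geq 0} \in k^{(\mathbb{N})} \setminus \{0\}$, where $G \big( (\alpha_{i})_{i \geq 0} \big)$ is the subgroup $\{ (\alpha, \beta) \in k^{*} \times k^{*} \mid \alpha^{p^{i}} = \beta^{2} \text{ for all } i \text{ such that } \alpha_{i} \neq 0 \}$ of $k^*\times k^*$. (2) There exists a bijection $\mathrm{Crp}(H_4, k[Y]) \cong k^{(\mathbb{N})}/_{\sim}$, where $\sim$ is the equivalence relation on $k^{(\mathbb{N})}$ defined by: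 $(\alpha_{i})_{i \geq 0} \sim (\beta_{i})_{i \geq 0}$ if and only if there exists $(\alpha, \beta) \in k^* \times k^*$ such that $\alpha^{p^{i}} \alpha_{i} = \beta^{2} \beta_{i}$, for all $i \geq 0$. (3) There exists a bijection $\mathcal{H}^{2}(H_4, k[Y]) \cong k^{(\mathbb{N})}$.
   Context: $k^{(\mathbb{N})}$ is the set of sequences $(\alpha_i)_{i\ge0}$ in $k$ with finitely many non-zero terms. The polynomial Hopf algebra $k[Y]$ has $Y$ primitive: $\Delta(Y)=Y\otimes1+1\otimes Y$. Group-like means $\Delta(g)=g\otimes g$; $x$ is $(1,g)$-primitive means $\Delta(x)=x\otimes 1+g\otimes x$. $\mathrm{Aut}_{\rm Hopf}$ denotes the group of Hopf algebra automorphisms. $H_4$ is Sweedler's 4-dimensional Hopf algebra over $k$, with basis $\{1,g,x,gx\}$, relations $g^2=1$, $x^2=0$, $xg=-gx$, $g$ group-like and $x$ $(1,g)$-primitive. Sweedler notation is used. For Hopf algebras $A$, $H$, a weak action of $H$ on $A$ is a $k$-linear map $\triangleright: H\otimes A\to A$ with $h\triangleright 1_A=\varepsilon_H(h)1_A$, $1_H\triangleright a=a$, and $h\triangleright(ab)=(h_{(1)}\triangleright a)(h_{(2)}\triangleright b)$. Given a weak action $\triangleright$ and a $k$-linear map $f:H\otimes H\to A$ (write $f(g,h)=f(g\otimes h)$), $A\#_f^{\triangleright}H$ denotes the vector space $A\otimes H$ (write $a\#h$ for $a\otimes h$) with multiplication $(a\#h)\cdot(c\#g):=a(h_{(1)}\triangleright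 c)f(h_{(2)},g_{(1)})\#h_{(3)}g_{(2)}$. $(A,H,\triangleright,f)$ is a crossed system of Hopf algebras, and $A\#_f^{\triangleright}H$ (also written $A\#H$) a crossed product of Hopf algebras, if $A\#_f^{\triangleright}H$ is a Hopf algebra with this multiplication, unit $1_A\#1_H$ and the tensor product coalgebra structure. $\mathrm{Crp}(H,A)$ is the set of Hopf algebra isomorphism types of all crossed products $A\#_f^{\triangleright}H$. Let $\mathcal{CS}(A,H)$ be the set of pairs $(\triangleright,f)$ such that $(A,H,\triangleright,f)$ is a crossed system of Hopf algebras. Put $(\triangleright,f)\approx(\triangleright',f')$ if there is a unitary cocentral map $r:H\to A$ (a coalgebra map with $r(1)=1$ and $r(h_{(1)})\otimes h_{(2)}=r(h_{(2)})\otimes h_{(1)}$ for all $h$) such that $h\triangleright' a=r(h_{(1)})(h_{(2)}\triangleright a)(S_A\circ r)(h_{(3)})$ and $f'(h,g)=r(h_{(1)})\bigl(h_{(2)}\triangleright r(g_{(1)})\bigr)f(h_{(3)},g_{(2)})(S_A\circ r)(h_{(4)}g_{(3)})$ for all $a\in A$, $h,g\in H$. This is an equivalence relation, and $\mathcal{H}^2(H,A):=\mathcal{CS}(A,H)/\approx$. *)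

theory Defs
  imports "HOL-Algebra.QuotRing" "HOL-Algebra.UnivPoly" "HOL-Algebra.Bij"
begin

section \<open>Vector spaces, quotients and tensor products\<close>

definition ring_char :: "('k, 'm) ring_scheme \<Rightarrow> nat" where
  "ring_char R =
     (if \<exists>n::nat. 0 < n \<and> [n] \<cdot>\<^bsub>R\<^esub> \<one>\<^bsub>R\<^esub> = \<zero>\<^bsub>R\<^esub>
      then LEAST n::nat. 0 < n \<and> [n] \<cdot>\<^bsub>R\<^esub> \<one>\<^bsub>R\<^esub> = \<zero>\<^bsub>R\<^esub>
      else 0)"

definition self_module :: "('k, 'm) ring_scheme \<Rightarrow> ('k, 'k) module" where
  "self_module k =
     \<lparr>carrier = carrier k, mult = mult k, one = \<one>\<^bsub>k\<^esub>, zero = \<zero>\<^bsub>k\<^esub>, add = add k,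
      smult = mult k\<rparr>"

definition lin_maps ::
  "('k, 'm) ring_scheme \<Rightarrow> ('k, 'v, 'n) module_scheme \<Rightarrow> ('k, 'w, 'o) module_scheme \<Rightarrow> ('v \<Rightarrow> 'w) set"
  where
  "lin_maps k V W =
     {\<phi> \<in> carrier V \<rightarrow> carrier W.
        (\<forall>x \<in> carrier V. \<forall>y \<in> carrier V. \<phi> (x \<oplus>\<^bsub>V\<^esub> y) = \<phi> x \<oplus>\<^bsub>W\<^esub> \<phi> y) \<and>
        (\<forall>c \<in> carrier k. \<forall>x \<in> carrier V. \<phi> (c \<odot>\<^bsub>V\<^esub> x) = c \<odot>\<^bsub>W\<^esub> \<phi> x)}"

definition lin_span ::
  "('k, 'm) ring_scheme \<Rightarrow> ('k, 'v, 'n) module_scheme \<Rightarrow> 'v set \<Rightarrow> 'v set" where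
  "lin_span k V S = \<Inter> {N. submodule N k V \<and> S \<subseteq> N}"

definition finite_dimensional ::
  "('k, 'm) ring_scheme \<Rightarrow> ('k, 'v, 'n) module_scheme \<Rightarrow> bool" where
  "finite_dimensional k V \<longleftrightarrow> (\<exists>S. finite S \<and> S \<subseteq> carrier V \<and> lin_span k V S = carrier V)"

definition single :: "('k, 'm) ring_scheme \<Rightarrow> 'b \<Rightarrow> 'b \<Rightarrow> 'k" where
  "single k b = (\<lambda>c. if c = b then \<one>\<^bsub>k\<^esub> else \<zero>\<^bsub>k\<^esub>)"

text \<open>The vector space with basis \<open>B\<close>; the multiplicative fields of the record are irrelevant.\<close>

definition free_space :: "('k, 'm) ring_scheme \<Rightarrow> 'b set \<Rightarrow> ('k, 'b \<Rightarrow> 'k) module" where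
  "free_space k B =
     \<lparr>carrier = {f. (\<forall>b. f b \<in> carrier k) \<and> finite {b. f b \<noteq> \<zero>\<^bsub>k\<^esub>} \<and> {b. f b \<noteq> \<zero>\<^bsub>k\<^esub>} \<subseteq> B},
      mult = undefined, one = undefined,
      zero = (\<lambda>b. \<zero>\<^bsub>k\<^esub>), add = (\<lambda>f h b. f b \<oplus>\<^bsub>k\<^esub> h b),
      smult = (\<lambda>c f b. c \<otimes>\<^bsub>k\<^esub> f b)\<rparr>"

text \<open>The analogue of \<^const>\<open>FactRing\<close> that keeps track of scalar multiplication.\<close>

definition quot_space :: "('k, 'v, 'n) module_scheme \<Rightarrow> 'v set \<Rightarrow> ('k, 'v set) module" where
  "quot_space M N =
     \<lparr>carrier = a_rcosets\<^bsub>M\<^esub> N, mult = rcoset_mult M N, one = N +>\<^bsub>M\<^esub> \<one>\<^bsub>M\<^esub>,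
      zero = N, add = set_add M,
      smult = (\<lambda>c X. \<Union>x\<in>X. N +>\<^bsub>M\<^esub> (c \<odot>\<^bsub>M\<^esub> x))\<rparr>"

definition tensor_relators ::
  "('k, 'm) ring_scheme \<Rightarrow> ('k, 'v, 'n) module_scheme \<Rightarrow> ('k, 'w, 'o) module_scheme
     \<Rightarrow> ('v \<times> 'w \<Rightarrow> 'k) set" where
  "tensor_relators k V W =
     (let F = free_space k (carrier V \<times> carrier W); e = (\<lambda>v w. single k (v, w)) in
       {e (v \<oplus>\<^bsub>V\<^esub> v') w \<ominus>\<^bsub>F\<^esub> (e v w \<oplus>\<^bsub>F\<^esub> e v' w) | v v' w.
          v \<in> carrier V \<and> v' \<in> carrier V \<and> w \<in> carrier W}
     \<union> {e v (w \<oplus>\<^bsub>W\<^esub> w') \<ominus>\<^bsub>F\<^esub> (e v w \<oplus>\<^bsub>F\<^esub> e v w') | v w w'.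
          v \<in> carrier V \<and> w \<in> carrier W \<and> w' \<in> carrier W}
     \<union> {e (c \<odot>\<^bsub>V\<^esub> v) w \<ominus>\<^bsub>F\<^esub> c \<odot>\<^bsub>F\<^esub> e v w | c v w.
          c \<in> carrier k \<and> v \<in> carrier V \<and> w \<in> carrier W}
     \<union> {e v (c \<odot>\<^bsub>W\<^esub> w) \<ominus>\<^bsub>F\<^esub> c \<odot>\<^bsub>F\<^esub> e v w | c v w.
          c \<in> carrier k \<and> v \<in> carrier V \<and> w \<in> carrier W})"

definition tensor_kernel ::
  "('k, 'm) ring_scheme \<Rightarrow> ('k, 'v, 'n) module_scheme \<Rightarrow> ('k, 'w, 'o) module_scheme
     \<Rightarrow> ('v \<times> 'w \<Rightarrow> 'k) set" where
  "tensor_kernel k V W =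
     lin_span k (free_space k (carrier V \<times> carrier W)) (tensor_relators k V W)"

definition pure ::
  "('k, 'm) ring_scheme \<Rightarrow> ('k, 'v, 'n) module_scheme \<Rightarrow> ('k, 'w, 'o) module_scheme
     \<Rightarrow> 'v \<Rightarrow> 'w \<Rightarrow> ('v \<times> 'w \<Rightarrow> 'k) set" where
  "pure k V W v w =
     tensor_kernel k V W +>\<^bsub>free_space k (carrier V \<times> carrier W)\<^esub> single k (v, w)"

text \<open>
  For a bilinear \<open>\<beta>\<close>, the linear map on the tensor product sending a pure tensor of \<open>v\<close> and \<open>w\<close> to
  \<open>\<beta> v w\<close>.  The value does not depend on the chosen representative \<open>f\<close> of the class \<open>t\<close>.
\<close>

definition tensor_lift ::
  "('k, 'm) ring_scheme \<Rightarrow> ('k, 'u, 'n) module_scheme \<Rightarrow> ('v \<Rightarrow> 'w \<Rightarrow> 'u)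
     \<Rightarrow> ('v \<times> 'w \<Rightarrow> 'k) set \<Rightarrow> 'u" where
  "tensor_lift k U \<beta> t =
     (let f = (SOME f. f \<in> t) in
      \<Oplus>\<^bsub>U\<^esub>b \<in> {b. f b \<noteq> \<zero>\<^bsub>k\<^esub>}. f b \<odot>\<^bsub>U\<^esub> \<beta> (fst b) (snd b))"

definition tensor_space ::
  "('k, 'm) ring_scheme \<Rightarrow> ('k, 'v, 'n) module_scheme \<Rightarrow> ('k, 'w, 'o) module_scheme
     \<Rightarrow> ('k, ('v \<times> 'w \<Rightarrow> 'k) set) module" where
  "tensor_space k V W =
     quot_space (free_space k (carrier V \<times> carrier W)) (tensor_kernel k V W)"

text \<open>
  The tensor product, with the componentwise multiplication when both factors are algebras.
\<close>

definition tensor ::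
  "('k, 'm) ring_scheme \<Rightarrow> ('k, 'v, 'n) module_scheme \<Rightarrow> ('k, 'w, 'o) module_scheme
     \<Rightarrow> ('k, ('v \<times> 'w \<Rightarrow> 'k) set) module" where
  "tensor k V W =
     (let T = tensor_space k V W in
      T\<lparr>mult := (\<lambda>s t. tensor_lift k T
           (\<lambda>a b. tensor_lift k T (\<lambda>c d. pure k V W (a \<otimes>\<^bsub>V\<^esub> c) (b \<otimes>\<^bsub>W\<^esub> d)) t) s),
        one := pure k V W \<one>\<^bsub>V\<^esub> \<one>\<^bsub>W\<^esub>\<rparr>)"


section \<open>Hopf algebras\<close>

record ('k, 'a) hopf = "('k, 'a) module" +
  comult :: "'a \<Rightarrow> ('a \<times> 'a \<Rightarrow> 'k) set"
  counit :: "'a \<Rightarrow> 'k"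

definition with_coalgebra ::
  "('k, 'a, 'n) module_scheme \<Rightarrow> ('a \<Rightarrow> ('a \<times> 'a \<Rightarrow> 'k) set) \<Rightarrow> ('a \<Rightarrow> 'k) \<Rightarrow> ('k, 'a) hopf" where
  "with_coalgebra M d e =
     \<lparr>carrier = carrier M, mult = mult M, one = \<one>\<^bsub>M\<^esub>, zero = \<zero>\<^bsub>M\<^esub>, add = add M,
      smult = smult M, comult = d, counit = e\<rparr>"

text \<open>
  Sweedler notation: \<open>sweedler k C U (\<lambda>c1 c2. \<beta> c1 c2) c\<close> is the element of \<open>U\<close> written
  \<open>\<beta> c1 c2\<close> with \<open>c1\<close>, \<open>c2\<close> the Sweedler components of \<open>c\<close>, where \<open>\<beta>\<close> is bilinear with values in \<open>U\<close>.
  For three and four components the comultiplication is iterated on the last component.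
\<close>

definition sweedler ::
  "('k, 'm) ring_scheme \<Rightarrow> ('k, 'c, 'n) hopf_scheme \<Rightarrow> ('k, 'u, 'o) module_scheme
     \<Rightarrow> ('c \<Rightarrow> 'c \<Rightarrow> 'u) \<Rightarrow> 'c \<Rightarrow> 'u" where
  "sweedler k C U \<beta> c = tensor_lift k U \<beta> (comult C c)"

definition sweedler3 ::
  "('k, 'm) ring_scheme \<Rightarrow> ('k, 'c, 'n) hopf_scheme \<Rightarrow> ('k, 'u, 'o) module_scheme
     \<Rightarrow> ('c \<Rightarrow> 'c \<Rightarrow> 'c \<Rightarrow> 'u) \<Rightarrow> 'c \<Rightarrow> 'u" where
  "sweedler3 k C U \<beta> c = sweedler k C U (\<lambda>c1 d. sweedler k C U (\<lambda>c2 c3. \<beta> c1 c2 c3) d) c"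

definition sweedler4 ::
  "('k, 'm) ring_scheme \<Rightarrow> ('k, 'c, 'n) hopf_scheme \<Rightarrow> ('k, 'u, 'o) module_scheme
     \<Rightarrow> ('c \<Rightarrow> 'c \<Rightarrow> 'c \<Rightarrow> 'c \<Rightarrow> 'u) \<Rightarrow> 'c \<Rightarrow> 'u" where
  "sweedler4 k C U \<beta> c = sweedler k C U (\<lambda>c1 d. sweedler3 k C U (\<lambda>c2 c3 c4. \<beta> c1 c2 c3 c4) d) c"

text \<open>The library locale \<^locale>\<open>algebra\<close> only covers commutative algebras.\<close>

locale k_algebra = field k + A?: ring A + module k A for k (structure) and A (structure) +
  assumes smult_mult_left:
      "\<lbrakk>c \<in> carrier k; x \<in> carrier A; y \<in> carrier A\<rbrakk>
        \<Longrightarrow> (c \<odot>\<^bsub>A\<^esub> x) \<otimes>\<^bsub>A\<^esub> y = c \<odot>\<^bsub>A\<^esub> (x \<otimes>\<^bsub>A\<^esub> y)"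
    and smult_mult_right:
      "\<lbrakk>c \<in> carrier k; x \<in> carrier A; y \<in> carrier A\<rbrakk>
        \<Longrightarrow> x \<otimes>\<^bsub>A\<^esub> (c \<odot>\<^bsub>A\<^esub> y) = c \<odot>\<^bsub>A\<^esub> (x \<otimes>\<^bsub>A\<^esub> y)"

locale bialgebra = k_algebra k H for k (structure) and H (structure) +
  assumes comult_linear: "comult H \<in> lin_maps k H (tensor k H H)"
    and counit_linear: "counit H \<in> lin_maps k H (self_module k)"
    and coassoc: "h \<in> carrier H \<Longrightarrow>
      sweedler k H (tensor k H (tensor k H H))
        (\<lambda>h' h3. sweedler k H (tensor k H (tensor k H H))
          (\<lambda>h1 h2. pure k H (tensor k H H) h1 (pure k H H h2 h3)) h') h =
      sweedler k H (tensor k H (tensor k H H))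
        (\<lambda>h1 h'. sweedler k H (tensor k H (tensor k H H))
          (\<lambda>h2 h3. pure k H (tensor k H H) h1 (pure k H H h2 h3)) h') h"
    and counit_left: "h \<in> carrier H \<Longrightarrow> sweedler k H H (\<lambda>h1 h2. counit H h1 \<odot>\<^bsub>H\<^esub> h2) h = h"
    and counit_right: "h \<in> carrier H \<Longrightarrow> sweedler k H H (\<lambda>h1 h2. counit H h2 \<odot>\<^bsub>H\<^esub> h1) h = h"
    and comult_one: "comult H \<one>\<^bsub>H\<^esub> = \<one>\<^bsub>tensor k H H\<^esub>"
    and comult_mult: "\<lbrakk>x \<in> carrier H; y \<in> carrier H\<rbrakk> \<Longrightarrow>
      comult H (x \<otimes>\<^bsub>H\<^esub> y) = comult H x \<otimes>\<^bsub>tensor k H H\<^esub> comult H y"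
    and counit_one: "counit H \<one>\<^bsub>H\<^esub> = \<one>\<^bsub>k\<^esub>"
    and counit_mult: "\<lbrakk>x \<in> carrier H; y \<in> carrier H\<rbrakk> \<Longrightarrow>
      counit H (x \<otimes>\<^bsub>H\<^esub> y) = counit H x \<otimes>\<^bsub>k\<^esub> counit H y"

definition is_antipode ::
  "('k, 'm) ring_scheme \<Rightarrow> ('k, 'a, 'n) hopf_scheme \<Rightarrow> ('a \<Rightarrow> 'a) \<Rightarrow> bool" where
  "is_antipode k H S \<longleftrightarrow>
     S \<in> lin_maps k H H \<and>
     (\<forall>h \<in> carrier H.
        sweedler k H H (\<lambda>h1 h2. S h1 \<otimes>\<^bsub>H\<^esub> h2) h = counit H h \<odot>\<^bsub>H\<^esub> \<one>\<^bsub>H\<^esub> \<and>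
        sweedler k H H (\<lambda>h1 h2. h1 \<otimes>\<^bsub>H\<^esub> S h2) h = counit H h \<odot>\<^bsub>H\<^esub> \<one>\<^bsub>H\<^esub>)"

definition antipode ::
  "('k, 'm) ring_scheme \<Rightarrow> ('k, 'a, 'n) hopf_scheme \<Rightarrow> 'a \<Rightarrow> 'a" where
  "antipode k H = (THE S. S \<in> extensional (carrier H) \<and> is_antipode k H S)"

locale hopf_algebra = bialgebra k H for k (structure) and H (structure) +
  assumes antipode_exists: "\<exists>S. is_antipode k H S"

definition group_like ::
  "('k, 'm) ring_scheme \<Rightarrow> ('k, 'a, 'n) hopf_scheme \<Rightarrow> 'a \<Rightarrow> bool" where
  "group_like k H g \<longleftrightarrow> g \<in> carrier H \<and> comult H g = pure k H H g g"

definition skew_primitive ::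
  "('k, 'm) ring_scheme \<Rightarrow> ('k, 'a, 'n) hopf_scheme \<Rightarrow> 'a \<Rightarrow> 'a \<Rightarrow> bool" where
  "skew_primitive k H g x \<longleftrightarrow>
     x \<in> carrier H \<and>
     comult H x = pure k H H x \<one>\<^bsub>H\<^esub> \<oplus>\<^bsub>tensor k H H\<^esub> pure k H H g x"

definition primitive ::
  "('k, 'm) ring_scheme \<Rightarrow> ('k, 'a, 'n) hopf_scheme \<Rightarrow> 'a \<Rightarrow> bool" where
  "primitive k H x \<longleftrightarrow>
     x \<in> carrier H \<and>
     comult H x = pure k H H x \<one>\<^bsub>H\<^esub> \<oplus>\<^bsub>tensor k H H\<^esub> pure k H H \<one>\<^bsub>H\<^esub> x"

definition coalgebra_map ::
  "('k, 'm) ring_scheme \<Rightarrow> ('k, 'a, 'n) hopf_scheme \<Rightarrow> ('k, 'b, 'o) hopf_scheme \<Rightarrow> ('a \<Rightarrow> 'b) \<Rightarrow> bool"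
  where
  "coalgebra_map k H A r \<longleftrightarrow>
     r \<in> lin_maps k H A \<and>
     (\<forall>h \<in> carrier H.
        sweedler k H (tensor k A A) (\<lambda>h1 h2. pure k A A (r h1) (r h2)) h = comult A (r h) \<and>
        counit A (r h) = counit H h)"

text \<open>A bialgebra map between Hopf algebras automatically commutes with the antipodes.\<close>

definition hopf_hom ::
  "('k, 'm) ring_scheme \<Rightarrow> ('k, 'a, 'n) hopf_scheme \<Rightarrow> ('k, 'b, 'o) hopf_scheme \<Rightarrow> ('a \<Rightarrow> 'b) set"
  where
  "hopf_hom k E F = {\<phi>. \<phi> \<in> ring_hom E F \<and> coalgebra_map k E F \<phi>}"

definition hopf_isomorphic ::
  "('k, 'm) ring_scheme \<Rightarrow> ('k, 'a, 'n) hopf_scheme \<Rightarrow> ('k, 'b, 'o) hopf_scheme \<Rightarrow> bool"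
  where
  "hopf_isomorphic k E F \<longleftrightarrow> (\<exists>\<phi> \<in> hopf_hom k E F. bij_betw \<phi> (carrier E) (carrier F))"

definition hopf_Aut ::
  "('k, 'm) ring_scheme \<Rightarrow> ('k, 'a, 'n) hopf_scheme \<Rightarrow> ('a \<Rightarrow> 'a) monoid" where
  "hopf_Aut k E = BijGroup (carrier E) \<lparr>carrier := hopf_hom k E E \<inter> Bij (carrier E)\<rparr>"

definition tensor_hopf ::
  "('k, 'm) ring_scheme \<Rightarrow> ('k, 'a, 'n) hopf_scheme \<Rightarrow> ('k, 'b, 'o) hopf_scheme
     \<Rightarrow> ('k, ('a \<times> 'b \<Rightarrow> 'k) set) hopf" where
  "tensor_hopf k A H =
     (let T = tensor k A H; TT = tensor k T T in
      with_coalgebra T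
        (tensor_lift k TT (\<lambda>a h.
           sweedler k A TT (\<lambda>a1 a2.
             sweedler k H TT (\<lambda>h1 h2. pure k T T (pure k A H a1 h1) (pure k A H a2 h2)) h) a))
        (tensor_lift k (self_module k) (\<lambda>a h. counit A a \<otimes>\<^bsub>k\<^esub> counit H h)))"


section \<open>Crossed products of Hopf algebras\<close>

text \<open>
  Weak actions and cocycles are linear maps on the tensor products; as functions they are extensional,
  so that equal linear maps are equal functions.
\<close>

definition weak_actions ::
  "('k, 'm) ring_scheme \<Rightarrow> ('k, 'a, 'n) hopf_scheme \<Rightarrow> ('k, 'h, 'o) hopf_scheme
     \<Rightarrow> (('h \<times> 'a \<Rightarrow> 'k) set \<Rightarrow> 'a) set" where
  "weak_actions k A H =
     {act \<in> lin_maps k (tensor k H A) A \<inter> extensional (carrier (tensor k H A)).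
        (\<forall>h \<in> carrier H. act (pure k H A h \<one>\<^bsub>A\<^esub>) = counit H h \<odot>\<^bsub>A\<^esub> \<one>\<^bsub>A\<^esub>) \<and>
        (\<forall>a \<in> carrier A. act (pure k H A \<one>\<^bsub>H\<^esub> a) = a) \<and>
        (\<forall>h \<in> carrier H. \<forall>a \<in> carrier A. \<forall>b \<in> carrier A.
           act (pure k H A h (a \<otimes>\<^bsub>A\<^esub> b)) =
           sweedler k H A (\<lambda>h1 h2. act (pure k H A h1 a) \<otimes>\<^bsub>A\<^esub> act (pure k H A h2 b)) h)}"

definition crossed_product ::
  "('k, 'm) ring_scheme \<Rightarrow> ('k, 'a, 'n) hopf_scheme \<Rightarrow> ('k, 'h, 'o) hopf_scheme
     \<Rightarrow> (('h \<times> 'a \<Rightarrow> 'k) set \<Rightarrow> 'a) \<Rightarrow> (('h \<times> 'h \<Rightarrow> 'k) set \<Rightarrow> 'a)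
     \<Rightarrow> ('k, ('a \<times> 'h \<Rightarrow> 'k) set) hopf" where
  "crossed_product k A H act f =
     (let T = tensor_hopf k A H in
      T\<lparr>mult := (\<lambda>s t.
           tensor_lift k T (\<lambda>a h. tensor_lift k T (\<lambda>c g.
             sweedler3 k H T (\<lambda>h1 h2 h3. sweedler k H T (\<lambda>g1 g2.
               pure k A H
                 (a \<otimes>\<^bsub>A\<^esub> act (pure k H A h1 c) \<otimes>\<^bsub>A\<^esub> f (pure k H H h2 g1))
                 (h3 \<otimes>\<^bsub>H\<^esub> g2)) g) h) t) s)\<rparr>)"

definition crossed_systems ::
  "('k, 'm) ring_scheme \<Rightarrow> ('k, 'a, 'n) hopf_scheme \<Rightarrow> ('k, 'h, 'o) hopf_scheme
     \<Rightarrow> ((('h \<times> 'a \<Rightarrow> 'k) set \<Rightarrow> 'a) \<times> (('h \<times> 'h \<Rightarrow> 'k) set \<Rightarrow> 'a)) set" where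
  "crossed_systems k A H =
     {(act, f). act \<in> weak_actions k A H \<and>
        f \<in> lin_maps k (tensor k H H) A \<inter> extensional (carrier (tensor k H H)) \<and>
        hopf_algebra k (crossed_product k A H act f)}"

definition crossed_products ::
  "('k, 'm) ring_scheme \<Rightarrow> ('k, 'a, 'n) hopf_scheme \<Rightarrow> ('k, 'h, 'o) hopf_scheme
     \<Rightarrow> ('k, ('a \<times> 'h \<Rightarrow> 'k) set) hopf set" where
  "crossed_products k A H = {crossed_product k A H act f | act f. (act, f) \<in> crossed_systems k A H}"

text \<open>All crossed products live on the same vector space, so their isomorphism types form a set.\<close>

definition Crp ::
  "('k, 'm) ring_scheme \<Rightarrow> ('k, 'h, 'o) hopf_scheme \<Rightarrow> ('k, 'a, 'n) hopf_scheme
     \<Rightarrow> ('k, ('a \<times> 'h \<Rightarrow> 'k) set) hopf set set" where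
  "Crp k H A =
     crossed_products k A H //
       {(E, F). E \<in> crossed_products k A H \<and> F \<in> crossed_products k A H \<and> hopf_isomorphic k E F}"

definition unitary_cocentral ::
  "('k, 'm) ring_scheme \<Rightarrow> ('k, 'h, 'o) hopf_scheme \<Rightarrow> ('k, 'a, 'n) hopf_scheme \<Rightarrow> ('h \<Rightarrow> 'a) \<Rightarrow> bool"
  where
  "unitary_cocentral k H A r \<longleftrightarrow>
     coalgebra_map k H A r \<and> r \<one>\<^bsub>H\<^esub> = \<one>\<^bsub>A\<^esub> \<and>
     (\<forall>h \<in> carrier H.
        sweedler k H (tensor k A H) (\<lambda>h1 h2. pure k A H (r h1) h2) h =
        sweedler k H (tensor k A H) (\<lambda>h1 h2. pure k A H (r h2) h1) h)"

definition crossed_equiv ::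
  "('k, 'm) ring_scheme \<Rightarrow> ('k, 'a, 'n) hopf_scheme \<Rightarrow> ('k, 'h, 'o) hopf_scheme
     \<Rightarrow> (((('h \<times> 'a \<Rightarrow> 'k) set \<Rightarrow> 'a) \<times> (('h \<times> 'h \<Rightarrow> 'k) set \<Rightarrow> 'a)) \<times>
         ((('h \<times> 'a \<Rightarrow> 'k) set \<Rightarrow> 'a) \<times> (('h \<times> 'h \<Rightarrow> 'k) set \<Rightarrow> 'a))) set" where
  "crossed_equiv k A H =
     {((act, f), (act', f')).
        (act, f) \<in> crossed_systems k A H \<and> (act', f') \<in> crossed_systems k A H \<and>
        (\<exists>r. unitary_cocentral k H A r \<and>
           (\<forall>h \<in> carrier H. \<forall>a \<in> carrier A.
              act' (pure k H A h a) =
              sweedler3 k H A (\<lambda>h1 h2 h3.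
                r h1 \<otimes>\<^bsub>A\<^esub> act (pure k H A h2 a) \<otimes>\<^bsub>A\<^esub> antipode k A (r h3)) h) \<and>
           (\<forall>h \<in> carrier H. \<forall>g \<in> carrier H.
              f' (pure k H H h g) =
              sweedler4 k H A (\<lambda>h1 h2 h3 h4. sweedler3 k H A (\<lambda>g1 g2 g3.
                r h1 \<otimes>\<^bsub>A\<^esub> act (pure k H A h2 (r g1)) \<otimes>\<^bsub>A\<^esub> f (pure k H H h3 g2)
                  \<otimes>\<^bsub>A\<^esub> antipode k A (r (h4 \<otimes>\<^bsub>H\<^esub> g3))) g) h))}"

definition H2 ::
  "('k, 'm) ring_scheme \<Rightarrow> ('k, 'h, 'o) hopf_scheme \<Rightarrow> ('k, 'a, 'n) hopf_scheme
     \<Rightarrow> ((('h \<times> 'a \<Rightarrow> 'k) set \<Rightarrow> 'a) \<times> (('h \<times> 'h \<Rightarrow> 'k) set \<Rightarrow> 'a)) set set" where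
  "H2 k H A = crossed_systems k A H // crossed_equiv k A H"


section \<open>The polynomial Hopf algebra\<close>

definition poly_hopf :: "('k, 'm) ring_scheme \<Rightarrow> ('k, nat \<Rightarrow> 'k) hopf" where
  "poly_hopf k =
     (let P = UP k; Y = monom P \<one>\<^bsub>k\<^esub> 1; T = tensor k P P in
      with_coalgebra P
        (eval k T (\<lambda>c. c \<odot>\<^bsub>T\<^esub> \<one>\<^bsub>T\<^esub>) (pure k P P Y \<one>\<^bsub>P\<^esub> \<oplus>\<^bsub>T\<^esub> pure k P P \<one>\<^bsub>P\<^esub> Y))
        (eval k k (\<lambda>c. c) \<zero>\<^bsub>k\<^esub>))"


section \<open>Sweedler's Hopf algebra\<close>

text \<open>
  The table records \<open>g g = 1\<close>, \<open>x x = 0\<close>, \<open>x g = - g x\<close> and the products of \<open>gx\<close> that follow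
  from them by associativity; the last equation covers the products in which \<open>x\<close> occurs twice.
\<close>

datatype h4_basis = B1 | Bg | Bx | Bgx

fun h4_table :: "('k, 'm) ring_scheme \<Rightarrow> h4_basis \<Rightarrow> h4_basis \<Rightarrow> h4_basis \<Rightarrow> 'k" where
  "h4_table k B1 b = single k b"
| "h4_table k a B1 = single k a"
| "h4_table k Bg Bg = single k B1"
| "h4_table k Bg Bx = single k Bgx"
| "h4_table k Bg Bgx = single k Bx"
| "h4_table k Bx Bg = \<ominus>\<^bsub>free_space k UNIV\<^esub> single k Bgx"
| "h4_table k Bgx Bg = \<ominus>\<^bsub>free_space k UNIV\<^esub> single k Bx"
| "h4_table k a b = \<zero>\<^bsub>free_space k UNIV\<^esub>"

definition h4_algebra :: "('k, 'm) ring_scheme \<Rightarrow> ('k, h4_basis \<Rightarrow> 'k) module" where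
  "h4_algebra k =
     (let F = free_space k UNIV in
      F\<lparr>mult := (\<lambda>u v. \<Oplus>\<^bsub>F\<^esub>a \<in> UNIV. \<Oplus>\<^bsub>F\<^esub>b \<in> UNIV. (u a \<otimes>\<^bsub>k\<^esub> v b) \<odot>\<^bsub>F\<^esub> h4_table k a b),
        one := single k B1\<rparr>)"

text \<open>On \<open>gx\<close> the comultiplication is the product of its values on \<open>g\<close> and \<open>x\<close>.\<close>

fun h4_comult_basis ::
  "('k, 'm) ring_scheme \<Rightarrow> h4_basis \<Rightarrow> ((h4_basis \<Rightarrow> 'k) \<times> (h4_basis \<Rightarrow> 'k) \<Rightarrow> 'k) set" where
  "h4_comult_basis k B1 = pure k (h4_algebra k) (h4_algebra k) (single k B1) (single k B1)"
| "h4_comult_basis k Bg = pure k (h4_algebra k) (h4_algebra k) (single k Bg) (single k Bg)"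
| "h4_comult_basis k Bx =
     pure k (h4_algebra k) (h4_algebra k) (single k Bx) (single k B1)
     \<oplus>\<^bsub>tensor k (h4_algebra k) (h4_algebra k)\<^esub>
     pure k (h4_algebra k) (h4_algebra k) (single k Bg) (single k Bx)"
| "h4_comult_basis k Bgx =
     pure k (h4_algebra k) (h4_algebra k) (single k Bgx) (single k Bg)
     \<oplus>\<^bsub>tensor k (h4_algebra k) (h4_algebra k)\<^esub>
     pure k (h4_algebra k) (h4_algebra k) (single k B1) (single k Bgx)"

definition H4 :: "('k, 'm) ring_scheme \<Rightarrow> ('k, h4_basis \<Rightarrow> 'k) hopf" where
  "H4 k =
     (let M = h4_algebra k; T = tensor k M M in
      with_coalgebra M
        (\<lambda>u. \<Oplus>\<^bsub>T\<^esub>a \<in> UNIV. u a \<odot>\<^bsub>T\<^esub> h4_comult_basis k a)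
        (\<lambda>u. u B1 \<oplus>\<^bsub>k\<^esub> u Bg))"


section \<open>The Hopf algebras given by generators and relations\<close>

datatype gen = GenY | Geng | Genx

text \<open>The free algebra: functions of finite support on words, with the convolution product.\<close>

definition free_algebra :: "('k, 'm) ring_scheme \<Rightarrow> ('k, 'g list \<Rightarrow> 'k) module" where
  "free_algebra k =
     (free_space k UNIV)
       \<lparr>mult := (\<lambda>p q w. \<Oplus>\<^bsub>k\<^esub>i \<in> {..length w}. p (take i w) \<otimes>\<^bsub>k\<^esub> q (drop i w)),
        one := single k []\<rparr>"

text \<open>The algebra map from the free algebra to \<open>T\<close> determined by the images of the generators.\<close>

definition free_eval ::
  "('k, 'm) ring_scheme \<Rightarrow> ('k, 't, 'n) module_scheme \<Rightarrow> ('g \<Rightarrow> 't) \<Rightarrow> ('g list \<Rightarrow> 'k) \<Rightarrow> 't" where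
  "free_eval k T \<phi> q =
     (\<Oplus>\<^bsub>T\<^esub>w \<in> {w. q w \<noteq> \<zero>\<^bsub>k\<^esub>}. q w \<odot>\<^bsub>T\<^esub> foldr (\<lambda>s t. \<phi> s \<otimes>\<^bsub>T\<^esub> t) w \<one>\<^bsub>T\<^esub>)"

definition fin_seqs :: "('k, 'm) ring_scheme \<Rightarrow> (nat \<Rightarrow> 'k) set" where
  "fin_seqs k = {\<alpha>. (\<forall>i. \<alpha> i \<in> carrier k) \<and> finite {i. \<alpha> i \<noteq> \<zero>\<^bsub>k\<^esub>}}"

definition A_ideal :: "('k, 'm) ring_scheme \<Rightarrow> nat \<Rightarrow> (nat \<Rightarrow> 'k) \<Rightarrow> (gen list \<Rightarrow> 'k) set" where
  "A_ideal k p \<alpha> =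
     (let F = free_algebra k;
          Y = single k [GenY]; g = single k [Geng]; x = single k [Genx] in
      Idl\<^bsub>F\<^esub>
       {g \<otimes>\<^bsub>F\<^esub> g \<ominus>\<^bsub>F\<^esub> \<one>\<^bsub>F\<^esub>,
        x \<otimes>\<^bsub>F\<^esub> x \<ominus>\<^bsub>F\<^esub> (\<Oplus>\<^bsub>F\<^esub>i \<in> {i. \<alpha> i \<noteq> \<zero>\<^bsub>k\<^esub>}. \<alpha> i \<odot>\<^bsub>F\<^esub> (Y [^]\<^bsub>F\<^esub> (p ^ i))),
        x \<otimes>\<^bsub>F\<^esub> g \<ominus>\<^bsub>F\<^esub> (\<ominus>\<^bsub>F\<^esub> (g \<otimes>\<^bsub>F\<^esub> x)),
        g \<otimes>\<^bsub>F\<^esub> Y \<ominus>\<^bsub>F\<^esub> Y \<otimes>\<^bsub>F\<^esub> g,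
        x \<otimes>\<^bsub>F\<^esub> Y \<ominus>\<^bsub>F\<^esub> Y \<otimes>\<^bsub>F\<^esub> x})"

definition A_algebra ::
  "('k, 'm) ring_scheme \<Rightarrow> nat \<Rightarrow> (nat \<Rightarrow> 'k) \<Rightarrow> ('k, (gen list \<Rightarrow> 'k) set) module" where
  "A_algebra k p \<alpha> = quot_space (free_algebra k) (A_ideal k p \<alpha>)"

definition A_gen ::
  "('k, 'm) ring_scheme \<Rightarrow> nat \<Rightarrow> (nat \<Rightarrow> 'k) \<Rightarrow> gen \<Rightarrow> (gen list \<Rightarrow> 'k) set" where
  "A_gen k p \<alpha> s = A_ideal k p \<alpha> +>\<^bsub>free_algebra k\<^esub> single k [s]"

text \<open>
  The comultiplication and the counit are the algebra maps with the prescribed values on the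
  generators; the values do not depend on the chosen representative of the class \<open>X\<close>.
\<close>

definition A_hopf ::
  "('k, 'm) ring_scheme \<Rightarrow> nat \<Rightarrow> (nat \<Rightarrow> 'k) \<Rightarrow> ('k, (gen list \<Rightarrow> 'k) set) hopf" where
  "A_hopf k p \<alpha> =
     (let M = A_algebra k p \<alpha>; T = tensor k M M;
          Y = A_gen k p \<alpha> GenY; g = A_gen k p \<alpha> Geng; x = A_gen k p \<alpha> Genx in
      with_coalgebra M
        (\<lambda>X. free_eval k T
           (case_gen (pure k M M Y \<one>\<^bsub>M\<^esub> \<oplus>\<^bsub>T\<^esub> pure k M M \<one>\<^bsub>M\<^esub> Y)
                     (pure k M M g g)
                     (pure k M M x \<one>\<^bsub>M\<^esub> \<oplus>\<^bsub>T\<^esub> pure k M M g x))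
           (SOME q. q \<in> X))
        (\<lambda>X. free_eval k (self_module k) (case_gen \<zero>\<^bsub>k\<^esub> \<one>\<^bsub>k\<^esub> \<zero>\<^bsub>k\<^esub>) (SOME q. q \<in> X)))"

definition G_set :: "('k, 'm) ring_scheme \<Rightarrow> nat \<Rightarrow> (nat \<Rightarrow> 'k) \<Rightarrow> ('k \<times> 'k) set" where
  "G_set k p \<alpha> =
     {(a, b). a \<in> Units k \<and> b \<in> Units k \<and>
        (\<forall>i. \<alpha> i \<noteq> \<zero>\<^bsub>k\<^esub> \<longrightarrow> a [^]\<^bsub>k\<^esub> (p ^ i) = b [^]\<^bsub>k\<^esub> (2::nat))}"

definition seq_equiv :: "('k, 'm) ring_scheme \<Rightarrow> nat \<Rightarrow> ((nat \<Rightarrow> 'k) \<times> (nat \<Rightarrow> 'k)) set" where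
  "seq_equiv k p =
     {(\<alpha>, \<beta>). \<alpha> \<in> fin_seqs k \<and> \<beta> \<in> fin_seqs k \<and>
        (\<exists>a \<in> Units k. \<exists>b \<in> Units k.
           \<forall>i. a [^]\<^bsub>k\<^esub> (p ^ i) \<otimes>\<^bsub>k\<^esub> \<alpha> i = b [^]\<^bsub>k\<^esub> (2::nat) \<otimes>\<^bsub>k\<^esub> \<beta> i)}"

end

theory Submission
  imports "HOL-Algebra.Exponent" Defs
begin

text \<open>
  Comparing components in the comultiplication of \<open>x a\<close> and of the products of basis elements of \<open>H4\<close>
  shows that in a crossed system the action on \<open>k[Y]\<close> is trivial and the cocycle is determined by
  \<open>P = f(x, x)\<close>, a primitive polynomial; in characteristic \<open>p\<close> these are the combinations of the
  \<open>Y^(p^i)\<close>.  Conversely the elements \<open>Y^n\<close>, \<open>Y^n g\<close>, \<open>Y^n x\<close>, \<open>Y^n g x\<close> form a basis of the algebra given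
  by generators and relations, which identifies it with the crossed product belonging to \<open>P\<close>.
  Unitary cocentral maps from \<open>H4\<close> to \<open>k[Y]\<close> are trivial, so equivalent crossed systems are equal.
  A Hopf isomorphism maps \<open>g\<close> to \<open>g\<close>, the only group-like element apart from \<open>1\<close> (and the junk value
  \<open>0\<close>, which satisfies the equation for group-likes); it maps \<open>x\<close> to a multiple of \<open>x\<close>, these being the
  skew-primitive elements that anticommute with \<open>g\<close>; and it maps \<open>Y\<close> to a primitive polynomial that is
  invertible under composition, hence to a multiple of \<open>Y\<close>.  The relation between the two sequences is
  read off from the image of \<open>x^2\<close>.
\<close>

\<comment> \<open>The tensor product is a quotient of a free space, so an equality in it can be
  tested only through linear maps out of it. This shapes the proof: \<open>cc\<close>,
  \<open>proj\<close>, \<open>lam\<close> and \<open>comp2\<close> are coordinate systems built for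
  that purpose, and identities between Sweedler sums become equalities of linear or algebra maps,
  checked on basis elements or generators. The Hopf axioms are not verified inside a crossed
  product. They are proved for the presented algebra, where three generators decide each axiom, and
  transported along the comparison map \<open>Th\<close>, associativity included. The signs f(gx, x)
  = P and f(x, gx) = f(gx, gx) = -P come from moving g past x. Odd characteristic enters through
  P(-Y) = -P(Y), which makes x -> -gx compatible with x^2 = P(Y) in the opposite algebra, and
  through 1 + 1 being nonzero, which removes the (1 - g)-component from the image of x.
  Invertibility under composition is turned into divisibility: if r(q(Y)) = Y and r has no constant
  term, then q divides Y.\<close>
section \<open>Linear algebra over a field\<close>

text \<open>A structure that is a single identifier may be written as a plain subscript.\<close>

syntax "_index_sub" :: "logic => index" ("\<^sub>_" [1000])
translations "_index_sub x" \<rightharpoonup> "_index x"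

locale base_field = field k for k :: "('k, 'm) ring_scheme" (structure)
begin

abbreviation "lin \<equiv> lin_maps k"
abbreviation "tlift \<equiv> tensor_lift k"

lemma mod_abelian: "module k V ==> abelian_group V"
  by (rule module.axioms)

lemma mod_monoid: "module k V ==> abelian_monoid V"
  using mod_abelian abelian_group.axioms by blast

text \<open>Module laws with \<open>module k V\<close> as an explicit premise: many spaces over the
  same field occur in one statement, and the simplifier can discharge this premise for each of
  them.\<close>

lemmas
  vadd_closed [simp] = abelian_monoid.a_closed [OF mod_monoid] and
  vzero_closed [simp] = abelian_monoid.zero_closed [OF mod_monoid] and
  vneg_closed [simp] = abelian_group.a_inv_closed [OF mod_abelian] and
  vminus_closed [simp] = abelian_group.minus_closed [OF mod_abelian] and
  vadd_assoc = abelian_monoid.a_assoc [OF mod_monoid] and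
  vadd_comm = abelian_monoid.a_comm [OF mod_monoid] and
  vadd_lcomm = abelian_monoid.a_lcomm [OF mod_monoid] and
  vzero_left [simp] = abelian_monoid.l_zero [OF mod_monoid] and
  vzero_right [simp] = abelian_monoid.r_zero [OF mod_monoid] and
  vneg_left [simp] = abelian_group.l_neg [OF mod_abelian] and
  vneg_right [simp] = abelian_group.r_neg [OF mod_abelian] and
  vneg_left2 [simp] = abelian_group.r_neg1 [OF mod_abelian] and
  vneg_right2 [simp] = abelian_group.r_neg2 [OF mod_abelian] and
  vneg_neg [simp] = abelian_group.minus_minus [OF mod_abelian] and
  vneg_add = abelian_group.minus_add [OF mod_abelian] and
  vsmult_closed [simp] = module.smult_closed [of k] and
  vsmult_add_left = module.smult_l_distr [of k] and
  vsmult_add = module.smult_r_distr [of k] and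
  vsmult_assoc = module.smult_assoc1 [of k] and
  vsmult_one [simp] = module.smult_one [of k] and
  vsmult_null [simp] = module.smult_l_null [of k] and
  vsmult_zero [simp] = module.smult_r_null [of k] and
  vsmult_neg_left = module.smult_l_minus [of k] and
  vsmult_neg = module.smult_r_minus [of k]

lemma vneg_zero [simp]: "module k V ==> \<ominus>\<^sub>V \<zero>\<^sub>V = \<zero>\<^sub>V"
  using vneg_left [of V "\<zero>\<^sub>V"] by (simp del: vneg_left)

lemma vcancel:
  assumes "module k V" "x \<in> carrier V" "y \<in> carrier V"
  shows "x \<ominus>\<^sub>V y = \<zero>\<^sub>V \<longleftrightarrow> x = y"
proof
  assume "x \<ominus>\<^sub>V y = \<zero>\<^sub>V"
  then have "(x \<oplus>\<^sub>V \<ominus>\<^sub>V y) \<oplus>\<^sub>V y = \<zero>\<^sub>V \<oplus>\<^sub>V y"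
    by (simp add: a_minus_def)
  then show "x = y"
    using assms by (simp add: vadd_assoc)
qed (use assms in \<open>simp add: a_minus_def\<close>)

lemmas vac = vadd_assoc vadd_comm vadd_lcomm

lemma vfinsum_closed [simp]:
  "module k V ==> (\<And>i. i \<in> I ==> \<gamma> i \<in> carrier V) ==> finsum V \<gamma> I \<in> carrier V"
  by (rule abelian_monoid.finsum_closed [OF mod_monoid]) auto

lemma vfinsum_insert:
  "module k V ==> finite I ==> a \<notin> I ==> \<gamma> a \<in> carrier V ==>
     (\<And>i. i \<in> I ==> \<gamma> i \<in> carrier V) ==> finsum V \<gamma> (insert a I) = \<gamma> a \<oplus>\<^sub>V finsum V \<gamma> I"
  by (rule abelian_monoid.finsum_insert [OF mod_monoid]) auto

lemma vfinsum_cong: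
  "module k V ==> I = J ==> (\<And>i. i \<in> J ==> \<gamma> i = \<delta> i) ==> (\<And>i. i \<in> J ==> \<delta> i \<in> carrier V) ==>
    finsum V \<gamma> I = finsum V \<delta> J"
  by (rule abelian_monoid.finsum_cong' [OF mod_monoid]) auto

lemma vfinsum_empty [simp]: "module k V ==> finsum V \<gamma> {} = \<zero>\<^sub>V"
  by (rule abelian_monoid.finsum_empty [OF mod_monoid])

lemma vfinsum_mono_neutral:
  "module k V ==> finite J ==> I \<subseteq> J ==> (\<And>i. i \<in> J - I ==> \<gamma> i = \<zero>\<^sub>V) ==>
     (\<And>i. i \<in> J ==> \<gamma> i \<in> carrier V) ==> finsum V \<gamma> I = finsum V \<gamma> J"
  unfolding finsum_def
  by (rule comm_monoid.finprod_mono_neutral_cong_left [OF abelian_monoid.a_comm_monoid [OF mod_monoid]])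
    auto

lemma vfinsum_add:
  "module k V ==> (\<And>i. i \<in> I ==> \<gamma> i \<in> carrier V) ==> (\<And>i. i \<in> I ==> \<delta> i \<in> carrier V) ==>
     (\<Oplus>\<^sub>V i\<in>I. \<gamma> i \<oplus>\<^sub>V \<delta> i) = finsum V \<gamma> I \<oplus>\<^sub>V finsum V \<delta> I"
  by (rule abelian_monoid.finsum_addf [OF mod_monoid]) auto

lemma vfinsum_smult:
  "module k V ==> finite I ==> (\<And>i. i \<in> I ==> \<gamma> i \<in> carrier V) ==> c \<in> carrier k ==>
     c \<odot>\<^sub>V finsum V \<gamma> I = (\<Oplus>\<^sub>V i\<in>I. c \<odot>\<^sub>V \<gamma> i)"
  by (rule module.finsum_smult_ldistr) auto

subsection \<open>Linear maps\<close>

lemma lin_mapsI: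
  assumes "\<And>x. x \<in> carrier V ==> \<phi> x \<in> carrier W"
    and "\<And>x y. x \<in> carrier V ==> y \<in> carrier V ==> \<phi> (x \<oplus>\<^sub>V y) = \<phi> x \<oplus>\<^sub>W \<phi> y"
    and "\<And>c x. c \<in> carrier k ==> x \<in> carrier V ==> \<phi> (c \<odot>\<^sub>V x) = c \<odot>\<^sub>W \<phi> x"
  shows "\<phi> \<in> lin V W"
  using assms by (auto simp: lin_maps_def)

lemma lin_closed: "\<phi> \<in> lin V W ==> x \<in> carrier V ==> \<phi> x \<in> carrier W"
  and lin_add: "\<phi> \<in> lin V W ==> x \<in> carrier V ==> y \<in> carrier V ==>
    \<phi> (x \<oplus>\<^sub>V y) = \<phi> x \<oplus>\<^sub>W \<phi> y"
  and lin_smult: "\<phi> \<in> lin V W ==> c \<in> carrier k ==> x \<in> carrier V ==>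
    \<phi> (c \<odot>\<^sub>V x) = c \<odot>\<^sub>W \<phi> x"
  by (auto simp: lin_maps_def)

lemma lin_zero: "module k V ==> module k W ==> \<phi> \<in> lin V W ==> \<phi> \<zero>\<^sub>V = \<zero>\<^sub>W"
  using lin_smult [of \<phi> V W \<zero> "\<zero>\<^sub>V"] lin_closed [of \<phi> V W] by simp

lemma lin_neg:
  "module k V ==> module k W ==> \<phi> \<in> lin V W ==> x \<in> carrier V ==>
     \<phi> (\<ominus>\<^sub>V x) = \<ominus>\<^sub>W \<phi> x"
  using lin_smult [of \<phi> V W "\<ominus> \<one>" x] lin_closed [of \<phi> V W] by (simp add: vsmult_neg_left)

lemma lin_id: "(\<lambda>z. z) \<in> lin V V"
  by (rule lin_mapsI) auto

lemma lin_comp: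
  "\<phi> \<in> lin W U ==> \<psi> \<in> lin V W ==> (\<lambda>z. \<phi> (\<psi> z)) \<in> lin V U"
  by (rule lin_mapsI) (simp_all add: lin_closed lin_add lin_smult)

lemma lin_cong:
  assumes "\<phi> \<in> lin V W" "module k V" "\<And>x. x \<in> carrier V ==> \<psi> x = \<phi> x"
  shows "\<psi> \<in> lin V W"
  using assms by (auto simp: lin_maps_def)

lemma lin_const_zero: "module k W ==> (\<lambda>z. \<zero>\<^sub>W) \<in> lin V W"
  by (rule lin_mapsI) auto

lemma lin_plus:
  assumes "module k W" "\<phi> \<in> lin V W" "\<psi> \<in> lin V W"
  shows "(\<lambda>z. \<phi> z \<oplus>\<^sub>W \<psi> z) \<in> lin V W"
  using assms(1) lin_closed [OF assms(2)] lin_closed [OF assms(3)]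
  by (intro lin_mapsI)
    (simp_all add: vac vsmult_add lin_add [OF assms(2)] lin_add [OF assms(3)]
      lin_smult [OF assms(2)] lin_smult [OF assms(3)])

lemma lin_uminus:
  assumes "module k W" "\<phi> \<in> lin V W"
  shows "(\<lambda>z. \<ominus>\<^sub>W \<phi> z) \<in> lin V W"
  using assms(1) lin_closed [OF assms(2)]
  by (intro lin_mapsI)
    (simp_all add: vneg_add vsmult_neg vadd_comm lin_add [OF assms(2)] lin_smult [OF assms(2)])

lemma lin_smult_left:
  assumes "module k W" "\<phi> \<in> lin V W" "c \<in> carrier k"
  shows "(\<lambda>z. c \<odot>\<^sub>W \<phi> z) \<in> lin V W"
  using assms(1,3) lin_closed [OF assms(2)]
  by (intro lin_mapsI)
    (simp_all add: vsmult_add lin_add [OF assms(2)] lin_smult [OF assms(2)] vsmult_assoc [symmetric] m_comm)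

lemma module_self [simp]: "module k (self_module k)"
  unfolding self_module_def
  by (rule moduleI)
    (auto intro!: abelian_groupI is_cring simp: m_assoc l_distr r_distr a_assoc a_comm a_lcomm
      intro: l_neg)

lemma self_module_simps [simp]:
  "carrier (self_module k) = carrier k" "monoid.mult (self_module k) = monoid.mult k"
  "one (self_module k) = \<one>" "zero (self_module k) = \<zero>" "add (self_module k) = add k"
  "smult (self_module k) = mult k"
  by (simp_all add: self_module_def)

lemma lin_smult_right:
  assumes "module k W" "\<epsilon> \<in> lin V (self_module k)" "w \<in> carrier W"
  shows "(\<lambda>z. \<epsilon> z \<odot>\<^sub>W w) \<in> lin V W"
  using assms(1,3) lin_closed [OF assms(2)]
  by (intro lin_mapsI)
    (simp_all add: vsmult_add_left vsmult_assoc lin_add [OF assms(2)] lin_smult [OF assms(2)])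

lemma lin_mult_right:
  assumes "\<epsilon> \<in> lin V (self_module k)" "c \<in> carrier k"
  shows "(\<lambda>z. \<epsilon> z \<otimes> c) \<in> lin V (self_module k)"
  using lin_smult_right [OF module_self assms(1), of c] assms(2) by simp

lemma lin_mult_left:
  assumes "\<epsilon> \<in> lin V (self_module k)" "c \<in> carrier k"
  shows "(\<lambda>z. c \<otimes> \<epsilon> z) \<in> lin V (self_module k)"
  using lin_smult_left [OF module_self assms(1), of c] assms(2) by simp

definition bilin where
  "bilin V W U \<beta> \<longleftrightarrow>
     (\<forall>v \<in> carrier V. (\<lambda>w. \<beta> v w) \<in> lin W U) \<and>
     (\<forall>w \<in> carrier W. (\<lambda>v. \<beta> v w) \<in> lin V U)"

lemma bilinI:
  assumes "\<And>v. v \<in> carrier V ==> (\<lambda>w. \<beta> v w) \<in> lin W U"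
    and "\<And>w. w \<in> carrier W ==> (\<lambda>v. \<beta> v w) \<in> lin V U"
  shows "bilin V W U \<beta>"
  using assms by (auto simp: bilin_def)

lemma bilin_lin:
  "bilin V W U \<beta> ==> v \<in> carrier V ==> (\<lambda>w. \<beta> v w) \<in> lin W U"
  "bilin V W U \<beta> ==> w \<in> carrier W ==> (\<lambda>v. \<beta> v w) \<in> lin V U"
  by (auto simp: bilin_def)

lemma bilin_closed:
  "bilin V W U \<beta> ==> v \<in> carrier V ==> w \<in> carrier W ==> \<beta> v w \<in> carrier U"
  using bilin_lin(1) lin_closed by fast

lemma bilin_comp_left: "bilin V W U \<beta> ==> \<phi> \<in> lin Z V ==> w \<in> carrier W ==>
    (\<lambda>z. \<beta> (\<phi> z) w) \<in> lin Z U"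
  by (rule lin_comp [of "\<lambda>v. \<beta> v w"]) (auto intro: bilin_lin)

lemma bilin_comp_right: "bilin V W U \<beta> ==> \<phi> \<in> lin Z W ==> v \<in> carrier V ==>
    (\<lambda>z. \<beta> v (\<phi> z)) \<in> lin Z U"
  by (rule lin_comp [of "\<lambda>w. \<beta> v w"]) (auto intro: bilin_lin)

subsection \<open>Free vector spaces\<close>

lemma free_space_simps:
  "f \<in> carrier (free_space k B) \<longleftrightarrow>
     (\<forall>b. f b \<in> carrier k) \<and> finite {b. f b \<noteq> \<zero>} \<and> {b. f b \<noteq> \<zero>} \<subseteq> B"
  "\<zero>\<^bsub>free_space k B\<^esub> = (\<lambda>b. \<zero>)"
  "f \<oplus>\<^bsub>free_space k B\<^esub> h = (\<lambda>b. f b \<oplus> h b)"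
  "c \<odot>\<^bsub>free_space k B\<^esub> f = (\<lambda>b. c \<otimes> f b)"
  by (auto simp: free_space_def)

lemma free_space_module [simp]: "module k (free_space k B)"
proof -
  have add: "f \<oplus>\<^bsub>free_space k B\<^esub> h \<in> carrier (free_space k B)"
    if "f \<in> carrier (free_space k B)" "h \<in> carrier (free_space k B)" for f h
  proof -
    have "{b. f b \<oplus> h b \<noteq> \<zero>} \<subseteq> {b. f b \<noteq> \<zero>} \<union> {b. h b \<noteq> \<zero>}"
      by auto
    with that show ?thesis
      unfolding free_space_simps by (auto intro: finite_subset)
  qed
  have smult: "c \<odot>\<^bsub>free_space k B\<^esub> f \<in> carrier (free_space k B)"
    if "c \<in> carrier k" "f \<in> carrier (free_space k B)" for c f
  proof -
    have "{b. c \<otimes> f b \<noteq> \<zero>} \<subseteq> {b. f b \<noteq> \<zero>}"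
      using that by auto
    with that show ?thesis
      unfolding free_space_simps by (auto intro: finite_subset)
  qed
  have neg: "\<exists>h \<in> carrier (free_space k B). h \<oplus>\<^bsub>free_space k B\<^esub> f = \<zero>\<^bsub>free_space k B\<^esub>"
    if "f \<in> carrier (free_space k B)" for f
  proof
    show "(\<ominus> \<one>) \<odot>\<^bsub>free_space k B\<^esub> f \<in> carrier (free_space k B)"
      by (rule smult) (auto simp: that)
    show "(\<ominus> \<one>) \<odot>\<^bsub>free_space k B\<^esub> f \<oplus>\<^bsub>free_space k B\<^esub> f = \<zero>\<^bsub>free_space k B\<^esub>"
      using that by (auto simp: free_space_simps l_minus l_neg)
  qed
  show ?thesis
    by (rule moduleI, rule is_cring, rule abelian_groupI)
      (use add smult neg in \<open>auto simp: free_space_simps a_ac l_distr r_distr m_assoc\<close>)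
qed

lemma single_closed [simp]: "b \<in> B ==> single k b \<in> carrier (free_space k B)"
  by (auto simp: free_space_simps single_def)

lemma free_space_induct [consumes 1, case_names zero single add smult]:
  assumes f: "f \<in> carrier (free_space k B)"
    and zero: "P \<zero>\<^bsub>free_space k B\<^esub>"
    and single: "\<And>b. b \<in> B ==> P (single k b)"
    and add: "\<And>f h. f \<in> carrier (free_space k B) ==> h \<in> carrier (free_space k B) ==>
                P f ==> P h ==> P (f \<oplus>\<^bsub>free_space k B\<^esub> h)"
    and smult: "\<And>c f. c \<in> carrier k ==> f \<in> carrier (free_space k B) ==> P f ==>
                P (c \<odot>\<^bsub>free_space k B\<^esub> f)"
  shows "P f"
proof -
  have "finite S ==> f \<in> carrier (free_space k B) ==> {b. f b \<noteq> \<zero>} \<subseteq> S ==> P f" for S f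
  proof (induction S arbitrary: f rule: finite_induct)
    case empty
    then have "f = \<zero>\<^bsub>free_space k B\<^esub>"
      by (auto simp: free_space_simps)
    then show ?case using zero by simp
  next
    case (insert b S)
    show ?case
    proof (cases "f b = \<zero>")
      case True
      then show ?thesis using insert by (intro insert.IH) auto
    next
      case False
      let ?f = "f(b := \<zero>)"
      have fk: "\<And>b. f b \<in> carrier k" using insert.prems by (auto simp: free_space_simps)
      have bB: "b \<in> B" using insert.prems False by (auto simp: free_space_simps)
      have "{b. ?f b \<noteq> \<zero>} \<subseteq> {b. f b \<noteq> \<zero>}" by auto
      then have f: "?f \<in> carrier (free_space k B)"
        using insert.prems unfolding free_space_simps by (auto intro: finite_subset)
      have "P ?f"
        by (rule insert.IH [OF f]) (use insert.prems in auto)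
      moreover have "f = ?f \<oplus>\<^bsub>free_space k B\<^esub> f b \<odot>\<^bsub>free_space k B\<^esub> single k b"
        by (rule ext) (simp add: free_space_simps single_def fk)
      ultimately show ?thesis
        using add [OF f, of "f b \<odot>\<^bsub>free_space k B\<^esub> single k b"] smult [of "f b" "single k b"]
          single bB fk by simp
    qed
  qed
  with f show ?thesis by (auto simp: free_space_simps)
qed

definition lin_ext where
  "lin_ext U \<gamma> f = (\<Oplus>\<^sub>U b \<in> {b. f b \<noteq> \<zero>}. f b \<odot>\<^sub>U \<gamma> b)"

text \<open>The sum in \<open>lin_ext\<close> runs over the support, which changes with the
  argument. Additivity needs a common finite index set, on which the extra terms vanish.\<close>

lemma lin_ext_superset:
  assumes "module k U" "f \<in> carrier (free_space k B)" "\<gamma> \<in> B \<rightarrow> carrier U"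
    "finite S" "{b. f b \<noteq> \<zero>} \<subseteq> S" "S \<subseteq> B"
  shows "lin_ext U \<gamma> f = (\<Oplus>\<^sub>U b \<in> S. f b \<odot>\<^sub>U \<gamma> b)"
  unfolding lin_ext_def
  by (rule vfinsum_mono_neutral) (use assms in \<open>auto simp: free_space_simps subset_iff Pi_iff\<close>)

lemma lin_ext_linear:
  assumes U: "module k U" and \<gamma>: "\<gamma> \<in> B \<rightarrow> carrier U"
  shows "lin_ext U \<gamma> \<in> lin (free_space k B) U"
proof (rule lin_mapsI)
  fix f assume f: "f \<in> carrier (free_space k B)"
  show "lin_ext U \<gamma> f \<in> carrier U"
    unfolding lin_ext_def using U \<gamma> f by (intro vfinsum_closed) (auto simp: free_space_simps Pi_iff subset_iff)
next
  fix f h assume f: "f \<in> carrier (free_space k B)" and h: "h \<in> carrier (free_space k B)"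
  let ?S = "{b. f b \<noteq> \<zero>} \<union> {b. h b \<noteq> \<zero>}"
  have fin: "finite ?S" "?S \<subseteq> B" using f h by (auto simp: free_space_simps)
  have fh: "f \<oplus>\<^bsub>free_space k B\<^esub> h \<in> carrier (free_space k B)" using f h by simp
  have sub: "{b. (f \<oplus>\<^bsub>free_space k B\<^esub> h) b \<noteq> \<zero>} \<subseteq> ?S" by (auto simp: free_space_simps)
  have "lin_ext U \<gamma> (f \<oplus>\<^bsub>free_space k B\<^esub> h) = (\<Oplus>\<^sub>U b \<in> ?S. f b \<odot>\<^sub>U \<gamma> b \<oplus>\<^sub>U h b \<odot>\<^sub>U \<gamma> b)"
    unfolding lin_ext_superset [OF U fh \<gamma> fin(1) sub fin(2)]
    by (rule vfinsum_cong) (use f h U \<gamma> fin(2) in \<open>auto simp: free_space_simps Pi_iff subset_iff vsmult_add_left\<close>)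
  also have "\<dots> = (\<Oplus>\<^sub>U b \<in> ?S. f b \<odot>\<^sub>U \<gamma> b) \<oplus>\<^sub>U (\<Oplus>\<^sub>U b \<in> ?S. h b \<odot>\<^sub>U \<gamma> b)"
    by (rule vfinsum_add) (use f h U \<gamma> fin(2) in \<open>auto simp: free_space_simps Pi_iff subset_iff\<close>)
  also have "\<dots> = lin_ext U \<gamma> f \<oplus>\<^sub>U lin_ext U \<gamma> h"
    using lin_ext_superset [OF U f \<gamma> fin(1) _ fin(2)] lin_ext_superset [OF U h \<gamma> fin(1) _ fin(2)] by auto
  finally show "lin_ext U \<gamma> (f \<oplus>\<^bsub>free_space k B\<^esub> h) = lin_ext U \<gamma> f \<oplus>\<^sub>U lin_ext U \<gamma> h" .
next
  fix c f assume c: "c \<in> carrier k" and f: "f \<in> carrier (free_space k B)"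
  let ?S = "{b. f b \<noteq> \<zero>}"
  have fin: "finite ?S" "?S \<subseteq> B" using f by (auto simp: free_space_simps)
  have cf: "c \<odot>\<^bsub>free_space k B\<^esub> f \<in> carrier (free_space k B)" using f c by simp
  have sub: "{b. (c \<odot>\<^bsub>free_space k B\<^esub> f) b \<noteq> \<zero>} \<subseteq> ?S" using c by (auto simp: free_space_simps)
  have "lin_ext U \<gamma> (c \<odot>\<^bsub>free_space k B\<^esub> f) = (\<Oplus>\<^sub>U b \<in> ?S. c \<odot>\<^sub>U (f b \<odot>\<^sub>U \<gamma> b))"
    unfolding lin_ext_superset [OF U cf \<gamma> fin(1) sub fin(2)]
    by (rule vfinsum_cong) (use f c U \<gamma> fin(2) in \<open>auto simp: free_space_simps Pi_iff subset_iff vsmult_assoc\<close>)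
  also have "\<dots> = c \<odot>\<^sub>U (\<Oplus>\<^sub>U b \<in> ?S. f b \<odot>\<^sub>U \<gamma> b)"
    by (rule vfinsum_smult [symmetric]) (use f c U \<gamma> fin in \<open>auto simp: free_space_simps Pi_iff subset_iff\<close>)
  finally show "lin_ext U \<gamma> (c \<odot>\<^bsub>free_space k B\<^esub> f) = c \<odot>\<^sub>U lin_ext U \<gamma> f"
    by (simp add: lin_ext_def)
qed

lemma lin_ext_single:
  assumes "module k U" "\<gamma> b \<in> carrier U"
  shows "lin_ext U \<gamma> (single k b) = \<gamma> b"
proof -
  have "{c. single k b c \<noteq> \<zero>} = {b}" by (auto simp: single_def)
  then have "lin_ext U \<gamma> (single k b) = (\<Oplus>\<^sub>U c \<in> {b}. single k b c \<odot>\<^sub>U \<gamma> c)"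
    by (simp only: lin_ext_def)
  also have "\<dots> = single k b b \<odot>\<^sub>U \<gamma> b \<oplus>\<^sub>U (\<Oplus>\<^sub>U c \<in> {}. single k b c \<odot>\<^sub>U \<gamma> c)"
    by (rule vfinsum_insert) (use assms in \<open>auto simp: single_def\<close>)
  also have "\<dots> = \<gamma> b"
    using assms by (simp add: single_def)
  finally show ?thesis .
qed

subsection \<open>Spans and quotients\<close>

lemma submodule_subset: "submodule N k V ==> N \<subseteq> carrier V"
  using subgroup.subset [OF submodule.axioms(1)] by fastforce

lemma submodule_zero: "submodule N k V ==> \<zero>\<^sub>V \<in> N"
  using subgroup.one_closed [OF submodule.axioms(1)] by fastforce

lemma submodule_add: "submodule N k V ==> x \<in> N ==> y \<in> N ==> x \<oplus>\<^sub>V y \<in> N"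
  using subgroup.m_closed [OF submodule.axioms(1), of N k V x y] by simp

lemma submodule_smult: "submodule N k V ==> c \<in> carrier k ==> x \<in> N ==> c \<odot>\<^sub>V x \<in> N"
  by (rule submodule.smult_closed)

lemma submoduleI':
  assumes V: "module k V" and sub: "N \<subseteq> carrier V" and zero: "\<zero>\<^sub>V \<in> N"
    and add: "\<And>a b. a \<in> N ==> b \<in> N ==> a \<oplus>\<^sub>V b \<in> N"
    and smult: "\<And>a x. a \<in> carrier k ==> x \<in> N ==> a \<odot>\<^sub>V x \<in> N"
  shows "submodule N k V"
proof (rule module.submoduleI [OF V sub zero])
  fix a assume a: "a \<in> N"
  then have "\<ominus>\<^sub>V a = (\<ominus> \<one>) \<odot>\<^sub>V a"
    using sub V by (simp add: vsmult_neg_left subsetD)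
  then show "\<ominus>\<^sub>V a \<in> N" using smult [OF _ a, of "\<ominus> \<one>"] by simp
qed (use add smult in auto)

lemma submodule_carrier: "module k V ==> submodule (carrier V) k V"
  by (rule submoduleI') auto

lemma submodule_lin_span:
  assumes V: "module k V" and S: "S \<subseteq> carrier V"
  shows "submodule (lin_span k V S) k V"
  unfolding lin_span_def
  by (rule submoduleI' [OF V])
    (use submodule_carrier [OF V] S in \<open>auto intro: submodule_zero submodule_add submodule_smult\<close>)

lemma lin_span_superset: "S \<subseteq> lin_span k V S"
  by (auto simp: lin_span_def)

lemma lin_span_minimal: "submodule N k V ==> S \<subseteq> N ==> lin_span k V S \<subseteq> N"
  by (auto simp: lin_span_def)

lemma submodule_kernel:
  assumes "module k V" "module k W" "\<phi> \<in> lin V W"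
  shows "submodule {v \<in> carrier V. \<phi> v = \<zero>\<^sub>W} k V"
  by (rule submoduleI') (use assms in \<open>auto simp: lin_zero lin_add [OF assms(3)] lin_smult [OF assms(3)]\<close>)

lemma submodule_equalizer:
  assumes "module k V" "module k W" "\<phi> \<in> lin V W" "\<psi> \<in> lin V W"
  shows "submodule {v \<in> carrier V. \<phi> v = \<psi> v} k V"
  by (rule submoduleI') (use assms in \<open>auto simp: lin_zero [of V W] lin_add [OF assms(3)] lin_smult [OF assms(3)]
     lin_add [OF assms(4)] lin_smult [OF assms(4)]\<close>)

lemma submodule_abelian:
  assumes "module k V" "submodule N k V"
  shows "abelian_subgroup N V"
  using assms submodule.axioms(1) by (auto intro!: abelian_subgroupI3 additive_subgroupI mod_abelian)

lemma coset_self: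
  assumes "module k V" "submodule N k V" "x \<in> carrier V"
  shows "x \<in> N +>\<^sub>V x"
  by (rule abelian_subgroup.a_rcos_self [OF submodule_abelian]) (use assms in auto)

lemma coset_mem:
  assumes "module k V" "submodule N k V" "x \<in> carrier V" "y \<in> carrier V"
  shows "y \<in> N +>\<^sub>V x \<longleftrightarrow> y \<ominus>\<^sub>V x \<in> N"
proof -
  interpret abelian_subgroup N V using assms submodule_abelian by blast
  show ?thesis
    using a_rcos_module [of x y] assms by (simp add: a_minus_def)
qed

lemma coset_eq:
  assumes "module k V" "submodule N k V" "x \<in> carrier V" "y \<in> carrier V"
  shows "N +>\<^sub>V x = N +>\<^sub>V y \<longleftrightarrow> x \<ominus>\<^sub>V y \<in> N"
proof -
  interpret abelian_subgroup N V using assms submodule_abelian by blast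
  show ?thesis
    by (metis assms coset_mem coset_self a_repr_independence a_subgroup)
qed

lemma quot_space_simps:
  "zero (quot_space V N) = N" "add (quot_space V N) = set_add V"
  "carrier (quot_space V N) = (\<lambda>x. N +>\<^sub>V x) ` carrier V"
  "smult (quot_space V N) = (\<lambda>c X. \<Union>x\<in>X. N +>\<^sub>V (c \<odot>\<^sub>V x))"
  by (auto simp: quot_space_def A_RCOSETS_def')

lemma coset_add:
  assumes "module k V" "submodule N k V" "x \<in> carrier V" "y \<in> carrier V"
  shows "(N +>\<^sub>V x) \<oplus>\<^bsub>quot_space V N\<^esub> (N +>\<^sub>V y) = N +>\<^sub>V (x \<oplus>\<^sub>V y)"
  using abelian_subgroup.a_rcos_sum [OF submodule_abelian] assms by (simp add: quot_space_simps)

text \<open>The cosets united in the scalar multiplication of \<open>quot_space\<close> all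
  coincide, because representatives differ by an element of \<open>N\<close> and \<open>N\<close> is
  closed under scalars.\<close>

lemma coset_smult:
  assumes V: "module k V" and N: "submodule N k V" and c: "c \<in> carrier k" and x: "x \<in> carrier V"
  shows "c \<odot>\<^bsub>quot_space V N\<^esub> (N +>\<^sub>V x) = N +>\<^sub>V (c \<odot>\<^sub>V x)"
proof -
  have "N +>\<^sub>V (c \<odot>\<^sub>V y) = N +>\<^sub>V (c \<odot>\<^sub>V x)" if y: "y \<in> N +>\<^sub>V x" for y
  proof -
    have yV: "y \<in> carrier V"
      by (rule abelian_subgroup.a_elemrcos_carrier [OF submodule_abelian [OF V N] x y])
    have "c \<odot>\<^sub>V (y \<ominus>\<^sub>V x) \<in> N"
      using y coset_mem [OF V N x yV] submodule_smult [OF N c] by simp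
    then show ?thesis
      using V c x yV by (simp add: coset_eq [OF V N] a_minus_def vsmult_add vsmult_neg)
  qed
  then have "(\<Union>y\<in>N +>\<^sub>V x. N +>\<^sub>V (c \<odot>\<^sub>V y)) = N +>\<^sub>V (c \<odot>\<^sub>V x)"
    using coset_self [OF V N x] by (intro UN_constant_eq) blast+
  then show ?thesis by (simp only: quot_space_simps)
qed

lemma coset_zero:
  assumes V: "module k V" and N: "submodule N k V"
  shows "N +>\<^sub>V \<zero>\<^sub>V = \<zero>\<^bsub>quot_space V N\<^esub>"
  using abelian_group.a_coset_add_zero [OF mod_abelian [OF V] submodule_subset [OF N]]
  by (simp add: quot_space_simps)

lemma quot_space_module:
  assumes V: "module k V" and N: "submodule N k V"
  shows "module k (quot_space V N)"
proof (rule moduleI [OF is_cring abelian_groupI])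
  fix X assume "X \<in> carrier (quot_space V N)"
  then obtain x where x: "x \<in> carrier V" "X = N +>\<^sub>V x"
    by (auto simp: quot_space_simps)
  show "\<exists>Z \<in> carrier (quot_space V N). Z \<oplus>\<^bsub>quot_space V N\<^esub> X = \<zero>\<^bsub>quot_space V N\<^esub>"
    by (rule bexI [of _ "N +>\<^sub>V \<ominus>\<^sub>V x"])
      (use x V N coset_zero [OF V N] in \<open>auto simp: coset_add quot_space_simps(3)\<close>)
qed (use V N coset_zero [OF V N, symmetric] in
  \<open>auto simp: quot_space_simps(3) coset_add coset_smult vac vsmult_add vsmult_add_left vsmult_assoc\<close>)

lemma coset_linear:
  assumes V: "module k V" and N: "submodule N k V"
  shows "(\<lambda>x. N +>\<^sub>V x) \<in> lin V (quot_space V N)"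
  by (rule lin_mapsI) (use assms in \<open>auto simp: coset_add coset_smult quot_space_simps(3)\<close>)

lemma coset_some:
  assumes V: "module k V" and N: "submodule N k V" and x: "x \<in> carrier V"
  shows "(SOME f. f \<in> N +>\<^sub>V x) \<in> carrier V" "N +>\<^sub>V (SOME f. f \<in> N +>\<^sub>V x) = N +>\<^sub>V x"
proof -
  have *: "(SOME f. f \<in> N +>\<^sub>V x) \<in> N +>\<^sub>V x"
    by (rule someI) (rule coset_self [OF V N x])
  show "(SOME f. f \<in> N +>\<^sub>V x) \<in> carrier V"
    by (rule abelian_subgroup.a_elemrcos_carrier [OF submodule_abelian [OF V N] x *])
  then show "N +>\<^sub>V (SOME f. f \<in> N +>\<^sub>V x) = N +>\<^sub>V x"
    using * V N x coset_mem [OF V N x] coset_eq [OF V N] by blast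
qed

text \<open>Representatives of a coset differ by an element of \<open>N\<close>, which \<phi> kills;
  evaluation at the representative chosen by \<open>SOME\<close> is therefore well defined and
  linear.\<close>

lemma quot_lift:
  assumes V: "module k V" and N: "submodule N k V" and U: "module k U"
    and \<phi>: "\<phi> \<in> lin V U" and ker: "\<And>n. n \<in> N ==> \<phi> n = \<zero>\<^sub>U"
  shows "x \<in> carrier V ==> \<phi> (SOME f. f \<in> N +>\<^sub>V x) = \<phi> x"
    and "(\<lambda>X. \<phi> (SOME f. f \<in> X)) \<in> lin (quot_space V N) U"
proof -
  show *: "\<phi> (SOME f. f \<in> N +>\<^sub>V x) = \<phi> x" if x: "x \<in> carrier V" for x
  proof -
    let ?y = "SOME f. f \<in> N +>\<^sub>V x"
    have y: "?y \<in> carrier V" "N +>\<^sub>V ?y = N +>\<^sub>V x"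
      using coset_some [OF V N x] by auto
    then have "?y \<ominus>\<^sub>V x \<in> N" using coset_eq [OF V N y(1) x] by blast
    then have "\<phi> (?y \<oplus>\<^sub>V \<ominus>\<^sub>V x) = \<zero>\<^sub>U" using ker by (simp add: a_minus_def)
    then have "\<phi> ?y \<ominus>\<^sub>U \<phi> x = \<zero>\<^sub>U"
      using V U x y(1) by (simp add: lin_add [OF \<phi>] lin_neg [OF V U \<phi>] a_minus_def)
    then show ?thesis
      using vcancel [OF U] lin_closed [OF \<phi>] x y(1) by blast
  qed
  show "(\<lambda>X. \<phi> (SOME f. f \<in> X)) \<in> lin (quot_space V N) U"
    by (rule lin_mapsI)
      (use V N lin_closed [OF \<phi>] in \<open>auto simp: quot_space_simps(3) coset_add coset_smult * lin_add [OF \<phi>] lin_smult [OF \<phi>]\<close>)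
qed

section \<open>Tensor products\<close>

text \<open>Equality of the linear structure only: the records may have different types and
  different products. Tensor spaces and linear maps depend on nothing else.\<close>

definition same_module where
  "same_module V W \<longleftrightarrow> carrier V = carrier W \<and> add V = add W \<and> zero V = zero W \<and> smult V = smult W"

lemma module_cong:
  assumes V: "module k V" and same: "same_module V W"
  shows "module k W"
proof -
  have eqs: "carrier W = carrier V" "add W = add V" "zero W = zero V" "smult W = smult V"
    using same by (simp_all add: same_module_def)
  show ?thesis
  proof (rule moduleI [OF is_cring abelian_groupI], unfold eqs)
    fix x assume "x \<in> carrier V"
    then show "\<exists>y \<in> carrier V. y \<oplus>\<^sub>V x = \<zero>\<^sub>V"
      using V by (intro bexI [of _ "\<ominus>\<^sub>V x"]) auto
  qed (use V in \<open>auto simp: vac vsmult_add vsmult_add_left vsmult_assoc\<close>)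
qed

lemma finsum_same_module:
  assumes V: "module k V" and same: "same_module V W" and \<gamma>: "\<And>i. i \<in> I ==> \<gamma> i \<in> carrier V"
  shows "finsum V \<gamma> I = finsum W \<gamma> I"
proof -
  have W: "module k W" by (rule module_cong [OF V same])
  show ?thesis
  proof (cases "finite I")
    case True
    then show ?thesis using \<gamma>
    proof (induction I rule: finite_induct)
      case empty
      then show ?case using V W same by (simp add: same_module_def)
    next
      case (insert i I)
      then show ?case
        using V W same vfinsum_insert [OF V, of I i \<gamma>] vfinsum_insert [OF W, of I i \<gamma>]
        by (simp add: same_module_def)
    qed
  next
    \<comment> \<open>Over an infinite index set both sums take the default value zero.\<close>
    case False
    then show ?thesis
      using same by (simp add: same_module_def finsum_def finprod_def)
  qed
qed

lemma tensor_simps: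
  "carrier (tensor k V W) = carrier (tensor_space k V W)"
  "add (tensor k V W) = add (tensor_space k V W)"
  "zero (tensor k V W) = zero (tensor_space k V W)"
  "smult (tensor k V W) = smult (tensor_space k V W)"
  "one (tensor k V W) = pure k V W \<one>\<^sub>V \<one>\<^sub>W"
  by (simp_all add: tensor_def Let_def)

lemma tensor_space_cong:
  assumes "same_module V V'" "same_module W W'"
  shows "tensor_space k V W = tensor_space k V' W'" "pure k V W = pure k V' W'"
proof -
  have *: "tensor_kernel k V W = tensor_kernel k V' W'"
    using assms by (simp add: same_module_def tensor_kernel_def tensor_relators_def Let_def)
  show "tensor_space k V W = tensor_space k V' W'" "pure k V W = pure k V' W'"
    using assms * by (simp_all add: same_module_def tensor_space_def pure_def fun_eq_iff)
qed

section \<open>Pure tensors and the universal property of the tensor product\<close>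

context
  fixes V :: "('k, 'v, 'n) module_scheme" and W :: "('k, 'w, 'o) module_scheme"
begin

private abbreviation "F \<equiv> free_space k (carrier V \<times> carrier W)"
private abbreviation "K \<equiv> tensor_kernel k V W"

lemma tensor_relators_subset:
  assumes "module k V" "module k W"
  shows "tensor_relators k V W \<subseteq> carrier F"
  using assms unfolding tensor_relators_def Let_def
  by (auto intro!: vminus_closed [OF free_space_module])

lemma submodule_tensor_kernel:
  assumes "module k V" "module k W"
  shows "submodule K k F"
  unfolding tensor_kernel_def
  by (rule submodule_lin_span) (use tensor_relators_subset assms in auto)

lemma tensor_module [simp]:
  assumes "module k V" "module k W"
  shows "module k (tensor k V W)"
  by (rule module_cong [of "tensor_space k V W"])
    (auto simp: tensor_space_def same_module_def tensor_simps
      intro!: quot_space_module submodule_tensor_kernel assms)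

lemma pure_closed [simp]:
  assumes "module k V" "module k W" "v \<in> carrier V" "w \<in> carrier W"
  shows "pure k V W v w \<in> carrier (tensor k V W)"
  using assms by (auto simp: tensor_simps tensor_space_def quot_space_simps(3) pure_def)

lemma tensor_relator_eq:
  assumes "module k V" "module k W" "f \<in> carrier F" "h \<in> carrier F"
    "f \<ominus>\<^sub>F h \<in> tensor_relators k V W"
  shows "K +>\<^sub>F f = K +>\<^sub>F h"
  using assms coset_eq [OF free_space_module submodule_tensor_kernel [OF assms(1,2)]]
    lin_span_superset [of "tensor_relators k V W" F]
  by (auto simp: tensor_kernel_def)

lemma tensor_coset_simps:
  assumes "module k V" "module k W" "f \<in> carrier F"
  shows "h \<in> carrier F ==> (K +>\<^sub>F f) \<oplus>\<^bsub>tensor k V W\<^esub> (K +>\<^sub>F h) = K +>\<^sub>F (f \<oplus>\<^sub>F h)"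
    and "c \<in> carrier k ==> c \<odot>\<^bsub>tensor k V W\<^esub> (K +>\<^sub>F f) = K +>\<^sub>F (c \<odot>\<^sub>F f)"
  using coset_add [OF free_space_module submodule_tensor_kernel [OF assms(1,2)]]
    coset_smult [OF free_space_module submodule_tensor_kernel [OF assms(1,2)]] assms(3)
  by (auto simp: tensor_simps tensor_space_def)

lemma pure_add_left:
  assumes "module k V" "module k W" "v \<in> carrier V" "v' \<in> carrier V" "w \<in> carrier W"
  shows "pure k V W (v \<oplus>\<^sub>V v') w = pure k V W v w \<oplus>\<^bsub>tensor k V W\<^esub> pure k V W v' w"
proof -
  have "K +>\<^sub>F single k (v \<oplus>\<^sub>V v', w) = K +>\<^sub>F (single k (v, w) \<oplus>\<^sub>F single k (v', w))"
    by (rule tensor_relator_eq)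
      (use assms in \<open>auto simp: tensor_relators_def Let_def simp del: free_space_simps intro!: vadd_closed\<close>)
  then show ?thesis using assms by (simp add: pure_def tensor_coset_simps)
qed

lemma pure_add_right:
  assumes "module k V" "module k W" "v \<in> carrier V" "w \<in> carrier W" "w' \<in> carrier W"
  shows "pure k V W v (w \<oplus>\<^sub>W w') = pure k V W v w \<oplus>\<^bsub>tensor k V W\<^esub> pure k V W v w'"
proof -
  have "K +>\<^sub>F single k (v, w \<oplus>\<^sub>W w') = K +>\<^sub>F (single k (v, w) \<oplus>\<^sub>F single k (v, w'))"
    by (rule tensor_relator_eq)
      (use assms in \<open>auto simp: tensor_relators_def Let_def intro!: vadd_closed\<close>)
  then show ?thesis using assms by (simp add: pure_def tensor_coset_simps)
qed

lemma pure_smult_left: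
  assumes "module k V" "module k W" "v \<in> carrier V" "w \<in> carrier W" "c \<in> carrier k"
  shows "pure k V W (c \<odot>\<^sub>V v) w = c \<odot>\<^bsub>tensor k V W\<^esub> pure k V W v w"
proof -
  have "K +>\<^sub>F single k (c \<odot>\<^sub>V v, w) = K +>\<^sub>F (c \<odot>\<^sub>F single k (v, w))"
    by (rule tensor_relator_eq)
      (use assms in \<open>auto simp: tensor_relators_def Let_def intro!: vsmult_closed\<close>)
  then show ?thesis using assms by (simp add: pure_def tensor_coset_simps)
qed

lemma pure_smult_right:
  assumes "module k V" "module k W" "v \<in> carrier V" "w \<in> carrier W" "c \<in> carrier k"
  shows "pure k V W v (c \<odot>\<^sub>W w) = c \<odot>\<^bsub>tensor k V W\<^esub> pure k V W v w"
proof -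
  have "K +>\<^sub>F single k (v, c \<odot>\<^sub>W w) = K +>\<^sub>F (c \<odot>\<^sub>F single k (v, w))"
    by (rule tensor_relator_eq)
      (use assms in \<open>auto simp: tensor_relators_def Let_def intro!: vsmult_closed\<close>)
  then show ?thesis using assms by (simp add: pure_def tensor_coset_simps)
qed

lemma bilin_pure:
  assumes "module k V" "module k W"
  shows "bilin V W (tensor k V W) (pure k V W)"
  by (intro bilinI lin_mapsI)
    (use assms in \<open>auto simp: pure_add_left pure_add_right pure_smult_left pure_smult_right\<close>)

lemma tensor_induct [consumes 3, case_names pure add]:
  assumes "module k V" "module k W" "t \<in> carrier (tensor k V W)"
    and pure: "\<And>v w. v \<in> carrier V ==> w \<in> carrier W ==> P (pure k V W v w)"
    and add: "\<And>s t. s \<in> carrier (tensor k V W) ==> t \<in> carrier (tensor k V W) ==> P s ==> P t ==>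
                P (s \<oplus>\<^bsub>tensor k V W\<^esub> t)"
  shows "P t"
proof -
  obtain f where f: "f \<in> carrier F" and t: "t = K +>\<^sub>F f"
    using assms(3) by (auto simp: tensor_simps tensor_space_def quot_space_simps(3))
  have car: "K +>\<^sub>F h \<in> carrier (tensor k V W)" if "h \<in> carrier F" for h
    using that by (auto simp: tensor_simps tensor_space_def quot_space_simps(3))
  have z: "pure k V W \<zero>\<^sub>V \<zero>\<^sub>W = \<zero>\<^bsub>tensor k V W\<^esub>"
    using pure_smult_left [OF assms(1,2), of "\<zero>\<^sub>V" "\<zero>\<^sub>W" \<zero>] assms(1,2) by simp
  \<comment> \<open>Strengthened to all scalar multiples. A scalar multiple of a pure tensor is
    again pure, which is why the induction rule has no case for scalars.\<close>
  have "P (K +>\<^sub>F f) \<and> (\<forall>c \<in> carrier k. P (c \<odot>\<^bsub>tensor k V W\<^esub> (K +>\<^sub>F f)))"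
    using f
  proof (induction f rule: free_space_induct)
    case zero
    have "K +>\<^sub>F \<zero>\<^sub>F = \<zero>\<^bsub>tensor k V W\<^esub>"
      using coset_zero [OF free_space_module submodule_tensor_kernel [OF assms(1,2)]]
      by (simp add: tensor_simps tensor_space_def)
    then show ?case
      using z pure [of "\<zero>\<^sub>V" "\<zero>\<^sub>W"] assms(1,2) by simp
  next
    case (single b)
    obtain v w where b: "b = (v, w)" by (cases b)
    then have vw: "v \<in> carrier V" "w \<in> carrier W" using single by auto
    have "K +>\<^sub>F single k b = pure k V W v w" by (simp add: b pure_def)
    then show ?case
      using pure vw assms(1,2) by (simp flip: pure_smult_left)
  next
    case (add f h)
    then show ?case
      using assms(1,2) car assms(5) [of "K +>\<^sub>F f" "K +>\<^sub>F h"]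
        assms(5) [of "c \<odot>\<^bsub>tensor k V W\<^esub> (K +>\<^sub>F f)" "c \<odot>\<^bsub>tensor k V W\<^esub> (K +>\<^sub>F h)" for c]
      by (auto simp: tensor_coset_simps(1) [symmetric] vsmult_add)
  next
    case (smult c f)
    then show ?case
      using assms(1,2) car
      by (auto simp: tensor_coset_simps(2) [symmetric] vsmult_assoc [symmetric])
  qed
  then show ?thesis using t by simp
qed

lemma tensor_lift_ext: "tlift U \<beta> t = lin_ext U (\<lambda>b. \<beta> (fst b) (snd b)) (SOME f. f \<in> t)"
  by (simp add: tensor_lift_def lin_ext_def Let_def)

text \<open>Universal property: bilinearity says exactly that the linear extension of \<beta> kills
  the relators, hence the submodule they span; the rest is the passage to the quotient.\<close>

lemma tensor_lift:
  assumes V: "module k V" and W: "module k W" and U: "module k U" and \<beta>: "bilin V W U \<beta>"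
  shows tensor_lift_linear: "tlift U \<beta> \<in> lin (tensor k V W) U"
    and tensor_lift_pure: "v \<in> carrier V ==> w \<in> carrier W ==>
           tlift U \<beta> (pure k V W v w) = \<beta> v w"
proof -
  let ?\<gamma> = "\<lambda>b. \<beta> (fst b) (snd b)"
  let ?L = "lin_ext U ?\<gamma>"
  have L: "?L \<in> lin F U"
    by (rule lin_ext_linear [OF U]) (auto intro: bilin_closed [OF \<beta>])
  have Ls: "?L (single k (v, w)) = \<beta> v w" if "v \<in> carrier V" "w \<in> carrier W" for v w
    using lin_ext_single [OF U, of ?\<gamma> "(v, w)"] bilin_closed [OF \<beta>] that by simp
  have Lm: "?L (f \<ominus>\<^sub>F h) = ?L f \<ominus>\<^sub>U ?L h" if "f \<in> carrier F" "h \<in> carrier F" for f h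
    using that by (simp add: a_minus_def lin_add [OF L] lin_neg [OF _ U L])
  have "tensor_relators k V W \<subseteq> {f \<in> carrier F. ?L f = \<zero>\<^sub>U}"
  proof
    fix f assume f: "f \<in> tensor_relators k V W"
    then have fF: "f \<in> carrier F" using tensor_relators_subset V W by blast
    have z: "a \<ominus>\<^sub>U a = \<zero>\<^sub>U" if "a \<in> carrier U" for a using vcancel [OF U that that] by simp
    note b1 = lin_add [OF bilin_lin(1) [OF \<beta>]] lin_add [OF bilin_lin(2) [OF \<beta>]]
      lin_smult [OF bilin_lin(1) [OF \<beta>]] lin_smult [OF bilin_lin(2) [OF \<beta>]] bilin_closed [OF \<beta>]
    have "?L f = \<zero>\<^sub>U"
      using f unfolding tensor_relators_def Let_def
    proof (elim UnE CollectE exE conjE)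
    qed (simp_all add: Lm lin_add [OF L] lin_smult [OF L] Ls b1 U V W z)
    with fF show "f \<in> {f \<in> carrier F. ?L f = \<zero>\<^sub>U}" by simp
  qed
  then have ker: "?L n = \<zero>\<^sub>U" if "n \<in> K" for n
    using that lin_span_minimal [OF submodule_kernel [OF free_space_module U L]]
    unfolding tensor_kernel_def by blast
  note lift = quot_lift [OF free_space_module submodule_tensor_kernel [OF V W] U L ker]
  show "tlift U \<beta> \<in> lin (tensor k V W) U"
    using lift(2) by (simp add: tensor_lift_ext [abs_def] lin_maps_def tensor_simps tensor_space_def)
  show "tlift U \<beta> (pure k V W v w) = \<beta> v w" if "v \<in> carrier V" "w \<in> carrier W"
    using lift(1) [of "single k (v, w)"] that Ls by (simp add: tensor_lift_ext pure_def)
qed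

lemma tensor_lift_closed:
  assumes "module k V" "module k W" "module k U" "bilin V W U \<beta>" "t \<in> carrier (tensor k V W)"
  shows "tlift U \<beta> t \<in> carrier U"
  using lin_closed [OF tensor_lift_linear] assms by blast

lemma tensor_lift_add:
  assumes "module k V" "module k W" "module k U" "bilin V W U \<beta>"
    "s \<in> carrier (tensor k V W)" "t \<in> carrier (tensor k V W)"
  shows "tlift U \<beta> (s \<oplus>\<^bsub>tensor k V W\<^esub> t) = tlift U \<beta> s \<oplus>\<^sub>U tlift U \<beta> t"
  using lin_add [OF tensor_lift_linear] assms by blast

lemma tensor_lin_eqI:
  assumes "module k V" "module k W" "\<phi> \<in> lin (tensor k V W) U" "\<psi> \<in> lin (tensor k V W) U"
    "\<And>v w. v \<in> carrier V ==> w \<in> carrier W ==> \<phi> (pure k V W v w) = \<psi> (pure k V W v w)"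
    "t \<in> carrier (tensor k V W)"
  shows "\<phi> t = \<psi> t"
  using assms(1,2,6)
  by (induction t rule: tensor_induct) (auto simp: assms(5) lin_add [OF assms(3)] lin_add [OF assms(4)])

lemma tensor_lift_cong:
  assumes "module k V" "module k W" "module k U" "bilin V W U \<beta>"
    "\<And>v w. v \<in> carrier V ==> w \<in> carrier W ==> \<beta>' v w = \<beta> v w"
    "t \<in> carrier (tensor k V W)"
  shows "tlift U \<beta>' t = tlift U \<beta> t"
proof (rule tensor_lin_eqI [OF assms(1,2) _ _ _ assms(6)])
  have *: "(\<lambda>w. \<beta>' v w) \<in> lin W U" if "v \<in> carrier V" for v
    by (rule lin_cong [OF bilin_lin(1) [OF assms(4) that] assms(2)]) (use assms(5) that in auto)
  have **: "(\<lambda>v. \<beta>' v w) \<in> lin V U" if "w \<in> carrier W" for w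
    by (rule lin_cong [OF bilin_lin(2) [OF assms(4) that] assms(1)]) (use assms(5) that in auto)
  have \<beta>': "bilin V W U \<beta>'" by (intro bilinI * **)
  show "tlift U \<beta>' \<in> lin (tensor k V W) U"
    by (rule tensor_lift_linear [OF assms(1-3) \<beta>'])
  show "tlift U \<beta> \<in> lin (tensor k V W) U"
    by (rule tensor_lift_linear [OF assms(1-4)])
  show "tlift U \<beta>' (pure k V W v w) = tlift U \<beta> (pure k V W v w)"
    if "v \<in> carrier V" "w \<in> carrier W" for v w
    using that assms(5) by (simp add: tensor_lift_pure [OF assms(1-3) \<beta>'] tensor_lift_pure [OF assms(1-4)])
qed

text \<open>For nested lifts: the inner lift depends on the argument of the outer one, and this
  dependence has to be linear.\<close>

lemma lin_tensor_lift_param: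
  assumes "module k V" "module k W" "module k U" "module k Z"
    and t: "t \<in> carrier (tensor k V W)"
    and bil: "\<And>z. z \<in> carrier Z ==> bilin V W U (\<beta> z)"
    and lin: "\<And>v w. v \<in> carrier V ==> w \<in> carrier W ==> (\<lambda>z. \<beta> z v w) \<in> lin Z U"
  shows "(\<lambda>z. tlift U (\<beta> z) t) \<in> lin Z U"
proof -
  have "\<forall>z \<in> carrier Z. \<forall>z' \<in> carrier Z. \<forall>c \<in> carrier k.
     tlift U (\<beta> (z \<oplus>\<^sub>Z z')) t = tlift U (\<beta> z) t \<oplus>\<^sub>U tlift U (\<beta> z') t \<and>
     tlift U (\<beta> (c \<odot>\<^sub>Z z)) t = c \<odot>\<^sub>U tlift U (\<beta> z) t"
    using assms(1,2) t
  proof (induction t rule: tensor_induct)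
    case (pure v w)
    then show ?case
      using lin_add [OF lin] lin_smult [OF lin] assms(4)
      by (simp add: tensor_lift_pure [OF assms(1-3) bil])
  next
    case (add s t)
    have "tlift U (\<beta> z) s \<in> carrier U" "tlift U (\<beta> z) t \<in> carrier U"
      if "z \<in> carrier Z" for z
      using add that by (auto intro!: tensor_lift_closed assms bil)
    with add show ?case
      using assms(3,4) by (simp add: tensor_lift_add [OF assms(1-3) bil] vac vsmult_add)
  qed
  then show ?thesis
    by (intro lin_mapsI) (auto intro!: tensor_lift_closed assms)
qed

text \<open>Moves a linear map inside a Sweedler sum.\<close>

lemma tensor_lift_comp:
  assumes "module k V" "module k W" "module k U" "module k U'" "bilin V W U \<beta>" "\<phi> \<in> lin U U'"
    "t \<in> carrier (tensor k V W)"
  shows "\<phi> (tlift U \<beta> t) = tlift U' (\<lambda>v w. \<phi> (\<beta> v w)) t"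
proof (rule tensor_lin_eqI [OF assms(1,2) _ _ _ assms(7)])
  have \<beta>': "bilin V W U' (\<lambda>v w. \<phi> (\<beta> v w))"
    by (intro bilinI lin_comp [OF assms(6)] bilin_lin [OF assms(5)])
  show "(\<lambda>t. \<phi> (tlift U \<beta> t)) \<in> lin (tensor k V W) U'"
    by (intro lin_comp [OF assms(6)] tensor_lift_linear assms)
  show "tlift U' (\<lambda>v w. \<phi> (\<beta> v w)) \<in> lin (tensor k V W) U'"
    by (intro tensor_lift_linear \<beta>' assms)
  show "\<phi> (tlift U \<beta> (pure k V W v w)) = tlift U' (\<lambda>v w. \<phi> (\<beta> v w)) (pure k V W v w)"
    if "v \<in> carrier V" "w \<in> carrier W" for v w
    using that by (simp add: tensor_lift_pure [OF assms(1-3,5)] tensor_lift_pure [OF assms(1,2,4) \<beta>'])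
qed

end

section \<open>Algebras\<close>

lemma kalg_ring: "k_algebra k A ==> ring A"
  and kalg_module [simp]: "k_algebra k A ==> module k A"
  by (simp_all add: k_algebra_def)

lemma kalg_monoid: "k_algebra k A ==> monoid A"
  using kalg_ring ring.axioms(2) by blast

lemmas
  amult_closed [simp] = monoid.m_closed [OF kalg_monoid] and
  aone_closed [simp] = monoid.one_closed [OF kalg_monoid] and
  aone_left [simp] = monoid.l_one [OF kalg_monoid] and
  aone_right [simp] = monoid.r_one [OF kalg_monoid] and
  amult_assoc = monoid.m_assoc [OF kalg_monoid] and
  apow_closed [simp] = monoid.nat_pow_closed [OF kalg_monoid] and
  amult_add_left = ring.ring_simprules(13) [OF kalg_ring] and
  amult_add_right = ring.ring_simprules(23) [OF kalg_ring] and
  amult_zero_left [simp] = ring.ring_simprules(24) [OF kalg_ring] and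
  amult_zero_right [simp] = ring.ring_simprules(25) [OF kalg_ring] and
  amult_neg_left = ring.ring_simprules(26) [OF kalg_ring] and
  amult_neg_right = ring.ring_simprules(27) [OF kalg_ring] and
  asmult_left = k_algebra.smult_mult_left [of k] and
  asmult_right = k_algebra.smult_mult_right [of k]

text \<open>Non-associative algebras: for these the product on the tensor product is still well defined.\<close>

definition na_algebra where
  "na_algebra A \<longleftrightarrow> module k A \<and> bilin A A A (monoid.mult A) \<and> \<one>\<^sub>A \<in> carrier A"

lemma kalg_na [simp]: "k_algebra k A ==> na_algebra A"
  unfolding na_algebra_def
  by (auto intro!: bilinI lin_mapsI simp: amult_add_left amult_add_right asmult_left asmult_right)

lemma na_module: "na_algebra A ==> module k A"
  and na_bilin: "na_algebra A ==> bilin A A A (monoid.mult A)"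
  and na_one: "na_algebra A ==> \<one>\<^sub>A \<in> carrier A"
  by (auto simp: na_algebra_def)

lemma na_mult_closed:
  "na_algebra A ==> x \<in> carrier A ==> y \<in> carrier A ==> x \<otimes>\<^sub>A y \<in> carrier A"
  using bilin_closed [OF na_bilin] .

lemma k_algebraI:
  assumes na: "na_algebra A"
    and assoc: "\<And>x y z. x \<in> carrier A ==> y \<in> carrier A ==> z \<in> carrier A ==>
      (x \<otimes>\<^sub>A y) \<otimes>\<^sub>A z = x \<otimes>\<^sub>A (y \<otimes>\<^sub>A z)"
    and one_l: "\<And>x. x \<in> carrier A ==> \<one>\<^sub>A \<otimes>\<^sub>A x = x"
    and one_r: "\<And>x. x \<in> carrier A ==> x \<otimes>\<^sub>A \<one>\<^sub>A = x"
  shows "k_algebra k A"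
proof -
  note M = na_module [OF na] and B = na_bilin [OF na]
  have "ring A"
    by (rule ringI, rule mod_abelian [OF M], rule monoidI)
      (use na_mult_closed [OF na] na_one [OF na] assoc one_l one_r lin_add [OF bilin_lin(1) [OF B]]
        lin_add [OF bilin_lin(2) [OF B]] in auto)
  then show ?thesis
    unfolding k_algebra_def k_algebra_axioms_def
    using M field_axioms lin_smult [OF bilin_lin(1) [OF B]] lin_smult [OF bilin_lin(2) [OF B]] by auto
qed

lemma self_algebra [simp]: "k_algebra k (self_module k)"
  by (rule k_algebraI) (auto simp: na_algebra_def m_assoc l_distr r_distr m_lcomm intro!: bilinI lin_mapsI)

subsection \<open>Linearity rules\<close>

lemma lin_pure_left:
  "module k V ==> module k W ==> \<phi> \<in> lin Z V ==> w \<in> carrier W ==>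
     (\<lambda>z. pure k V W (\<phi> z) w) \<in> lin Z (tensor k V W)"
  by (rule bilin_comp_left [OF bilin_pure])

lemma lin_pure_right:
  "module k V ==> module k W ==> \<phi> \<in> lin Z W ==> v \<in> carrier V ==>
     (\<lambda>z. pure k V W v (\<phi> z)) \<in> lin Z (tensor k V W)"
  by (rule bilin_comp_right [OF bilin_pure])

lemma lin_amult_left:
  "na_algebra A ==> \<phi> \<in> lin Z A ==> y \<in> carrier A ==> (\<lambda>z. \<phi> z \<otimes>\<^sub>A y) \<in> lin Z A"
  by (rule bilin_comp_left [OF na_bilin])

lemma lin_amult_right:
  "na_algebra A ==> \<phi> \<in> lin Z A ==> y \<in> carrier A ==> (\<lambda>z. y \<otimes>\<^sub>A \<phi> z) \<in> lin Z A"
  by (rule bilin_comp_right [OF na_bilin])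

lemmas lin_intros = lin_pure_left lin_pure_right lin_amult_left lin_amult_right lin_plus lin_smult_right
  lin_smult_left lin_uminus lin_id

lemma tensor_lift_id:
  assumes V: "module k V" and W: "module k W" and t: "t \<in> carrier (tensor k V W)"
  shows "tlift (tensor k V W) (pure k V W) t = t"
  by (rule tensor_lin_eqI [OF V W _ lin_id _ t])
    (use V W in \<open>auto intro!: tensor_lift_linear bilin_pure simp: tensor_lift_pure bilin_pure\<close>)

lemma tensor_lift_comp_id:
  assumes "module k V" "module k W" "module k U" "\<phi> \<in> lin (tensor k V W) U"
    "t \<in> carrier (tensor k V W)"
  shows "tlift U (\<lambda>v w. \<phi> (pure k V W v w)) t = \<phi> t"
  using tensor_lift_comp [OF assms(1,2) tensor_module [OF assms(1,2)] assms(3) bilin_pure [OF assms(1,2)] assms(4,5)]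
  by (simp add: tensor_lift_id assms)

subsection \<open>The tensor product of two algebras\<close>

lemma lin_maps_tensor_space: "lin X (tensor_space k V W) = lin X (tensor k V W)"
  by (simp add: lin_maps_def tensor_simps)

lemma bilin_tensor_space: "bilin X Y (tensor_space k V W) \<beta> = bilin X Y (tensor k V W) \<beta>"
  by (simp add: bilin_def lin_maps_tensor_space)

lemma tensor_space_module: "module k V ==> module k W ==> module k (tensor_space k V W)"
  by (rule module_cong [OF tensor_module, of V W]) (auto simp: same_module_def tensor_simps)

context
  fixes V :: "('k, 'v, 'n) module_scheme" and W :: "('k, 'w, 'o) module_scheme"
  assumes V: "na_algebra V" and W: "na_algebra W"
begin

private lemma modules: "module k V" "module k W" "module k (tensor k V W)" "module k (tensor_space k V W)"
  using V W by (auto intro: na_module tensor_space_module tensor_module)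

private lemma inner_bilin:
  "v \<in> carrier V ==> w \<in> carrier W ==>
     bilin V W (tensor k V W) (\<lambda>c d. pure k V W (v \<otimes>\<^sub>V c) (w \<otimes>\<^sub>W d))"
  by (intro bilinI lin_intros modules V W na_mult_closed)

private lemma outer_bilin:
  "t \<in> carrier (tensor k V W) ==> bilin V W (tensor k V W)
     (\<lambda>a b. tlift (tensor_space k V W) (\<lambda>c d. pure k V W (a \<otimes>\<^sub>V c) (b \<otimes>\<^sub>W d)) t)"
  unfolding bilin_tensor_space [symmetric]
  by (intro bilinI lin_tensor_lift_param modules)
    (auto simp: bilin_tensor_space lin_maps_tensor_space intro!: inner_bilin lin_intros modules V W na_mult_closed)

lemma tensor_mult_pure:
  assumes "a \<in> carrier V" "b \<in> carrier W" "c \<in> carrier V" "d \<in> carrier W"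
  shows "pure k V W a b \<otimes>\<^bsub>tensor k V W\<^esub> pure k V W c d = pure k V W (a \<otimes>\<^sub>V c) (b \<otimes>\<^sub>W d)"
  unfolding tensor_def Let_def using assms
  by (simp add: tensor_lift_pure modules inner_bilin outer_bilin bilin_tensor_space)

lemma tensor_na: "na_algebra (tensor k V W)"
proof -
  have mult: "s \<otimes>\<^bsub>tensor k V W\<^esub> t = tlift (tensor_space k V W)
     (\<lambda>a b. tlift (tensor_space k V W) (\<lambda>c d. pure k V W (a \<otimes>\<^sub>V c) (b \<otimes>\<^sub>W d)) t) s" for s t
    by (simp add: tensor_def Let_def)
  have "(\<lambda>s. s \<otimes>\<^bsub>tensor k V W\<^esub> t) \<in> lin (tensor k V W) (tensor k V W)"
    if "t \<in> carrier (tensor k V W)" for t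
    unfolding mult lin_maps_tensor_space [symmetric]
    by (rule tensor_lift_linear) (use that in \<open>auto simp: modules outer_bilin bilin_tensor_space\<close>)
  moreover have "(\<lambda>t. s \<otimes>\<^bsub>tensor k V W\<^esub> t) \<in> lin (tensor k V W) (tensor k V W)"
    if "s \<in> carrier (tensor k V W)" for s
    unfolding mult lin_maps_tensor_space [symmetric]
    by (intro lin_tensor_lift_param tensor_lift_linear modules)
      (use that in \<open>auto simp: modules inner_bilin outer_bilin bilin_tensor_space lin_maps_tensor_space\<close>)
  ultimately show ?thesis
    unfolding na_algebra_def using modules na_one [OF V] na_one [OF W]
    by (auto intro!: bilinI simp: tensor_simps(5))
qed

end

text \<open>The laws are linear in each variable, so nested inductions reduce them to pure tensors,
  where they hold factor by factor.\<close>

lemma tensor_k_algebra [simp]: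
  assumes V: "k_algebra k V" and W: "k_algebra k W"
  shows "k_algebra k (tensor k V W)"
proof -
  note na = tensor_na [OF kalg_na kalg_na, OF V W]
  note B = na_bilin [OF na]
  have M: "module k V" "module k W" "module k (tensor k V W)" using V W by auto
  note closed = na_mult_closed [OF na]
  have dist: "(s \<oplus>\<^bsub>tensor k V W\<^esub> s') \<otimes>\<^bsub>tensor k V W\<^esub> t =
      s \<otimes>\<^bsub>tensor k V W\<^esub> t \<oplus>\<^bsub>tensor k V W\<^esub> s' \<otimes>\<^bsub>tensor k V W\<^esub> t"
    "t \<otimes>\<^bsub>tensor k V W\<^esub> (s \<oplus>\<^bsub>tensor k V W\<^esub> s') =
      t \<otimes>\<^bsub>tensor k V W\<^esub> s \<oplus>\<^bsub>tensor k V W\<^esub> t \<otimes>\<^bsub>tensor k V W\<^esub> s'"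
    if "s \<in> carrier (tensor k V W)" "s' \<in> carrier (tensor k V W)" "t \<in> carrier (tensor k V W)" for s s' t
    using lin_add [OF bilin_lin(1) [OF B]] lin_add [OF bilin_lin(2) [OF B]] that by auto
  show ?thesis
  proof (rule k_algebraI [OF na])
    fix x y z
    assume x: "x \<in> carrier (tensor k V W)" and y: "y \<in> carrier (tensor k V W)"
      and z: "z \<in> carrier (tensor k V W)"
    show "(x \<otimes>\<^bsub>tensor k V W\<^esub> y) \<otimes>\<^bsub>tensor k V W\<^esub> z = x \<otimes>\<^bsub>tensor k V W\<^esub> (y \<otimes>\<^bsub>tensor k V W\<^esub> z)"
      using M(1,2) x
    proof (induction x rule: tensor_induct)
      case (pure a b)
      show ?case
        using M(1,2) y
      proof (induction y rule: tensor_induct)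
        case (pure c d)
        show ?case
          using M(1,2) z
        proof (induction z rule: tensor_induct)
          case (pure e f)
          then show ?case
            using V W \<open>a \<in> carrier V\<close> \<open>b \<in> carrier W\<close> \<open>c \<in> carrier V\<close> \<open>d \<in> carrier W\<close>
            by (simp add: tensor_mult_pure amult_assoc)
        next
          case (add s t)
          then show ?case
            using M \<open>a \<in> carrier V\<close> \<open>b \<in> carrier W\<close> \<open>c \<in> carrier V\<close> \<open>d \<in> carrier W\<close>
            by (simp add: dist closed)
        qed
      next
        case (add s t)
        then show ?case
          using M z \<open>a \<in> carrier V\<close> \<open>b \<in> carrier W\<close> by (simp add: dist closed)
      qed
    next
      case (add s t)
      then show ?case using M y z by (simp add: dist closed)
    qed
  next
    fix x assume x: "x \<in> carrier (tensor k V W)"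
    show "\<one>\<^bsub>tensor k V W\<^esub> \<otimes>\<^bsub>tensor k V W\<^esub> x = x"
      using M(1,2) x
      by (induction x rule: tensor_induct)
        (use V W na_one [OF na] in \<open>auto simp: dist tensor_simps(5) tensor_mult_pure\<close>)
    show "x \<otimes>\<^bsub>tensor k V W\<^esub> \<one>\<^bsub>tensor k V W\<^esub> = x"
      using M(1,2) x
      by (induction x rule: tensor_induct)
        (use V W na_one [OF na] in \<open>auto simp: dist tensor_simps(5) tensor_mult_pure\<close>)
  qed
qed

subsection \<open>Algebra homomorphisms\<close>

definition alg_hom where
  "alg_hom A B = {\<phi> \<in> lin A B. \<phi> \<one>\<^sub>A = \<one>\<^sub>B \<and>
     (\<forall>x \<in> carrier A. \<forall>y \<in> carrier A. \<phi> (x \<otimes>\<^sub>A y) = \<phi> x \<otimes>\<^sub>B \<phi> y)}"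

lemma alg_hom_lin: "\<phi> \<in> alg_hom A B ==> \<phi> \<in> lin A B"
  and alg_hom_one: "\<phi> \<in> alg_hom A B ==> \<phi> \<one>\<^sub>A = \<one>\<^sub>B"
  and alg_hom_mult: "\<phi> \<in> alg_hom A B ==> x \<in> carrier A ==> y \<in> carrier A ==>
    \<phi> (x \<otimes>\<^sub>A y) = \<phi> x \<otimes>\<^sub>B \<phi> y"
  by (auto simp: alg_hom_def)

lemmas alg_hom_closed = lin_closed [OF alg_hom_lin]
  and alg_hom_add = lin_add [OF alg_hom_lin]
  and alg_hom_smult = lin_smult [OF alg_hom_lin]

lemma alg_hom_neg:
  "k_algebra k A ==> k_algebra k B ==> \<phi> \<in> alg_hom A B ==> x \<in> carrier A ==>
     \<phi> (\<ominus>\<^sub>A x) = \<ominus>\<^sub>B \<phi> x"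
  by (simp add: lin_neg [OF _ _ alg_hom_lin])

lemma alg_hom_pow:
  assumes "k_algebra k A" "k_algebra k B" "\<phi> \<in> alg_hom A B" "x \<in> carrier A"
  shows "\<phi> (x [^]\<^bsub>A\<^esub> (n::nat)) = \<phi> x [^]\<^bsub>B\<^esub> n"
  using assms by (induction n) (auto simp: alg_hom_one [OF assms(3)] alg_hom_mult [OF assms(3)])

lemma alg_homI:
  "\<phi> \<in> lin A B ==> \<phi> \<one>\<^sub>A = \<one>\<^sub>B ==>
     (\<And>x y. x \<in> carrier A ==> y \<in> carrier A ==> \<phi> (x \<otimes>\<^sub>A y) = \<phi> x \<otimes>\<^sub>B \<phi> y) ==> \<phi> \<in> alg_hom A B"
  by (simp add: alg_hom_def)

lemma alg_hom_id: "(\<lambda>x. x) \<in> alg_hom A A"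
  by (rule alg_homI) (auto intro: lin_id)

lemma alg_hom_comp:
  "\<psi> \<in> alg_hom B C ==> \<phi> \<in> alg_hom A B ==> (\<lambda>x. \<psi> (\<phi> x)) \<in> alg_hom A C"
  by (rule alg_homI)
    (auto simp: alg_hom_one alg_hom_mult alg_hom_closed intro: lin_comp alg_hom_lin)

lemma alg_hom_cong:
  assumes "\<phi> \<in> alg_hom A B" "k_algebra k A" "\<And>x. x \<in> carrier A ==> \<psi> x = \<phi> x"
  shows "\<psi> \<in> alg_hom A B"
  using assms by (auto simp: alg_hom_def intro: lin_cong [of \<phi>])

lemma alg_hom_incl_left: "k_algebra k V ==> k_algebra k W ==>
    (\<lambda>v. pure k V W v \<one>\<^sub>W) \<in> alg_hom V (tensor k V W)"
  by (rule alg_homI) (auto simp: tensor_mult_pure tensor_simps(5) intro: lin_intros)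

lemma alg_hom_incl_right: "k_algebra k V ==> k_algebra k W ==>
    (\<lambda>w. pure k V W \<one>\<^sub>V w) \<in> alg_hom W (tensor k V W)"
  by (rule alg_homI) (auto simp: tensor_mult_pure tensor_simps(5) intro: lin_intros)

lemma alg_hom_scalar: "k_algebra k A ==> (\<lambda>c. c \<odot>\<^sub>A \<one>\<^sub>A) \<in> alg_hom (self_module k) A"
  by (rule alg_homI) (auto simp: asmult_left vsmult_assoc intro!: lin_smult_right lin_id)

lemma bilin_hom_mult:
  assumes "na_algebra U" "\<phi> \<in> lin V U" "\<psi> \<in> lin W U"
  shows "bilin V W U (\<lambda>v w. \<phi> v \<otimes>\<^sub>U \<psi> w)"
  by (intro bilinI lin_intros assms lin_closed [OF assms(2)] lin_closed [OF assms(3)])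

text \<open>Commuting images are what allows \<open>\<phi> c\<close> to pass \<open>\<psi> b\<close>
  in the product of two pure tensors.\<close>

lemma alg_hom_lift:
  assumes V: "k_algebra k V" and W: "k_algebra k W" and U: "k_algebra k U"
    and \<phi>: "\<phi> \<in> alg_hom V U" and \<psi>: "\<psi> \<in> alg_hom W U"
    and comm: "\<And>v w. v \<in> carrier V ==> w \<in> carrier W ==> \<psi> w \<otimes>\<^sub>U \<phi> v = \<phi> v \<otimes>\<^sub>U \<psi> w"
  shows "tlift U (\<lambda>v w. \<phi> v \<otimes>\<^sub>U \<psi> w) \<in> alg_hom (tensor k V W) U"
proof (rule alg_homI)
  have M: "module k V" "module k W" "module k U" and TM: "module k (tensor k V W)" using V W U by auto
  let ?L = "tlift U (\<lambda>v w. \<phi> v \<otimes>\<^sub>U \<psi> w)"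
  have b: "bilin V W U (\<lambda>v w. \<phi> v \<otimes>\<^sub>U \<psi> w)"
    by (rule bilin_hom_mult) (use U \<phi> \<psi> in \<open>auto intro: alg_hom_lin\<close>)
  note p = tensor_lift_pure [OF M b]
  show L: "?L \<in> lin (tensor k V W) U" by (rule tensor_lift_linear [OF M b])
  show "?L \<one>\<^bsub>tensor k V W\<^esub> = \<one>\<^sub>U"
    using V W U by (simp add: tensor_simps(5) p alg_hom_one [OF \<phi>] alg_hom_one [OF \<psi>])
  fix x y assume x: "x \<in> carrier (tensor k V W)" and y: "y \<in> carrier (tensor k V W)"
  show "?L (x \<otimes>\<^bsub>tensor k V W\<^esub> y) = ?L x \<otimes>\<^sub>U ?L y"
    using M(1,2) x
  proof (induction x rule: tensor_induct)
    case (pure a b)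
    show ?case
      using M(1,2) y
    proof (induction y rule: tensor_induct)
      case (pure c d)
      have "(\<phi> a \<otimes>\<^sub>U \<phi> c) \<otimes>\<^sub>U (\<psi> b \<otimes>\<^sub>U \<psi> d) = \<phi> a \<otimes>\<^sub>U ((\<phi> c \<otimes>\<^sub>U \<psi> b) \<otimes>\<^sub>U \<psi> d)"
        using U \<open>a \<in> carrier V\<close> \<open>b \<in> carrier W\<close> pure
        by (simp add: amult_assoc alg_hom_closed [OF \<phi>] alg_hom_closed [OF \<psi>])
      also have "\<dots> = (\<phi> a \<otimes>\<^sub>U \<psi> b) \<otimes>\<^sub>U (\<phi> c \<otimes>\<^sub>U \<psi> d)"
        unfolding comm [OF \<open>c \<in> carrier V\<close> \<open>b \<in> carrier W\<close>, symmetric]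
        using U \<open>a \<in> carrier V\<close> \<open>b \<in> carrier W\<close> pure
        by (simp add: amult_assoc alg_hom_closed [OF \<phi>] alg_hom_closed [OF \<psi>])
      finally show ?case
        using V W pure \<open>a \<in> carrier V\<close> \<open>b \<in> carrier W\<close>
        by (simp add: tensor_mult_pure p alg_hom_mult [OF \<phi>] alg_hom_mult [OF \<psi>])
    next
      case (add s t)
      then show ?case
        using V W U M \<open>a \<in> carrier V\<close> \<open>b \<in> carrier W\<close>
        by (simp add: amult_add_right lin_add [OF L] lin_closed [OF L])
    qed
  next
    case (add s t)
    then show ?case
      using V W U M y by (simp add: amult_add_left lin_add [OF L] lin_closed [OF L])
  qed
qed

text \<open>The map \<phi> \<otimes> \<psi> is the product of its compositions with the two
  inclusions, whose images commute.\<close>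

lemma alg_hom_tensor_map:
  assumes V: "k_algebra k V" and W: "k_algebra k W" and V': "k_algebra k V'" and W': "k_algebra k W'"
    and \<phi>: "\<phi> \<in> alg_hom V V'" and \<psi>: "\<psi> \<in> alg_hom W W'"
  shows "tlift (tensor k V' W') (\<lambda>v w. pure k V' W' (\<phi> v) (\<psi> w)) \<in> alg_hom (tensor k V W) (tensor k V' W')"
proof -
  let ?T = "tensor k V' W'"
  have T: "k_algebra k ?T" using V' W' by simp
  have *: "tlift ?T (\<lambda>v w. pure k V' W' (\<phi> v) \<one>\<^sub>W' \<otimes>\<^sub>?T pure k V' W' \<one>\<^sub>V' (\<psi> w)) \<in> alg_hom (tensor k V W) ?T"
    by (rule alg_hom_lift [OF V W T alg_hom_comp [OF alg_hom_incl_left \<phi>] alg_hom_comp [OF alg_hom_incl_right \<psi>]])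
      (use V' W' in \<open>auto simp: tensor_mult_pure alg_hom_closed [OF \<phi>] alg_hom_closed [OF \<psi>]\<close>)
  show ?thesis
  proof (rule alg_hom_cong [OF *])
    fix t assume "t \<in> carrier (tensor k V W)"
    then show "tlift ?T (\<lambda>v w. pure k V' W' (\<phi> v) (\<psi> w)) t =
      tlift ?T (\<lambda>v w. pure k V' W' (\<phi> v) \<one>\<^sub>W' \<otimes>\<^sub>?T pure k V' W' \<one>\<^sub>V' (\<psi> w)) t"
      by (intro tensor_lift_cong bilin_hom_mult lin_intros)
        (use V W V' W' \<phi> \<psi> in \<open>auto simp: tensor_mult_pure alg_hom_closed alg_hom_lin\<close>)
  qed (use V W in simp)
qed

subsection \<open>Generating sets\<close>

definition subalg where
  "subalg N A \<longleftrightarrow> submodule N k A \<and> \<one>\<^sub>A \<in> N \<and> (\<forall>x \<in> N. \<forall>y \<in> N. x \<otimes>\<^sub>A y \<in> N)"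

text \<open>Generation is expressed by quantifying over subalgebras: a property holds everywhere
  once it is seen to define a subalgebra containing \<open>G\<close>.\<close>

definition generates where
  "generates G A \<longleftrightarrow> G \<subseteq> carrier A \<and> (\<forall>N. subalg N A \<longrightarrow> G \<subseteq> N \<longrightarrow> carrier A \<subseteq> N)"

lemma generates_subset: "generates G A ==> x \<in> G ==> x \<in> carrier A"
  by (auto simp: generates_def)

text \<open>The elements on which two algebra maps agree form a subalgebra.\<close>

lemma generates_alg_hom_eq:
  assumes A: "k_algebra k A" and B: "k_algebra k B" and G: "generates G A"
    and \<phi>: "\<phi> \<in> alg_hom A B" and \<psi>: "\<psi> \<in> alg_hom A B" and eq: "\<And>x. x \<in> G ==> \<phi> x = \<psi> x"
    and x: "x \<in> carrier A"
  shows "\<phi> x = \<psi> x"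
proof -
  have "subalg {x \<in> carrier A. \<phi> x = \<psi> x} A"
    unfolding subalg_def
    using submodule_equalizer [OF _ _ alg_hom_lin [OF \<phi>] alg_hom_lin [OF \<psi>]] A B
    by (auto simp: alg_hom_one [OF \<phi>] alg_hom_one [OF \<psi>] alg_hom_mult [OF \<phi>] alg_hom_mult [OF \<psi>])
  moreover have "G \<subseteq> {x \<in> carrier A. \<phi> x = \<psi> x}" using eq G by (auto simp: generates_def)
  ultimately have "carrier A \<subseteq> {x \<in> carrier A. \<phi> x = \<psi> x}" using G unfolding generates_def by blast
  with x show ?thesis by blast
qed

section \<open>Bialgebras and Hopf algebras\<close>

declare lin_id [simp]

lemma bilin_post:
  "bilin V W U \<beta> ==> \<phi> \<in> lin U U' ==> bilin V W U' (\<lambda>v w. \<phi> (\<beta> v w))"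
  by (rule bilinI; rule lin_comp [of \<phi> U U']) (auto simp: bilin_lin)

lemma bialg_kalg: "bialgebra k H ==> k_algebra k H"
  by (rule bialgebra.axioms)

lemma hopf_bialg: "hopf_algebra k H ==> bialgebra k H"
  by (rule hopf_algebra.axioms)

lemma bialg_comult_hom:
  assumes "bialgebra k H"
  shows "comult H \<in> alg_hom H (tensor k H H)"
  using assms by (auto intro!: alg_homI simp: bialgebra.comult_linear bialgebra.comult_one bialgebra.comult_mult)

lemma bialg_counit_hom:
  assumes "bialgebra k H"
  shows "counit H \<in> alg_hom H (self_module k)"
  using assms by (auto intro!: alg_homI simp: bialgebra.counit_linear bialgebra.counit_one bialgebra.counit_mult)

text \<open>The associator from left-bracketed to right-bracketed threefold tensors; the axiom
  \<open>coassoc\<close> is stated in the right-bracketed space.\<close>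

definition tensor_assoc where
  "tensor_assoc H = tlift (tensor k H (tensor k H H))
     (\<lambda>s h3. tlift (tensor k H (tensor k H H)) (\<lambda>h1 h2. pure k H (tensor k H H) h1 (pure k H H h2 h3)) s)"

context
  fixes H :: "('k, 'h, 'n) hopf_scheme"
begin

private abbreviation "T \<equiv> tensor k H H"
private abbreviation "T3 \<equiv> tensor k H T"

lemma assoc_inner_bilin:
  assumes "module k H" "h3 \<in> carrier H"
  shows "bilin H H T3 (\<lambda>h1 h2. pure k H T h1 (pure k H H h2 h3))"
  by (intro bilinI lin_intros) (use assms in auto)

lemma assoc_outer_bilin:
  assumes "module k H"
  shows "bilin T H T3 (\<lambda>s h3. tlift T3 (\<lambda>h1 h2. pure k H T h1 (pure k H H h2 h3)) s)"
  by (intro bilinI lin_tensor_lift_param tensor_lift_linear assoc_inner_bilin lin_intros) (use assms in auto)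

text \<open>Built from the three commuting embeddings of \<open>H\<close> into the right-bracketed
  cube, the associator is an iterated \<open>alg_hom_lift\<close> and hence multiplicative;
  \<open>eq\<close> identifies this with the nested lift of the definition.\<close>

lemma tensor_assoc_hom:
  assumes H: "k_algebra k H"
  shows "tensor_assoc H \<in> alg_hom (tensor k T H) T3"
proof -
  have T: "k_algebra k T" and T3: "k_algebra k T3" using H by auto
  have M: "module k H" "module k T" "module k T3" using H by auto
  let ?\<phi>1 = "\<lambda>h. pure k H T h \<one>\<^sub>T" and ?\<phi>2 = "\<lambda>h. pure k H T \<one>\<^sub>H (pure k H H h \<one>\<^sub>H)"
    and ?\<phi>3 = "\<lambda>h. pure k H T \<one>\<^sub>H (pure k H H \<one>\<^sub>H h)"
  have 1: "?\<phi>1 \<in> alg_hom H T3" by (rule alg_hom_incl_left [OF H T])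
  have 2: "?\<phi>2 \<in> alg_hom H T3" by (rule alg_hom_comp [OF alg_hom_incl_right alg_hom_incl_left]) (use H T in auto)
  have 3: "?\<phi>3 \<in> alg_hom H T3" by (rule alg_hom_comp [OF alg_hom_incl_right alg_hom_incl_right]) (use H T in auto)
  note s = tensor_mult_pure tensor_simps(5)
  define B where "B = tlift T3 (\<lambda>h1 h2. ?\<phi>1 h1 \<otimes>\<^sub>T3 ?\<phi>2 h2)"
  have B: "B \<in> alg_hom T T3"
    unfolding B_def by (rule alg_hom_lift [OF H H T3 1 2]) (use H T in \<open>simp add: s\<close>)
  have Bp: "B (pure k H H a b) = ?\<phi>1 a \<otimes>\<^sub>T3 ?\<phi>2 b" if "a \<in> carrier H" "b \<in> carrier H" for a b
    unfolding B_def by (rule tensor_lift_pure [OF M(1,1,3) bilin_hom_mult]) (use T3 1 2 that in \<open>auto intro: alg_hom_lin\<close>)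
  have comm: "?\<phi>3 h3 \<otimes>\<^sub>T3 B t = B t \<otimes>\<^sub>T3 ?\<phi>3 h3" if h3: "h3 \<in> carrier H" and t: "t \<in> carrier T" for t h3
    using M(1,1) t
  proof (induction t rule: tensor_induct)
    case (pure v w)
    then show ?case using H T h3 by (simp add: Bp s)
  next
    case (add s t)
    then show ?case
      using H T T3 h3 M by (simp add: alg_hom_add [OF B] alg_hom_closed [OF B] amult_add_left amult_add_right)
  qed
  have *: "tlift T3 (\<lambda>s h3. B s \<otimes>\<^sub>T3 ?\<phi>3 h3) \<in> alg_hom (tensor k T H) T3"
    by (rule alg_hom_lift [OF T H T3 B 3]) (rule comm)
  have eq: "B s \<otimes>\<^sub>T3 ?\<phi>3 h3 = tlift T3 (\<lambda>h1 h2. pure k H T h1 (pure k H H h2 h3)) s"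
    if "h3 \<in> carrier H" and "s \<in> carrier T" for s h3
    by (rule tensor_lin_eqI [where U = T3, OF M(1,1) _ _ _ that(2)])
      (use that H T T3 M in \<open>auto simp: s Bp tensor_lift_pure assoc_inner_bilin
        intro!: tensor_lift_linear assoc_inner_bilin lin_amult_left alg_hom_lin [OF B]\<close>)
  show ?thesis
  proof (rule alg_hom_cong [OF *])
    fix x assume "x \<in> carrier (tensor k T H)"
    then show "tensor_assoc H x = tlift T3 (\<lambda>s h3. B s \<otimes>\<^sub>T3 ?\<phi>3 h3) x"
      unfolding tensor_assoc_def
      by (intro tensor_lift_cong bilin_hom_mult)
        (use H T T3 alg_hom_lin [OF B] alg_hom_lin [OF 3] in \<open>simp_all add: eq\<close>)
  qed (use H T in simp)
qed

text \<open>Rewrites the nested Sweedler sum as the associator after \<Delta> \<otimes> id after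
  \<Delta>; \<open>coassoc_right\<close> does the same with id \<otimes> \<Delta>. In this form both
  sides are algebra maps as soon as \<Delta> is one.\<close>

lemma coassoc_left:
  assumes M: "module k H" and \<Delta>: "comult H \<in> lin H T" and h: "h \<in> carrier H"
  shows "sweedler k H T3 (\<lambda>h' h3. sweedler k H T3 (\<lambda>h1 h2. pure k H T h1 (pure k H H h2 h3)) h') h =
    tensor_assoc H (tlift (tensor k T H) (\<lambda>a b. pure k T H (comult H a) b) (comult H h))"
proof -
  have T: "module k T" "module k T3" "module k (tensor k T H)" using M by auto
  have b: "bilin H H (tensor k T H) (\<lambda>a b. pure k T H (comult H a) b)"
    by (intro bilinI lin_intros \<Delta>) (use M lin_closed [OF \<Delta>] in auto)
  have L: "tensor_assoc H \<in> lin (tensor k T H) T3"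
    unfolding tensor_assoc_def by (intro tensor_lift_linear assoc_outer_bilin M T)
  show ?thesis
    unfolding tensor_lift_comp [OF M M T(3) T(2) b L lin_closed [OF \<Delta> h]] sweedler_def
  proof (rule tensor_lift_cong [OF M M T(2) bilin_post [OF b L]])
    show "tlift T3 (\<lambda>h1 h2. pure k H T h1 (pure k H H h2 w)) (comult H v) =
      tensor_assoc H (pure k T H (comult H v) w)" if "v \<in> carrier H" "w \<in> carrier H" for v w
      using that M lin_closed [OF \<Delta>] by (simp add: tensor_assoc_def tensor_lift_pure assoc_outer_bilin)
  qed (use lin_closed [OF \<Delta> h] in simp)
qed

lemma coassoc_right:
  assumes M: "module k H" and \<Delta>: "comult H \<in> lin H T" and h: "h \<in> carrier H"
  shows "sweedler k H T3 (\<lambda>h1 h'. sweedler k H T3 (\<lambda>h2 h3. pure k H T h1 (pure k H H h2 h3)) h') h =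
    tlift T3 (\<lambda>a b. pure k H T a (comult H b)) (comult H h)"
  unfolding sweedler_def
proof (rule tensor_lift_cong)
  show "bilin H H T3 (\<lambda>a b. pure k H T a (comult H b))"
    by (intro bilinI lin_intros \<Delta>) (use M lin_closed [OF \<Delta>] in auto)
  show "tlift T3 (\<lambda>h2 h3. pure k H T a (pure k H H h2 h3)) (comult H b) = pure k H T a (comult H b)"
    if "a \<in> carrier H" "b \<in> carrier H" for a b
    by (rule tensor_lift_comp_id [where \<phi> = "pure k H T a"])
      (use that M lin_closed [OF \<Delta>] in \<open>simp_all add: bilin_lin(1) [OF bilin_pure]\<close>)
qed (use M lin_closed [OF \<Delta>] h in auto)

text \<open>Each axiom equates two algebra maps: the two iterated comultiplications, or the identity
  and a composite with the counit. Agreement on \<open>G\<close> therefore suffices.\<close>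

lemma bialgebra_from_generators:
  assumes H: "k_algebra k H" and \<Delta>: "comult H \<in> alg_hom H T" and \<epsilon>: "counit H \<in> alg_hom H (self_module k)"
    and G: "generates G H"
    and coassoc: "\<And>h. h \<in> G ==>
      tensor_assoc H (tlift (tensor k T H) (\<lambda>a b. pure k T H (comult H a) b) (comult H h)) =
      tlift T3 (\<lambda>a b. pure k H T a (comult H b)) (comult H h)"
    and counit_l: "\<And>h. h \<in> G ==> sweedler k H H (\<lambda>h1 h2. counit H h1 \<odot>\<^sub>H h2) h = h"
    and counit_r: "\<And>h. h \<in> G ==> sweedler k H H (\<lambda>h1 h2. counit H h2 \<odot>\<^sub>H h1) h = h"
  shows "bialgebra k H"
proof -
  have T: "k_algebra k T" "k_algebra k T3" "k_algebra k (tensor k T H)" using H by auto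
  have M: "module k H" using H by simp
  note \<Delta>l = alg_hom_lin [OF \<Delta>]
  have cl: "sweedler k H H (\<lambda>h1 h2. counit H h1 \<odot>\<^sub>H h2) h = h" if "h \<in> carrier H" for h
  proof (rule generates_alg_hom_eq [OF H H G _ alg_hom_id counit_l that])
    \<comment> \<open>The scalars \<epsilon>(a) 1 are central, so \<open>alg_hom_lift\<close>
      applies to a \<otimes> b -> \<epsilon>(a) b.\<close>
    have "(\<lambda>h. tlift H (\<lambda>a b. (counit H a \<odot>\<^sub>H \<one>\<^sub>H) \<otimes>\<^sub>H b) (comult H h)) \<in> alg_hom H H"
      by (rule alg_hom_comp [OF alg_hom_lift [OF H H H alg_hom_comp [OF alg_hom_scalar [OF H] \<epsilon>] alg_hom_id] \<Delta>])
        (use H alg_hom_closed [OF \<epsilon>] in \<open>auto simp: asmult_left asmult_right\<close>)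
    then show "sweedler k H H (\<lambda>h1 h2. counit H h1 \<odot>\<^sub>H h2) \<in> alg_hom H H"
    proof (rule alg_hom_cong [OF _ H])
      fix x assume "x \<in> carrier H"
      then show "sweedler k H H (\<lambda>h1 h2. counit H h1 \<odot>\<^sub>H h2) x =
         tlift H (\<lambda>a b. (counit H a \<odot>\<^sub>H \<one>\<^sub>H) \<otimes>\<^sub>H b) (comult H x)"
        unfolding sweedler_def
        by (intro tensor_lift_cong bilin_hom_mult lin_intros alg_hom_lin [OF \<epsilon>])
          (use H alg_hom_lin [OF \<epsilon>] alg_hom_closed [OF \<epsilon>] alg_hom_closed [OF \<Delta>] in \<open>auto simp: asmult_left\<close>)
    qed
  qed
  have cr: "sweedler k H H (\<lambda>h1 h2. counit H h2 \<odot>\<^sub>H h1) h = h" if "h \<in> carrier H" for h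
  proof (rule generates_alg_hom_eq [OF H H G _ alg_hom_id counit_r that])
    have "(\<lambda>h. tlift H (\<lambda>a b. a \<otimes>\<^sub>H (counit H b \<odot>\<^sub>H \<one>\<^sub>H)) (comult H h)) \<in> alg_hom H H"
      by (rule alg_hom_comp [OF alg_hom_lift [OF H H H alg_hom_id alg_hom_comp [OF alg_hom_scalar [OF H] \<epsilon>]] \<Delta>])
        (use H alg_hom_closed [OF \<epsilon>] in \<open>auto simp: asmult_left asmult_right\<close>)
    then show "sweedler k H H (\<lambda>h1 h2. counit H h2 \<odot>\<^sub>H h1) \<in> alg_hom H H"
    proof (rule alg_hom_cong [OF _ H])
      fix x assume "x \<in> carrier H"
      then show "sweedler k H H (\<lambda>h1 h2. counit H h2 \<odot>\<^sub>H h1) x =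
         tlift H (\<lambda>a b. a \<otimes>\<^sub>H (counit H b \<odot>\<^sub>H \<one>\<^sub>H)) (comult H x)"
        unfolding sweedler_def
        by (intro tensor_lift_cong bilin_hom_mult lin_intros alg_hom_lin [OF \<epsilon>])
          (use H alg_hom_lin [OF \<epsilon>] alg_hom_closed [OF \<epsilon>] alg_hom_closed [OF \<Delta>] in \<open>auto simp: asmult_right\<close>)
    qed
  qed
  have co: "tensor_assoc H (tlift (tensor k T H) (\<lambda>a b. pure k T H (comult H a) b) (comult H h)) =
      tlift T3 (\<lambda>a b. pure k H T a (comult H b)) (comult H h)" if "h \<in> carrier H" for h
    by (rule generates_alg_hom_eq [OF H T(2) G
         alg_hom_comp [OF tensor_assoc_hom [OF H] alg_hom_comp [OF alg_hom_tensor_map [OF H H T(1) H \<Delta> alg_hom_id] \<Delta>]]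
         alg_hom_comp [OF alg_hom_tensor_map [OF H H H T(1) alg_hom_id \<Delta>] \<Delta>] coassoc that])
  show ?thesis
  proof (intro bialgebra.intro bialgebra_axioms.intro H alg_hom_lin [OF \<Delta>] alg_hom_lin [OF \<epsilon>] cl cr)
    fix h assume h: "h \<in> carrier H"
    show "sweedler k H T3 (\<lambda>h' h3. sweedler k H T3 (\<lambda>h1 h2. pure k H T h1 (pure k H H h2 h3)) h') h =
       sweedler k H T3 (\<lambda>h1 h'. sweedler k H T3 (\<lambda>h2 h3. pure k H T h1 (pure k H H h2 h3)) h') h"
      unfolding coassoc_left [OF M \<Delta>l h] coassoc_right [OF M \<Delta>l h] by (rule co [OF h])
  next
    show "comult H \<one>\<^sub>H = \<one>\<^sub>T" by (rule alg_hom_one [OF \<Delta>])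
    show "comult H (x \<otimes>\<^sub>H y) = comult H x \<otimes>\<^sub>T comult H y" if "x \<in> carrier H" "y \<in> carrier H" for x y
      by (rule alg_hom_mult [OF \<Delta> that])
    show "counit H \<one>\<^sub>H = \<one>" using alg_hom_one [OF \<epsilon>] by simp
    show "counit H (x \<otimes>\<^sub>H y) = counit H x \<otimes> counit H y" if "x \<in> carrier H" "y \<in> carrier H" for x y
      using alg_hom_mult [OF \<epsilon> that] by simp
  qed
qed

end

section \<open>Antipodes: verification on generators and uniqueness\<close>

lemma generates_induct [consumes 2, case_names closed mem]:
  assumes "generates G H" "h \<in> carrier H" "subalg {h \<in> carrier H. P h} H" "\<And>h. h \<in> G ==> P h"
  shows "P h"
  using assms generates_subset [OF assms(1)] unfolding generates_def by blast

text \<open>Anti-multiplicativity of \<open>S\<close> makes the elements satisfying a convolution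
  identity a subalgebra. With \<open>L\<close> the multiplication after S \<otimes> id one has L(s
  (c \<otimes> d)) = S(c) L(s) d, and symmetrically for \<open>R\<close>.\<close>

lemma hopf_from_generators:
  assumes B: "bialgebra k H" and G: "generates G H" and S: "S \<in> lin H H"
    and S1: "S \<one>\<^sub>H = \<one>\<^sub>H"
    and Smult: "\<And>x y. x \<in> carrier H ==> y \<in> carrier H ==> S (x \<otimes>\<^sub>H y) = S y \<otimes>\<^sub>H S x"
    and l: "\<And>h. h \<in> G ==> sweedler k H H (\<lambda>h1 h2. S h1 \<otimes>\<^sub>H h2) h = counit H h \<odot>\<^sub>H \<one>\<^sub>H"
    and r: "\<And>h. h \<in> G ==> sweedler k H H (\<lambda>h1 h2. h1 \<otimes>\<^sub>H S h2) h = counit H h \<odot>\<^sub>H \<one>\<^sub>H"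
  shows "hopf_algebra k H"
proof -
  have H: "k_algebra k H" using B by (rule bialg_kalg)
  note \<Delta> = bialg_comult_hom [OF B] and \<epsilon> = bialg_counit_hom [OF B]
  let ?T = "tensor k H H"
  have M: "module k H" "module k ?T" and T: "k_algebra k ?T" using H by auto
  define L where "L = tlift H (\<lambda>a b. S a \<otimes>\<^sub>H b)"
  define R where "R = tlift H (\<lambda>a b. a \<otimes>\<^sub>H S b)"
  have bl: "bilin H H H (\<lambda>a b. S a \<otimes>\<^sub>H b)" and br: "bilin H H H (\<lambda>a b. a \<otimes>\<^sub>H S b)"
    by (rule bilin_hom_mult; use H S in simp)+
  have Ll: "L \<in> lin ?T H" and Rl: "R \<in> lin ?T H"
    unfolding L_def R_def by (auto intro!: tensor_lift_linear bl br M)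
  have Lp: "L (pure k H H a b) = S a \<otimes>\<^sub>H b" and Rp: "R (pure k H H a b) = a \<otimes>\<^sub>H S b"
    if "a \<in> carrier H" "b \<in> carrier H" for a b
    unfolding L_def R_def using that by (simp_all add: tensor_lift_pure M bl br)
  note Sc = lin_closed [OF S] and cl = lin_closed [OF Ll] lin_closed [OF Rl]
    and ad = lin_add [OF Ll] lin_add [OF Rl]
  have Lpt: "L (pure k H H a b \<otimes>\<^sub>?T pure k H H c d) = S c \<otimes>\<^sub>H (L (pure k H H a b) \<otimes>\<^sub>H d)"
    "R (pure k H H a b \<otimes>\<^sub>?T pure k H H c d) = a \<otimes>\<^sub>H (R (pure k H H c d) \<otimes>\<^sub>H S b)"
    if "a \<in> carrier H" "b \<in> carrier H" "c \<in> carrier H" "d \<in> carrier H" for a b c d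
    using that H by (simp_all add: tensor_mult_pure Lp Rp Smult amult_assoc Sc)
  have L2: "L (s \<otimes>\<^sub>?T pure k H H c d) = S c \<otimes>\<^sub>H (L s \<otimes>\<^sub>H d)"
    if "s \<in> carrier ?T" "c \<in> carrier H" "d \<in> carrier H" for s c d
    using M(1,1) that(1)
    by (induction s rule: tensor_induct)
      (use that T H M Lpt cl Sc in \<open>auto simp: amult_add_left amult_add_right ad\<close>)
  have R2: "R (pure k H H a b \<otimes>\<^sub>?T t) = a \<otimes>\<^sub>H (R t \<otimes>\<^sub>H S b)"
    if "t \<in> carrier ?T" "a \<in> carrier H" "b \<in> carrier H" for t a b
    using M(1,1) that(1)
    by (induction t rule: tensor_induct)
      (use that T H M Lpt cl Sc in \<open>auto simp: amult_add_left amult_add_right ad\<close>)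
  \<comment> \<open>When L(s) is a scalar it can be pulled out; for s = \<Delta>(x) and t =
    \<Delta>(y) the result is \<epsilon>(x) \<epsilon>(y).\<close>
  have L3: "L (s \<otimes>\<^sub>?T t) = e \<odot>\<^sub>H L t" if s: "s \<in> carrier ?T" "L s = e \<odot>\<^sub>H \<one>\<^sub>H" and e: "e \<in> carrier k"
    and t: "t \<in> carrier ?T" for s t e
    using M(1,1) t
    by (induction t rule: tensor_induct)
      (use s e T H M cl Sc in \<open>auto simp: amult_add_right ad L2 Lp asmult_left asmult_right vsmult_add\<close>)
  have R3: "R (s \<otimes>\<^sub>?T t) = e \<odot>\<^sub>H R s" if t: "t \<in> carrier ?T" "R t = e \<odot>\<^sub>H \<one>\<^sub>H" and e: "e \<in> carrier k"
    and s: "s \<in> carrier ?T" for s t e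
    using M(1,1) s
    by (induction s rule: tensor_induct)
      (use t e T H M cl Sc in \<open>auto simp: amult_add_left ad R2 Rp asmult_left asmult_right vsmult_add\<close>)
  let ?lin = "\<lambda>x. counit H x \<odot>\<^sub>H \<one>\<^sub>H"
  have lin: "?lin \<in> lin H H"
    by (rule lin_smult_right) (use H alg_hom_lin [OF \<epsilon>] in auto)
  note ec = alg_hom_closed [OF \<epsilon>, simplified]
  have subL: "subalg {h \<in> carrier H. L (comult H h) = ?lin h} H"
    unfolding subalg_def
    using submodule_equalizer [OF M(1,1) lin_comp [OF Ll alg_hom_lin [OF \<Delta>]] lin] H
    by (auto simp: alg_hom_one [OF \<Delta>] alg_hom_mult [OF \<Delta>] alg_hom_one [OF \<epsilon>] alg_hom_mult [OF \<epsilon>] tensor_simps(5)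
       Lp S1 L3 ec alg_hom_closed [OF \<Delta>] vsmult_assoc)
  have subR: "subalg {h \<in> carrier H. R (comult H h) = ?lin h} H"
    unfolding subalg_def
    using submodule_equalizer [OF M(1,1) lin_comp [OF Rl alg_hom_lin [OF \<Delta>]] lin] H
    by (auto simp: alg_hom_one [OF \<Delta>] alg_hom_mult [OF \<Delta>] alg_hom_one [OF \<epsilon>] alg_hom_mult [OF \<epsilon>] tensor_simps(5)
       Rp S1 R3 ec alg_hom_closed [OF \<Delta>] vsmult_assoc [symmetric] m_comm)
  have "is_antipode k H S"
    unfolding is_antipode_def sweedler_def
    using S generates_induct [OF G _ subL] generates_induct [OF G _ subR] l r
    by (auto simp: L_def R_def sweedler_def)
  then show ?thesis
    using B by (auto simp: hopf_algebra_def hopf_algebra_axioms_def)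
qed

text \<open>Convolution inverses agree: S * id * S' is bracketed in two ways, and coassociativity
  equates the results.\<close>

lemma antipode_unique:
  assumes B: "bialgebra k H" and S: "is_antipode k H S" and S': "is_antipode k H S'" and h: "h \<in> carrier H"
  shows "S h = S' h"
proof -
  have H: "k_algebra k H" using B by (rule bialg_kalg)
  note \<Delta> = alg_hom_lin [OF bialg_comult_hom [OF B]] and \<epsilon> = alg_hom_lin [OF bialg_counit_hom [OF B]]
  let ?T = "tensor k H H"
  let ?T3 = "tensor k H ?T"
  have M: "module k H" "module k ?T" "module k ?T3" using H by auto
  have Sl: "S \<in> lin H H" "S' \<in> lin H H" using S S' by (auto simp: is_antipode_def)
  note Sc = lin_closed [OF Sl(1)] lin_closed [OF Sl(2)]
  note \<Delta>c = lin_closed [OF \<Delta>] and \<epsilon>c = lin_closed [OF \<epsilon>, simplified]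
  have bi: "bilin H H H (\<lambda>b c. S a \<otimes>\<^sub>H (b \<otimes>\<^sub>H S' c))" if "a \<in> carrier H" for a
    by (intro bilinI lin_intros) (use that H Sl Sc in auto)
  \<comment> \<open>This sends a \<otimes> (b \<otimes> c) to S(a) b S'(c).\<close>
  define \<tau> where "\<tau> = tlift H (\<lambda>a t. tlift H (\<lambda>b c. S a \<otimes>\<^sub>H (b \<otimes>\<^sub>H S' c)) t)"
  have bo: "bilin H ?T H (\<lambda>a t. tlift H (\<lambda>b c. S a \<otimes>\<^sub>H (b \<otimes>\<^sub>H S' c)) t)"
    by (rule bilinI, rule tensor_lift_linear, simp_all add: M bi)
      (rule lin_tensor_lift_param, use H bi Sl Sc in \<open>auto intro!: lin_amult_left\<close>)
  have \<tau>: "\<tau> \<in> lin ?T3 H" unfolding \<tau>_def by (rule tensor_lift_linear [OF M(1,2,1) bo])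
  have \<tau>p: "\<tau> (pure k H ?T a t) = tlift H (\<lambda>b c. S a \<otimes>\<^sub>H (b \<otimes>\<^sub>H S' c)) t"
    if "a \<in> carrier H" "t \<in> carrier ?T" for a t
    unfolding \<tau>_def by (rule tensor_lift_pure [OF M(1,2,1) bo that])
  have bS: "bilin H H H (\<lambda>a b. S a \<otimes>\<^sub>H b)" and bS': "bilin H H H (\<lambda>a b. a \<otimes>\<^sub>H S' b)"
    by (rule bilin_hom_mult; use H Sl in simp)+
  have be: "bilin H H H (\<lambda>a b. counit H b \<odot>\<^sub>H a)" "bilin H H H (\<lambda>a b. counit H a \<odot>\<^sub>H b)"
    by (intro bilinI lin_intros \<epsilon>; use H \<epsilon>c in simp)+
  \<comment> \<open>Right bracketing: the inner sum over b S'(c) collapses to the counit and S(h)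
    remains.\<close>
  have "\<tau> (sweedler k H ?T3 (\<lambda>h1 h'. sweedler k H ?T3 (\<lambda>h2 h3. pure k H ?T h1 (pure k H H h2 h3)) h') h) =
      \<tau> (tlift ?T3 (\<lambda>a b. pure k H ?T a (comult H b)) (comult H h))"
    unfolding coassoc_right [OF M(1) \<Delta> h] ..
  also have "\<dots> = tlift H (\<lambda>a b. \<tau> (pure k H ?T a (comult H b))) (comult H h)"
    by (rule tensor_lift_comp [OF M(1,1,3,1) _ \<tau> \<Delta>c [OF h]])
      (intro bilinI lin_intros \<Delta>; use M \<Delta>c in simp)
  also have "\<dots> = tlift H (\<lambda>a b. S (counit H b \<odot>\<^sub>H a)) (comult H h)"
  proof (rule tensor_lift_cong [OF M(1,1,1) bilin_post [OF be(1) Sl(1)] _ \<Delta>c [OF h]])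
    fix a b assume ab: "a \<in> carrier H" "b \<in> carrier H"
    have "tlift H (\<lambda>b c. S a \<otimes>\<^sub>H (b \<otimes>\<^sub>H S' c)) (comult H b) =
       S a \<otimes>\<^sub>H tlift H (\<lambda>b c. b \<otimes>\<^sub>H S' c) (comult H b)"
      by (rule tensor_lift_comp [symmetric, where \<phi> = "\<lambda>x. S a \<otimes>\<^sub>H x", OF M(1,1,1,1) bS'])
        (use ab H Sc \<Delta>c in \<open>simp_all add: lin_amult_right\<close>)
    also have "\<dots> = S a \<otimes>\<^sub>H (counit H b \<odot>\<^sub>H \<one>\<^sub>H)"
      using S' ab by (simp add: is_antipode_def sweedler_def)
    also have "\<dots> = S (counit H b \<odot>\<^sub>H a)"
      using ab H Sc \<epsilon>c by (simp add: asmult_right lin_smult [OF Sl(1)])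
    finally show "\<tau> (pure k H ?T a (comult H b)) = S (counit H b \<odot>\<^sub>H a)"
      using ab \<Delta>c by (simp add: \<tau>p)
  qed
  also have "\<dots> = S (tlift H (\<lambda>a b. counit H b \<odot>\<^sub>H a) (comult H h))"
    by (rule tensor_lift_comp [symmetric, OF M(1,1,1,1) be(1) Sl(1) \<Delta>c [OF h]])
  also have "\<dots> = S h"
    using bialgebra.counit_right [OF B h] by (simp add: sweedler_def)
  finally have 1: "\<tau> (sweedler k H ?T3 (\<lambda>h1 h'. sweedler k H ?T3 (\<lambda>h2 h3. pure k H ?T h1 (pure k H H h2 h3)) h') h) = S h" .
  have inner: "tlift H (\<lambda>h1 h2. S h1 \<otimes>\<^sub>H (h2 \<otimes>\<^sub>H S' b)) (comult H a) = S' (counit H a \<odot>\<^sub>H b)"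
    if ab: "a \<in> carrier H" "b \<in> carrier H" for a b
  proof -
    have "tlift H (\<lambda>h1 h2. S h1 \<otimes>\<^sub>H (h2 \<otimes>\<^sub>H S' b)) (comult H a) =
       tlift H (\<lambda>h1 h2. (S h1 \<otimes>\<^sub>H h2) \<otimes>\<^sub>H S' b) (comult H a)"
      by (rule tensor_lift_cong [OF M(1,1,1) bilin_post [OF bS lin_amult_left [OF _ lin_id]]])
        (use ab H Sc \<Delta>c in \<open>simp_all add: amult_assoc\<close>)
    also have "\<dots> = tlift H (\<lambda>h1 h2. S h1 \<otimes>\<^sub>H h2) (comult H a) \<otimes>\<^sub>H S' b"
      by (rule tensor_lift_comp [symmetric, where \<phi> = "\<lambda>x. x \<otimes>\<^sub>H S' b", OF M(1,1,1,1) bS])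
        (use ab H Sc \<Delta>c in \<open>simp_all add: lin_amult_left\<close>)
    also have "\<dots> = (counit H a \<odot>\<^sub>H \<one>\<^sub>H) \<otimes>\<^sub>H S' b"
      using S ab by (simp add: is_antipode_def sweedler_def)
    also have "\<dots> = S' (counit H a \<odot>\<^sub>H b)"
      using ab H Sc \<epsilon>c by (simp add: asmult_left lin_smult [OF Sl(2)])
    finally show ?thesis .
  qed
  have bT: "bilin H H ?T3 (\<lambda>h' h3. tlift ?T3 (\<lambda>h1 h2. pure k H ?T h1 (pure k H H h2 h3)) (comult H h'))"
  proof (rule bilinI)
    show "(\<lambda>h3. tlift ?T3 (\<lambda>h1 h2. pure k H ?T h1 (pure k H H h2 h3)) (comult H h')) \<in> lin H ?T3"
      if "h' \<in> carrier H" for h'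
      by (rule bilin_lin(1) [OF assoc_outer_bilin [OF M(1)] \<Delta>c [OF that]])
    show "(\<lambda>h'. tlift ?T3 (\<lambda>h1 h2. pure k H ?T h1 (pure k H H h2 h3)) (comult H h')) \<in> lin H ?T3"
      if "h3 \<in> carrier H" for h3
      by (rule lin_comp [OF bilin_lin(2) [OF assoc_outer_bilin [OF M(1)] that] \<Delta>])
  qed
  \<comment> \<open>Left bracketing: the inner sum over S(a) b collapses and S'(h) remains.\<close>
  have "\<tau> (sweedler k H ?T3 (\<lambda>h' h3. sweedler k H ?T3 (\<lambda>h1 h2. pure k H ?T h1 (pure k H H h2 h3)) h') h) =
     tlift H (\<lambda>h' h3. \<tau> (tlift ?T3 (\<lambda>h1 h2. pure k H ?T h1 (pure k H H h2 h3)) (comult H h'))) (comult H h)"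
    unfolding sweedler_def by (rule tensor_lift_comp [OF M(1,1,3,1) bT \<tau> \<Delta>c [OF h]])
  also have "\<dots> = tlift H (\<lambda>a b. S' (counit H a \<odot>\<^sub>H b)) (comult H h)"
  proof (rule tensor_lift_cong [OF M(1,1,1) bilin_post [OF be(2) Sl(2)] _ \<Delta>c [OF h]])
    fix a b assume ab: "a \<in> carrier H" "b \<in> carrier H"
    have "\<tau> (tlift ?T3 (\<lambda>h1 h2. pure k H ?T h1 (pure k H H h2 b)) (comult H a)) =
       tlift H (\<lambda>h1 h2. \<tau> (pure k H ?T h1 (pure k H H h2 b))) (comult H a)"
      by (rule tensor_lift_comp [OF M(1,1,3,1) assoc_inner_bilin [OF M(1) ab(2)] \<tau> \<Delta>c [OF ab(1)]])
    also have "\<dots> = tlift H (\<lambda>h1 h2. S h1 \<otimes>\<^sub>H (h2 \<otimes>\<^sub>H S' b)) (comult H a)"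
      by (rule tensor_lift_cong [OF M(1,1,1) bilin_hom_mult [where \<psi> = "\<lambda>x. x \<otimes>\<^sub>H S' b"]])
        (use ab H Sl Sc \<Delta>c in \<open>auto simp: \<tau>p tensor_lift_pure bi lin_amult_left\<close>)
    finally show "\<tau> (tlift ?T3 (\<lambda>h1 h2. pure k H ?T h1 (pure k H H h2 b)) (comult H a)) = S' (counit H a \<odot>\<^sub>H b)"
      using inner [OF ab] by simp
  qed
  also have "\<dots> = S' (tlift H (\<lambda>a b. counit H a \<odot>\<^sub>H b) (comult H h))"
    by (rule tensor_lift_comp [symmetric, OF M(1,1,1,1) be(2) Sl(2) \<Delta>c [OF h]])
  also have "\<dots> = S' h"
    using bialgebra.counit_left [OF B h] by (simp add: sweedler_def)
  finally show ?thesis using 1 bialgebra.coassoc [OF B h] by simp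
qed

text \<open>The description \<open>THE\<close> ranges over extensional maps. Restricting any
  antipode to the carrier gives one, and \<open>antipode_unique\<close> makes it the only
  one.\<close>

lemma antipode_is_antipode:
  assumes H: "hopf_algebra k H"
  shows "is_antipode k H (antipode k H)"
proof -
  note B = hopf_bialg [OF H]
  have kH: "k_algebra k H" using bialg_kalg [OF B] .
  obtain S where S: "is_antipode k H S" using hopf_algebra.antipode_exists [OF H] by blast
  let ?S = "restrict S (carrier H)"
  note \<Delta> = alg_hom_lin [OF bialg_comult_hom [OF B]]
  have Sl: "S \<in> lin H H" using S by (simp add: is_antipode_def)
  have "is_antipode k H ?S"
  proof -
    have "?S \<in> lin H H" by (rule lin_cong [OF Sl]) (use kH in auto)
    moreover have "sweedler k H H (\<lambda>h1 h2. ?S h1 \<otimes>\<^sub>H h2) h = sweedler k H H (\<lambda>h1 h2. S h1 \<otimes>\<^sub>H h2) h"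
      "sweedler k H H (\<lambda>h1 h2. h1 \<otimes>\<^sub>H ?S h2) h = sweedler k H H (\<lambda>h1 h2. h1 \<otimes>\<^sub>H S h2) h"
      if "h \<in> carrier H" for h
      unfolding sweedler_def
      by (rule tensor_lift_cong; use kH Sl that lin_closed [OF \<Delta>] in \<open>auto intro!: bilin_hom_mult\<close>)+
    ultimately show ?thesis using S by (simp add: is_antipode_def)
  qed
  moreover have "?S \<in> extensional (carrier H)" by simp
  moreover have "S' = ?S" if "S' \<in> extensional (carrier H)" "is_antipode k H S'" for S'
    by (rule extensionalityI [OF that(1)]) (use antipode_unique [OF B that(2) calculation(1)] in auto)
  ultimately have "antipode k H = ?S" unfolding antipode_def by (intro the_equality) auto
  with \<open>is_antipode k H ?S\<close> show ?thesis by simp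
qed

lemma antipode_one:
  assumes H: "hopf_algebra k H"
  shows "antipode k H \<one>\<^sub>H = \<one>\<^sub>H"
proof -
  note B = hopf_bialg [OF H]
  have kH: "k_algebra k H" using bialg_kalg [OF B] .
  have S: "antipode k H \<in> lin H H"
    using antipode_is_antipode [OF H] by (simp add: is_antipode_def)
  have "sweedler k H H (\<lambda>h1 h2. antipode k H h1 \<otimes>\<^sub>H h2) \<one>\<^sub>H = counit H \<one>\<^sub>H \<odot>\<^sub>H \<one>\<^sub>H"
    using antipode_is_antipode [OF H] kH by (simp add: is_antipode_def)
  then show ?thesis
    using kH lin_closed [OF S] S
    by (simp add: sweedler_def bialgebra.comult_one [OF B] bialgebra.counit_one [OF B] tensor_simps(5)
      tensor_lift_pure bilin_hom_mult)
qed

section \<open>Homomorphisms of Hopf algebras\<close>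

text \<open>The structure maps with their linearity, without axioms. Crossed products satisfy this
  before they are known to be Hopf algebras, so the calculus of homomorphisms is developed at this
  level.\<close>

definition hopf_like where
  "hopf_like A \<longleftrightarrow> na_algebra A \<and> comult A \<in> lin A (tensor k A A) \<and>
     counit A \<in> lin A (self_module k)"

lemma hopf_like_hopf:
  assumes A: "hopf_algebra k A"
  shows "hopf_like A"
  unfolding hopf_like_def
  using alg_hom_lin [OF bialg_comult_hom [OF hopf_bialg [OF A]]]
    alg_hom_lin [OF bialg_counit_hom [OF hopf_bialg [OF A]]] kalg_na [OF bialg_kalg [OF hopf_bialg [OF A]]]
  by simp

lemma hopf_like_simps:
  assumes "hopf_like A"
  shows "na_algebra A" "module k A" "comult A \<in> lin A (tensor k A A)"
    "counit A \<in> lin A (self_module k)"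
    "\<And>x. x \<in> carrier A ==> comult A x \<in> carrier (tensor k A A)"
    "\<And>x. x \<in> carrier A ==> counit A x \<in> carrier k"
  using assms lin_closed [of "counit A" A "self_module k"] by (auto simp: hopf_like_def na_module lin_closed)

text \<open>Scalar compatibility, which a ring homomorphism lacks, is supplied by the linearity
  contained in \<open>coalgebra_map\<close>.\<close>

lemma hopf_hom_iff:
  "\<phi> \<in> hopf_hom k A B \<longleftrightarrow> \<phi> \<in> alg_hom A B \<and> coalgebra_map k A B \<phi>"
  by (auto simp: hopf_hom_def alg_hom_def coalgebra_map_def ring_hom_def lin_maps_def)

lemma hopf_hom_alg: "\<phi> \<in> hopf_hom k A B ==> \<phi> \<in> alg_hom A B"
  by (simp add: hopf_hom_iff)

lemma hopf_hom_counit: "\<phi> \<in> hopf_hom k A B ==> x \<in> carrier A ==> counit B (\<phi> x) = counit A x"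
  by (simp add: hopf_hom_iff coalgebra_map_def)

lemma bilin_pure_map:
  assumes "module k B" "module k C" "\<phi> \<in> lin A B" "\<psi> \<in> lin A' C"
  shows "bilin A A' (tensor k B C) (\<lambda>x y. pure k B C (\<phi> x) (\<psi> y))"
  by (intro bilinI lin_intros) (use assms lin_closed [OF assms(3)] lin_closed [OF assms(4)] in auto)

lemma bilin_compose:
  assumes "bilin B C U \<beta>" "\<phi> \<in> lin A B" "\<psi> \<in> lin A' C"
  shows "bilin A A' U (\<lambda>x y. \<beta> (\<phi> x) (\<psi> y))"
proof (rule bilinI)
  show "(\<lambda>y. \<beta> (\<phi> v) (\<psi> y)) \<in> lin A' U" if "v \<in> carrier A" for v
    by (rule lin_comp [OF bilin_lin(1) [OF assms(1)] assms(3)]) (rule lin_closed [OF assms(2) that])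
  show "(\<lambda>x. \<beta> (\<phi> x) (\<psi> w)) \<in> lin A U" if "w \<in> carrier A'" for w
    by (rule lin_comp [OF bilin_lin(2) [OF assms(1)] assms(2)]) (rule lin_closed [OF assms(3) that])
qed

text \<open>The Sweedler components of \<phi>(a) may be taken to be the images of those of
  a.\<close>

lemma sweedler_map:
  assumes A: "hopf_like A" and B: "module k B" and U: "module k U" and \<phi>: "coalgebra_map k A B \<phi>"
    and \<beta>: "bilin B B U \<beta>" and a: "a \<in> carrier A"
  shows "sweedler k B U \<beta> (\<phi> a) = sweedler k A U (\<lambda>x y. \<beta> (\<phi> x) (\<phi> y)) a"
proof -
  note A' = hopf_like_simps [OF A]
  have \<phi>l: "\<phi> \<in> lin A B" using \<phi> by (simp add: coalgebra_map_def)
  have "comult B (\<phi> a) = tlift (tensor k B B) (\<lambda>x y. pure k B B (\<phi> x) (\<phi> y)) (comult A a)"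
    using \<phi> a by (simp add: coalgebra_map_def sweedler_def)
  then have "sweedler k B U \<beta> (\<phi> a) =
      tlift U \<beta> (tlift (tensor k B B) (\<lambda>x y. pure k B B (\<phi> x) (\<phi> y)) (comult A a))"
    by (simp add: sweedler_def)
  also have "\<dots> = tlift U (\<lambda>x y. tlift U \<beta> (pure k B B (\<phi> x) (\<phi> y))) (comult A a)"
    by (rule tensor_lift_comp [OF A'(2,2) tensor_module [OF B B] U bilin_pure_map [OF B B \<phi>l \<phi>l]
          tensor_lift_linear [OF B B U \<beta>] A'(5) [OF a]])
  also have "\<dots> = tlift U (\<lambda>x y. \<beta> (\<phi> x) (\<phi> y)) (comult A a)"
    by (rule tensor_lift_cong [OF A'(2,2) U bilin_compose [OF \<beta> \<phi>l \<phi>l] _ A'(5) [OF a]])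
      (rule tensor_lift_pure [OF B B U \<beta>]; rule lin_closed [OF \<phi>l])
  finally show ?thesis by (simp add: sweedler_def)
qed

lemma sweedler_cong:
  assumes "hopf_like A" "module k U" "bilin A A U \<beta>"
    "\<And>x y. x \<in> carrier A ==> y \<in> carrier A ==> \<beta>' x y = \<beta> x y" "a \<in> carrier A"
  shows "sweedler k A U \<beta>' a = sweedler k A U \<beta> a"
  unfolding sweedler_def using assms hopf_like_simps [OF assms(1)] by (auto intro: tensor_lift_cong)

lemma sweedler_comp:
  assumes "hopf_like A" "module k U" "module k U'" "bilin A A U \<beta>" "\<phi> \<in> lin U U'" "a \<in> carrier A"
  shows "\<phi> (sweedler k A U \<beta> a) = sweedler k A U' (\<lambda>x y. \<phi> (\<beta> x y)) a"
  unfolding sweedler_def using hopf_like_simps [OF assms(1)] assms by (intro tensor_lift_comp) auto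

lemma sweedler_linear:
  assumes "hopf_like A" "module k U" "bilin A A U \<beta>"
  shows "sweedler k A U \<beta> \<in> lin A U"
proof -
  note A' = hopf_like_simps [OF assms(1)]
  have "(\<lambda>a. tlift U \<beta> (comult A a)) \<in> lin A U"
    by (rule lin_comp [OF tensor_lift_linear A'(3)]) (use A' assms in auto)
  then show ?thesis by (simp add: sweedler_def [abs_def])
qed

lemma hopf_hom_id:
  assumes A: "hopf_like A"
  shows "(\<lambda>x. x) \<in> hopf_hom k A A"
  using hopf_like_simps [OF A]
  by (auto simp: hopf_hom_iff coalgebra_map_def sweedler_def tensor_lift_id alg_hom_id)

lemma hopf_hom_comp:
  assumes A: "hopf_like A" and B: "hopf_like B" and C: "hopf_like C"
    and \<phi>: "\<phi> \<in> hopf_hom k A B" and \<psi>: "\<psi> \<in> hopf_hom k B C"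
  shows "(\<lambda>x. \<psi> (\<phi> x)) \<in> hopf_hom k A C"
proof -
  have l: "\<phi> \<in> alg_hom A B" "\<psi> \<in> alg_hom B C" using \<phi> \<psi> by (simp_all add: hopf_hom_iff)
  note c = alg_hom_closed [OF l(1)]
  note M = hopf_like_simps(2) [OF A] hopf_like_simps(2) [OF B] hopf_like_simps(2) [OF C]
  have "sweedler k A (tensor k C C) (\<lambda>h1 h2. pure k C C (\<psi> (\<phi> h1)) (\<psi> (\<phi> h2))) h = comult C (\<psi> (\<phi> h))"
    if "h \<in> carrier A" for h
  proof -
    have "sweedler k A (tensor k C C) (\<lambda>h1 h2. pure k C C (\<psi> (\<phi> h1)) (\<psi> (\<phi> h2))) h =
      sweedler k B (tensor k C C) (\<lambda>h1 h2. pure k C C (\<psi> h1) (\<psi> h2)) (\<phi> h)"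
      by (rule sweedler_map [symmetric, where \<beta> = "\<lambda>h1 h2. pure k C C (\<psi> h1) (\<psi> h2)", OF A M(2) tensor_module [OF M(3,3)]])
        (use that \<phi> l M in \<open>auto simp: hopf_hom_iff intro!: bilin_pure_map alg_hom_lin [OF l(2)]\<close>)
    also have "\<dots> = comult C (\<psi> (\<phi> h))"
      using \<psi> c [OF that] by (simp add: hopf_hom_iff coalgebra_map_def)
    finally show ?thesis .
  qed
  with alg_hom_comp [OF l(2,1)] \<phi> \<psi> c show ?thesis
    by (auto simp: hopf_hom_iff coalgebra_map_def alg_hom_lin)
qed

lemma hopf_hom_cong:
  assumes A: "hopf_like A" and B: "module k B" and \<phi>: "\<phi> \<in> hopf_hom k A B"
    and eq: "\<And>x. x \<in> carrier A ==> \<psi> x = \<phi> x"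
  shows "\<psi> \<in> hopf_hom k A B"
proof -
  have a: "\<phi> \<in> alg_hom A B" using \<phi> by (simp add: hopf_hom_iff)
  note A' = hopf_like_simps [OF A]
  have "\<psi> \<in> lin A B" by (rule lin_cong [OF alg_hom_lin [OF a] A'(2) eq])
  then have "\<psi> \<in> alg_hom A B"
    using a eq A' na_one [OF A'(1)] na_mult_closed [OF A'(1)] by (simp add: alg_hom_def)
  moreover have "sweedler k A (tensor k B B) (\<lambda>h1 h2. pure k B B (\<psi> h1) (\<psi> h2)) h =
     sweedler k A (tensor k B B) (\<lambda>h1 h2. pure k B B (\<phi> h1) (\<phi> h2)) h" if "h \<in> carrier A" for h
    by (rule sweedler_cong [OF A]) (use B eq that alg_hom_lin [OF a] in \<open>auto intro!: bilin_pure_map\<close>)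
  ultimately show ?thesis
    using \<phi> eq by (auto simp: hopf_hom_iff coalgebra_map_def alg_hom_lin)
qed

lemma hopf_hom_inv:
  assumes A: "hopf_like A" and B: "module k B" and \<phi>: "\<phi> \<in> hopf_hom k A B"
    and bij: "bij_betw \<phi> (carrier A) (carrier B)"
  shows "inv_into (carrier A) \<phi> \<in> hopf_hom k B A"
proof -
  let ?i = "inv_into (carrier A) \<phi>"
  have a: "\<phi> \<in> alg_hom A B" using \<phi> by (simp add: hopf_hom_iff)
  note A' = hopf_like_simps [OF A]
  have i: "?i (\<phi> x) = x" if "x \<in> carrier A" for x
    using bij that by (simp add: bij_betw_inv_into_left)
  have ex: "\<exists>x \<in> carrier A. b = \<phi> x" if "b \<in> carrier B" for b
    using bij that by (auto simp: bij_betw_def)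
  have il: "?i \<in> lin B A"
  proof (rule lin_mapsI)
    fix x assume "x \<in> carrier B"
    then obtain x' where x': "x' \<in> carrier A" "x = \<phi> x'" using ex by blast
    then show "?i x \<in> carrier A" by (simp add: i)
    show "?i (c \<odot>\<^sub>B x) = c \<odot>\<^sub>A ?i x" if "c \<in> carrier k" for c
      using x' that A' by (simp add: i alg_hom_smult [OF a, symmetric])
    fix y assume "y \<in> carrier B"
    then obtain y' where y': "y' \<in> carrier A" "y = \<phi> y'" using ex by blast
    show "?i (x \<oplus>\<^sub>B y) = ?i x \<oplus>\<^sub>A ?i y"
      using x' y' A' by (simp add: i alg_hom_add [OF a, symmetric])
  qed
  have "?i \<in> alg_hom B A"
  proof (rule alg_homI [OF il])
    show "?i \<one>\<^sub>B = \<one>\<^sub>A"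
      using i [OF na_one [OF A'(1)]] by (simp add: alg_hom_one [OF a])
    fix x y assume "x \<in> carrier B" "y \<in> carrier B"
    then obtain x' y' where "x' \<in> carrier A" "x = \<phi> x'" "y' \<in> carrier A" "y = \<phi> y'" using ex by metis
    then show "?i (x \<otimes>\<^sub>B y) = ?i x \<otimes>\<^sub>A ?i y"
      using na_mult_closed [OF A'(1)] by (simp add: i alg_hom_mult [OF a, symmetric])
  qed
  moreover have "coalgebra_map k B A ?i"
    unfolding coalgebra_map_def
  proof (intro conjI ballI il)
    fix b assume "b \<in> carrier B"
    then obtain x where x: "x \<in> carrier A" "b = \<phi> x" using ex by blast
    have cm: "coalgebra_map k A B \<phi>" using \<phi> by (simp add: hopf_hom_iff)
    have "sweedler k B (tensor k A A) (\<lambda>h1 h2. pure k A A (?i h1) (?i h2)) b =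
       sweedler k A (tensor k A A) (\<lambda>h1 h2. pure k A A (?i (\<phi> h1)) (?i (\<phi> h2))) x"
      unfolding x(2) by (rule sweedler_map [OF A B _ cm bilin_pure_map [OF _ _ il il] x(1)]) (use A' in auto)
    also have "\<dots> = sweedler k A (tensor k A A) (pure k A A) x"
      by (rule sweedler_cong [OF A]) (use A' x in \<open>auto simp: i bilin_pure\<close>)
    also have "\<dots> = comult A (?i b)"
      using A' x by (simp add: sweedler_def tensor_lift_id i)
    finally show "sweedler k B (tensor k A A) (\<lambda>h1 h2. pure k A A (?i h1) (?i h2)) b = comult A (?i b)" .
    show "counit A (?i b) = counit B b"
      using x hopf_hom_counit [OF \<phi>] by (simp add: i)
  qed
  ultimately show ?thesis by (simp add: hopf_hom_iff)
qed

lemma hopf_isomorphic_refl: "hopf_like A ==> hopf_isomorphic k A A"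
  unfolding hopf_isomorphic_def using hopf_hom_id bij_betw_id [unfolded id_def] by blast

lemma hopf_isomorphic_sym:
  assumes "hopf_like A" "hopf_like B" "hopf_isomorphic k A B"
  shows "hopf_isomorphic k B A"
  using assms(3) hopf_hom_inv [OF assms(1) hopf_like_simps(2) [OF assms(2)]] bij_betw_inv_into
  unfolding hopf_isomorphic_def by blast

lemma hopf_isomorphic_trans:
  assumes "hopf_like A" "hopf_like B" "hopf_like C" "hopf_isomorphic k A B" "hopf_isomorphic k B C"
  shows "hopf_isomorphic k A C"
proof -
  obtain \<phi> \<psi> where "\<phi> \<in> hopf_hom k A B" "bij_betw \<phi> (carrier A) (carrier B)"
    "\<psi> \<in> hopf_hom k B C" "bij_betw \<psi> (carrier B) (carrier C)"
    using assms(4,5) unfolding hopf_isomorphic_def by blast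
  then show ?thesis
    unfolding hopf_isomorphic_def
    using hopf_hom_comp [OF assms(1-3)] bij_betw_trans [of \<phi> _ _ \<psi>] by (force simp: comp_def)
qed

text \<open>Both sides of each compatibility condition are algebra maps on \<open>A\<close>.\<close>

lemma hopf_hom_from_generators:
  assumes A: "bialgebra k A" and B: "bialgebra k B" and G: "generates G A" and \<phi>: "\<phi> \<in> alg_hom A B"
    and co: "\<And>h. h \<in> G ==> sweedler k A (tensor k B B) (\<lambda>h1 h2. pure k B B (\<phi> h1) (\<phi> h2)) h = comult B (\<phi> h)"
    and cu: "\<And>h. h \<in> G ==> counit B (\<phi> h) = counit A h"
  shows "\<phi> \<in> hopf_hom k A B"
proof -
  have kA: "k_algebra k A" and kB: "k_algebra k B" using A B by (auto intro: bialg_kalg)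
  have kT: "k_algebra k (tensor k B B)" using kB by simp
  have "sweedler k A (tensor k B B) (\<lambda>h1 h2. pure k B B (\<phi> h1) (\<phi> h2)) h = comult B (\<phi> h)"
    if "h \<in> carrier A" for h
    unfolding sweedler_def
    by (rule generates_alg_hom_eq [OF kA kT G
        alg_hom_comp [OF alg_hom_tensor_map [OF kA kA kB kB \<phi> \<phi>] bialg_comult_hom [OF A]]
        alg_hom_comp [OF bialg_comult_hom [OF B] \<phi>] _ that]) (use co in \<open>auto simp: sweedler_def\<close>)
  moreover have "counit B (\<phi> h) = counit A h" if "h \<in> carrier A" for h
    by (rule generates_alg_hom_eq [OF kA self_algebra G alg_hom_comp [OF bialg_counit_hom [OF B] \<phi>]
          bialg_counit_hom [OF A] cu that])
  ultimately show ?thesis using \<phi> by (simp add: hopf_hom_iff coalgebra_map_def alg_hom_lin)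
qed

section \<open>Transport of the Hopf axioms along a bijective homomorphism\<close>

lemma generates_carrier: "generates (carrier A) A"
  by (auto simp: generates_def)

text \<open>Of \<open>C\<close> only linear structure maps are known beforehand; associativity, the
  coalgebra axioms and an antipode are carried over from \<open>A\<close> through the bijection.
  This yields the Hopf axioms for crossed products.\<close>

lemma hopf_algebra_transport:
  assumes A: "hopf_algebra k A" and C: "hopf_like C" and \<phi>: "\<phi> \<in> hopf_hom k A C"
    and bij: "bij_betw \<phi> (carrier A) (carrier C)"
  shows "hopf_algebra k C"
proof -
  note HA = hopf_like_hopf [OF A]
  note A' = hopf_like_simps [OF HA] and C' = hopf_like_simps [OF C]
  note BA = hopf_bialg [OF A]
  have kA: "k_algebra k A" using BA by (rule bialg_kalg)
  let ?i = "inv_into (carrier A) \<phi>"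
  have a: "\<phi> \<in> alg_hom A C" using \<phi> by (simp add: hopf_hom_iff)
  note ac = alg_hom_closed [OF a] and al = alg_hom_lin [OF a]
  have cm: "coalgebra_map k A C \<phi>" using \<phi> by (simp add: hopf_hom_iff)
  have ih: "?i \<in> hopf_hom k C A" by (rule hopf_hom_inv [OF HA C'(2) \<phi> bij])
  then have ia: "?i \<in> alg_hom C A" by (simp add: hopf_hom_iff)
  have i: "?i (\<phi> x) = x" if "x \<in> carrier A" for x
    using bij that by (simp add: bij_betw_inv_into_left)
  have ri: "\<phi> (?i x) = x" if "x \<in> carrier C" for x
    using bij that by (simp add: bij_betw_inv_into_right)
  have ex: "\<exists>x \<in> carrier A. c = \<phi> x" if "c \<in> carrier C" for c
    using bij that by (auto simp: bij_betw_def)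
  have kC: "k_algebra k C"
  proof (rule k_algebraI [OF C'(1)])
    fix x y z assume "x \<in> carrier C" "y \<in> carrier C" "z \<in> carrier C"
    then obtain x' y' z' where "x' \<in> carrier A" "x = \<phi> x'" "y' \<in> carrier A" "y = \<phi> y'" "z' \<in> carrier A" "z = \<phi> z'"
      using ex by metis
    then show "(x \<otimes>\<^sub>C y) \<otimes>\<^sub>C z = x \<otimes>\<^sub>C (y \<otimes>\<^sub>C z)"
      using kA by (simp add: alg_hom_mult [OF a, symmetric] amult_assoc)
  next
    fix x assume "x \<in> carrier C"
    then obtain x' where "x' \<in> carrier A" "x = \<phi> x'" using ex by blast
    then show "\<one>\<^sub>C \<otimes>\<^sub>C x = x" "x \<otimes>\<^sub>C \<one>\<^sub>C = x"
      using kA by (simp_all add: alg_hom_mult [OF a, symmetric] alg_hom_one [OF a, symmetric])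
  qed
  let ?T = "tensor k C C"
  let ?T3 = "tensor k C ?T"
  let ?A3 = "tensor k A (tensor k A A)"
  have M: "module k ?T" "module k ?T3" "module k (tensor k A A)" "module k ?A3" using A' C' by auto
  have kT: "k_algebra k ?T" using kC by simp
  have \<Delta>: "comult C \<in> alg_hom C ?T"
  proof (rule alg_hom_cong [OF alg_hom_comp [OF alg_hom_comp [OF alg_hom_tensor_map [OF kA kA kC kC a a]
            bialg_comult_hom [OF BA]] ia] kC])
    fix c assume c: "c \<in> carrier C"
    show "comult C c = tlift ?T (\<lambda>v w. pure k C C (\<phi> v) (\<phi> w)) (comult A (?i c))"
      using cm c alg_hom_closed [OF ia c] ri [OF c] by (auto simp: coalgebra_map_def sweedler_def)
  qed
  have \<epsilon>: "counit C \<in> alg_hom C (self_module k)"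
    by (rule alg_hom_cong [OF alg_hom_comp [OF bialg_counit_hom [OF BA] ia] kC])
      (use hopf_hom_counit [OF ih] in auto)
  \<comment> \<open>\<open>\<phi>2\<close> and \<open>\<phi>3\<close> are \<phi> \<otimes> \<phi>
    and \<phi> \<otimes> \<phi> \<otimes> \<phi>; \<open>lhs\<close> and \<open>rhs\<close> say that
    they intertwine the two sides of coassociativity.\<close>
  define \<phi>2 where "\<phi>2 = tlift ?T (\<lambda>x y. pure k C C (\<phi> x) (\<phi> y))"
  have b2: "bilin A A ?T (\<lambda>x y. pure k C C (\<phi> x) (\<phi> y))" by (rule bilin_pure_map [OF C'(2,2) al al])
  have \<phi>2: "\<phi>2 \<in> lin (tensor k A A) ?T"
    unfolding \<phi>2_def by (rule tensor_lift_linear [OF A'(2,2) M(1) b2])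
  have b3: "bilin A (tensor k A A) ?T3 (\<lambda>x t. pure k C ?T (\<phi> x) (\<phi>2 t))"
    by (rule bilin_pure_map [OF C'(2) M(1) al \<phi>2])
  define \<phi>3 where "\<phi>3 = tlift ?T3 (\<lambda>x t. pure k C ?T (\<phi> x) (\<phi>2 t))"
  have \<phi>3: "\<phi>3 \<in> lin ?A3 ?T3"
    unfolding \<phi>3_def by (rule tensor_lift_linear [OF A'(2) M(3,2) b3])
  have p3: "\<phi>3 (pure k A (tensor k A A) x (pure k A A y z)) = pure k C ?T (\<phi> x) (pure k C C (\<phi> y) (\<phi> z))"
    if "x \<in> carrier A" "y \<in> carrier A" "z \<in> carrier A" for x y z
    using that A' by (simp add: \<phi>3_def \<phi>2_def tensor_lift_pure [OF A'(2) M(3,2) b3, unfolded \<phi>2_def]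
       tensor_lift_pure [OF A'(2,2) M(1) b2])
  have lhs: "sweedler k C ?T3 (\<lambda>h' h3. sweedler k C ?T3 (\<lambda>h1 h2. pure k C ?T h1 (pure k C C h2 h3)) h') (\<phi> x) =
      \<phi>3 (sweedler k A ?A3 (\<lambda>h' h3. sweedler k A ?A3 (\<lambda>h1 h2. pure k A (tensor k A A) h1 (pure k A A h2 h3)) h') x)"
    if x: "x \<in> carrier A" for x
  proof -
    have bA: "bilin A A ?A3 (\<lambda>h' h3. sweedler k A ?A3 (\<lambda>h1 h2. pure k A (tensor k A A) h1 (pure k A A h2 h3)) h')"
      unfolding sweedler_def by (rule bilin_compose [OF assoc_outer_bilin [OF A'(2)] A'(3) lin_id])
    have bC: "bilin C C ?T3 (\<lambda>h' h3. sweedler k C ?T3 (\<lambda>h1 h2. pure k C ?T h1 (pure k C C h2 h3)) h')"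
      unfolding sweedler_def by (rule bilin_compose [OF assoc_outer_bilin [OF C'(2)] C'(3) lin_id])
    have "sweedler k C ?T3 (\<lambda>h' h3. sweedler k C ?T3 (\<lambda>h1 h2. pure k C ?T h1 (pure k C C h2 h3)) h') (\<phi> x) =
        sweedler k A ?T3 (\<lambda>h' h3. sweedler k C ?T3 (\<lambda>h1 h2. pure k C ?T h1 (pure k C C h2 (\<phi> h3))) (\<phi> h')) x"
      by (rule sweedler_map [OF HA C'(2) M(2) cm bC x])
    also have "\<dots> = sweedler k A ?T3 (\<lambda>h' h3. \<phi>3 (sweedler k A ?A3 (\<lambda>h1 h2. pure k A (tensor k A A) h1 (pure k A A h2 h3)) h')) x"
    proof (rule sweedler_cong [OF HA M(2) bilin_post [OF bA \<phi>3] _ x])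
      fix u v assume u: "u \<in> carrier A" and v: "v \<in> carrier A"
      have "sweedler k C ?T3 (\<lambda>h1 h2. pure k C ?T h1 (pure k C C h2 (\<phi> v))) (\<phi> u) =
         sweedler k A ?T3 (\<lambda>h1 h2. pure k C ?T (\<phi> h1) (pure k C C (\<phi> h2) (\<phi> v))) u"
        by (rule sweedler_map [OF HA C'(2) M(2) cm assoc_inner_bilin [OF C'(2) ac [OF v]] u])
      also have "\<dots> = sweedler k A ?T3 (\<lambda>h1 h2. \<phi>3 (pure k A (tensor k A A) h1 (pure k A A h2 v))) u"
        by (rule sweedler_cong [OF HA M(2) bilin_post [OF assoc_inner_bilin [OF A'(2) v] \<phi>3] _ u])
          (simp add: p3 v)
      also have "\<dots> = \<phi>3 (sweedler k A ?A3 (\<lambda>h1 h2. pure k A (tensor k A A) h1 (pure k A A h2 v)) u)"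
        by (rule sweedler_comp [symmetric, OF HA M(4,2) assoc_inner_bilin [OF A'(2) v] \<phi>3 u])
      finally show "sweedler k C ?T3 (\<lambda>h1 h2. pure k C ?T h1 (pure k C C h2 (\<phi> v))) (\<phi> u) =
        \<phi>3 (sweedler k A ?A3 (\<lambda>h1 h2. pure k A (tensor k A A) h1 (pure k A A h2 v)) u)" .
    qed
    also have "\<dots> = \<phi>3 (sweedler k A ?A3 (\<lambda>h' h3. sweedler k A ?A3 (\<lambda>h1 h2. pure k A (tensor k A A) h1 (pure k A A h2 h3)) h') x)"
      by (rule sweedler_comp [symmetric, OF HA M(4,2) bA \<phi>3 x])
    finally show ?thesis .
  qed
  have rhs: "tlift ?T3 (\<lambda>a b. pure k C ?T a (comult C b)) (comult C (\<phi> x)) =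
      \<phi>3 (tlift ?A3 (\<lambda>a b. pure k A (tensor k A A) a (comult A b)) (comult A x))"
    if x: "x \<in> carrier A" for x
  proof -
    have bA: "bilin A A ?A3 (\<lambda>a b. pure k A (tensor k A A) a (comult A b))"
      by (rule bilin_pure_map [OF A'(2) M(3) lin_id A'(3)])
    have bC: "bilin C C ?T3 (\<lambda>a b. pure k C ?T a (comult C b))"
      by (rule bilin_pure_map [OF C'(2) M(1) lin_id C'(3)])
    have "sweedler k C ?T3 (\<lambda>a b. pure k C ?T a (comult C b)) (\<phi> x) =
        sweedler k A ?T3 (\<lambda>a b. pure k C ?T (\<phi> a) (comult C (\<phi> b))) x"
      by (rule sweedler_map [OF HA C'(2) M(2) cm bC x])
    also have "\<dots> = sweedler k A ?T3 (\<lambda>a b. \<phi>3 (pure k A (tensor k A A) a (comult A b))) x"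
    proof (rule sweedler_cong [OF HA M(2) bilin_post [OF bA \<phi>3] _ x])
      fix u v assume u: "u \<in> carrier A" and v: "v \<in> carrier A"
      have "comult C (\<phi> v) = \<phi>2 (comult A v)"
        using cm v by (simp add: coalgebra_map_def sweedler_def \<phi>2_def)
      then show "pure k C ?T (\<phi> u) (comult C (\<phi> v)) = \<phi>3 (pure k A (tensor k A A) u (comult A v))"
        unfolding \<phi>3_def using tensor_lift_pure [OF A'(2) M(3,2) b3 u A'(5) [OF v]] by simp
    qed
    also have "\<dots> = \<phi>3 (sweedler k A ?A3 (\<lambda>a b. pure k A (tensor k A A) a (comult A b)) x)"
      by (rule sweedler_comp [symmetric, OF HA M(4,2) bA \<phi>3 x])
    finally show ?thesis by (simp add: sweedler_def)
  qed
  have BC: "bialgebra k C"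
  \<comment> \<open>The whole carrier serves as generating set, since the identities are available
    for every element \<phi>(x).\<close>
  proof (rule bialgebra_from_generators [OF kC \<Delta> \<epsilon> generates_carrier])
    fix c assume "c \<in> carrier C"
    then obtain x where x: "x \<in> carrier A" "c = \<phi> x" using ex by blast
    note cx = ac [OF x(1)]
    show "tensor_assoc C (tlift (tensor k ?T C) (\<lambda>a b. pure k ?T C (comult C a) b) (comult C c)) =
      tlift ?T3 (\<lambda>a b. pure k C ?T a (comult C b)) (comult C c)"
      unfolding x(2) coassoc_left [OF C'(2,3) cx, symmetric] lhs [OF x(1)] rhs [OF x(1)]
        coassoc_right [OF A'(2,3) x(1), symmetric] bialgebra.coassoc [OF BA x(1)] ..
    have be: "bilin C C C (\<lambda>a b. counit C a \<odot>\<^sub>C b)" "bilin C C C (\<lambda>a b. counit C b \<odot>\<^sub>C a)"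
      by (intro bilinI lin_intros C'(4); use C' in simp)+
    have be': "bilin A A A (\<lambda>a b. counit A a \<odot>\<^sub>A b)" "bilin A A A (\<lambda>a b. counit A b \<odot>\<^sub>A a)"
      by (intro bilinI lin_intros A'(4); use A' in simp)+
    have "sweedler k C C (\<lambda>h1 h2. counit C h1 \<odot>\<^sub>C h2) (\<phi> x) =
      sweedler k A C (\<lambda>h1 h2. \<phi> (counit A h1 \<odot>\<^sub>A h2)) x"
      unfolding sweedler_map [OF HA C'(2,2) cm be(1) x(1)]
      by (rule sweedler_cong [OF HA C'(2) bilin_post [OF be'(1) al] _ x(1)])
        (use hopf_hom_counit [OF \<phi>] A'(6) in \<open>auto simp: alg_hom_smult [OF a]\<close>)
    also have "\<dots> = \<phi> x"
      using sweedler_comp [OF HA A'(2) C'(2) be'(1) al x(1)] bialgebra.counit_left [OF BA x(1)] by simp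
    finally show "sweedler k C C (\<lambda>h1 h2. counit C h1 \<odot>\<^sub>C h2) c = c" using x by simp
    have "sweedler k C C (\<lambda>h1 h2. counit C h2 \<odot>\<^sub>C h1) (\<phi> x) =
      sweedler k A C (\<lambda>h1 h2. \<phi> (counit A h2 \<odot>\<^sub>A h1)) x"
      unfolding sweedler_map [OF HA C'(2,2) cm be(2) x(1)]
      by (rule sweedler_cong [OF HA C'(2) bilin_post [OF be'(2) al] _ x(1)])
        (use hopf_hom_counit [OF \<phi>] A'(6) in \<open>auto simp: alg_hom_smult [OF a]\<close>)
    also have "\<dots> = \<phi> x"
      using sweedler_comp [OF HA A'(2) C'(2) be'(2) al x(1)] bialgebra.counit_right [OF BA x(1)] by simp
    finally show "sweedler k C C (\<lambda>h1 h2. counit C h2 \<odot>\<^sub>C h1) c = c" using x by simp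
  qed
  obtain S where S: "is_antipode k A S" using hopf_algebra.antipode_exists [OF A] by blast
  then have Sl: "S \<in> lin A A" by (simp add: is_antipode_def)
  let ?S = "\<lambda>c. \<phi> (S (?i c))"
  have SC: "?S \<in> lin C C" by (rule lin_comp [OF al lin_comp [OF Sl alg_hom_lin [OF ia]]])
  have "is_antipode k C ?S"
    unfolding is_antipode_def
  proof (intro conjI ballI SC)
    fix c assume "c \<in> carrier C"
    then obtain x where x: "x \<in> carrier A" "c = \<phi> x" using ex by blast
    have b: "bilin C C C (\<lambda>a b. ?S a \<otimes>\<^sub>C b)" "bilin C C C (\<lambda>a b. a \<otimes>\<^sub>C ?S b)"
      by (rule bilin_hom_mult [OF C'(1)]; use SC in simp)+
    have b': "bilin A A A (\<lambda>a b. S a \<otimes>\<^sub>A b)" "bilin A A A (\<lambda>a b. a \<otimes>\<^sub>A S b)"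
      by (rule bilin_hom_mult [OF A'(1)]; use Sl in simp)+
    have "sweedler k C C (\<lambda>a b. ?S a \<otimes>\<^sub>C b) (\<phi> x) = sweedler k A C (\<lambda>a b. \<phi> (S a \<otimes>\<^sub>A b)) x"
      unfolding sweedler_map [OF HA C'(2,2) cm b(1) x(1)]
      by (rule sweedler_cong [OF HA C'(2) bilin_post [OF b'(1) al] _ x(1)])
        (use lin_closed [OF Sl] in \<open>auto simp: i alg_hom_mult [OF a]\<close>)
    also have "\<dots> = \<phi> (sweedler k A A (\<lambda>a b. S a \<otimes>\<^sub>A b) x)"
      by (rule sweedler_comp [symmetric, OF HA A'(2) C'(2) b'(1) al x(1)])
    finally show "sweedler k C C (\<lambda>a b. ?S a \<otimes>\<^sub>C b) c = counit C c \<odot>\<^sub>C \<one>\<^sub>C"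
      using S x hopf_hom_counit [OF \<phi>] na_one [OF A'(1)] A'(6)
      by (simp add: is_antipode_def alg_hom_smult [OF a] alg_hom_one [OF a])
    have "sweedler k C C (\<lambda>a b. a \<otimes>\<^sub>C ?S b) (\<phi> x) = sweedler k A C (\<lambda>a b. \<phi> (a \<otimes>\<^sub>A S b)) x"
      unfolding sweedler_map [OF HA C'(2,2) cm b(2) x(1)]
      by (rule sweedler_cong [OF HA C'(2) bilin_post [OF b'(2) al] _ x(1)])
        (use lin_closed [OF Sl] in \<open>auto simp: i alg_hom_mult [OF a]\<close>)
    also have "\<dots> = \<phi> (sweedler k A A (\<lambda>a b. a \<otimes>\<^sub>A S b) x)"
      by (rule sweedler_comp [symmetric, OF HA A'(2) C'(2) b'(2) al x(1)])
    finally show "sweedler k C C (\<lambda>a b. a \<otimes>\<^sub>C ?S b) c = counit C c \<odot>\<^sub>C \<one>\<^sub>C"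
      using S x hopf_hom_counit [OF \<phi>] na_one [OF A'(1)] A'(6)
      by (simp add: is_antipode_def alg_hom_smult [OF a] alg_hom_one [OF a])
  qed
  then show ?thesis using BC by (auto simp: hopf_algebra_def hopf_algebra_axioms_def)
qed

section \<open>Automorphism groups of isomorphic Hopf algebras\<close>

lemma Bij_iff: "f \<in> Bij S \<longleftrightarrow> f \<in> extensional S \<and> bij_betw f S S"
  by (auto simp: Bij_def)

lemma hopf_Aut_simps:
  "carrier (hopf_Aut k A) = hopf_hom k A A \<inter> Bij (carrier A)"
  "\<theta> \<in> carrier (hopf_Aut k A) ==> \<eta> \<in> carrier (hopf_Aut k A) ==>
     \<theta> \<otimes>\<^bsub>hopf_Aut k A\<^esub> \<eta> = compose (carrier A) \<theta> \<eta>"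
  by (auto simp: hopf_Aut_def BijGroup_def)

lemma hopf_Aut_conj:
  assumes A: "hopf_like A" and B: "hopf_like B" and \<phi>: "\<phi> \<in> hopf_hom k A B"
    and bij: "bij_betw \<phi> (carrier A) (carrier B)" and \<theta>: "\<theta> \<in> carrier (hopf_Aut k A)"
  shows "restrict (\<lambda>x. \<phi> (\<theta> (inv_into (carrier A) \<phi> x))) (carrier B) \<in> carrier (hopf_Aut k B)"
proof -
  let ?i = "inv_into (carrier A) \<phi>"
  have i: "?i \<in> hopf_hom k B A" by (rule hopf_hom_inv [OF A hopf_like_simps(2) [OF B] \<phi> bij])
  have \<theta>': "\<theta> \<in> hopf_hom k A A" "bij_betw \<theta> (carrier A) (carrier A)"
    using \<theta> by (auto simp: hopf_Aut_simps Bij_iff)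
  have h: "(\<lambda>x. \<phi> (\<theta> (?i x))) \<in> hopf_hom k B B"
    by (rule hopf_hom_comp [OF B A B hopf_hom_comp [OF B A A i \<theta>'(1)] \<phi>])
  have "restrict (\<lambda>x. \<phi> (\<theta> (?i x))) (carrier B) \<in> hopf_hom k B B"
    by (rule hopf_hom_cong [OF B hopf_like_simps(2) [OF B] h]) simp
  moreover have "bij_betw (\<lambda>x. \<phi> (\<theta> (?i x))) (carrier B) (carrier B)"
    using bij_betw_trans [OF bij_betw_trans [OF bij_betw_inv_into [OF bij] \<theta>'(2)] bij] by (simp add: comp_def)
  then have "bij_betw (restrict (\<lambda>x. \<phi> (\<theta> (?i x))) (carrier B)) (carrier B) (carrier B)"
    by (simp cong: bij_betw_cong)
  ultimately show ?thesis by (simp add: hopf_Aut_simps Bij_iff)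
qed

text \<open>Conjugation by the isomorphism, restricted to the carrier because elements of
  \<open>Bij\<close> are extensional.\<close>

lemma hopf_Aut_iso:
  assumes A: "hopf_like A" and B: "hopf_like B" and AB: "hopf_isomorphic k A B"
  shows "hopf_Aut k A \<cong> hopf_Aut k B"
proof -
  obtain \<phi> where \<phi>: "\<phi> \<in> hopf_hom k A B" and bij: "bij_betw \<phi> (carrier A) (carrier B)"
    using AB unfolding hopf_isomorphic_def by blast
  let ?i = "inv_into (carrier A) \<phi>"
  let ?F = "\<lambda>\<theta>. restrict (\<lambda>x. \<phi> (\<theta> (?i x))) (carrier B)"
  let ?G = "\<lambda>\<theta>. restrict (\<lambda>x. ?i (\<theta> (\<phi> x))) (carrier A)"
  have i: "?i \<in> hopf_hom k B A" by (rule hopf_hom_inv [OF A hopf_like_simps(2) [OF B] \<phi> bij])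
  have ibij: "bij_betw ?i (carrier B) (carrier A)" by (rule bij_betw_inv_into [OF bij])
  have il: "?i (\<phi> x) = x" if "x \<in> carrier A" for x using bij that by (simp add: bij_betw_inv_into_left)
  have ir: "\<phi> (?i x) = x" if "x \<in> carrier B" for x using bij that by (simp add: bij_betw_inv_into_right)
  have c: "?i x \<in> carrier A" if "x \<in> carrier B" for x using ibij that by (auto simp: bij_betw_def)
  have c': "\<phi> x \<in> carrier B" if "x \<in> carrier A" for x using bij that by (auto simp: bij_betw_def)
  have ca: "\<theta> x \<in> carrier E" if "\<theta> \<in> carrier (hopf_Aut k E)" "x \<in> carrier E" for \<theta> x and E :: "('k, 'z) hopf"
    using that by (auto simp: hopf_Aut_simps Bij_iff bij_betw_def)
  have Acl: "\<theta> x \<in> carrier A" if "\<theta> \<in> carrier (hopf_Aut k A)" "x \<in> carrier A" for \<theta> x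
    using that by (auto simp: hopf_Aut_simps Bij_iff bij_betw_def)
  have Bcl: "\<theta> x \<in> carrier B" if "\<theta> \<in> carrier (hopf_Aut k B)" "x \<in> carrier B" for \<theta> x
    using that by (auto simp: hopf_Aut_simps Bij_iff bij_betw_def)
  have F: "?F \<theta> \<in> carrier (hopf_Aut k B)" if "\<theta> \<in> carrier (hopf_Aut k A)" for \<theta>
    by (rule hopf_Aut_conj [OF A B \<phi> bij that])
  have G: "?G \<theta> \<in> carrier (hopf_Aut k A)" if \<theta>: "\<theta> \<in> carrier (hopf_Aut k B)" for \<theta>
  proof -
    have "inv_into (carrier B) ?i x = \<phi> x" if "x \<in> carrier A" for x
      by (rule inv_into_f_eq) (use ibij that il c' in \<open>auto simp: bij_betw_def\<close>)
    then have "?G \<theta> = restrict (\<lambda>x. ?i (\<theta> (inv_into (carrier B) ?i x))) (carrier A)"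
      by (auto simp: restrict_def fun_eq_iff)
    then show ?thesis using hopf_Aut_conj [OF B A i ibij \<theta>] by simp
  qed
  have "?F \<in> hom (hopf_Aut k A) (hopf_Aut k B)"
  proof (rule homI)
    fix \<theta> \<eta> assume *: "\<theta> \<in> carrier (hopf_Aut k A)" "\<eta> \<in> carrier (hopf_Aut k A)"
    show "?F \<theta> \<in> carrier (hopf_Aut k B)" by (rule F [OF *(1)])
    show "?F (\<theta> \<otimes>\<^bsub>hopf_Aut k A\<^esub> \<eta>) = ?F \<theta> \<otimes>\<^bsub>hopf_Aut k B\<^esub> ?F \<eta>"
      unfolding hopf_Aut_simps(2) [OF *] hopf_Aut_simps(2) [OF F [OF *(1)] F [OF *(2)]]
      by (rule ext) (use c c' Acl * in \<open>auto simp: compose_def restrict_def il\<close>)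
  qed
  moreover have "bij_betw ?F (carrier (hopf_Aut k A)) (carrier (hopf_Aut k B))"
  proof (rule bij_betw_byWitness [where f' = ?G])
    show "\<forall>\<theta> \<in> carrier (hopf_Aut k A). ?G (?F \<theta>) = \<theta>"
    proof
      fix \<theta> assume \<theta>: "\<theta> \<in> carrier (hopf_Aut k A)"
      then have "\<theta> \<in> extensional (carrier A)" by (simp add: hopf_Aut_simps Bij_iff)
      then show "?G (?F \<theta>) = \<theta>"
        by (intro extensionalityI [of _ "carrier A"]) (use c c' Acl \<theta> in \<open>auto simp: il\<close>)
    qed
    show "\<forall>\<theta> \<in> carrier (hopf_Aut k B). ?F (?G \<theta>) = \<theta>"
    proof
      fix \<theta> assume \<theta>: "\<theta> \<in> carrier (hopf_Aut k B)"
      then have "\<theta> \<in> extensional (carrier B)" by (simp add: hopf_Aut_simps Bij_iff)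
      then show "?F (?G \<theta>) = \<theta>"
        by (intro extensionalityI [of _ "carrier B"]) (use c c' Bcl \<theta> in \<open>auto simp: ir\<close>)
    qed
  qed (use F G in auto)
  ultimately show ?thesis by (auto simp: is_iso_def iso_def)
qed

subsection \<open>Group-like and skew-primitive elements\<close>

lemma hopf_hom_comult:
  assumes "\<phi> \<in> hopf_hom k A B" "x \<in> carrier A"
  shows "comult B (\<phi> x) = tlift (tensor k B B) (\<lambda>a b. pure k B B (\<phi> a) (\<phi> b)) (comult A x)"
  using assms by (simp add: hopf_hom_iff coalgebra_map_def sweedler_def)

lemma hopf_hom_tensor_lin:
  assumes A: "hopf_like A" and B: "hopf_like B" and \<phi>: "\<phi> \<in> hopf_hom k A B"
  shows "tlift (tensor k B B) (\<lambda>a b. pure k B B (\<phi> a) (\<phi> b)) \<in> lin (tensor k A A) (tensor k B B)"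
    "\<And>x y. x \<in> carrier A ==> y \<in> carrier A ==>
      tlift (tensor k B B) (\<lambda>a b. pure k B B (\<phi> a) (\<phi> b)) (pure k A A x y) = pure k B B (\<phi> x) (\<phi> y)"
proof -
  note A' = hopf_like_simps [OF A] and B' = hopf_like_simps [OF B]
  note l = alg_hom_lin [OF hopf_hom_alg [OF \<phi>]]
  note b = bilin_pure_map [OF B'(2,2) l l]
  show "tlift (tensor k B B) (\<lambda>a b. pure k B B (\<phi> a) (\<phi> b)) \<in> lin (tensor k A A) (tensor k B B)"
    by (rule tensor_lift_linear [OF A'(2,2) tensor_module [OF B'(2,2)] b])
  show "tlift (tensor k B B) (\<lambda>a b. pure k B B (\<phi> a) (\<phi> b)) (pure k A A x y) = pure k B B (\<phi> x) (\<phi> y)"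
    if "x \<in> carrier A" "y \<in> carrier A" for x y
    by (rule tensor_lift_pure [OF A'(2,2) tensor_module [OF B'(2,2)] b that])
qed

context
  fixes A :: "('k, 'a, 'n) hopf_scheme" and B :: "('k, 'b, 'o) hopf_scheme" and \<phi>
  assumes A: "hopf_like A" and B: "hopf_like B" and \<phi>: "\<phi> \<in> hopf_hom k A B"
begin

private lemmas facts = hopf_like_simps [OF A] hopf_like_simps [OF B]
  lin_add [OF hopf_hom_tensor_lin(1) [OF A B \<phi>]] hopf_hom_tensor_lin(2) [OF A B \<phi>]
  alg_hom_closed [OF hopf_hom_alg [OF \<phi>]] alg_hom_one [OF hopf_hom_alg [OF \<phi>]]
  hopf_hom_comult [OF \<phi>] na_one [OF hopf_like_simps(1) [OF A]]

lemma hopf_hom_group_like: "group_like k A g ==> group_like k B (\<phi> g)"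
  by (simp add: group_like_def facts)

lemma hopf_hom_primitive: "primitive k A x ==> primitive k B (\<phi> x)"
  by (simp add: primitive_def facts)

lemma hopf_hom_skew_primitive:
  "skew_primitive k A g x ==> g \<in> carrier A ==> skew_primitive k B (\<phi> g) (\<phi> x)"
  by (simp add: skew_primitive_def facts)

end

section \<open>Free algebras and quotients\<close>

lemma free_algebra_simps:
  "carrier (free_algebra k) = carrier (free_space k UNIV)"
  "add (free_algebra k) = add (free_space k UNIV)"
  "zero (free_algebra k) = zero (free_space k UNIV)"
  "smult (free_algebra k) = smult (free_space k UNIV)"
  "one (free_algebra k) = single k []"
  "p \<otimes>\<^bsub>free_algebra k\<^esub> q = (\<lambda>w. \<Oplus>i \<in> {..length w}. p (take i w) \<otimes> q (drop i w))"
  by (simp_all add: free_algebra_def)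

lemma free_algebra_module [simp]: "module k (free_algebra k)"
  by (rule module_cong [OF free_space_module [of UNIV]]) (simp add: same_module_def free_algebra_simps)

lemma lin_maps_same_module:
  assumes "same_module V V'" "same_module U U'"
  shows "lin V U = lin V' U'"
  using assms by (simp add: lin_maps_def same_module_def)

lemma lin_maps_free_algebra [simp]: "lin (free_algebra k) U = lin (free_space k UNIV) U"
  by (rule lin_maps_same_module) (auto simp: same_module_def free_algebra_simps)

lemma free_algebra_na: "na_algebra (free_algebra k)"
proof -
  have clos: "p \<otimes>\<^bsub>free_algebra k\<^esub> q \<in> carrier (free_algebra k)"
    if p: "p \<in> carrier (free_algebra k)" and q: "q \<in> carrier (free_algebra k)" for p q :: "'g list => 'k"
  proof -
    have pk: "p w \<in> carrier k" "q w \<in> carrier k" for w using p q by (auto simp: free_algebra_simps free_space_simps)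
    \<comment> \<open>A word in the support of a product is a word from the support of p followed by
      one from the support of q, so finiteness is inherited.\<close>
    have "{w. (p \<otimes>\<^bsub>free_algebra k\<^esub> q) w \<noteq> \<zero>} \<subseteq> (\<lambda>(u, v). u @ v) ` ({u. p u \<noteq> \<zero>} \<times> {v. q v \<noteq> \<zero>})"
    proof
      fix w assume "w \<in> {w. (p \<otimes>\<^bsub>free_algebra k\<^esub> q) w \<noteq> \<zero>}"
      then have "(\<Oplus>i \<in> {..length w}. p (take i w) \<otimes> q (drop i w)) \<noteq> \<zero>" by (simp add: free_algebra_simps)
      then obtain i where "p (take i w) \<otimes> q (drop i w) \<noteq> \<zero>"
        using add.finprod_one_eqI [of "{..length w}" "\<lambda>i. p (take i w) \<otimes> q (drop i w)"] by auto
      then have "p (take i w) \<noteq> \<zero>" "q (drop i w) \<noteq> \<zero>" using pk by auto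
      then show "w \<in> (\<lambda>(u, v). u @ v) ` ({u. p u \<noteq> \<zero>} \<times> {v. q v \<noteq> \<zero>})"
        by (intro image_eqI [of _ _ "(take i w, drop i w)"]) auto
    qed
    moreover have "finite ({u. p u \<noteq> \<zero>} \<times> {v. q v \<noteq> \<zero>})"
      using p q by (simp add: free_algebra_simps free_space_simps)
    ultimately have "finite {w. (p \<otimes>\<^bsub>free_algebra k\<^esub> q) w \<noteq> \<zero>}"
      by (meson finite_imageI finite_subset)
    moreover have "(p \<otimes>\<^bsub>free_algebra k\<^esub> q) w \<in> carrier k" for w
      by (simp add: free_algebra_simps(6) pk)
    ultimately show ?thesis unfolding free_algebra_simps(1) free_space_simps by auto
  qed
  have "bilin (free_algebra k) (free_algebra k) (free_algebra k) (monoid.mult (free_algebra k))"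
  proof (intro bilinI lin_mapsI clos)
    fix p q r :: "'g list => 'k"
    assume p: "p \<in> carrier (free_algebra k)" and q: "q \<in> carrier (free_algebra k)" and r: "r \<in> carrier (free_algebra k)"
    have pk: "p w \<in> carrier k" "q w \<in> carrier k" "r w \<in> carrier k" for w
      using p q r by (auto simp: free_algebra_simps free_space_simps)
    show "p \<otimes>\<^bsub>free_algebra k\<^esub> (q \<oplus>\<^bsub>free_algebra k\<^esub> r) =
       p \<otimes>\<^bsub>free_algebra k\<^esub> q \<oplus>\<^bsub>free_algebra k\<^esub> p \<otimes>\<^bsub>free_algebra k\<^esub> r"
      by (simp add: free_algebra_simps free_space_simps r_distr pk add.finprod_multf)
    show "(q \<oplus>\<^bsub>free_algebra k\<^esub> r) \<otimes>\<^bsub>free_algebra k\<^esub> p =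
       q \<otimes>\<^bsub>free_algebra k\<^esub> p \<oplus>\<^bsub>free_algebra k\<^esub> r \<otimes>\<^bsub>free_algebra k\<^esub> p"
      by (simp add: free_algebra_simps free_space_simps l_distr pk add.finprod_multf)
  next
    fix p q :: "'g list => 'k" and c
    assume p: "p \<in> carrier (free_algebra k)" and q: "q \<in> carrier (free_algebra k)" and c: "c \<in> carrier k"
    have pk: "p w \<in> carrier k" "q w \<in> carrier k" for w
      using p q by (auto simp: free_algebra_simps free_space_simps)
    show "p \<otimes>\<^bsub>free_algebra k\<^esub> (c \<odot>\<^bsub>free_algebra k\<^esub> q) = c \<odot>\<^bsub>free_algebra k\<^esub> (p \<otimes>\<^bsub>free_algebra k\<^esub> q)"
      using c by (simp add: free_algebra_simps free_space_simps pk m_lcomm finsum_rdistr)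
    show "(c \<odot>\<^bsub>free_algebra k\<^esub> q) \<otimes>\<^bsub>free_algebra k\<^esub> p = c \<odot>\<^bsub>free_algebra k\<^esub> (q \<otimes>\<^bsub>free_algebra k\<^esub> p)"
      using c by (simp add: free_algebra_simps free_space_simps pk m_assoc finsum_rdistr)
  qed
  then show ?thesis by (simp add: na_algebra_def free_algebra_simps)
qed

lemma free_algebra_single_mult:
  "single k u \<otimes>\<^bsub>free_algebra k\<^esub> single k v = single k (u @ v)"
proof (rule ext)
  fix w
  \<comment> \<open>Of all cuts of w only the one at position \<open>length u\<close> can
    contribute, and only for w = u v.\<close>
  have eq: "single k u (take i w) \<otimes> single k v (drop i w) = (if i = length u \<and> w = u @ v then \<one> else \<zero>)"
    if "i \<le> length w" for i
  proof -
    have "take i w = u \<and> drop i w = v \<longleftrightarrow> i = length u \<and> w = u @ v"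
      using that by (auto simp: min_def)
    then show ?thesis by (auto simp: single_def)
  qed
  have "(\<Oplus>i \<in> {..length w}. single k u (take i w) \<otimes> single k v (drop i w)) =
     (\<Oplus>i \<in> {..length w}. if i = length u \<and> w = u @ v then \<one> else \<zero>)"
    by (rule finsum_cong') (auto simp: eq)
  also have "\<dots> = single k (u @ v) w"
  proof (cases "w = u @ v")
    case True
    then have "(\<Oplus>i \<in> {..length w}. if i = length u \<and> w = u @ v then \<one> else \<zero>) =
       (\<Oplus>i \<in> {..length w}. if length u = i then \<one> else \<zero>)" by (simp add: eq_commute)
    also have "\<dots> = \<one>" by (rule add.finprod_singleton [of _ _ "\<lambda>i. \<one>"]) (use True in auto)
    finally show ?thesis using True by (simp add: single_def)
  next
    case False
    then show ?thesis by (simp add: single_def)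
  qed
  finally show "(single k u \<otimes>\<^bsub>free_algebra k\<^esub> single k v) w = single k (u @ v) w"
    by (simp add: free_algebra_simps)
qed

lemma free_algebra_induct [consumes 1, case_names single add smult]:
  assumes "f \<in> carrier (free_algebra k)"
    and single: "\<And>b. P (single k b)"
    and add: "\<And>f h. f \<in> carrier (free_algebra k) ==> h \<in> carrier (free_algebra k) ==>
                P f ==> P h ==> P (f \<oplus>\<^bsub>free_algebra k\<^esub> h)"
    and smult: "\<And>c f. c \<in> carrier k ==> f \<in> carrier (free_algebra k) ==> P f ==>
                P (c \<odot>\<^bsub>free_algebra k\<^esub> f)"
  shows "P f"
  using assms(1) unfolding free_algebra_simps
proof (induction f rule: free_space_induct)
  case zero
  have "\<zero> \<odot>\<^bsub>free_algebra k\<^esub> single k [] = \<zero>\<^bsub>free_space k UNIV\<^esub>"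
    by (simp add: free_algebra_simps)
  then show ?case using smult [of \<zero> "single k []"] single by (simp add: free_algebra_simps)
qed (use single add smult in \<open>auto simp: free_algebra_simps\<close>)

lemma free_algebra_kalg [simp]: "k_algebra k (free_algebra k)"
proof (rule k_algebraI [OF free_algebra_na])
  note B = na_bilin [OF free_algebra_na] and cl = na_mult_closed [OF free_algebra_na]
  note dist = lin_add [OF bilin_lin(1) [OF B]] lin_add [OF bilin_lin(2) [OF B]]
    lin_smult [OF bilin_lin(1) [OF B]] lin_smult [OF bilin_lin(2) [OF B]]
  have s: "single k w \<in> carrier (free_algebra k)" for w :: "'g list" by (simp add: free_algebra_simps)
  fix p q r :: "'g list => 'k"
  assume p: "p \<in> carrier (free_algebra k)" and q: "q \<in> carrier (free_algebra k)" and r: "r \<in> carrier (free_algebra k)"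
  show "(p \<otimes>\<^bsub>free_algebra k\<^esub> q) \<otimes>\<^bsub>free_algebra k\<^esub> r = p \<otimes>\<^bsub>free_algebra k\<^esub> (q \<otimes>\<^bsub>free_algebra k\<^esub> r)"
    using p
  proof (induction p rule: free_algebra_induct)
    case (single u)
    show ?case using q
    proof (induction q rule: free_algebra_induct)
      case (single v)
      show ?case using r
      proof (induction r rule: free_algebra_induct)
        case (single w)
        then show ?case by (simp add: free_algebra_single_mult)
      qed (simp_all add: dist cl s)
    qed (use r in \<open>simp_all add: dist cl s\<close>)
  qed (use q r in \<open>simp_all add: dist cl s\<close>)
next
  note B = na_bilin [OF free_algebra_na] and cl = na_mult_closed [OF free_algebra_na]
  note dist = lin_add [OF bilin_lin(1) [OF B]] lin_add [OF bilin_lin(2) [OF B]]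
    lin_smult [OF bilin_lin(1) [OF B]] lin_smult [OF bilin_lin(2) [OF B]]
  have s: "single k w \<in> carrier (free_algebra k)" for w :: "'g list" by (simp add: free_algebra_simps)
  fix p :: "'g list => 'k" assume p: "p \<in> carrier (free_algebra k)"
  show "\<one>\<^bsub>free_algebra k\<^esub> \<otimes>\<^bsub>free_algebra k\<^esub> p = p" using p unfolding free_algebra_simps(5)
    by (induction p rule: free_algebra_induct) (simp_all add: free_algebra_single_mult dist s)
  show "p \<otimes>\<^bsub>free_algebra k\<^esub> \<one>\<^bsub>free_algebra k\<^esub> = p" using p unfolding free_algebra_simps(5)
    by (induction p rule: free_algebra_induct) (simp_all add: free_algebra_single_mult dist s)
qed

lemma free_algebra_generates: "generates (range (\<lambda>s. single k [s])) (free_algebra k)"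
  unfolding generates_def
proof (intro conjI allI impI)
  show "range (\<lambda>s. single k [s]) \<subseteq> carrier (free_algebra k)" by (auto simp: free_algebra_simps)
  fix N :: "('g list => 'k) set" assume N: "subalg N (free_algebra k)" and G: "range (\<lambda>s. single k [s]) \<subseteq> N"
  have N': "submodule N k (free_algebra k)" using N by (simp add: subalg_def)
  have w: "single k w \<in> N" for w
  proof (induction w)
    case Nil
    then show ?case using N by (simp add: subalg_def free_algebra_simps)
  next
    case (Cons s w)
    have "single k [s] \<otimes>\<^bsub>free_algebra k\<^esub> single k w \<in> N"
      using N G Cons by (auto simp: subalg_def)
    then show ?case by (simp add: free_algebra_single_mult)
  qed
  show "carrier (free_algebra k) \<subseteq> N"
  proof
    fix f :: "'g list => 'k" assume "f \<in> carrier (free_algebra k)"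
    then show "f \<in> N"
      by (induction f rule: free_algebra_induct)
        (auto intro: w submodule_add [OF N'] submodule_smult [OF N'])
  qed
qed

lemma free_eval_hom:
  fixes \<phi> :: "'g => 't"
  assumes T: "k_algebra k T" and \<phi>: "\<And>s. \<phi> s \<in> carrier T"
  shows "free_eval k T \<phi> \<in> alg_hom (free_algebra k) T"
    and "free_eval k T \<phi> (single k [s]) = \<phi> s"
proof -
  let ?\<gamma> = "\<lambda>w. foldr (\<lambda>s t. \<phi> s \<otimes>\<^sub>T t) w \<one>\<^sub>T"
  have g: "?\<gamma> w \<in> carrier T" for w by (induction w) (use T \<phi> in auto)
  have eq: "free_eval k T \<phi> = lin_ext T ?\<gamma>" by (simp add: fun_eq_iff free_eval_def lin_ext_def)
  have l: "free_eval k T \<phi> \<in> lin (free_algebra k) T"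
    unfolding eq using lin_ext_linear [of T ?\<gamma> UNIV] g T by simp
  have s: "free_eval k T \<phi> (single k w) = ?\<gamma> w" for w
    unfolding eq using lin_ext_single [of T ?\<gamma> w] g T by simp
  have app: "?\<gamma> (u @ v) = ?\<gamma> u \<otimes>\<^sub>T ?\<gamma> v" for u v
  proof (induction u)
    case Nil
    then show ?case using g [of v] T by simp
  next
    case (Cons a u)
    then show ?case using g [of v] g [of u] T \<phi> [of a] by (simp add: amult_assoc)
  qed
  show "free_eval k T \<phi> (single k [s]) = \<phi> s" using T \<phi> by (simp add: s)
  note F = free_algebra_kalg
  have c: "single k w \<in> carrier (free_algebra k)" for w :: "'g list" by (simp add: free_algebra_simps)
  show "free_eval k T \<phi> \<in> alg_hom (free_algebra k) T"
  proof (rule alg_homI [OF l])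
    show "free_eval k T \<phi> \<one>\<^bsub>free_algebra k\<^esub> = \<one>\<^sub>T" by (simp add: free_algebra_simps s)
    fix p q :: "'g list => 'k" assume p: "p \<in> carrier (free_algebra k)" and q: "q \<in> carrier (free_algebra k)"
    show "free_eval k T \<phi> (p \<otimes>\<^bsub>free_algebra k\<^esub> q) = free_eval k T \<phi> p \<otimes>\<^sub>T free_eval k T \<phi> q"
      using p
    proof (induction p rule: free_algebra_induct)
      case (single u)
      show ?case using q
      proof (induction q rule: free_algebra_induct)
        case (single v)
        then show ?case by (simp add: free_algebra_single_mult s app del: foldr_append)
      qed (use T in \<open>simp_all add: amult_add_right c lin_add [OF l] lin_closed [OF l] asmult_right lin_smult [OF l]\<close>)
    qed (use T q in \<open>simp_all add: amult_add_left c lin_add [OF l] lin_closed [OF l] asmult_left lin_smult [OF l]\<close>)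
  qed
qed

subsection \<open>Quotient algebras\<close>

text \<open>A scalar acts as left multiplication by its multiple of the unit, so ideals are closed
  under it.\<close>

lemma ideal_submodule:
  assumes F: "k_algebra k F" and I: "ideal I F"
  shows "submodule I k F"
proof (rule submoduleI')
  show "module k F" using F by simp
  show sub: "I \<subseteq> carrier F" using ideal.Icarr [OF I] by blast
  show "\<zero>\<^sub>F \<in> I" using additive_subgroup.zero_closed [OF ideal.axioms(1) [OF I]] .
  show "a \<oplus>\<^sub>F b \<in> I" if "a \<in> I" "b \<in> I" for a b
    using additive_subgroup.a_closed [OF ideal.axioms(1) [OF I]] that .
  show "c \<odot>\<^sub>F x \<in> I" if "c \<in> carrier k" "x \<in> I" for c x
  proof -
    have "(c \<odot>\<^sub>F \<one>\<^sub>F) \<otimes>\<^sub>F x \<in> I"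
      using ideal.I_l_closed [OF I that(2)] F that by simp
    then show ?thesis using F that sub by (simp add: asmult_left subset_iff)
  qed
qed

context
  fixes F :: "('k, 'f, 'n) module_scheme" and I
  assumes F: "k_algebra k F" and I: "ideal I F"
begin

private abbreviation "Q \<equiv> quot_space F I"
private abbreviation "\<pi> x \<equiv> I +>\<^sub>F x"

private lemmas sub = ideal_submodule [OF F I]

lemma quot_alg_mult:
  "x \<in> carrier F ==> y \<in> carrier F ==> (I +>\<^sub>F x) \<otimes>\<^sub>Q (I +>\<^sub>F y) = I +>\<^sub>F (x \<otimes>\<^sub>F y)"
  using ideal.rcoset_mult_add [OF I] by (simp add: quot_space_def)

lemma quot_alg_one: "\<one>\<^sub>Q = I +>\<^sub>F \<one>\<^sub>F"
  by (simp add: quot_space_def)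

lemma quot_k_algebra: "k_algebra k Q"
proof (rule k_algebraI)
  have M: "module k F" using F by simp
  show "na_algebra Q"
    unfolding na_algebra_def
    by (auto intro!: bilinI lin_mapsI quot_space_module M sub
      simp: quot_space_simps(3) quot_alg_mult quot_alg_one coset_add [OF M sub] coset_smult [OF M sub] F
        amult_add_left amult_add_right asmult_left asmult_right)
qed (auto simp: quot_space_simps(3) quot_alg_mult quot_alg_one F amult_assoc)

lemma quot_proj_hom: "(\<lambda>x. I +>\<^sub>F x) \<in> alg_hom F Q"
  by (rule alg_homI) (auto simp: quot_alg_mult quot_alg_one intro!: coset_linear sub kalg_module F)

lemma quot_generates:
  assumes G: "generates G F"
  shows "generates ((\<lambda>x. I +>\<^sub>F x) ` G) Q"
  unfolding generates_def
proof (intro conjI allI impI)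
  show "(\<lambda>x. I +>\<^sub>F x) ` G \<subseteq> carrier Q"
    using generates_subset [OF G] by (auto simp: quot_space_simps(3))
  fix N assume N: "subalg N Q" and GN: "(\<lambda>x. I +>\<^sub>F x) ` G \<subseteq> N"
  have M: "module k F" using F by simp
  have N': "submodule N k Q" using N by (simp add: subalg_def)
  have "submodule {x \<in> carrier F. I +>\<^sub>F x \<in> N} k F"
    by (rule submoduleI' [OF M])
      (use F M submodule_zero [OF N'] submodule_add [OF N'] submodule_smult [OF N']
        coset_add [OF M sub, symmetric] coset_smult [OF M sub, symmetric] coset_zero [OF M sub] in auto)
  then have "subalg {x \<in> carrier F. I +>\<^sub>F x \<in> N} F"
    using N F by (auto simp: subalg_def quot_alg_one quot_alg_mult [symmetric])
  then have "carrier F \<subseteq> {x \<in> carrier F. I +>\<^sub>F x \<in> N}"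
    using G GN generates_subset [OF G] unfolding generates_def by blast
  then show "carrier Q \<subseteq> N" by (auto simp: quot_space_simps(3))
qed

lemma quot_alg_lift:
  assumes U: "k_algebra k U" and \<phi>: "\<phi> \<in> alg_hom F U" and ker: "\<And>n. n \<in> I ==> \<phi> n = \<zero>\<^sub>U"
  shows "x \<in> carrier F ==> \<phi> (SOME f. f \<in> I +>\<^sub>F x) = \<phi> x"
    and "(\<lambda>X. \<phi> (SOME f. f \<in> X)) \<in> alg_hom Q U"
proof -
  have M: "module k F" "module k U" using F U by simp_all
  note l = quot_lift [OF M(1) sub M(2) alg_hom_lin [OF \<phi>] ker]
  show "x \<in> carrier F ==> \<phi> (SOME f. f \<in> I +>\<^sub>F x) = \<phi> x" by (rule l(1))
  show "(\<lambda>X. \<phi> (SOME f. f \<in> X)) \<in> alg_hom Q U"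
    by (rule alg_homI [OF l(2)])
      (use F in \<open>auto simp: quot_space_simps(3) quot_alg_one quot_alg_mult l(1) alg_hom_one [OF \<phi>] alg_hom_mult [OF \<phi>]\<close>)
qed

end

lemma alg_hom_kernel_ideal:
  assumes F: "k_algebra k F" and U: "k_algebra k U" and \<phi>: "\<phi> \<in> alg_hom F U"
  shows "ideal {x \<in> carrier F. \<phi> x = \<zero>\<^sub>U} F"
proof (rule idealI [OF kalg_ring [OF F]])
  have "submodule {x \<in> carrier F. \<phi> x = \<zero>\<^sub>U} k F"
    by (rule submodule_kernel) (use F U alg_hom_lin [OF \<phi>] in auto)
  then show "subgroup {x \<in> carrier F. \<phi> x = \<zero>\<^sub>U} (add_monoid F)" by (rule submodule.axioms)
qed (use F U in \<open>auto simp: alg_hom_mult [OF \<phi>] alg_hom_closed [OF \<phi>]\<close>)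

declare One_nat_def [simp del]

lemmas apow_one [simp] = monoid.nat_pow_eone [OF kalg_monoid]

section \<open>Hopf algebra axioms on generators\<close>

lemma kalg_cong:
  assumes A: "k_algebra k A" and same: "same_module A B" and mult: "monoid.mult B = monoid.mult A" and one: "one B = one A"
  shows "k_algebra k B"
proof (rule k_algebraI)
  have eqs: "carrier B = carrier A" "add B = add A" "smult B = smult A"
    using same by (simp_all add: same_module_def)
  have "module k B" by (rule module_cong [OF _ same]) (use A in simp)
  then show "na_algebra B"
    using kalg_na [OF A] by (simp add: na_algebra_def bilin_def lin_maps_def eqs mult one)
qed (use A same in \<open>auto simp: same_module_def mult one amult_assoc\<close>)

lemma with_coalgebra_simps [simp]:
  "carrier (with_coalgebra M d e) = carrier M" "monoid.mult (with_coalgebra M d e) = monoid.mult M"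
  "one (with_coalgebra M d e) = one M" "zero (with_coalgebra M d e) = zero M"
  "add (with_coalgebra M d e) = add M" "smult (with_coalgebra M d e) = smult M"
  "comult (with_coalgebra M d e) = d" "counit (with_coalgebra M d e) = e"
  by (simp_all add: with_coalgebra_def)

lemma same_module_with_coalgebra: "same_module M (with_coalgebra M d e)"
  by (simp add: same_module_def)

lemma same_module_sym: "same_module M N ==> same_module N M"
  by (simp add: same_module_def)

lemma pure_with_coalgebra [simp]:
  "pure k (with_coalgebra M d e) (with_coalgebra N d' e') = pure k M N"
  by (rule tensor_space_cong [OF same_module_sym [OF same_module_with_coalgebra] same_module_sym [OF same_module_with_coalgebra]])

lemma tensor_with_coalgebra [simp]:
  "tensor k (with_coalgebra M d e) (with_coalgebra N d' e') = tensor k M N"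
  unfolding tensor_def Let_def
  by (simp add: tensor_space_cong [OF same_module_sym [OF same_module_with_coalgebra] same_module_sym [OF same_module_with_coalgebra]])

context
  fixes H :: "('k, 'h, 'n) hopf_scheme" and g x
  assumes H: "k_algebra k H" and \<Delta>: "comult H \<in> alg_hom H (tensor k H H)"
    and \<epsilon>: "counit H \<in> alg_hom H (self_module k)"
    and g: "group_like k H g" and x: "skew_primitive k H g x"
    and \<epsilon>g: "counit H g = \<one>" and \<epsilon>x: "counit H x = \<zero>"
begin

private abbreviation "HH \<equiv> tensor k H H"
private abbreviation "HHH \<equiv> tensor k H HH"

private lemma gx: "g \<in> carrier H" "x \<in> carrier H" "comult H g = pure k H H g g"
  "comult H x = pure k H H x \<one>\<^sub>H \<oplus>\<^sub>HH pure k H H g x"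
  "comult H \<one>\<^sub>H = pure k H H \<one>\<^sub>H \<one>\<^sub>H" "counit H \<one>\<^sub>H = \<one>"
  using g x alg_hom_one [OF \<Delta>] alg_hom_one [OF \<epsilon>]
  by (auto simp: group_like_def skew_primitive_def tensor_simps(5))

private lemma M: "module k H" "module k HH" "module k HHH" "module k (tensor k HH H)" "\<one>\<^sub>H \<in> carrier H"
  using H by auto

private lemma eval_lift:
  assumes "module k U" "bilin H H U \<beta>"
  shows "tlift U \<beta> (comult H g) = \<beta> g g"
    "tlift U \<beta> (comult H x) = \<beta> x \<one>\<^sub>H \<oplus>\<^sub>U \<beta> g x"
  using assms H gx(1,2) by (simp_all add: gx(3,4) tensor_lift_add tensor_lift_pure)

private lemma bilins:
  "bilin H H (tensor k HH H) (\<lambda>a b. pure k HH H (comult H a) b)"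
  "bilin H H HHH (\<lambda>a b. pure k H HH a (comult H b))"
  "bilin H H H (\<lambda>h1 h2. counit H h1 \<odot>\<^sub>H h2)"
  "bilin H H H (\<lambda>h1 h2. counit H h2 \<odot>\<^sub>H h1)"
proof -
  note l = alg_hom_lin [OF \<Delta>] alg_hom_lin [OF \<epsilon>]
  show "bilin H H (tensor k HH H) (\<lambda>a b. pure k HH H (comult H a) b)"
    by (rule bilin_pure_map [OF M(2,1) l(1) lin_id])
  show "bilin H H HHH (\<lambda>a b. pure k H HH a (comult H b))"
    by (rule bilin_pure_map [OF M(1,2) lin_id l(1)])
  show "bilin H H H (\<lambda>h1 h2. counit H h1 \<odot>\<^sub>H h2)" "bilin H H H (\<lambda>h1 h2. counit H h2 \<odot>\<^sub>H h1)"
    using M l lin_closed [OF l(2)] by (auto intro!: bilinI lin_smult_right lin_smult_left)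
qed

private lemma assoc_pure:
  "a \<in> carrier H ==> b \<in> carrier H ==> c \<in> carrier H ==>
     tensor_assoc H (pure k HH H (pure k H H a b) c) = pure k H HH a (pure k H H b c)"
  using M by (simp add: tensor_assoc_def tensor_lift_pure assoc_outer_bilin assoc_inner_bilin)

text \<open>With g = 1 this also covers the primitive generator Y, both in k[Y] and in the presented
  algebra.\<close>

lemma coassoc_skew_primitive:
  "tensor_assoc H (tlift (tensor k HH H) (\<lambda>a b. pure k HH H (comult H a) b) (comult H x)) =
      tlift HHH (\<lambda>a b. pure k H HH a (comult H b)) (comult H x)"
  unfolding eval_lift(2) [OF M(4) bilins(1)] eval_lift(2) [OF M(3) bilins(2)]
  using M gx by (simp add: pure_add_left pure_add_right
      lin_add [OF alg_hom_lin [OF tensor_assoc_hom [OF H]]] assoc_pure vac)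

lemma coassoc_group_like:
  "tensor_assoc H (tlift (tensor k HH H) (\<lambda>a b. pure k HH H (comult H a) b) (comult H g)) =
      tlift HHH (\<lambda>a b. pure k H HH a (comult H b)) (comult H g)"
  unfolding eval_lift(1) [OF M(4) bilins(1)] eval_lift(1) [OF M(3) bilins(2)]
  using M gx by (simp add: assoc_pure)

lemma counit_skew_primitive:
  "sweedler k H H (\<lambda>h1 h2. counit H h1 \<odot>\<^sub>H h2) x = x"
  "sweedler k H H (\<lambda>h1 h2. counit H h2 \<odot>\<^sub>H h1) x = x"
  "sweedler k H H (\<lambda>h1 h2. counit H h1 \<odot>\<^sub>H h2) g = g"
  "sweedler k H H (\<lambda>h1 h2. counit H h2 \<odot>\<^sub>H h1) g = g"
  unfolding sweedler_def eval_lift [OF M(1) bilins(3)] eval_lift [OF M(1) bilins(4)]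
  using M gx by (simp_all add: \<epsilon>g \<epsilon>x)

text \<open>For \<Delta>(x) = x \<otimes> 1 + g \<otimes> x the identity S(x) + S(g) x = 0 leaves no
  choice for S(x); the other identity then follows from g S(g) = 1.\<close>

lemma antipode_skew_primitive:
  assumes S: "S \<in> lin H H" and S1: "S \<one>\<^sub>H = \<one>\<^sub>H"
    and Sg: "S g \<otimes>\<^sub>H g = \<one>\<^sub>H" "g \<otimes>\<^sub>H S g = \<one>\<^sub>H" and Sx: "S x = \<ominus>\<^sub>H (S g \<otimes>\<^sub>H x)"
  shows "sweedler k H H (\<lambda>h1 h2. S h1 \<otimes>\<^sub>H h2) g = counit H g \<odot>\<^sub>H \<one>\<^sub>H"
    "sweedler k H H (\<lambda>h1 h2. h1 \<otimes>\<^sub>H S h2) g = counit H g \<odot>\<^sub>H \<one>\<^sub>H"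
    "sweedler k H H (\<lambda>h1 h2. S h1 \<otimes>\<^sub>H h2) x = counit H x \<odot>\<^sub>H \<one>\<^sub>H"
    "sweedler k H H (\<lambda>h1 h2. h1 \<otimes>\<^sub>H S h2) x = counit H x \<odot>\<^sub>H \<one>\<^sub>H"
proof -
  have b: "bilin H H H (\<lambda>h1 h2. S h1 \<otimes>\<^sub>H h2)" "bilin H H H (\<lambda>h1 h2. h1 \<otimes>\<^sub>H S h2)"
    by (rule bilin_hom_mult; use H S in simp)+
  have c: "S g \<in> carrier H" using lin_closed [OF S] gx by blast
  have "g \<otimes>\<^sub>H (S g \<otimes>\<^sub>H x) = x"
    using Sg(2) H gx c by (simp add: amult_assoc [symmetric])
  then show "sweedler k H H (\<lambda>h1 h2. h1 \<otimes>\<^sub>H S h2) x = counit H x \<odot>\<^sub>H \<one>\<^sub>H"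
    unfolding sweedler_def eval_lift(2) [OF M(1) b(2)] using H M gx c by (simp add: S1 Sx \<epsilon>x amult_neg_right)
  show "sweedler k H H (\<lambda>h1 h2. S h1 \<otimes>\<^sub>H h2) x = counit H x \<odot>\<^sub>H \<one>\<^sub>H"
    "sweedler k H H (\<lambda>h1 h2. S h1 \<otimes>\<^sub>H h2) g = counit H g \<odot>\<^sub>H \<one>\<^sub>H"
    "sweedler k H H (\<lambda>h1 h2. h1 \<otimes>\<^sub>H S h2) g = counit H g \<odot>\<^sub>H \<one>\<^sub>H"
    unfolding sweedler_def eval_lift [OF M(1) b(1)] eval_lift [OF M(1) b(2)]
    using H M gx c by (simp_all add: S1 Sg Sx \<epsilon>g \<epsilon>x)
qed

end

section \<open>The polynomial Hopf algebra\<close>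

abbreviation PA where "PA \<equiv> poly_hopf k"

lemma UP_cring_k: "UP_cring k"
  by (simp add: UP_cring_def is_cring)

text \<open>Functions on the naturals that vanish beyond some bound are those of finite support.
  Hence k[Y] is the free space on the exponents and inherits its induction principle and its linear
  extensions.\<close>

lemma up_carrier: "carrier (UP k) = carrier (free_space k (UNIV :: nat set))"
proof -
  have "(\<exists>n. bound \<zero> n f) \<longleftrightarrow> finite {b. f b \<noteq> \<zero>}" for f :: "nat => 'k"
  proof
    assume "\<exists>n. bound \<zero> n f"
    then obtain n where "bound \<zero> n f" ..
    then have "{b. f b \<noteq> \<zero>} \<subseteq> {..n}" by (auto dest: bound_below)
    then show "finite {b. f b \<noteq> \<zero>}" using finite_subset by blast
  next
    assume "finite {b. f b \<noteq> \<zero>}"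
    then obtain n where "\<forall>b \<in> {b. f b \<noteq> \<zero>}. b \<le> n" using finite_nat_set_iff_bounded_le by auto
    then have "bound \<zero> n f" by (intro bound.intro) (force simp: not_le [symmetric])
    then show "\<exists>n. bound \<zero> n f" ..
  qed
  then show ?thesis by (auto simp: UP_def up_def free_space_simps Pi_iff)
qed

lemma PA_fields:
  "carrier PA = carrier (UP k)" "monoid.mult PA = monoid.mult (UP k)" "one PA = one (UP k)" "zero PA = zero (UP k)"
  "add PA = add (UP k)" "smult PA = smult (UP k)"
  by (simp_all add: poly_hopf_def Let_def)

lemma PA_carrier: "carrier PA = carrier (free_space k (UNIV :: nat set))"
  by (simp add: PA_fields up_carrier)

lemma PA_ops:
  "\<zero>\<^sub>PA = (\<lambda>n. \<zero>)" "\<one>\<^sub>PA = single k 0"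
  "q \<in> carrier PA ==> r \<in> carrier PA ==> q \<oplus>\<^sub>PA r = (\<lambda>n. q n \<oplus> r n)"
  "c \<in> carrier k ==> q \<in> carrier PA ==> c \<odot>\<^sub>PA q = (\<lambda>n. c \<otimes> q n)"
  "q \<in> carrier PA ==> r \<in> carrier PA ==> q \<otimes>\<^sub>PA r = (\<lambda>n. \<Oplus>i \<in> {..n}. q i \<otimes> r (n - i))"
  by (auto simp: PA_fields UP_def single_def)

lemma PA_kalg [simp]: "k_algebra k PA"
proof -
  interpret U: UP_cring k "UP k" by (rule UP_cring_k) simp
  have "k_algebra k (UP k)"
    unfolding k_algebra_def k_algebra_axioms_def
    using U.UP_algebra algebra.module field_axioms U.UP_ring U.UP_smult_assoc2
    by (auto simp: U.m_comm algebra.module U.algebra_axioms)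
  then show ?thesis
    by (rule kalg_cong) (auto simp: same_module_def PA_fields)
qed

lemma PA_comm: "q \<in> carrier PA ==> r \<in> carrier PA ==> q \<otimes>\<^sub>PA r = r \<otimes>\<^sub>PA q"
proof -
  interpret U: UP_cring k "UP k" by (rule UP_cring_k) simp
  show "q \<in> carrier PA ==> r \<in> carrier PA ==> ?thesis" by (simp add: PA_fields U.m_comm)
qed

lemma PA_coeff_closed [simp]: "q \<in> carrier PA ==> q n \<in> carrier k"
  by (simp add: PA_carrier free_space_simps)

lemma PA_single_closed [simp]: "single k n \<in> carrier PA"
  by (simp add: PA_carrier)

lemma UP_monom_single: "monom (UP k) \<one> n = single k n"
  by (auto simp: UP_def single_def)

lemma PA_single_mult: "single k m \<otimes>\<^sub>PA single k n = single k (m + n)"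
proof -
  interpret U: UP_cring k "UP k" by (rule UP_cring_k) simp
  show ?thesis
    using U.monom_mult [of \<one> \<one> m n] by (simp add: PA_fields UP_monom_single)
qed

lemma PA_single_pow: "single k m [^]\<^bsub>PA\<^esub> n = single k (m * n)" for m n :: nat
  by (induction n) (auto simp: PA_ops PA_single_mult add.commute)

lemma PA_induct [consumes 1, case_names single add smult]:
  assumes "q \<in> carrier PA" and "\<And>n. P (single k n)"
    and "\<And>q r. q \<in> carrier PA ==> r \<in> carrier PA ==> P q ==> P r ==> P (q \<oplus>\<^sub>PA r)"
    and "\<And>c q. c \<in> carrier k ==> q \<in> carrier PA ==> P q ==> P (c \<odot>\<^sub>PA q)"
  shows "P q"
  using assms(1) unfolding PA_carrier
proof (induction q rule: free_space_induct)
  case zero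
  have "\<zero> \<odot>\<^sub>PA single k 0 = \<zero>\<^bsub>free_space k UNIV\<^esub>"
    by (simp add: PA_ops free_space_simps)
  then show ?case using assms(4) [of \<zero> "single k 0"] assms(2) by simp
next
  case (add f h)
  then show ?case using assms(3) [of f h] by (simp add: PA_carrier PA_ops free_space_simps(3))
next
  case (smult c f)
  then show ?case using assms(4) [of c f] by (simp add: PA_carrier PA_ops free_space_simps(4))
qed (use assms(2) in simp)

lemma PA_generates: "generates {single k (1::nat)} PA"
  unfolding generates_def
proof (intro conjI allI impI)
  fix N assume N: "subalg N PA" and "{single k 1} \<subseteq> N"
  then have N': "submodule N k PA" and Y: "single k 1 \<in> N" by (auto simp: subalg_def)
  have s: "single k n \<in> N" for n
  proof (induction n)
    case 0
    then show ?case using N by (simp add: subalg_def PA_ops)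
  next
    case (Suc n)
    have "single k 1 \<otimes>\<^sub>PA single k n \<in> N" using N Y Suc by (simp add: subalg_def)
    then show ?case by (simp add: PA_single_mult One_nat_def)
  qed
  show "carrier PA \<subseteq> N"
  proof
    fix q assume "q \<in> carrier PA"
    then show "q \<in> N"
      by (induction q rule: PA_induct) (auto intro: s submodule_add [OF N'] submodule_smult [OF N'])
  qed
qed simp

lemma lin_maps_PA: "lin PA U = lin (free_space k UNIV) U"
  by (auto simp: lin_maps_def PA_carrier PA_ops(3,4) free_space_simps(3,4))

text \<open>Substitution of y for Y; the target may be noncommutative, since only powers of one
  element occur.\<close>

definition peval where
  "peval B y = lin_ext B (\<lambda>i::nat. y [^]\<^bsub>B\<^esub> i)"

lemma peval_hom:
  assumes B: "k_algebra k B" and y: "y \<in> carrier B"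
  shows "peval B y \<in> alg_hom PA B" and "peval B y (single k n) = y [^]\<^bsub>B\<^esub> n"
proof -
  have l: "peval B y \<in> lin PA B"
    unfolding peval_def lin_maps_PA by (rule lin_ext_linear) (use B y in auto)
  have s: "peval B y (single k n) = y [^]\<^bsub>B\<^esub> n" for n
    unfolding peval_def by (rule lin_ext_single) (use B y in auto)
  show "peval B y (single k n) = y [^]\<^bsub>B\<^esub> n" by (rule s)
  show "peval B y \<in> alg_hom PA B"
  proof (rule alg_homI [OF l])
    show "peval B y \<one>\<^sub>PA = \<one>\<^sub>B" by (simp add: PA_ops s)
    fix q r assume q: "q \<in> carrier PA" and r: "r \<in> carrier PA"
    show "peval B y (q \<otimes>\<^sub>PA r) = peval B y q \<otimes>\<^sub>B peval B y r"
      using q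
    proof (induction q rule: PA_induct)
      case (single m)
      show ?case using r
      proof (induction r rule: PA_induct)
        case (single n)
        then show ?case
          using monoid.nat_pow_mult [OF kalg_monoid [OF B] y] by (simp add: PA_single_mult s)
      qed (use B in \<open>simp_all add: lin_add [OF l] lin_smult [OF l] lin_closed [OF l] amult_add_right asmult_right\<close>)
    qed (use B r in \<open>simp_all add: lin_add [OF l] lin_smult [OF l] lin_closed [OF l] amult_add_left asmult_left\<close>)
  qed
qed

text \<open>Links substitution to \<open>eval\<close>, which sums over all degrees up to
  \<open>deg\<close> and through which \<open>poly_hopf\<close> defines its
  comultiplication.\<close>

lemma peval_eq_sum:
  assumes B: "module k B" and y: "\<And>i. y [^]\<^bsub>B\<^esub> (i::nat) \<in> carrier B" and q: "q \<in> carrier PA"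
  shows "(\<Oplus>\<^sub>B i \<in> {..deg k q}. q i \<odot>\<^sub>B y [^]\<^bsub>B\<^esub> i) = peval B y q"
  unfolding peval_def
proof (rule lin_ext_superset [symmetric, OF B, of _ UNIV])
  interpret U: UP_cring k "UP k" by (rule UP_cring_k) simp
  have "q n = coeff (UP k) q n" for n using q by (simp add: UP_def PA_fields)
  then show "{b. q b \<noteq> \<zero>} \<subseteq> {..deg k q}" 
    using U.deg_aboveD [of q] q by (auto simp: PA_fields not_le [symmetric])
qed (use q y in \<open>auto simp: PA_carrier\<close>)

lemma tensor_PA: "tensor k (UP k) (UP k) = tensor k PA PA" "pure k (UP k) (UP k) = pure k PA PA"
  by (simp_all add: poly_hopf_def Let_def)

abbreviation "YY \<equiv> pure k PA PA (single k 1) \<one>\<^sub>PA \<oplus>\<^bsub>tensor k PA PA\<^esub> pure k PA PA \<one>\<^sub>PA (single k 1)"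

lemma PA_comult:
  assumes q: "q \<in> carrier PA"
  shows "comult PA q = peval (tensor k PA PA) YY q"
proof -
  let ?T = "tensor k PA PA"
  have T: "k_algebra k ?T" by simp
  have y: "YY \<in> carrier ?T" by (simp add: kalg_module)
  have "comult PA q = eval k ?T (\<lambda>c. c \<odot>\<^sub>?T \<one>\<^sub>?T) YY q"
    unfolding tensor_PA [symmetric] PA_fields(3)
    by (simp add: poly_hopf_def Let_def UP_monom_single)
  also have "\<dots> = (\<Oplus>\<^sub>?T i \<in> {..deg k q}. (q i \<odot>\<^sub>?T \<one>\<^sub>?T) \<otimes>\<^sub>?T YY [^]\<^bsub>?T\<^esub> i)"
    using q by (simp add: eval_def PA_fields) (simp add: UP_def)
  also have "\<dots> = (\<Oplus>\<^sub>?T i \<in> {..deg k q}. q i \<odot>\<^sub>?T YY [^]\<^bsub>?T\<^esub> i)"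
    by (rule vfinsum_cong) (use T y q in \<open>auto simp: asmult_left\<close>)
  also have "\<dots> = peval ?T YY q"
    by (rule peval_eq_sum) (use T y q in auto)
  finally show ?thesis .
qed

lemma PA_counit:
  assumes q: "q \<in> carrier PA"
  shows "counit PA q = q 0"
proof -
  have "counit PA q = eval k k (\<lambda>c. c) \<zero> q"
    by (simp add: poly_hopf_def Let_def)
  also have "\<dots> = (\<Oplus>i \<in> {..deg k q}. q i \<otimes> \<zero> [^] i)"
    using q by (simp add: eval_def PA_fields) (simp add: UP_def)
  \<comment> \<open>Since 0^0 = 1, exactly the constant coefficient survives.\<close>
  also have "\<dots> = (\<Oplus>i \<in> {..deg k q}. if 0 = i then q i else \<zero>)"
    by (rule finsum_cong') (use q in \<open>auto simp: nat_pow_zero\<close>)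
  also have "\<dots> = q 0" by (rule add.finprod_singleton) (use q in auto)
  finally show ?thesis .
qed

lemma PA_comult_hom: "comult PA \<in> alg_hom PA (tensor k PA PA)"
  by (rule alg_hom_cong [OF peval_hom(1) _ PA_comult]) auto

lemma PA_comult_Y: "comult PA (single k 1) = YY"
  by (simp add: PA_comult peval_hom(2))

lemma PA_counit_hom: "counit PA \<in> alg_hom PA (self_module k)"
proof -
  have "(\<lambda>q. q 0) \<in> alg_hom PA (self_module k)"
    by (rule alg_homI, rule lin_mapsI) (auto simp: PA_ops(3-5) PA_ops(2) single_def)
  then show ?thesis by (rule alg_hom_cong [OF _ PA_kalg PA_counit])
qed

lemma PA_one_group_like: "group_like k PA \<one>\<^sub>PA"
  by (simp add: group_like_def alg_hom_one [OF PA_comult_hom] tensor_simps(5))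

lemma PA_Y_primitive: "skew_primitive k PA \<one>\<^sub>PA (single k 1)"
  by (simp add: skew_primitive_def PA_comult_Y)

lemma PA_counit_vals: "counit PA \<one>\<^sub>PA = \<one>" "counit PA (single k 1) = \<zero>"
  by (simp_all add: PA_counit PA_ops(2)) (auto simp: single_def)

lemma PA_bialgebra: "bialgebra k PA"
proof (rule bialgebra_from_generators [OF PA_kalg PA_comult_hom PA_counit_hom PA_generates])
qed (use coassoc_skew_primitive [OF PA_kalg PA_comult_hom PA_counit_hom PA_one_group_like PA_Y_primitive PA_counit_vals]
    counit_skew_primitive [OF PA_kalg PA_comult_hom PA_counit_hom PA_one_group_like PA_Y_primitive PA_counit_vals] in auto)

text \<open>The antipode substitutes -Y for Y; by commutativity this algebra map is also
  anti-multiplicative.\<close>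

lemma PA_hopf: "hopf_algebra k PA"
proof -
  let ?S = "peval PA (\<ominus>\<^sub>PA single k 1)"
  have S: "?S \<in> alg_hom PA PA" by (rule peval_hom) auto
  have S1: "?S \<one>\<^sub>PA = \<one>\<^sub>PA" by (rule alg_hom_one [OF S])
  have SY: "?S (single k 1) = \<ominus>\<^sub>PA (?S \<one>\<^sub>PA \<otimes>\<^sub>PA single k 1)"
    by (simp add: peval_hom(2) S1)
  note a = antipode_skew_primitive [OF PA_kalg PA_comult_hom PA_counit_hom PA_one_group_like PA_Y_primitive PA_counit_vals
     alg_hom_lin [OF S] S1 _ _ SY]
  show ?thesis
    by (rule hopf_from_generators [OF PA_bialgebra PA_generates alg_hom_lin [OF S] S1])
      (use a S1 in \<open>auto simp: alg_hom_mult [OF S] alg_hom_closed [OF S] PA_comm\<close>)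
qed

section \<open>Coordinates on the tensor square of the polynomial algebra\<close>

definition nk where "nk (n::nat) = [n] \<cdot> \<one>"

lemma nk_simps [simp]: "nk 0 = \<zero>" "nk (Suc n) = nk n \<oplus> \<one>" "nk n \<in> carrier k" "nk 1 = \<one>"
  unfolding nk_def by (auto simp: add.nat_pow_0 add.nat_pow_Suc add.nat_pow_eone)

lemma nk_add: "nk (m + n) = nk m \<oplus> nk n"
  by (induction n) (auto simp: a_ac)

lemma nk_mult: "nk (m * n) = nk m \<otimes> nk n"
  by (induction m) (auto simp: nk_add l_distr a_comm)

lemma PA_coeff:
  "q \<in> carrier PA ==> r \<in> carrier PA ==> (q \<oplus>\<^sub>PA r) n = q n \<oplus> r n"
  "c \<in> carrier k ==> q \<in> carrier PA ==> (c \<odot>\<^sub>PA q) n = c \<otimes> q n"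
  by (simp_all add: PA_ops(3,4))

lemma PA_Y_mult: "q \<in> carrier PA ==> (single k 1 \<otimes>\<^sub>PA q) n = (if n = 0 then \<zero> else q (n - 1))"
proof (induction q rule: PA_induct)
  case (single m)
  show ?case unfolding PA_single_mult by (auto simp: single_def)
qed (auto simp: amult_add_right asmult_right PA_coeff [of _ _ n] PA_coeff [of _ _ "n - 1"])

text \<open>Coordinates with respect to the tensors Y^i \<otimes> Y^j.\<close>

definition cc where
  "cc = tlift (free_space k (UNIV :: (nat \<times> nat) set)) (\<lambda>a b ij. a (fst ij) \<otimes> b (snd ij))"

lemma cc_bilin: "bilin PA PA (free_space k UNIV) (\<lambda>a b ij. a (fst ij) \<otimes> b (snd ij))"
proof -
  have c: "(\<lambda>ij. a (fst ij) \<otimes> b (snd ij)) \<in> carrier (free_space k UNIV)"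
    if a: "a \<in> carrier PA" and b: "b \<in> carrier PA" for a b
  proof -
    have "{ij. a (fst ij) \<otimes> b (snd ij) \<noteq> \<zero>} \<subseteq> {i. a i \<noteq> \<zero>} \<times> {j. b j \<noteq> \<zero>}"
      using a b by (auto simp: PA_coeff_closed)
    moreover have "finite ({i. a i \<noteq> \<zero>} \<times> {j. b j \<noteq> \<zero>})"
      using a b by (simp add: PA_carrier free_space_simps)
    ultimately show ?thesis
      using a b unfolding free_space_simps by (auto intro: finite_subset)
  qed
  show ?thesis
    by (intro bilinI lin_mapsI c) (auto simp: PA_coeff free_space_simps l_distr r_distr m_ac)
qed

lemma cc_linear: "cc \<in> lin (tensor k PA PA) (free_space k UNIV)"
  unfolding cc_def by (rule tensor_lift_linear [OF _ _ _ cc_bilin]) auto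

lemma cc_pure: "a \<in> carrier PA ==> b \<in> carrier PA ==> cc (pure k PA PA a b) (i, j) = a i \<otimes> b j"
  by (simp add: cc_def tensor_lift_pure cc_bilin)

lemma cc_closed: "t \<in> carrier (tensor k PA PA) ==> cc t ij \<in> carrier k"
  using lin_closed [OF cc_linear, of t] unfolding free_space_simps by blast

lemma cc_add: "s \<in> carrier (tensor k PA PA) ==> t \<in> carrier (tensor k PA PA) ==>
    cc (s \<oplus>\<^bsub>tensor k PA PA\<^esub> t) ij = cc s ij \<oplus> cc t ij"
  by (simp add: lin_add [OF cc_linear] free_space_simps)

lemma cc_YY:
  assumes t: "t \<in> carrier (tensor k PA PA)"
  shows "cc (YY \<otimes>\<^bsub>tensor k PA PA\<^esub> t) (i, j) =
     (if i = 0 then \<zero> else cc t (i - 1, j)) \<oplus> (if j = 0 then \<zero> else cc t (i, j - 1))"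
proof -
  have M: "module k PA" "module k (tensor k PA PA)" "k_algebra k (tensor k PA PA)" by auto
  show ?thesis
    using M(1,1) t
  proof (induction t rule: tensor_induct)
    case (pure a b)
    then show ?case
      using PA_Y_mult [of a i] PA_Y_mult [of b j] M
      by (simp add: amult_add_left tensor_mult_pure cc_add cc_pure)
  next
    case (add s t)
    then show ?case
      using M by (auto simp: amult_add_right cc_add cc_closed a_ac)
  qed
qed

text \<open>Multiplication by Y \<otimes> 1 + 1 \<otimes> Y adds two shifted arrays of coordinates
  (\<open>cc_YY\<close>), and that recursion is Pascal's rule.\<close>

lemma cc_pow:
  "cc (YY [^]\<^bsub>tensor k PA PA\<^esub> n) (i, j) = (if i + j = n then nk ((i + j) choose i) else \<zero>)"
proof (induction n arbitrary: i j)
  case 0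
  have "cc \<one>\<^bsub>tensor k PA PA\<^esub> (i, j) = single k 0 i \<otimes> single k 0 j"
    by (simp add: tensor_simps(5) cc_pure PA_ops(2))
  then show ?case by (auto simp: single_def)
next
  case (Suc n)
  let ?T = "tensor k PA PA"
  have T: "k_algebra k ?T" "module k PA" by auto
  have y: "YY \<in> carrier ?T" by simp
  have "YY [^]\<^bsub>?T\<^esub> Suc n = YY \<otimes>\<^sub>?T YY [^]\<^bsub>?T\<^esub> n"
    by (rule monoid.nat_pow_Suc2 [OF kalg_monoid [OF T(1)] y])
  then have "cc (YY [^]\<^bsub>?T\<^esub> Suc n) (i, j) =
     (if i = 0 then \<zero> else cc (YY [^]\<^bsub>?T\<^esub> n) (i - 1, j)) \<oplus> (if j = 0 then \<zero> else cc (YY [^]\<^bsub>?T\<^esub> n) (i, j - 1))"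
    using cc_YY [OF apow_closed [OF T(1) y]] by simp
  also have "\<dots> = (if i + j = Suc n then nk ((i + j) choose i) else \<zero>)"
  proof (cases i)
    case 0
    then show ?thesis by (cases j) (auto simp: Suc)
  next
    case (Suc i')
    show ?thesis
    proof (cases j)
      case 0
      then show ?thesis using \<open>i = Suc i'\<close> by (auto simp: Suc.IH)
    next
      case (Suc j')
      have "Suc (i' + Suc j') choose Suc i' = (i' + Suc j' choose i') + (Suc i' + j' choose Suc i')"
        by simp
      then show ?thesis
        using \<open>i = Suc i'\<close> \<open>j = Suc j'\<close> by (auto simp: Suc.IH nk_add)
    qed
  qed
  finally show ?case .
qed

lemma cc_comult:
  assumes q: "q \<in> carrier PA"
  shows "cc (comult PA q) (i, j) = nk ((i + j) choose i) \<otimes> q (i + j)"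
  using q
proof (induction q rule: PA_induct)
  case (single n)
  have *: "comult PA (single k n) = YY [^]\<^bsub>tensor k PA PA\<^esub> n"
    by (simp add: PA_comult peval_hom(2))
  show ?case unfolding * cc_pow by (auto simp: single_def)
next
  case (add q r)
  then show ?case
    by (simp add: lin_add [OF alg_hom_lin [OF PA_comult_hom]] lin_closed [OF alg_hom_lin [OF PA_comult_hom]]
      cc_add PA_coeff [of _ _ "i + j"] r_distr)
next
  case (smult c q)
  then show ?case
    by (simp add: lin_smult [OF alg_hom_lin [OF PA_comult_hom]] lin_closed [OF alg_hom_lin [OF PA_comult_hom]]
      lin_smult [OF cc_linear] free_space_simps(4) PA_coeff [of _ _ "i + j"] m_lcomm)
qed

text \<open>A tensor can be reassembled from its coordinates. It follows that \<open>cc\<close> is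
  injective, so tensors may be compared coefficient by coefficient.\<close>

lemma cc_inverse:
  assumes t: "t \<in> carrier (tensor k PA PA)"
  shows "lin_ext (tensor k PA PA) (\<lambda>ij. pure k PA PA (single k (fst ij)) (single k (snd ij))) (cc t) = t"
proof -
  let ?T = "tensor k PA PA"
  let ?L = "lin_ext ?T (\<lambda>ij. pure k PA PA (single k (fst ij)) (single k (snd ij)))"
  have M: "module k PA" "module k ?T" by auto
  have L: "?L \<in> lin (free_space k UNIV) ?T"
    by (rule lin_ext_linear) auto
  have LC: "(\<lambda>t. ?L (cc t)) \<in> lin ?T ?T" by (rule lin_comp [OF L cc_linear])
  have "?L (cc (pure k PA PA a b)) = pure k PA PA a b" if a: "a \<in> carrier PA" and b: "b \<in> carrier PA" for a b
    using a
  proof (induction a rule: PA_induct)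
    case (single m)
    show ?case using b
    proof (induction b rule: PA_induct)
      case (single n)
      have "cc (pure k PA PA (single k m) (single k n)) = single k (m, n)"
      proof
        fix ij :: "nat \<times> nat"
        have "cc (pure k PA PA (single k m) (single k n)) (fst ij, snd ij) =
          single k m (fst ij) \<otimes> single k n (snd ij)"
          by (rule cc_pure) auto
        also have "\<dots> = single k (m, n) ij" by (cases ij) (auto simp: single_def)
        finally show "cc (pure k PA PA (single k m) (single k n)) ij = single k (m, n) ij" by simp
      qed
      then show ?case by (simp add: lin_ext_single)
    qed (use lin_add [OF LC] lin_smult [OF LC] in \<open>simp_all add: pure_add_right pure_smult_right\<close>)
  qed (use b lin_add [OF LC] lin_smult [OF LC] in \<open>simp_all add: pure_add_left pure_smult_left\<close>)
  then show ?thesis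
    by (intro tensor_lin_eqI [OF M(1,1) LC lin_id _ t]) auto
qed

lemma cc_inject:
  assumes "s \<in> carrier (tensor k PA PA)" "t \<in> carrier (tensor k PA PA)" "\<And>i j. cc s (i, j) = cc t (i, j)"
  shows "s = t"
proof -
  have "cc s = cc t" using assms(3) by (auto simp: fun_eq_iff)
  then show ?thesis using cc_inverse [OF assms(1)] cc_inverse [OF assms(2)] by argo
qed

text \<open>Compare coordinates of \<Delta>(q) and q \<otimes> 1 + 1 \<otimes> q: at (0, 0) this
  reads q 0 = q 0 + q 0, and at positive (i, j) the right-hand side vanishes.\<close>

lemma PA_primitive_coeff:
  assumes q: "primitive k PA q"
  shows "q 0 = \<zero>" and "i > 0 ==> j > 0 ==> nk ((i + j) choose i) \<otimes> q (i + j) = \<zero>"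
proof -
  have qP: "q \<in> carrier PA" using q by (simp add: primitive_def)
  have *: "nk ((i + j) choose i) \<otimes> q (i + j) = q i \<otimes> single k 0 j \<oplus> single k 0 i \<otimes> q j" for i j
    using q cc_comult [OF qP, of i j] by (simp add: primitive_def cc_add cc_pure PA_ops(2))
  show "q 0 = \<zero>"
    using *[of 0 0] qP add.l_cancel_one' [of "q 0" "q 0"] by (simp add: single_def)
  show "i > 0 ==> j > 0 ==> nk ((i + j) choose i) \<otimes> q (i + j) = \<zero>"
    using *[of i j] qP by (simp add: single_def)
qed

subsection \<open>Degrees\<close>

lemma PA_shift:
  assumes q: "q \<in> carrier PA" and q0: "q 0 = \<zero>"
  shows "\<exists>r \<in> carrier PA. q = single k 1 \<otimes>\<^sub>PA r"
proof
  have "Suc ` {n. q (Suc n) \<noteq> \<zero>} \<subseteq> {n. q n \<noteq> \<zero>}" by auto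
  then have "finite (Suc ` {n. q (Suc n) \<noteq> \<zero>})"
    using q finite_subset by (auto simp: PA_carrier free_space_simps)
  then have "finite {n. q (Suc n) \<noteq> \<zero>}" by (simp add: finite_image_iff)
  then show r: "(\<lambda>n. q (Suc n)) \<in> carrier PA"
    using q by (simp add: PA_carrier free_space_simps)
  show "q = single k 1 \<otimes>\<^sub>PA (\<lambda>n. q (Suc n))"
    by (rule ext) (simp add: PA_Y_mult [OF r] q0)
qed

text \<open>Write q = Y s. Cancelling Y gives s r = 1, and degrees add over a field, so s is a
  nonzero constant. In \<open>AH_iso_form\<close> the factor q arises from an inverse under
  composition.\<close>

lemma PA_factor_Y:
  assumes q: "q \<in> carrier PA" and r: "r \<in> carrier PA" and qr: "q \<otimes>\<^sub>PA r = single k 1" and q0: "q 0 = \<zero>"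
  shows "\<exists>a \<in> Units k. q = a \<odot>\<^sub>PA single k 1"
proof -
  obtain s where s: "s \<in> carrier PA" "q = single k 1 \<otimes>\<^sub>PA s" using PA_shift [OF q q0] by blast
  have Y: "single k 1 \<in> carrier PA" by simp
  have one: "s \<otimes>\<^sub>PA r = \<one>\<^sub>PA"
  proof (rule ext)
    fix n
    have "(single k 1 \<otimes>\<^sub>PA (s \<otimes>\<^sub>PA r)) (Suc n) = single k 1 (Suc n)"
      using qr s r by (simp add: amult_assoc)
    then show "(s \<otimes>\<^sub>PA r) n = \<one>\<^sub>PA n"
      using PA_Y_mult [of "s \<otimes>\<^sub>PA r" "Suc n"] s r by (simp add: PA_ops(2) single_def One_nat_def)
  qed
  interpret U: UP_domain k "UP k" by (simp add: UP_domain_def domain_axioms)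
  have P: "s \<in> carrier (UP k)" "r \<in> carrier (UP k)" using s r by (simp_all add: PA_fields)
  have ne: "s \<noteq> \<zero>\<^bsub>UP k\<^esub>" "r \<noteq> \<zero>\<^bsub>UP k\<^esub>"
    using one P U.UP_one_not_zero by (auto simp: PA_fields)
  have "deg k (s \<otimes>\<^bsub>UP k\<^esub> r) = 0" using one by (simp add: PA_fields)
  then have d: "deg k s = 0" using U.deg_mult [OF ne P] by simp
  have sn: "s n = coeff (UP k) s n" for n using P by (simp add: UP_def)
  have z: "s n = \<zero>" if "n > 0" for n
    using U.deg_aboveD [of s n] P(1) d that sn by simp
  have s0: "s 0 \<in> carrier k" using s by simp
  have "s 0 \<noteq> \<zero>"
  proof
    assume "s 0 = \<zero>"
    then have "s n = \<zero>" for n using z [of n] by (cases n) auto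
    then have "s = \<zero>\<^bsub>UP k\<^esub>" by (auto simp: UP_def)
    with ne show False by simp
  qed
  then have "s 0 \<in> Units k" using s0 field_Units by auto
  moreover have "q = s 0 \<odot>\<^sub>PA single k 1"
  proof
    fix n
    have "q n = s 0 \<otimes> single k 1 n"
      unfolding s(2) PA_Y_mult [OF s(1)] using z [of "n - 1"] s0
      by (cases "n = 1") (auto simp: single_def)
    then show "q n = (s 0 \<odot>\<^sub>PA single k 1) n"
      using s0 by (simp add: PA_coeff(2) [of _ _ n])
  qed
  ultimately show ?thesis by blast
qed

lemma fin_seqs_carrier: "fin_seqs k = carrier (free_space k UNIV)"
  by (auto simp: fin_seqs_def free_space_simps)

end

section \<open>Primitive polynomials in positive characteristic\<close>

locale char_field = base_field k for k :: "('k, 'm) ring_scheme" (structure) +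
  fixes p :: nat
  assumes char_eq: "ring_char k = p" and p_ge: "p \<ge> 3"
begin

lemma nk_char: "nk p = \<zero>" "0 < m ==> m < p ==> nk m \<noteq> \<zero>"
proof -
  \<comment> \<open>The bound \<open>p_ge\<close> excludes the value 0 that \<open>ring_char\<close>
    takes in characteristic zero, so the minimum exists.\<close>
  have ex: "\<exists>n::nat. 0 < n \<and> nk n = \<zero>" and p: "p = (LEAST n::nat. 0 < n \<and> nk n = \<zero>)"
    using char_eq p_ge unfolding ring_char_def nk_def by (auto split: if_splits)
  show "nk p = \<zero>" using LeastI_ex [OF ex] p by simp
  show "0 < m ==> m < p ==> nk m \<noteq> \<zero>" using not_less_Least [of m "\<lambda>n. 0 < n \<and> nk n = \<zero>"] p by auto
qed

lemma nk_zero_iff: "nk n = \<zero> \<longleftrightarrow> p dvd n"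
proof -
  have "nk n = nk (p * (n div p) + n mod p)" by simp
  also have "\<dots> = nk (n mod p)" unfolding nk_add nk_mult by (simp add: nk_char(1))
  finally have "nk n = nk (n mod p)" .
  moreover have "n mod p < p" using p_ge by simp
  ultimately show ?thesis
    using nk_char(2) [of "n mod p"] by (cases "n mod p = 0") (auto simp: dvd_eq_mod_eq_0)
qed

text \<open>A factorisation p = m q becomes a vanishing product in the field, so p divides one of
  the factors.\<close>

lemma prime_p: "prime p"
  unfolding prime_nat_iff
proof (intro conjI allI impI)
  show "1 < p" using p_ge by simp
  fix m assume "m dvd p"
  then obtain q where q: "p = m * q" by (auto simp: dvd_def)
  then have "nk m \<otimes> nk q = \<zero>" using nk_char(1) by (simp flip: nk_mult)
  then have "nk m = \<zero> \<or> nk q = \<zero>" using integral by simp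
  then have "p dvd m \<or> p dvd q" by (simp add: nk_zero_iff)
  then show "m = 1 \<or> m = p"
  proof
    assume "p dvd m" then show ?thesis using \<open>m dvd p\<close> dvd_antisym by blast
  next
    assume "p dvd q"
    then have "q = p" using q dvd_antisym by (metis dvd_triv_right)
    then show ?thesis using q p_ge by (auto simp: One_nat_def)
  qed
qed

text \<open>The image of 2 in k is nonzero because 2 < p. This removes the (1 - g)-component of the
  image of x under an isomorphism.\<close>

lemma double_zero: "a \<in> carrier k ==> a \<oplus> a = \<zero> ==> a = \<zero>"
proof -
  assume a: "a \<in> carrier k" and z: "a \<oplus> a = \<zero>"
  have "nk 2 \<otimes> a = a \<oplus> a" using a by (simp add: numeral_2_eq_2 l_distr)
  moreover have "nk 2 \<noteq> \<zero>" by (rule nk_char(2)) (use p_ge in auto)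
  ultimately show "a = \<zero>" using integral [of "nk 2" a] a z by auto
qed

lemma p_pow_inj: "p ^ i = p ^ j \<longleftrightarrow> i = j"
  using p_ge by (simp add: power_inject_exp)

text \<open>Write n = p^a m with m prime to p and m > 1. Then n choose p^a has the same p-adic
  valuation as m, namely zero.\<close>

lemma nonpower_binomial:
  assumes n: "n > 0" and np: "\<And>i. n \<noteq> p ^ i"
  shows "\<exists>j. 0 < j \<and> j < n \<and> \<not> p dvd (n choose j)"
proof -
  have "\<not> is_unit p" using prime_p by (simp add: not_prime_unit)
  obtain m where m: "n = p ^ multiplicity p n * m" "\<not> p dvd m"
    using multiplicity_decompose' [of n p] n \<open>\<not> is_unit p\<close> by auto
  let ?a = "multiplicity p n"
  have "m \<noteq> 0" using m(2) by (metis dvd_0_right)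
  moreover have "m \<noteq> 1"
  proof
    assume "m = 1"
    then have "n = p ^ ?a" using m(1) by simp
    then show False using np [of ?a] by contradiction
  qed
  ultimately have "m > 1" by simp
  have "multiplicity p (p ^ ?a * m choose p ^ ?a) = multiplicity p m"
    by (rule const_p_fac) (use \<open>m > 1\<close> prime_p in auto)
  then have "multiplicity p (n choose p ^ ?a) = 0"
    using m by (simp add: not_dvd_imp_multiplicity_0)
  moreover have "p ^ ?a \<le> n" using n by (intro dvd_imp_le multiplicity_dvd) auto
  then have "n choose p ^ ?a \<noteq> 0" by (simp add: binomial_eq_0_iff not_less)
  ultimately have "\<not> p dvd (n choose p ^ ?a)"
    using \<open>\<not> is_unit p\<close> by (simp add: multiplicity_eq_zero_iff)
  moreover have "p ^ ?a * 1 < p ^ ?a * m" using \<open>m > 1\<close> p_ge by (intro mult_strict_left_mono) auto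
  then have "p ^ ?a < n" by (simp only: m(1) [symmetric] mult_1_right)
  ultimately show ?thesis using p_ge by (intro exI [of _ "p ^ ?a"]) auto
qed

text \<open>From j (p^n choose j) = p^n (p^n - 1 choose j - 1): a binomial coefficient prime to p
  would force p^n to divide j.\<close>

lemma p_dvd_binomial:
  assumes "0 < j" "j < p ^ n"
  shows "p dvd (p ^ n choose j)"
proof (rule ccontr)
  assume "\<not> p dvd (p ^ n choose j)"
  then have cop: "coprime (p ^ n) (p ^ n choose j)"
    using prime_p by (simp add: prime_imp_coprime)
  have "j * (p ^ n choose j) = p ^ n * ((p ^ n - 1) choose (j - 1))"
    by (rule times_binomial_minus1_eq) (use assms in simp)
  then have "p ^ n dvd j * (p ^ n choose j)" by simp
  then have "p ^ n dvd j" using cop by (simp add: coprime_dvd_mult_left_iff)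
  then show False using assms by (auto dest: dvd_imp_le)
qed

text \<open>If n is not a power of p, some n choose j with 0 < j < n is nonzero in k, and the
  coordinate (j, n - j) forces \<open>q n\<close> to vanish.\<close>

lemma PA_primitive_support:
  assumes q: "primitive k PA q" and n: "q n \<noteq> \<zero>"
  shows "\<exists>i. n = p ^ i"
proof (rule ccontr)
  assume np: "\<nexists>i. n = p ^ i"
  have qP: "q \<in> carrier PA" using q by (simp add: primitive_def)
  have n0: "n > 0" using n PA_primitive_coeff(1) [OF q] by (cases n) auto
  obtain j where j: "0 < j" "j < n" "\<not> p dvd (n choose j)" using nonpower_binomial [OF n0] np by blast
  have "nk (n choose j) \<otimes> q n = \<zero>" using PA_primitive_coeff(2) [OF q, of j "n - j"] j by simp
  then have "nk (n choose j) = \<zero>" using integral [of "nk (n choose j)" "q n"] n qP by simp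
  then show False using j nk_zero_iff by simp
qed

lemma PA_power_primitive: "primitive k PA (single k (p ^ n))"
  unfolding primitive_def
proof (intro conjI cc_inject)
  fix i j
  have "p ^ n \<noteq> 0" using p_ge by simp
  have "nk ((i + j) choose i) = \<zero>" if "i + j = p ^ n" "i > 0" "j > 0"
    using p_dvd_binomial [of i n] that nk_zero_iff by auto
  then have *: "nk ((i + j) choose i) \<otimes> single k (p ^ n) (i + j) =
     single k (p ^ n) i \<otimes> single k 0 j \<oplus> single k 0 i \<otimes> single k (p ^ n) j"
    using \<open>p ^ n \<noteq> 0\<close> by (cases "i = 0"; cases "j = 0") (auto simp: single_def)
  show "cc (comult PA (single k (p ^ n))) (i, j) = cc (pure k PA PA (single k (p ^ n)) \<one>\<^sub>PA
     \<oplus>\<^bsub>tensor k PA PA\<^esub> pure k PA PA \<one>\<^sub>PA (single k (p ^ n))) (i, j)"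
    by (simp add: cc_comult cc_add cc_pure PA_ops(2) *)
qed (auto simp: lin_closed [OF alg_hom_lin [OF PA_comult_hom]])

text \<open>The polynomial P_\<alpha>, the sum of the \<alpha>_i Y^(p^i), evaluated at y. The
  algebra is arbitrary because the expression is needed in the free algebra, its quotient, tensor
  squares, opposite algebras and endomorphism algebras.\<close>

definition pp where
  "pp B \<alpha> y = lin_ext B (\<lambda>i. y [^]\<^bsub>B\<^esub> (p ^ i)) \<alpha>"

lemma pp_linear:
  assumes "k_algebra k B" "y \<in> carrier B"
  shows "(\<lambda>\<alpha>. pp B \<alpha> y) \<in> lin (free_space k UNIV) B"
  unfolding pp_def by (rule lin_ext_linear) (use assms in auto)

lemma pp_closed [simp]:
  "k_algebra k B ==> y \<in> carrier B ==> \<alpha> \<in> fin_seqs k ==> pp B \<alpha> y \<in> carrier B"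
  using lin_closed [OF pp_linear] by (auto simp: fin_seqs_carrier)

lemma pp_single: "k_algebra k B ==> y \<in> carrier B ==> pp B (single k i) y = y [^]\<^bsub>B\<^esub> (p ^ i)"
  unfolding pp_def by (rule lin_ext_single) auto

lemma pp_alg_hom:
  assumes B: "k_algebra k B" and C: "k_algebra k C" and \<phi>: "\<phi> \<in> alg_hom B C" and y: "y \<in> carrier B"
    and \<alpha>: "\<alpha> \<in> fin_seqs k"
  shows "\<phi> (pp B \<alpha> y) = pp C \<alpha> (\<phi> y)"
proof -
  note l = pp_linear [OF B y] pp_linear [OF C alg_hom_closed [OF \<phi> y]]
  have "(\<lambda>\<alpha>. \<phi> (pp B \<alpha> y)) \<in> lin (free_space k UNIV) C"
    by (rule lin_comp [OF alg_hom_lin [OF \<phi>] l(1)])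
  note l' = lin_add [OF this] lin_smult [OF this] lin_zero [OF _ _ this]
  show ?thesis
    using \<alpha> unfolding fin_seqs_carrier
  proof (induction \<alpha> rule: free_space_induct)
    case zero
    then show ?case using l' C lin_zero [OF _ _ l(2)] by simp
  next
    case (single b)
    then show ?case using B C y by (simp add: pp_single alg_hom_closed [OF \<phi>] alg_hom_pow [OF B C \<phi>])
  qed (simp_all add: l' lin_add [OF l(2)] lin_smult [OF l(2)])
qed

lemma pp_coeff:
  assumes \<alpha>: "\<alpha> \<in> fin_seqs k"
  shows "pp PA \<alpha> (single k 1) (p ^ i) = \<alpha> i" "(\<And>i. n \<noteq> p ^ i) ==> pp PA \<alpha> (single k 1) n = \<zero>"
proof -
  note l = pp_linear [OF PA_kalg PA_single_closed, of 1]
  note c = lin_closed [OF l]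
  have "pp PA \<alpha> (single k 1) (p ^ i) = \<alpha> i \<and> ((\<forall>i. n \<noteq> p ^ i) \<longrightarrow> pp PA \<alpha> (single k 1) n = \<zero>)"
    using \<alpha> unfolding fin_seqs_carrier
  proof (induction \<alpha> rule: free_space_induct)
    case zero
    have "pp PA \<zero>\<^bsub>free_space k UNIV\<^esub> (single k 1) = \<zero>\<^sub>PA" using lin_zero [OF _ _ l] by simp
    then show ?case by (simp add: PA_ops(1) free_space_simps)
  next
    case (single j)
    have "pp PA (single k j) (single k 1) = single k (p ^ j)"
      by (simp add: pp_single PA_single_pow)
    then show ?case by (simp add: single_def p_pow_inj)
  next
    case (add f h)
    then show ?case
      unfolding lin_add [OF l add(1,2)] using c
      by (simp add: PA_coeff [of _ _ n] PA_coeff [of _ _ "p ^ i"] free_space_simps(3))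
  next
    case (smult d f)
    then show ?case
      unfolding lin_smult [OF l smult(1,2)] using c
      by (simp add: PA_coeff [of _ _ n] PA_coeff [of _ _ "p ^ i"] free_space_simps(4))
  qed
  then show "pp PA \<alpha> (single k 1) (p ^ i) = \<alpha> i" "(\<And>i. n \<noteq> p ^ i) ==> pp PA \<alpha> (single k 1) n = \<zero>"
    by auto
qed

lemma PA_primitive_pp:
  assumes q: "primitive k PA q"
  shows "\<exists>\<alpha> \<in> fin_seqs k. q = pp PA \<alpha> (single k 1)"
proof
  have qP: "q \<in> carrier PA" using q by (simp add: primitive_def)
  have "(\<lambda>i. p ^ i) ` {i. q (p ^ i) \<noteq> \<zero>} \<subseteq> {n. q n \<noteq> \<zero>}" by auto
  then have "finite ((\<lambda>i. p ^ i) ` {i. q (p ^ i) \<noteq> \<zero>})"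
    using qP finite_subset by (auto simp: PA_carrier free_space_simps)
  then have "finite {i. q (p ^ i) \<noteq> \<zero>}"
    by (rule finite_imageD) (auto simp: inj_on_def p_pow_inj)
  then show \<alpha>: "(\<lambda>i. q (p ^ i)) \<in> fin_seqs k" using qP by (simp add: fin_seqs_def)
  show "q = pp PA (\<lambda>i. q (p ^ i)) (single k 1)"
  proof
    fix n
    show "q n = pp PA (\<lambda>i. q (p ^ i)) (single k 1) n"
    proof (cases "\<exists>i. n = p ^ i")
      case True
      then show ?thesis using pp_coeff(1) [OF \<alpha>] by auto
    next
      case False
      then show ?thesis using pp_coeff(2) [OF \<alpha>, of n] PA_primitive_support [OF q, of n] by auto
    qed
  qed
qed

end

context base_field
begin

section \<open>The Hopf algebras given by generators and relations\<close>

lemma pure_neg_left: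
  "module k V ==> module k W ==> v \<in> carrier V ==> w \<in> carrier W ==>
     pure k V W (\<ominus>\<^sub>V v) w = \<ominus>\<^bsub>tensor k V W\<^esub> pure k V W v w"
  by (rule lin_neg [OF _ _ bilin_lin(2) [OF bilin_pure]]) auto

lemma pure_neg_right:
  "module k V ==> module k W ==> v \<in> carrier V ==> w \<in> carrier W ==>
     pure k V W v (\<ominus>\<^sub>W w) = \<ominus>\<^bsub>tensor k V W\<^esub> pure k V W v w"
  by (rule lin_neg [OF _ _ bilin_lin(1) [OF bilin_pure]]) auto

lemma pure_zero:
  "module k V ==> module k W ==> w \<in> carrier W ==> pure k V W \<zero>\<^sub>V w = \<zero>\<^bsub>tensor k V W\<^esub>"
  "module k V ==> module k W ==> v \<in> carrier V ==> pure k V W v \<zero>\<^sub>W = \<zero>\<^bsub>tensor k V W\<^esub>"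
  by (rule lin_zero [OF _ _ bilin_lin(2) [OF bilin_pure]]; simp)
    (rule lin_zero [OF _ _ bilin_lin(1) [OF bilin_pure]]; simp)

lemma submodule_same_module:
  assumes V: "module k V" and same: "same_module V W" and N: "submodule N k V"
  shows "submodule N k W"
proof -
  have eqs: "carrier W = carrier V" "add W = add V" "zero W = zero V" "smult W = smult V"
    using same by (simp_all add: same_module_def)
  show ?thesis
    by (rule submoduleI' [OF module_cong [OF V same]])
      (use submodule_subset [OF N] submodule_zero [OF N] submodule_add [OF N] submodule_smult [OF N] in
        \<open>auto simp: eqs\<close>)
qed

text \<open>Meant for \<Delta>(x)^2: the summands x \<otimes> 1 and g \<otimes> x anticommute, so
  the mixed terms cancel.\<close>

lemma square_add:
  assumes T: "k_algebra k T" and a: "a \<in> carrier T" and b: "b \<in> carrier T" and c: "c \<in> carrier T"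
    and ba: "b \<otimes>\<^sub>T a = c" and ab: "a \<otimes>\<^sub>T b = \<ominus>\<^sub>T c"
  shows "(a \<oplus>\<^sub>T b) \<otimes>\<^sub>T (a \<oplus>\<^sub>T b) = a \<otimes>\<^sub>T a \<oplus>\<^sub>T b \<otimes>\<^sub>T b"
proof -
  have "(a \<oplus>\<^sub>T b) \<otimes>\<^sub>T (a \<oplus>\<^sub>T b) = (a \<otimes>\<^sub>T a \<oplus>\<^sub>T c) \<oplus>\<^sub>T (\<ominus>\<^sub>T c \<oplus>\<^sub>T b \<otimes>\<^sub>T b)"
    using T a b c by (simp add: amult_add_left amult_add_right ab ba vadd_assoc)
  then show ?thesis using T a b c by (simp add: vadd_assoc)
qed

text \<open>Target of the antipode: an anti-multiplicative map is an algebra map into the opposite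
  algebra, to which the universal property of a presentation applies.\<close>

definition opposite where
  "opposite A = A\<lparr>mult := (\<lambda>x y. y \<otimes>\<^sub>A x)\<rparr>"

lemma opposite_simps [simp]:
  "carrier (opposite A) = carrier A" "add (opposite A) = add A" "zero (opposite A) = zero A"
  "smult (opposite A) = smult A" "one (opposite A) = one A" "x \<otimes>\<^bsub>opposite A\<^esub> y = y \<otimes>\<^sub>A x"
  by (simp_all add: opposite_def)

lemma opposite_kalg:
  fixes A :: "('k, 'a, 'n) module_scheme"
  assumes A: "k_algebra k A"
  shows "k_algebra k (opposite A)"
proof (rule k_algebraI)
  have M: "module k (opposite A)" by (rule module_cong [of A]) (use A in \<open>auto simp: same_module_def\<close>)
  show "na_algebra (opposite A)"
    unfolding na_algebra_def using M A
    by (auto intro!: bilinI lin_mapsI simp: amult_add_left amult_add_right asmult_left asmult_right)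
qed (use A in \<open>auto simp: amult_assoc\<close>)

lemma opposite_pow:
  assumes A: "k_algebra k A" and x: "x \<in> carrier A"
  shows "x [^]\<^bsub>opposite A\<^esub> (n::nat) = x [^]\<^bsub>A\<^esub> n"
proof (induction n)
  case (Suc n)
  then show ?case
    using monoid.nat_pow_Suc2 [OF kalg_monoid [OF A] x, of n] by simp
qed simp

lemma opposite_neg: fixes A :: "('k, 'a, 'n) module_scheme" shows "\<ominus>\<^bsub>opposite A\<^esub> x = \<ominus>\<^sub>A x"
  by (simp add: a_inv_def m_inv_def)

lemma neg_pow_odd:
  assumes A: "k_algebra k A" and x: "x \<in> carrier A"
  shows "odd n ==> (\<ominus>\<^sub>A x) [^]\<^bsub>A\<^esub> (n::nat) = \<ominus>\<^sub>A (x [^]\<^bsub>A\<^esub> n)"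
proof -
  have "(even n \<longrightarrow> (\<ominus>\<^sub>A x) [^]\<^bsub>A\<^esub> n = x [^]\<^bsub>A\<^esub> n) \<and> (odd n \<longrightarrow> (\<ominus>\<^sub>A x) [^]\<^bsub>A\<^esub> n = \<ominus>\<^sub>A (x [^]\<^bsub>A\<^esub> n))"
    using A x by (induction n) (auto simp: amult_neg_left amult_neg_right)
  then show "odd n ==> ?thesis" by blast
qed

end

context char_field
begin

lemma pp_primitive:
  assumes \<alpha>: "\<alpha> \<in> fin_seqs k"
  shows "primitive k PA (pp PA \<alpha> (single k 1))"
proof -
  let ?T = "tensor k PA PA"
  note l = pp_linear [OF PA_kalg PA_single_closed, of 1]
  note \<Delta> = alg_hom_lin [OF PA_comult_hom]
  have 1: "(\<lambda>\<alpha>. comult PA (pp PA \<alpha> (single k 1))) \<in> lin (free_space k UNIV) ?T"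
    by (rule lin_comp [OF \<Delta> l])
  have 2: "(\<lambda>\<alpha>. pure k PA PA (pp PA \<alpha> (single k 1)) \<one>\<^sub>PA \<oplus>\<^sub>?T pure k PA PA \<one>\<^sub>PA (pp PA \<alpha> (single k 1)))
     \<in> lin (free_space k UNIV) ?T"
    by (intro lin_plus lin_pure_left lin_pure_right l) auto
  have "comult PA (pp PA \<alpha> (single k 1)) =
     pure k PA PA (pp PA \<alpha> (single k 1)) \<one>\<^sub>PA \<oplus>\<^sub>?T pure k PA PA \<one>\<^sub>PA (pp PA \<alpha> (single k 1))"
    using \<alpha> unfolding fin_seqs_carrier
  proof (induction \<alpha> rule: free_space_induct)
    case zero
    then show ?case using lin_zero [OF _ _ 1] lin_zero [OF _ _ 2] by simp
  next
    case (single i)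
    then show ?case using PA_power_primitive [of i] by (simp add: pp_single PA_single_pow primitive_def)
  next
    case (add f h)
    then show ?case unfolding lin_add [OF 1 add(1,2)] lin_add [OF 2 add(1,2)] by simp
  next
    case (smult c f)
    then show ?case unfolding lin_smult [OF 1 smult(1,2)] lin_smult [OF 2 smult(1,2)] by simp
  qed
  then show ?thesis using \<alpha> by (simp add: primitive_def)
qed

lemma peval_pp:
  assumes "k_algebra k B" "y \<in> carrier B" "\<alpha> \<in> fin_seqs k"
  shows "peval B y (pp PA \<alpha> (single k 1)) = pp B \<alpha> y"
  using pp_alg_hom [OF PA_kalg assms(1) peval_hom(1) PA_single_closed assms(3), of y 1] assms
  by (simp add: peval_hom(2))

text \<open>The identity \<Delta>(P_\<alpha>) = P_\<alpha> \<otimes> 1 + 1 \<otimes> P_\<alpha> in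
  the square of k[Y] is pushed forward by ev \<otimes> ev, where ev substitutes y for Y.\<close>

lemma pp_tensor:
  assumes B: "k_algebra k B" and y: "y \<in> carrier B" and \<alpha>: "\<alpha> \<in> fin_seqs k"
  shows "pp (tensor k B B) \<alpha> (pure k B B y \<one>\<^sub>B \<oplus>\<^bsub>tensor k B B\<^esub> pure k B B \<one>\<^sub>B y) =
     pure k B B (pp B \<alpha> y) \<one>\<^sub>B \<oplus>\<^bsub>tensor k B B\<^esub> pure k B B \<one>\<^sub>B (pp B \<alpha> y)"
proof -
  let ?T = "tensor k B B" and ?P = "tensor k PA PA"
  let ?e = "peval B y"
  let ?Y = "single k 1"
  have e: "?e \<in> alg_hom PA B" by (rule peval_hom [OF B y])
  define E where "E = tlift ?T (\<lambda>a b. pure k B B (?e a) (?e b))"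
  have E: "E \<in> alg_hom ?P ?T" unfolding E_def by (rule alg_hom_tensor_map [OF PA_kalg PA_kalg B B e e])
  have Ep: "E (pure k PA PA a b) = pure k B B (?e a) (?e b)" if "a \<in> carrier PA" "b \<in> carrier PA" for a b
    unfolding E_def
    by (rule tensor_lift_pure [OF _ _ _ bilin_pure_map [OF _ _ alg_hom_lin [OF e] alg_hom_lin [OF e]]]) (use B that in auto)
  have YY: "YY \<in> carrier ?P" by simp
  have eY: "?e ?Y = y" using B y by (simp add: peval_hom(2))
  note e1 = alg_hom_one [OF e]
  have "comult PA (pp PA \<alpha> ?Y) = pp ?P \<alpha> YY"
    using pp_alg_hom [OF PA_kalg _ PA_comult_hom PA_single_closed \<alpha>, of 1] by (simp add: PA_comult_Y)
  then have "E (comult PA (pp PA \<alpha> ?Y)) = pp ?T \<alpha> (E YY)"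
    using pp_alg_hom [OF _ _ E YY \<alpha>] B by simp
  moreover have "E YY = pure k B B y \<one>\<^sub>B \<oplus>\<^sub>?T pure k B B \<one>\<^sub>B y"
    by (simp add: alg_hom_add [OF E] Ep eY e1)
  moreover have "E (comult PA (pp PA \<alpha> ?Y)) = pure k B B (pp B \<alpha> y) \<one>\<^sub>B \<oplus>\<^sub>?T pure k B B \<one>\<^sub>B (pp B \<alpha> y)"
    using pp_primitive [OF \<alpha>] \<alpha> B y by (simp add: primitive_def alg_hom_add [OF E] Ep e1 peval_pp)
  ultimately show ?thesis by simp
qed

text \<open>The prime p is odd, hence so are all exponents p^i. The antipode, which sends Y to -Y,
  relies on this.\<close>

lemma pp_odd:
  assumes B: "k_algebra k B" and y: "y \<in> carrier B" and \<alpha>: "\<alpha> \<in> fin_seqs k"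
  shows "pp B \<alpha> (\<ominus>\<^sub>B y) = \<ominus>\<^sub>B pp B \<alpha> y"
proof -
  have ny: "\<ominus>\<^sub>B y \<in> carrier B" using B y by simp
  note l = pp_linear [OF B ny]
  have l2: "(\<lambda>\<alpha>. \<ominus>\<^sub>B pp B \<alpha> y) \<in> lin (free_space k UNIV) B"
    by (rule lin_uminus [OF _ pp_linear [OF B y]]) (use B in simp)
  have p: "odd p"
    using prime_p p_ge by (simp add: prime_odd_nat)
  show ?thesis
    using \<alpha> unfolding fin_seqs_carrier
  proof (induction \<alpha> rule: free_space_induct)
    case zero
    then show ?case using lin_zero [OF _ _ l] lin_zero [OF _ _ l2] B by simp
  next
    case (single i)
    then show ?case using B y ny p by (simp add: pp_single neg_pow_odd)
  next
    case (add f h)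
    then show ?case unfolding lin_add [OF l add(1,2)] lin_add [OF l2 add(1,2)] by simp
  next
    case (smult c f)
    then show ?case unfolding lin_smult [OF l smult(1,2)] lin_smult [OF l2 smult(1,2)] by simp
  qed
qed

text \<open>The defining relations as a condition on a triple in an arbitrary algebra; by
  \<open>A_lift\<close> such a triple determines an algebra map out of the presented
  algebra.\<close>

definition A_rel where
  "A_rel \<alpha> B y g x \<longleftrightarrow> y \<in> carrier B \<and> g \<in> carrier B \<and> x \<in> carrier B \<and>
     g \<otimes>\<^sub>B g = \<one>\<^sub>B \<and> x \<otimes>\<^sub>B x = pp B \<alpha> y \<and> x \<otimes>\<^sub>B g = \<ominus>\<^sub>B (g \<otimes>\<^sub>B x) \<and>
     g \<otimes>\<^sub>B y = y \<otimes>\<^sub>B g \<and> x \<otimes>\<^sub>B y = y \<otimes>\<^sub>B x"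

section \<open>The presented algebra and its universal property\<close>

context
  fixes \<alpha> assumes \<alpha>: "\<alpha> \<in> fin_seqs k"
begin

private abbreviation "FA \<equiv> free_algebra k :: ('k, gen list => 'k) module"
private abbreviation "II \<equiv> A_ideal k p \<alpha>"
private abbreviation "w s \<equiv> single k [s :: gen]"
abbreviation "AH \<equiv> A_hopf k p \<alpha>"
abbreviation "AY \<equiv> A_gen k p \<alpha> GenY"
abbreviation "Ag \<equiv> A_gen k p \<alpha> Geng"
abbreviation "Ax \<equiv> A_gen k p \<alpha> Genx"
abbreviation "AT \<equiv> tensor k AH AH"

private definition "relators = {w Geng \<otimes>\<^sub>FA w Geng \<ominus>\<^sub>FA \<one>\<^sub>FA,
        w Genx \<otimes>\<^sub>FA w Genx \<ominus>\<^sub>FA pp FA \<alpha> (w GenY),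
        w Genx \<otimes>\<^sub>FA w Geng \<ominus>\<^sub>FA (\<ominus>\<^sub>FA (w Geng \<otimes>\<^sub>FA w Genx)),
        w Geng \<otimes>\<^sub>FA w GenY \<ominus>\<^sub>FA w GenY \<otimes>\<^sub>FA w Geng,
        w Genx \<otimes>\<^sub>FA w GenY \<ominus>\<^sub>FA w GenY \<otimes>\<^sub>FA w Genx}"

private lemma A_ideal_eq: "II = Idl\<^bsub>FA\<^esub> relators"
  by (simp add: A_ideal_def relators_def Let_def pp_def lin_ext_def)

private lemma w_closed [simp]: "w s \<in> carrier FA"
  by (simp add: free_algebra_simps)

private lemma FM: "module k FA" "k_algebra k FA" "ring FA"
  using kalg_ring [OF free_algebra_kalg] by auto

private lemma relators_subset: "relators \<subseteq> carrier FA"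
  using \<alpha> FM by (auto simp: relators_def intro!: vminus_closed [OF FM(1)])

private lemma ideal: "ideal II FA"
  unfolding A_ideal_eq by (rule ring.genideal_ideal [OF FM(3) relators_subset])

private lemma relators_in: "relators \<subseteq> II"
  unfolding A_ideal_eq by (rule ring.genideal_self [OF FM(3) relators_subset])

private abbreviation "QA \<equiv> A_algebra k p \<alpha>"

private lemma QA_kalg: "k_algebra k QA"
  unfolding A_algebra_def by (rule quot_k_algebra [OF FM(2) ideal])

private lemma QA_proj: "(\<lambda>q. II +>\<^sub>FA q) \<in> alg_hom FA QA"
  unfolding A_algebra_def by (rule quot_proj_hom [OF FM(2) ideal])

private lemma QA_eq:
  assumes "f \<in> carrier FA" "h \<in> carrier FA" "f \<ominus>\<^sub>FA h \<in> relators"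
  shows "II +>\<^sub>FA f = II +>\<^sub>FA h"
  using coset_eq [OF FM(1) ideal_submodule [OF FM(2) ideal] assms(1,2)] assms(3) relators_in by blast

private lemma QA_rel: "A_rel \<alpha> QA AY Ag Ax"
proof -
  note P = alg_hom_mult [OF QA_proj, symmetric] alg_hom_one [OF QA_proj, symmetric]
    pp_alg_hom [OF FM(2) QA_kalg QA_proj _ \<alpha>, symmetric] alg_hom_neg [OF FM(2) QA_kalg QA_proj, symmetric]
  have c: "AY \<in> carrier QA" "Ag \<in> carrier QA" "Ax \<in> carrier QA"
    unfolding A_gen_def by (auto intro!: alg_hom_closed [OF QA_proj])
  have "II +>\<^sub>FA (w Geng \<otimes>\<^sub>FA w Geng) = II +>\<^sub>FA \<one>\<^sub>FA"
    "II +>\<^sub>FA (w Genx \<otimes>\<^sub>FA w Genx) = II +>\<^sub>FA pp FA \<alpha> (w GenY)"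
    "II +>\<^sub>FA (w Genx \<otimes>\<^sub>FA w Geng) = II +>\<^sub>FA (\<ominus>\<^sub>FA (w Geng \<otimes>\<^sub>FA w Genx))"
    "II +>\<^sub>FA (w Geng \<otimes>\<^sub>FA w GenY) = II +>\<^sub>FA (w GenY \<otimes>\<^sub>FA w Geng)"
    "II +>\<^sub>FA (w Genx \<otimes>\<^sub>FA w GenY) = II +>\<^sub>FA (w GenY \<otimes>\<^sub>FA w Genx)"
    by (rule QA_eq; use FM \<alpha> in \<open>simp add: relators_def\<close>)+
  then show ?thesis
    unfolding A_rel_def using c FM by (simp add: A_gen_def P)
qed

private lemma same: "same_module QA AH" "monoid.mult AH = monoid.mult QA" "one AH = one QA"
  by (simp_all add: same_module_def A_hopf_def Let_def)

lemma AH_kalg [simp]: "k_algebra k AH"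
  by (rule kalg_cong [OF QA_kalg same])

lemma A_rel_cong:
  assumes "k_algebra k B" "same_module B C" "monoid.mult C = monoid.mult B" "one C = one B" "A_rel \<alpha> B y g x"
  shows "A_rel \<alpha> C y g x"
proof -
  have pow: "z [^]\<^bsub>C\<^esub> (n::nat) = z [^]\<^bsub>B\<^esub> n" for z n by (simp add: nat_pow_def assms(3,4))
  have sm: "smult C = smult B" using assms(2) by (simp add: same_module_def)
  have "pp C \<alpha> z = pp B \<alpha> z" if z: "z \<in> carrier B" for z
  proof -
    have "finsum B (\<lambda>i. \<alpha> i \<odot>\<^sub>B z [^]\<^bsub>B\<^esub> (p ^ i)) {b. \<alpha> b \<noteq> \<zero>} =
      finsum C (\<lambda>i. \<alpha> i \<odot>\<^sub>B z [^]\<^bsub>B\<^esub> (p ^ i)) {b. \<alpha> b \<noteq> \<zero>}"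
      by (rule finsum_same_module [OF kalg_module [OF assms(1)] assms(2)])
        (use assms(1) z \<alpha> in \<open>auto simp: fin_seqs_def\<close>)
    then show ?thesis by (simp add: pp_def lin_ext_def pow sm)
  qed
  moreover have "\<ominus>\<^sub>C z = \<ominus>\<^sub>B z" for z using assms(2) by (simp add: a_inv_def m_inv_def same_module_def)
  ultimately show ?thesis using assms by (simp add: A_rel_def same_module_def)
qed

lemma AH_rel: "A_rel \<alpha> AH AY Ag Ax"
  by (rule A_rel_cong [OF QA_kalg same QA_rel])

lemmas AH_rels = AH_rel [unfolded A_rel_def]

lemma AH_closed [simp]: "AY \<in> carrier AH" "Ag \<in> carrier AH" "Ax \<in> carrier AH"
  using AH_rels by auto

lemma AH_generates: "generates {AY, Ag, Ax} AH"
proof -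
  have "generates ((\<lambda>q. II +>\<^sub>FA q) ` range w) QA"
    unfolding A_algebra_def by (rule quot_generates [OF FM(2) ideal free_algebra_generates])
  moreover have "(\<lambda>q. II +>\<^sub>FA q) ` range w = {AY, Ag, Ax}"
  proof -
    have U: "(UNIV :: gen set) = {GenY, Geng, Genx}" using gen.exhaust by auto
    show ?thesis unfolding A_gen_def image_image U by simp
  qed
  ultimately have G: "generates {AY, Ag, Ax} QA" by simp
  have "subalg N QA" if N: "subalg N AH" for N
    using N same submodule_same_module [OF kalg_module [OF AH_kalg] same_module_sym [OF same(1)], of N]
    by (simp add: subalg_def)
  then show ?thesis
    using G same(1) unfolding generates_def by (simp add: same_module_def)
qed

text \<open>Repeats the choice of a representative made in \<open>A_hopf\<close>, so that
  comultiplication and counit there are instances of it.\<close>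

definition A_lift where
  "A_lift B y g x = (\<lambda>X. free_eval k B (case_gen y g x) (SOME q. q \<in> X))"

text \<open>The kernel of the evaluation of words is an ideal; since it contains the relators, it
  contains the ideal they generate.\<close>

lemma A_lift:
  assumes B: "k_algebra k B" and rel: "A_rel \<alpha> B y g x"
  shows "A_lift B y g x \<in> alg_hom AH B" "A_lift B y g x AY = y" "A_lift B y g x Ag = g" "A_lift B y g x Ax = x"
proof -
  let ?\<phi> = "free_eval k B (case_gen y g x)"
  have c: "case_gen y g x s \<in> carrier B" for s using rel by (cases s) (auto simp: A_rel_def)
  have \<phi>: "?\<phi> \<in> alg_hom FA B" "?\<phi> (w s) = case_gen y g x s" for s
    by (rule free_eval_hom [OF B c])+
  note B' = B kalg_module [OF B]
  have "relators \<subseteq> {q \<in> carrier FA. ?\<phi> q = \<zero>\<^sub>B}"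
  proof -
    have "?\<phi> (a \<ominus>\<^sub>FA b) = \<zero>\<^sub>B" if "a \<in> carrier FA" "b \<in> carrier FA" "?\<phi> a = ?\<phi> b" for a b
      using that FM B' alg_hom_closed [OF \<phi>(1)] vcancel [OF B'(2), of "?\<phi> b" "?\<phi> b"]
      by (simp add: a_minus_def alg_hom_add [OF \<phi>(1)] alg_hom_neg [OF FM(2) B \<phi>(1)])
    then show ?thesis
      using relators_subset rel FM \<alpha>
      by (auto simp: relators_def A_rel_def alg_hom_mult [OF \<phi>(1)] alg_hom_one [OF \<phi>(1)] \<phi>(2)
        alg_hom_neg [OF FM(2) B \<phi>(1)] pp_alg_hom [OF FM(2) B \<phi>(1) _ \<alpha>])
  qed
  then have "II \<subseteq> {q \<in> carrier FA. ?\<phi> q = \<zero>\<^sub>B}"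
    unfolding A_ideal_eq
    by (rule ring.genideal_minimal [OF FM(3) alg_hom_kernel_ideal [OF FM(2) B \<phi>(1)]])
  then have ker: "?\<phi> n = \<zero>\<^sub>B" if "n \<in> II" for n using that by blast
  note l = quot_alg_lift [OF FM(2) ideal B \<phi>(1) ker]
  have "A_lift B y g x \<in> alg_hom QA B" unfolding A_lift_def A_algebra_def by (rule l(2))
  then show "A_lift B y g x \<in> alg_hom AH B"
    using same by (simp add: alg_hom_def lin_maps_def same_module_def)
  show "A_lift B y g x AY = y" "A_lift B y g x Ag = g" "A_lift B y g x Ax = x"
    unfolding A_lift_def A_gen_def using l(1) by (simp_all add: \<phi>(2))
qed

section \<open>Comultiplication, counit and antipode of the presented algebra\<close>

private lemma AT_eq: "tensor k QA QA = AT" "pure k QA QA = pure k AH AH"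
  by (simp_all add: A_hopf_def Let_def)

abbreviation "AYY \<equiv> pure k AH AH AY \<one>\<^sub>AH \<oplus>\<^sub>AT pure k AH AH \<one>\<^sub>AH AY"
abbreviation "Axx \<equiv> pure k AH AH Ax \<one>\<^sub>AH \<oplus>\<^sub>AT pure k AH AH Ag Ax"

lemma AH_comult_def: "comult AH = A_lift AT AYY (pure k AH AH Ag Ag) Axx"
  unfolding AT_eq [symmetric] same(3) A_lift_def by (simp add: A_hopf_def Let_def)

lemma AH_counit_def: "counit AH = A_lift (self_module k) \<zero> \<one> \<zero>"
  unfolding A_lift_def by (simp add: A_hopf_def Let_def)

text \<open>Makes \<Delta> well defined. The mixed terms of \<Delta>(x)^2 cancel, and what remains,
  x^2 \<otimes> 1 + 1 \<otimes> x^2, is P_\<alpha> evaluated at \<Delta>(Y) by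
  \<open>pp_tensor\<close>.\<close>

lemma AH_comult_rel: "A_rel \<alpha> AT AYY (pure k AH AH Ag Ag) Axx"
proof -
  have H: "k_algebra k AH" "module k AH" "k_algebra k AT" "module k AT" by auto
  note r = AH_rels
  let ?p = "pure k AH AH"
  have gx: "Ag \<otimes>\<^sub>AH Ax \<in> carrier AH" using H by simp
  have 1: "Axx \<otimes>\<^sub>AT Axx = ?p (pp AH \<alpha> AY) \<one>\<^sub>AH \<oplus>\<^sub>AT ?p \<one>\<^sub>AH (pp AH \<alpha> AY)"
  proof -
    have "Axx \<otimes>\<^sub>AT Axx = ?p Ax \<one>\<^sub>AH \<otimes>\<^sub>AT ?p Ax \<one>\<^sub>AH \<oplus>\<^sub>AT ?p Ag Ax \<otimes>\<^sub>AT ?p Ag Ax"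
      by (rule square_add [where c = "?p (Ag \<otimes>\<^sub>AH Ax) Ax"])
        (use H r gx in \<open>simp_all add: tensor_mult_pure pure_neg_left\<close>)
    then show ?thesis using H r by (simp add: tensor_mult_pure)
  qed
  have 2: "Axx \<otimes>\<^sub>AT ?p Ag Ag = \<ominus>\<^sub>AT (?p Ag Ag \<otimes>\<^sub>AT Axx)"
    using H r gx by (simp add: amult_add_left amult_add_right tensor_mult_pure pure_neg_left pure_neg_right vneg_add)
  show ?thesis
    unfolding A_rel_def pp_tensor [OF H(1) AH_closed(1) \<alpha>] 1 2
    using H r by (simp add: amult_add_left amult_add_right tensor_mult_pure tensor_simps(5) vac)
qed

lemma AH_comult_hom: "comult AH \<in> alg_hom AH AT"
  and AH_comult_Y: "comult AH AY = AYY"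
  and AH_comult_g: "comult AH Ag = pure k AH AH Ag Ag"
  and AH_comult_x: "comult AH Ax = Axx"
  unfolding AH_comult_def by (rule A_lift [OF _ AH_comult_rel]; simp)+

lemma AH_counit_rel: "A_rel \<alpha> (self_module k) \<zero> \<one> \<zero>"
proof -
  \<comment> \<open>The exponents p^i are positive, so P_\<alpha> has no constant term and the
    counit may send both Y and x to 0.\<close>
  have "pp PA \<alpha> (single k 1) 0 = \<zero>"
    by (rule pp_coeff(2) [OF \<alpha>]) (use p_ge in simp)
  moreover have "counit PA (pp PA \<alpha> (single k 1)) = pp (self_module k) \<alpha> \<zero>"
    using pp_alg_hom [OF PA_kalg self_algebra PA_counit_hom PA_single_closed \<alpha>, of 1] by (simp add: PA_counit_vals)
  ultimately have "pp (self_module k) \<alpha> \<zero> = \<zero>"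
    using \<alpha> by (simp add: PA_counit)
  moreover have "\<ominus>\<^bsub>self_module k\<^esub> \<zero> = \<zero>" using vneg_zero [OF module_self] by simp
  ultimately show ?thesis by (simp add: A_rel_def)
qed

lemma AH_counit_hom: "counit AH \<in> alg_hom AH (self_module k)"
  and AH_counit_Y: "counit AH AY = \<zero>"
  and AH_counit_g: "counit AH Ag = \<one>"
  and AH_counit_x: "counit AH Ax = \<zero>"
  unfolding AH_counit_def by (rule A_lift [OF self_algebra AH_counit_rel])+

lemma AH_primitive: "primitive k AH AY"
  and AH_group_like: "group_like k AH Ag"
  and AH_skew_primitive: "skew_primitive k AH Ag Ax"
  by (simp_all add: primitive_def group_like_def skew_primitive_def AH_comult_Y AH_comult_g AH_comult_x)

private lemma AH_one: "group_like k AH \<one>\<^sub>AH" "skew_primitive k AH \<one>\<^sub>AH AY" "counit AH \<one>\<^sub>AH = \<one>"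
  using alg_hom_one [OF AH_comult_hom] alg_hom_one [OF AH_counit_hom]
  by (simp_all add: group_like_def skew_primitive_def AH_comult_Y tensor_simps(5))

private lemmas gen_facts = AH_kalg AH_comult_hom AH_counit_hom
private lemmas factsx = gen_facts AH_group_like AH_skew_primitive AH_counit_g AH_counit_x
private lemmas factsY = gen_facts AH_one(1,2,3) AH_counit_Y

lemma AH_bialgebra: "bialgebra k AH"
proof (rule bialgebra_from_generators [OF gen_facts AH_generates])
qed (use coassoc_skew_primitive [OF factsx] coassoc_group_like [OF factsx] counit_skew_primitive [OF factsx]
    coassoc_skew_primitive [OF factsY] counit_skew_primitive [OF factsY] in auto)

text \<open>The antipode is the algebra map into the opposite algebra with Y -> -Y, g -> g and x ->
  -gx. The square of -gx is -x^2, in agreement with P_\<alpha>(-Y) because P_\<alpha> is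
  odd.\<close>

lemma AH_hopf: "hopf_algebra k AH"
proof -
  let ?O = "opposite AH"
  have H: "k_algebra k AH" "module k AH" by auto
  have O: "k_algebra k ?O" by (rule opposite_kalg) simp
  note r = AH_rels
  let ?X = "\<ominus>\<^sub>AH (Ag \<otimes>\<^sub>AH Ax)"
  have ppO: "pp ?O \<alpha> z = pp AH \<alpha> z" if "z \<in> carrier AH" for z
  proof -
    have "finsum AH (\<lambda>i. \<alpha> i \<odot>\<^sub>AH z [^]\<^bsub>AH\<^esub> (p ^ i)) {b. \<alpha> b \<noteq> \<zero>} =
      finsum ?O (\<lambda>i. \<alpha> i \<odot>\<^sub>AH z [^]\<^bsub>AH\<^esub> (p ^ i)) {b. \<alpha> b \<noteq> \<zero>}"
      by (rule finsum_same_module) (use H that \<alpha> in \<open>auto simp: same_module_def fin_seqs_def\<close>)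
    then show ?thesis using H that by (simp add: pp_def lin_ext_def opposite_pow)
  qed
  have ggx: "Ag \<otimes>\<^sub>AH (Ag \<otimes>\<^sub>AH Ax) = Ax" using r H by (simp add: amult_assoc [symmetric])
  have gxg: "(Ag \<otimes>\<^sub>AH Ax) \<otimes>\<^sub>AH Ag = \<ominus>\<^sub>AH Ax" using r H ggx by (simp add: amult_assoc amult_neg_right)
  have "(Ag \<otimes>\<^sub>AH Ax) \<otimes>\<^sub>AH (Ag \<otimes>\<^sub>AH Ax) = ((Ag \<otimes>\<^sub>AH Ax) \<otimes>\<^sub>AH Ag) \<otimes>\<^sub>AH Ax"
    using H by (simp add: amult_assoc)
  then have XX: "?X \<otimes>\<^sub>AH ?X = \<ominus>\<^sub>AH pp AH \<alpha> AY"
    using H r \<alpha> by (simp add: gxg amult_neg_left amult_neg_right)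
  have gxY: "(Ag \<otimes>\<^sub>AH Ax) \<otimes>\<^sub>AH AY = AY \<otimes>\<^sub>AH (Ag \<otimes>\<^sub>AH Ax)"
    using H r by (metis amult_assoc AH_closed)
  have rel: "A_rel \<alpha> ?O (\<ominus>\<^sub>AH AY) Ag ?X"
    unfolding A_rel_def using H r \<alpha>
    by (simp add: ppO pp_odd XX opposite_neg amult_neg_left amult_neg_right ggx gxg gxY)
  define S where "S = A_lift ?O (\<ominus>\<^sub>AH AY) Ag ?X"
  note S = A_lift [OF O rel, folded S_def]
  have Sl: "S \<in> lin AH AH" using alg_hom_lin [OF S(1)] by (simp add: lin_maps_def)
  have S1: "S \<one>\<^sub>AH = \<one>\<^sub>AH" using alg_hom_one [OF S(1)] by simp
  have Sm: "S (x \<otimes>\<^sub>AH y) = S y \<otimes>\<^sub>AH S x" if "x \<in> carrier AH" "y \<in> carrier AH" for x y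
    using alg_hom_mult [OF S(1) that] by simp
  have "S Ag \<otimes>\<^sub>AH Ag = \<one>\<^sub>AH" "Ag \<otimes>\<^sub>AH S Ag = \<one>\<^sub>AH" "S Ax = \<ominus>\<^sub>AH (S Ag \<otimes>\<^sub>AH Ax)"
    using r by (simp_all add: S)
  note a = antipode_skew_primitive [OF factsx Sl S1 this]
  have "S \<one>\<^sub>AH \<otimes>\<^sub>AH \<one>\<^sub>AH = \<one>\<^sub>AH" "\<one>\<^sub>AH \<otimes>\<^sub>AH S \<one>\<^sub>AH = \<one>\<^sub>AH" "S AY = \<ominus>\<^sub>AH (S \<one>\<^sub>AH \<otimes>\<^sub>AH AY)"
    by (simp_all add: S1 S)
  note a' = antipode_skew_primitive [OF factsY Sl S1 this]
  show ?thesis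
    by (rule hopf_from_generators [OF AH_bialgebra AH_generates Sl S1 Sm]) (use a a' in auto)
qed

end

end

context base_field
begin

section \<open>Sweedler's Hopf algebra\<close>

abbreviation H where "H \<equiv> H4 k"
abbreviation b1 where "b1 \<equiv> single k B1"
abbreviation bg where "bg \<equiv> single k Bg"
abbreviation bx where "bx \<equiv> single k Bx"
abbreviation bgx where "bgx \<equiv> single k Bgx"

lemma UNIV_h4: "(UNIV :: h4_basis set) = {B1, Bg, Bx, Bgx}"
  using h4_basis.exhaust by auto

lemma finite_h4 [simp]: "finite (X :: h4_basis set)"
  by (rule finite_subset [OF subset_UNIV]) (simp add: UNIV_h4)

abbreviation F4 where "F4 \<equiv> free_space k (UNIV :: h4_basis set)"

lemma H4_fields:
  "carrier H = carrier F4" "zero H = zero F4" "add H = add F4" "smult H = smult F4" "one H = b1"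
  "monoid.mult H = monoid.mult (h4_algebra k)"
  by (simp_all add: H4_def h4_algebra_def Let_def)

lemma H4_carrier: "u \<in> carrier H \<longleftrightarrow> (\<forall>b. u b \<in> carrier k)"
  by (simp add: H4_fields free_space_simps)

lemma H4_same: "same_module F4 H"
  by (simp add: same_module_def H4_fields)

lemma H4_module [simp]: "module k H"
  by (rule module_cong [OF free_space_module H4_same])

lemma H4_single [simp]: "single k b \<in> carrier H"
  by (simp add: H4_fields)

lemma lin_maps_H4: "lin H U = lin F4 U" "lin U H = lin U F4"
  by (simp_all add: lin_maps_def H4_fields)

lemma H4_induct [consumes 1, case_names single add smult]:
  assumes "u \<in> carrier H" and "\<And>b. P (single k b)"
    and "\<And>u v. u \<in> carrier H ==> v \<in> carrier H ==> P u ==> P v ==> P (u \<oplus>\<^sub>H v)"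
    and "\<And>c u. c \<in> carrier k ==> u \<in> carrier H ==> P u ==> P (c \<odot>\<^sub>H u)"
  shows "P u"
  using assms(1) unfolding H4_fields
proof (induction u rule: free_space_induct)
  case zero
  have "\<zero> \<odot>\<^sub>H b1 = \<zero>\<^sub>F4" using vsmult_null [OF H4_module H4_single, of B1] by (simp add: H4_fields)
  then show ?case using assms(4) [of \<zero> b1] assms(2) by simp
qed (use assms(2-4) in \<open>auto simp: H4_fields\<close>)

lemma H4_lin_eqI:
  assumes "\<phi> \<in> lin H U" "\<psi> \<in> lin H U" "\<And>b. \<phi> (single k b) = \<psi> (single k b)" "u \<in> carrier H"
  shows "\<phi> u = \<psi> u"
  using assms(4)
  by (induction u rule: H4_induct)
    (auto simp: assms(3) lin_add [OF assms(1)] lin_add [OF assms(2)] lin_smult [OF assms(1)] lin_smult [OF assms(2)])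

definition h4_ext where "h4_ext U \<gamma> = lin_ext U (\<gamma> :: h4_basis => _)"

lemma h4_ext_linear:
  assumes "module k U" "\<And>b. \<gamma> b \<in> carrier U"
  shows "h4_ext U \<gamma> \<in> lin H U" "h4_ext U \<gamma> (single k b) = \<gamma> b"
  unfolding h4_ext_def lin_maps_H4 by (auto intro!: lin_ext_linear lin_ext_single assms)

lemma h4_ext_sum:
  assumes "module k U" "\<And>b. \<gamma> b \<in> carrier U" "u \<in> carrier H"
  shows "(\<Oplus>\<^sub>U b \<in> UNIV. u b \<odot>\<^sub>U \<gamma> b) = h4_ext U \<gamma> u"
  unfolding h4_ext_def by (rule lin_ext_superset [symmetric, of _ _ UNIV]) (use assms in \<open>auto simp: H4_fields\<close>)

lemma h4_ext_param:
  assumes U: "module k U" and Z: "module k Z" and u: "u \<in> carrier H"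
    and lin: "\<And>b. (\<lambda>z. \<gamma> z b) \<in> lin Z U"
  shows "(\<lambda>z. h4_ext U (\<gamma> z) u) \<in> lin Z U"
proof (rule lin_mapsI)
  have c: "\<gamma> z b \<in> carrier U" if "z \<in> carrier Z" for z b using lin_closed [OF lin that] .
  show cl: "h4_ext U (\<gamma> z) u \<in> carrier U" if "z \<in> carrier Z" for z
    using lin_closed [OF h4_ext_linear(1) [OF U c [OF that]] u] .
  fix x assume x: "x \<in> carrier Z"
  show "h4_ext U (\<gamma> (d \<odot>\<^sub>Z x)) u = d \<odot>\<^sub>U h4_ext U (\<gamma> x) u" if d: "d \<in> carrier k" for d
    using u
    by (rule H4_lin_eqI [rotated -1]) (use U Z x c d in \<open>auto simp: h4_ext_linear lin_smult [OF lin]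
      intro!: h4_ext_linear(1) lin_smult_left\<close>)
  fix y assume y: "y \<in> carrier Z"
  show "h4_ext U (\<gamma> (x \<oplus>\<^sub>Z y)) u = h4_ext U (\<gamma> x) u \<oplus>\<^sub>U h4_ext U (\<gamma> y) u"
    using u
    by (rule H4_lin_eqI [rotated -1]) (use U Z x y c in \<open>auto simp: h4_ext_linear lin_add [OF lin]
      intro!: h4_ext_linear(1) lin_plus\<close>)
qed

lemma h4_table_closed [simp]: "h4_table k a b \<in> carrier F4"
  by (cases a; cases b) auto

text \<open>The double sum of the definition becomes two nested linear extensions, from which
  bilinearity is immediate.\<close>

lemma H4_mult:
  assumes u: "u \<in> carrier H" and v: "v \<in> carrier H"
  shows "u \<otimes>\<^sub>H v = h4_ext F4 (\<lambda>a. h4_ext F4 (h4_table k a) v) u"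
proof -
  have uk: "u b \<in> carrier k" "v b \<in> carrier k" for b using u v by (auto simp: H4_carrier)
  have "u \<otimes>\<^sub>H v = (\<Oplus>\<^sub>F4 a \<in> UNIV. \<Oplus>\<^sub>F4 b \<in> UNIV. (u a \<otimes> v b) \<odot>\<^sub>F4 h4_table k a b)"
    by (simp add: H4_fields h4_algebra_def Let_def)
  also have "\<dots> = (\<Oplus>\<^sub>F4 a \<in> UNIV. u a \<odot>\<^sub>F4 h4_ext F4 (h4_table k a) v)"
  proof (rule vfinsum_cong [OF free_space_module refl])
    fix a
    have "(\<Oplus>\<^sub>F4 b \<in> UNIV. (u a \<otimes> v b) \<odot>\<^sub>F4 h4_table k a b) = (\<Oplus>\<^sub>F4 b \<in> UNIV. u a \<odot>\<^sub>F4 (v b \<odot>\<^sub>F4 h4_table k a b))"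
      by (rule vfinsum_cong) (use uk in \<open>auto simp: vsmult_assoc\<close>)
    also have "\<dots> = u a \<odot>\<^sub>F4 (\<Oplus>\<^sub>F4 b \<in> UNIV. v b \<odot>\<^sub>F4 h4_table k a b)"
      by (rule vfinsum_smult [symmetric]) (use uk in auto)
    finally show "(\<Oplus>\<^sub>F4 b \<in> UNIV. (u a \<otimes> v b) \<odot>\<^sub>F4 h4_table k a b) = u a \<odot>\<^sub>F4 h4_ext F4 (h4_table k a) v"
      by (simp add: h4_ext_sum v)
    show "u a \<odot>\<^sub>F4 h4_ext F4 (h4_table k a) v \<in> carrier F4"
      using uk lin_closed [OF h4_ext_linear(1) v, of F4 "h4_table k a"] by simp
  qed
  also have "\<dots> = h4_ext F4 (\<lambda>a. h4_ext F4 (h4_table k a) v) u"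
    by (rule h4_ext_sum) (use u lin_closed [OF h4_ext_linear(1) v, of F4] in auto)
  finally show ?thesis .
qed

lemma H4_na [simp]: "na_algebra H"
proof -
  have c: "h4_ext F4 (h4_table k a) v \<in> carrier F4" if "v \<in> carrier H" for a v
    using lin_closed [OF h4_ext_linear(1) that, of F4] by simp
  have "(\<lambda>v. u \<otimes>\<^sub>H v) \<in> lin H H" if u: "u \<in> carrier H" for u
  proof (rule lin_cong)
    show "(\<lambda>v. h4_ext F4 (\<lambda>a. h4_ext F4 (h4_table k a) v) u) \<in> lin H H"
      unfolding lin_maps_H4(2) by (rule h4_ext_param [OF _ _ u]) (auto intro!: h4_ext_linear(1))
  qed (auto simp: H4_mult u)
  moreover have "(\<lambda>u. u \<otimes>\<^sub>H v) \<in> lin H H" if v: "v \<in> carrier H" for v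
  proof (rule lin_cong)
    show "h4_ext F4 (\<lambda>a. h4_ext F4 (h4_table k a) v) \<in> lin H H"
      unfolding lin_maps_H4(2) by (rule h4_ext_linear(1)) (auto simp: c v)
  qed (auto simp: H4_mult v)
  ultimately show ?thesis
    by (auto simp: na_algebra_def H4_fields(5) intro!: bilinI)
qed

lemma H4_mult_single: "single k a \<otimes>\<^sub>H single k b = h4_table k a b"
proof -
  have c: "h4_ext F4 (h4_table k a) (single k b) \<in> carrier F4" for a
    using lin_closed [OF h4_ext_linear(1) H4_single, of F4] by simp
  show ?thesis by (simp add: H4_mult h4_ext_linear(2) c)
qed

lemma H4_neg: "\<ominus>\<^sub>F4 u = \<ominus>\<^sub>H u"
  by (simp add: a_inv_def m_inv_def H4_fields)

lemma H4_table_simps [simp]: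
  "single k B1 \<otimes>\<^sub>H single k b = single k b" "single k b \<otimes>\<^sub>H single k B1 = single k b"
  "bg \<otimes>\<^sub>H bg = b1" "bg \<otimes>\<^sub>H bx = bgx" "bg \<otimes>\<^sub>H bgx = bx"
  "bx \<otimes>\<^sub>H bg = \<ominus>\<^sub>H bgx" "bx \<otimes>\<^sub>H bx = \<zero>\<^sub>H" "bx \<otimes>\<^sub>H bgx = \<zero>\<^sub>H"
  "bgx \<otimes>\<^sub>H bg = \<ominus>\<^sub>H bx" "bgx \<otimes>\<^sub>H bx = \<zero>\<^sub>H" "bgx \<otimes>\<^sub>H bgx = \<zero>\<^sub>H"
  by (cases b; simp add: H4_mult_single H4_neg H4_fields(2))+

lemma H4_tensor_eq: "tensor k (h4_algebra k) (h4_algebra k) = tensor k H H" "pure k (h4_algebra k) (h4_algebra k) = pure k H H"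
  by (simp_all add: H4_def Let_def)

definition h4_comult where
  "h4_comult b = (case b of B1 => pure k H H b1 b1 | Bg => pure k H H bg bg
     | Bx => pure k H H bx b1 \<oplus>\<^bsub>tensor k H H\<^esub> pure k H H bg bx
     | Bgx => pure k H H bgx bg \<oplus>\<^bsub>tensor k H H\<^esub> pure k H H b1 bgx)"

lemma h4_comult_closed [simp]: "h4_comult b \<in> carrier (tensor k H H)"
  by (cases b) (auto simp: h4_comult_def)

lemma H4_comult:
  assumes "u \<in> carrier H"
  shows "comult H u = h4_ext (tensor k H H) h4_comult u"
proof -
  have "h4_comult_basis k b = h4_comult b" for b
    by (cases b) (auto simp: h4_comult_def H4_tensor_eq)
  then have "comult H u = (\<Oplus>\<^bsub>tensor k H H\<^esub>b \<in> UNIV. u b \<odot>\<^bsub>tensor k H H\<^esub> h4_comult b)"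
    unfolding H4_tensor_eq [symmetric] by (simp add: H4_def Let_def)
  also have "\<dots> = h4_ext (tensor k H H) h4_comult u" by (rule h4_ext_sum) (use assms in auto)
  finally show ?thesis .
qed

lemma H4_comult_single: "comult H (single k b) = h4_comult b"
  by (simp add: H4_comult h4_ext_linear)

lemma H4_counit: "counit H u = u B1 \<oplus> u Bg"
  by (simp add: H4_def Let_def)

lemma H4_coord_lin: "(\<lambda>u. u b) \<in> lin H (self_module k)"
  by (rule lin_mapsI) (auto simp: H4_fields free_space_simps)

lemma H4_hopf_like [simp]: "hopf_like H"
proof -
  have "comult H \<in> lin H (tensor k H H)"
    by (rule lin_cong [OF h4_ext_linear(1) _ H4_comult]) auto
  moreover have "counit H \<in> lin H (self_module k)"
  proof -
    have "(\<lambda>u. u B1 \<oplus>\<^bsub>self_module k\<^esub> u Bg) \<in> lin H (self_module k)"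
      by (intro lin_plus H4_coord_lin module_self)
    then show ?thesis by (rule lin_cong) (auto simp: H4_counit)
  qed
  ultimately show ?thesis by (simp add: hopf_like_def)
qed

lemma H4_counit_single [simp]:
  "counit H b1 = \<one>" "counit H bg = \<one>" "counit H bx = \<zero>" "counit H bgx = \<zero>"
  by (simp_all add: H4_counit) (simp_all add: single_def)

lemma H4_sweedler:
  assumes "module k U" "bilin H H U \<beta>"
  shows "sweedler k H U \<beta> b1 = \<beta> b1 b1" "sweedler k H U \<beta> bg = \<beta> bg bg"
    "sweedler k H U \<beta> bx = \<beta> bx b1 \<oplus>\<^sub>U \<beta> bg bx"
    "sweedler k H U \<beta> bgx = \<beta> bgx bg \<oplus>\<^sub>U \<beta> b1 bgx"
  unfolding sweedler_def H4_comult_single h4_comult_def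
  using assms by (simp_all add: tensor_lift_add tensor_lift_pure)

section \<open>The endomorphism algebra of a vector space\<close>

text \<open>Operators are restricted to the carrier so that equality of operators is pointwise
  equality on it. This algebra receives the representation that proves linear independence.\<close>

definition End_alg :: "('k, 'v, 'n) module_scheme => ('k, 'v => 'v) module" where
  "End_alg V = \<lparr>carrier = lin V V \<inter> extensional (carrier V),
     monoid.mult = (\<lambda>f h. \<lambda>x\<in>carrier V. f (h x)), one = (\<lambda>x\<in>carrier V. x), zero = (\<lambda>x\<in>carrier V. \<zero>\<^sub>V),
     add = (\<lambda>f h. \<lambda>x\<in>carrier V. f x \<oplus>\<^sub>V h x), smult = (\<lambda>c f. \<lambda>x\<in>carrier V. c \<odot>\<^sub>V f x)\<rparr>"

lemma restrict_lin:
  assumes "module k V" "f \<in> lin V W"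
  shows "restrict f (carrier V) \<in> lin V W"
  by (rule lin_cong [OF assms(2,1)]) simp

lemma End_carrierI: "module k V ==> f \<in> lin V V ==> restrict f (carrier V) \<in> carrier (End_alg V)"
  by (simp add: End_alg_def restrict_lin)

lemma End_eqI:
  assumes "f \<in> carrier (End_alg V)" "h \<in> carrier (End_alg V)" "\<And>x. x \<in> carrier V ==> f x = h x"
  shows "f = h"
  using assms by (auto simp: End_alg_def intro: extensionalityI)

lemma End_apply:
  "x \<in> carrier V ==> (f \<otimes>\<^bsub>End_alg V\<^esub> h) x = f (h x)" "x \<in> carrier V ==> \<one>\<^bsub>End_alg V\<^esub> x = x"
  "x \<in> carrier V ==> (f \<oplus>\<^bsub>End_alg V\<^esub> h) x = f x \<oplus>\<^sub>V h x" "x \<in> carrier V ==> \<zero>\<^bsub>End_alg V\<^esub> x = \<zero>\<^sub>V"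
  "x \<in> carrier V ==> (c \<odot>\<^bsub>End_alg V\<^esub> f) x = c \<odot>\<^sub>V f x"
  by (simp_all add: End_alg_def)

lemma End_lin: "f \<in> carrier (End_alg V) ==> f \<in> lin V V"
  by (simp add: End_alg_def)

lemma End_kalg:
  assumes V: "module k V"
  shows "k_algebra k (End_alg V)"
proof (rule k_algebraI)
  have add: "f \<oplus>\<^bsub>End_alg V\<^esub> h \<in> carrier (End_alg V)" if "f \<in> carrier (End_alg V)" "h \<in> carrier (End_alg V)" for f h
    using End_carrierI [OF V lin_plus [OF V End_lin [OF that(1)] End_lin [OF that(2)]]] by (simp add: End_alg_def)
  have smult: "c \<odot>\<^bsub>End_alg V\<^esub> f \<in> carrier (End_alg V)" if "c \<in> carrier k" "f \<in> carrier (End_alg V)" for c f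
    using End_carrierI [OF V lin_smult_left [OF V End_lin [OF that(2)] that(1)]] by (simp add: End_alg_def)
  have mult: "f \<otimes>\<^bsub>End_alg V\<^esub> h \<in> carrier (End_alg V)" if "f \<in> carrier (End_alg V)" "h \<in> carrier (End_alg V)" for f h
    using End_carrierI [OF V lin_comp [OF End_lin [OF that(1)] End_lin [OF that(2)]]] by (simp add: End_alg_def)
  have zero: "\<zero>\<^bsub>End_alg V\<^esub> \<in> carrier (End_alg V)"
    using End_carrierI [OF V lin_const_zero [OF V, of V]] by (simp add: End_alg_def)
  have one: "\<one>\<^bsub>End_alg V\<^esub> \<in> carrier (End_alg V)"
    using End_carrierI [OF V lin_id] by (simp add: End_alg_def)
  note c = lin_closed [OF End_lin]
  have M: "module k (End_alg V)"
  proof (rule moduleI [OF is_cring abelian_groupI])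
    fix f assume f: "f \<in> carrier (End_alg V)"
    show "\<exists>h \<in> carrier (End_alg V). h \<oplus>\<^bsub>End_alg V\<^esub> f = \<zero>\<^bsub>End_alg V\<^esub>"
    proof
      show n: "(\<ominus> \<one>) \<odot>\<^bsub>End_alg V\<^esub> f \<in> carrier (End_alg V)" by (rule smult [OF _ f]) simp
      show "(\<ominus> \<one>) \<odot>\<^bsub>End_alg V\<^esub> f \<oplus>\<^bsub>End_alg V\<^esub> f = \<zero>\<^bsub>End_alg V\<^esub>"
        by (rule End_eqI [OF add [OF n f] zero]) (use V c [OF f] in \<open>simp add: End_apply vsmult_neg_left\<close>)
    qed
  qed (use add smult zero V in \<open>auto intro!: End_eqI [where V = V] simp: End_apply c vac vsmult_add vsmult_add_left vsmult_assoc\<close>)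
  have "(\<lambda>h. f \<otimes>\<^bsub>End_alg V\<^esub> h) \<in> lin (End_alg V) (End_alg V)" if f: "f \<in> carrier (End_alg V)" for f
    by (intro lin_mapsI End_eqI [where V = V])
      (use f mult add smult V in \<open>auto simp: End_apply c lin_add [OF End_lin [OF f]] lin_smult [OF End_lin [OF f]]\<close>)
  moreover have "(\<lambda>f. f \<otimes>\<^bsub>End_alg V\<^esub> h) \<in> lin (End_alg V) (End_alg V)" if h: "h \<in> carrier (End_alg V)" for h
    by (intro lin_mapsI End_eqI [where V = V])
      (use h mult add smult V in \<open>auto simp: End_apply c\<close>)
  ultimately show "na_algebra (End_alg V)"
    unfolding na_algebra_def using M one by (auto intro!: bilinI)
  show "(f \<otimes>\<^bsub>End_alg V\<^esub> h) \<otimes>\<^bsub>End_alg V\<^esub> l = f \<otimes>\<^bsub>End_alg V\<^esub> (h \<otimes>\<^bsub>End_alg V\<^esub> l)"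
    if "f \<in> carrier (End_alg V)" "h \<in> carrier (End_alg V)" "l \<in> carrier (End_alg V)" for f h l
    by (rule End_eqI [where V = V]) (use that mult in \<open>auto simp: End_apply c\<close>)
  show "\<one>\<^bsub>End_alg V\<^esub> \<otimes>\<^bsub>End_alg V\<^esub> f = f" "f \<otimes>\<^bsub>End_alg V\<^esub> \<one>\<^bsub>End_alg V\<^esub> = f" if "f \<in> carrier (End_alg V)" for f
    by (rule End_eqI [where V = V]; use that mult one in \<open>auto simp: End_apply c\<close>)+
qed

section \<open>Tensor products of Hopf algebras as coalgebras\<close>

text \<open>The interchange of the middle factors, (A \<otimes> A) \<otimes> (K \<otimes> K) -> (A
  \<otimes> K) \<otimes> (A \<otimes> K), as a bilinear map. The comultiplication of A \<otimes> K
  is \<open>quad\<close> after the two comultiplications.\<close>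

definition quad where
  "quad A K s t = (let U = tensor k A K; UU = tensor k U U in
     tlift UU (\<lambda>a1 a2. tlift UU (\<lambda>h1 h2.
       pure k U U (pure k A K a1 h1) (pure k A K a2 h2)) t) s)"

context
  fixes A :: "('k, 'a, 'n) hopf_scheme" and K :: "('k, 'h, 'o) hopf_scheme"
  assumes A: "hopf_like A" and K: "hopf_like K"
begin

private abbreviation "AK \<equiv> tensor k A K"
private abbreviation "AK2 \<equiv> tensor k AK AK"

private lemma factor_modules: "module k A" "module k K" "module k AK" "module k AK2"
  using hopf_like_simps(2) [OF A] hopf_like_simps(2) [OF K] by auto

lemma tensor_hopf_fields [simp]:
  "carrier (tensor_hopf k A K) = carrier AK" "add (tensor_hopf k A K) = add AK"
  "zero (tensor_hopf k A K) = zero AK" "smult (tensor_hopf k A K) = smult AK"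
  "one (tensor_hopf k A K) = one AK" "monoid.mult (tensor_hopf k A K) = monoid.mult AK"
  by (simp_all add: tensor_hopf_def Let_def)

private lemma quad_inner:
  "a1 \<in> carrier A ==> a2 \<in> carrier A ==>
    bilin K K AK2 (\<lambda>h1 h2. pure k AK AK (pure k A K a1 h1) (pure k A K a2 h2))"
  by (rule bilin_pure_map; use factor_modules in \<open>simp add: lin_pure_right\<close>)

private lemma quad_outer:
  assumes t: "t \<in> carrier (tensor k K K)"
  shows "bilin A A AK2 (\<lambda>a1 a2. tlift AK2 (\<lambda>h1 h2. pure k AK AK (pure k A K a1 h1) (pure k A K a2 h2)) t)"
  by (rule bilinI; rule lin_tensor_lift_param [OF factor_modules(2,2,4,1) t])
    (use factor_modules in \<open>simp_all add: quad_inner lin_pure_left lin_pure_right\<close>)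

lemma quad_bilin: "bilin (tensor k A A) (tensor k K K) AK2 (quad A K)"
proof (rule bilinI)
  fix t assume t: "t \<in> carrier (tensor k K K)"
  show "(\<lambda>s. quad A K s t) \<in> lin (tensor k A A) AK2"
    unfolding quad_def Let_def by (rule tensor_lift_linear [OF factor_modules(1,1,4) quad_outer [OF t]])
next
  fix s assume s: "s \<in> carrier (tensor k A A)"
  show "(\<lambda>t. quad A K s t) \<in> lin (tensor k K K) AK2"
    unfolding quad_def Let_def
    by (rule lin_tensor_lift_param [OF factor_modules(1,1,4) _ s quad_outer])
      (use factor_modules in \<open>simp_all add: tensor_lift_linear quad_inner\<close>)
qed

lemma quad_pure:
  assumes "a1 \<in> carrier A" "a2 \<in> carrier A" "h1 \<in> carrier K" "h2 \<in> carrier K"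
  shows "quad A K (pure k A A a1 a2) (pure k K K h1 h2) = pure k AK AK (pure k A K a1 h1) (pure k A K a2 h2)"
  unfolding quad_def Let_def
  using assms factor_modules by (simp add: tensor_lift_pure quad_outer quad_inner)

lemma tensor_hopf_comult:
  "comult (tensor_hopf k A K) = tlift AK2 (\<lambda>a h. quad A K (comult A a) (comult K h))"
  by (simp add: tensor_hopf_def Let_def quad_def sweedler_def)

lemma tensor_hopf_comult_bilin: "bilin A K AK2 (\<lambda>a h. quad A K (comult A a) (comult K h))"
  by (rule bilin_compose [OF quad_bilin hopf_like_simps(3) [OF A] hopf_like_simps(3) [OF K]])

lemma tensor_hopf_comult_pure:
  "a \<in> carrier A ==> h \<in> carrier K ==>
     comult (tensor_hopf k A K) (pure k A K a h) = quad A K (comult A a) (comult K h)"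
  unfolding tensor_hopf_comult
  by (rule tensor_lift_pure [OF factor_modules(1,2,4) tensor_hopf_comult_bilin])

lemma tensor_hopf_counit_bilin: "bilin A K (self_module k) (\<lambda>a h. counit A a \<otimes> counit K h)"
  using hopf_like_simps [OF A] hopf_like_simps [OF K]
  by (auto intro!: bilinI lin_mult_left lin_mult_right)

lemma tensor_hopf_counit_pure:
  "a \<in> carrier A ==> h \<in> carrier K ==>
     counit (tensor_hopf k A K) (pure k A K a h) = counit A a \<otimes> counit K h"
  unfolding tensor_hopf_def Let_def
  by (simp add: tensor_lift_pure [OF factor_modules(1,2) module_self tensor_hopf_counit_bilin])

lemma tensor_hopf_coalgebra:
  "comult (tensor_hopf k A K) \<in> lin AK AK2" "counit (tensor_hopf k A K) \<in> lin AK (self_module k)"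
  unfolding tensor_hopf_comult
  by (rule tensor_lift_linear [OF factor_modules(1,2,4) tensor_hopf_comult_bilin])
    (simp add: tensor_hopf_def Let_def tensor_lift_linear [OF factor_modules(1,2) module_self tensor_hopf_counit_bilin])

text \<open>Replacing the product leaves the linear structure alone, so tensor spaces formed over
  the new record are those of A \<otimes> K.\<close>

lemma tensor_hopf_mult_pure:
  fixes m
  defines "C \<equiv> (tensor_hopf k A K)\<lparr>mult := m\<rparr>"
  shows "same_module AK C" "pure k C C = pure k AK AK" "tensor_space k C C = tensor_space k AK AK"
    "lin U (tensor k C C) = lin U AK2"
    "carrier (tensor k C C) = carrier AK2" "add (tensor k C C) = add AK2" "module k C"
proof -
  show s: "same_module AK C" by (simp add: C_def same_module_def)
  show e: "pure k C C = pure k AK AK" "tensor_space k C C = tensor_space k AK AK"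
    using tensor_space_cong [OF same_module_sym [OF s] same_module_sym [OF s]] by auto
  show "lin U (tensor k C C) = lin U AK2"
    "carrier (tensor k C C) = carrier AK2" "add (tensor k C C) = add AK2"
    by (simp_all add: lin_maps_def tensor_simps e)
  show "module k C" by (rule module_cong [OF factor_modules(3) s])
qed

lemma tensor_hopf_mult_hopf_like:
  assumes "bilin AK AK AK m"
  shows "hopf_like ((tensor_hopf k A K)\<lparr>mult := m\<rparr>)"
proof -
  note s = tensor_hopf_mult_pure [where m = m]
  have l: "lin ((tensor_hopf k A K)\<lparr>mult := m\<rparr>) U = lin AK U" for U
    by (rule lin_maps_same_module [OF same_module_sym [OF s(1)]]) (simp add: same_module_def)
  have l': "lin U ((tensor_hopf k A K)\<lparr>mult := m\<rparr>) = lin U AK" for U :: "('k, 'z, 'y) module_scheme"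
    by (rule lin_maps_same_module [OF _ same_module_sym [OF s(1)]]) (simp add: same_module_def)
  have one: "\<one>\<^sub>A \<in> carrier A" "\<one>\<^sub>K \<in> carrier K"
    using hopf_like_simps(1) [OF A] hopf_like_simps(1) [OF K] by (auto intro: na_one)
  have "na_algebra ((tensor_hopf k A K)\<lparr>mult := m\<rparr>)"
    unfolding na_algebra_def using s(7) assms one factor_modules
    by (auto simp: bilin_def lin_maps_def tensor_simps(5))
  then show ?thesis
    unfolding hopf_like_def s(4) l using tensor_hopf_coalgebra by simp
qed

end

lemma PA_hopf_like [simp]: "hopf_like PA"
  by (rule hopf_like_hopf [OF PA_hopf])

section \<open>The space k[Y] \<otimes> H and operators on it\<close>

abbreviation "V0 \<equiv> tensor k PA H"

lemma V0_lin_eqI: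
  assumes "\<phi> \<in> lin V0 U" "\<psi> \<in> lin V0 U"
    "\<And>q b. q \<in> carrier PA ==> \<phi> (pure k PA H q (single k b)) = \<psi> (pure k PA H q (single k b))" "t \<in> carrier V0"
  shows "\<phi> t = \<psi> t"
proof (rule tensor_lin_eqI [OF kalg_module [OF PA_kalg] H4_module assms(1,2) _ assms(4)])
  fix q u assume q: "q \<in> carrier PA" and u: "u \<in> carrier H"
  have l: "pure k PA H q \<in> lin H V0" by (rule bilin_lin(1) [OF bilin_pure]) (use q in auto)
  show "\<phi> (pure k PA H q u) = \<psi> (pure k PA H q u)"
    by (rule H4_lin_eqI [OF lin_comp [OF assms(1) l] lin_comp [OF assms(2) l] assms(3) u]) (rule q)
qed

lemma V0_bilin_eqI:
  assumes "bilin V0 V0 U \<beta>" "bilin V0 V0 U \<beta>'"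
    "\<And>q a r b. q \<in> carrier PA ==> r \<in> carrier PA ==>
       \<beta> (pure k PA H q (single k a)) (pure k PA H r (single k b)) = \<beta>' (pure k PA H q (single k a)) (pure k PA H r (single k b))"
    "s \<in> carrier V0" "t \<in> carrier V0"
  shows "\<beta> s t = \<beta>' s t"
proof (rule V0_lin_eqI [where \<phi> = "\<lambda>s. \<beta> s t" and \<psi> = "\<lambda>s. \<beta>' s t", OF bilin_lin(2) [OF assms(1,5)] bilin_lin(2) [OF assms(2,5)] _ assms(4)])
  fix q a assume q: "q \<in> carrier PA"
  have p: "pure k PA H q (single k a) \<in> carrier V0" using q by simp
  show "\<beta> (pure k PA H q (single k a)) t = \<beta>' (pure k PA H q (single k a)) t"
    by (rule V0_lin_eqI [OF bilin_lin(1) [OF assms(1) p] bilin_lin(1) [OF assms(2) p] assms(3)[OF q] assms(5)])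
qed

lemma peval_commute:
  assumes B: "k_algebra k B" and y: "y \<in> carrier B" and z: "z \<in> carrier B" and zy: "z \<otimes>\<^sub>B y = y \<otimes>\<^sub>B z"
    and q: "q \<in> carrier PA"
  shows "z \<otimes>\<^sub>B peval B y q = peval B y q \<otimes>\<^sub>B z"
proof -
  note e = peval_hom(1) [OF B y]
  have l: "(\<lambda>q. z \<otimes>\<^sub>B peval B y q) \<in> lin PA B" "(\<lambda>q. peval B y q \<otimes>\<^sub>B z) \<in> lin PA B"
    using B z alg_hom_lin [OF e] by (auto intro: lin_amult_right lin_amult_left)
  show ?thesis using q
  proof (induction q rule: PA_induct)
    case (single n)
    have "z \<otimes>\<^sub>B y [^]\<^bsub>B\<^esub> n = y [^]\<^bsub>B\<^esub> n \<otimes>\<^sub>B z"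
    proof (induction n)
      case (Suc n)
      have "z \<otimes>\<^sub>B (y [^]\<^bsub>B\<^esub> n \<otimes>\<^sub>B y) = (z \<otimes>\<^sub>B y [^]\<^bsub>B\<^esub> n) \<otimes>\<^sub>B y"
        using B y z by (simp add: amult_assoc)
      also have "\<dots> = (y [^]\<^bsub>B\<^esub> n \<otimes>\<^sub>B z) \<otimes>\<^sub>B y" by (simp add: Suc)
      also have "\<dots> = (y [^]\<^bsub>B\<^esub> n \<otimes>\<^sub>B y) \<otimes>\<^sub>B z"
        using B y z zy by (simp add: amult_assoc)
      finally show ?case by simp
    qed (use B z in simp)
    then show ?case by (simp add: peval_hom(2) [OF B y])
  next
    case (add q r)
    then show ?case unfolding lin_add [OF l(1) add(1,2)] lin_add [OF l(2) add(1,2)] by simp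
  next
    case (smult c q)
    then show ?case unfolding lin_smult [OF l(1) smult(1,2)] lin_smult [OF l(2) smult(1,2)] by simp
  qed
qed

text \<open>The part of a product of two basis elements that multiplies x^2 when the words in g and
  x are reduced; for example x (gx) = -g x^2.\<close>

definition h4_E where
  "h4_E a b = (case (a, b) of (Bx, Bx) => b1 | (Bx, Bgx) => \<ominus>\<^sub>H bg | (Bgx, Bx) => bg
     | (Bgx, Bgx) => \<ominus>\<^sub>H b1 | _ => \<zero>\<^sub>H)"

lemma h4_E_closed [simp]: "h4_E a b \<in> carrier H"
  by (cases a; cases b) (auto simp: h4_E_def)

text \<open>The operator on k[Y] \<otimes> H with prescribed values on the elements q \<otimes> b,
  where b runs through the basis of \<open>H\<close>.\<close>

definition OP where
  "OP \<gamma> = restrict (tlift V0 (\<lambda>q. h4_ext V0 (\<gamma> q))) (carrier V0)"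

lemma OP:
  assumes \<gamma>: "\<And>b. (\<lambda>q. \<gamma> q b) \<in> lin PA V0"
  shows "OP \<gamma> \<in> carrier (End_alg V0)"
    "q \<in> carrier PA ==> OP \<gamma> (pure k PA H q (single k b)) = \<gamma> q b"
proof -
  have c: "\<gamma> q b \<in> carrier V0" if "q \<in> carrier PA" for q b using lin_closed [OF \<gamma> that] .
  have b: "bilin PA H V0 (\<lambda>q. h4_ext V0 (\<gamma> q))"
    by (rule bilinI) (auto intro!: h4_ext_linear(1) h4_ext_param c \<gamma>)
  show "OP \<gamma> \<in> carrier (End_alg V0)"
    unfolding OP_def by (rule End_carrierI) (auto intro!: tensor_lift_linear b)
  show "q \<in> carrier PA ==> OP \<gamma> (pure k PA H q (single k b)) = \<gamma> q b"
    unfolding OP_def using c by (simp add: tensor_lift_pure b h4_ext_linear(2))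
qed

lemma End_V0_eqI:
  assumes "f \<in> carrier (End_alg V0)" "h \<in> carrier (End_alg V0)"
    "\<And>q b. q \<in> carrier PA ==> f (pure k PA H q (single k b)) = h (pure k PA H q (single k b))"
  shows "f = h"
  by (rule End_eqI [OF assms(1,2)], rule V0_lin_eqI [OF End_lin [OF assms(1)] End_lin [OF assms(2)] assms(3)])

lemma End_neg_apply:
  assumes V: "module k V" and f: "f \<in> carrier (End_alg V)" and x: "x \<in> carrier V"
  shows "(\<ominus>\<^bsub>End_alg V\<^esub> f) x = \<ominus>\<^sub>V f x"
proof -
  have "\<ominus>\<^bsub>End_alg V\<^esub> f = (\<ominus> \<one>) \<odot>\<^bsub>End_alg V\<^esub> f"
    using vsmult_neg_left [OF kalg_module [OF End_kalg [OF V]] one_closed f] End_kalg [OF V] f by simp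
  then show ?thesis
    using V x lin_closed [OF End_lin [OF f] x] by (simp add: End_apply vsmult_neg_left)
qed

end

context char_field
begin

section \<open>The comparison map from k[Y] \<otimes> H to the presented algebra\<close>

context
  fixes \<alpha> assumes \<alpha>: "\<alpha> \<in> fin_seqs k"
begin

private abbreviation "B \<equiv> A_hopf k p \<alpha>"
private abbreviation "y \<equiv> A_gen k p \<alpha> GenY"
private abbreviation "g \<equiv> A_gen k p \<alpha> Geng"
private abbreviation "x \<equiv> A_gen k p \<alpha> Genx"
private abbreviation "ev \<equiv> peval B y"
private abbreviation "P \<equiv> pp PA \<alpha> (single k 1)"
private abbreviation "pt \<equiv> pure k PA H"

private lemma BK [simp]: "k_algebra k B" "module k B" "na_algebra B"
  using AH_kalg [OF \<alpha>] by auto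

private lemma HB [simp]: "hopf_like B"
  by (rule hopf_like_hopf [OF AH_hopf [OF \<alpha>]])

private lemmas B_closed [simp] = AH_closed [OF \<alpha>]
private lemmas rels = AH_rel [OF \<alpha>, unfolded A_rel_def]

private lemma P_closed [simp]: "P \<in> carrier PA" using \<alpha> by simp

private lemma ev: "ev \<in> alg_hom PA B" by (rule peval_hom) auto

private lemmas evc [simp] = alg_hom_closed [OF ev]

private lemma ev_Y: "ev (single k 1) = y" by (simp add: peval_hom(2))

private lemma ev_P: "ev P = pp B \<alpha> y" by (rule peval_pp) (use \<alpha> in auto)

text \<open>Places the basis of \<open>H\<close> in the presented algebra. The map respects the
  coalgebra structure, but in general not products.\<close>

private definition "io = h4_ext B (\<lambda>b. case b of B1 => \<one>\<^sub>B | Bg => g | Bx => x | Bgx => g \<otimes>\<^sub>B x)"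

private lemma io_lin: "io \<in> lin H B"
  and io_single: "io b1 = \<one>\<^sub>B" "io bg = g" "io bx = x" "io bgx = g \<otimes>\<^sub>B x"
  unfolding io_def by (auto intro!: h4_ext_linear(1) simp: h4_ext_linear(2) split: h4_basis.splits)

private lemmas ioc [simp] = lin_closed [OF io_lin]
private lemma io_neg: "u \<in> carrier H ==> io (\<ominus>\<^sub>H u) = \<ominus>\<^sub>B io u"
  and io_zero: "io \<zero>\<^sub>H = \<zero>\<^sub>B"
  by (rule lin_neg [OF _ _ io_lin]; simp) (rule lin_zero [OF _ _ io_lin]; simp)

private lemma ev_comm:
  assumes q: "q \<in> carrier PA"
  shows "g \<otimes>\<^sub>B ev q = ev q \<otimes>\<^sub>B g" "x \<otimes>\<^sub>B ev q = ev q \<otimes>\<^sub>B x"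
  by (rule peval_commute; use rels q in auto)+

private lemma io_ev:
  assumes q: "q \<in> carrier PA" and u: "u \<in> carrier H"
  shows "io u \<otimes>\<^sub>B ev q = ev q \<otimes>\<^sub>B io u"
proof (rule H4_lin_eqI [OF _ _ _ u])
  show "(\<lambda>u. io u \<otimes>\<^sub>B ev q) \<in> lin H B" "(\<lambda>u. ev q \<otimes>\<^sub>B io u) \<in> lin H B"
    using q by (auto intro!: lin_amult_left lin_amult_right io_lin)
  fix b
  have "(g \<otimes>\<^sub>B x) \<otimes>\<^sub>B ev q = g \<otimes>\<^sub>B (ev q \<otimes>\<^sub>B x)" using q ev_comm by (simp add: amult_assoc)
  also have "\<dots> = (g \<otimes>\<^sub>B ev q) \<otimes>\<^sub>B x" using q by (simp add: amult_assoc)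
  also have "\<dots> = ev q \<otimes>\<^sub>B (g \<otimes>\<^sub>B x)" using q ev_comm by (simp add: amult_assoc)
  finally show "io (single k b) \<otimes>\<^sub>B ev q = ev q \<otimes>\<^sub>B io (single k b)"
    using q ev_comm by (cases b) (auto simp: io_single)
qed

text \<open>Reduction of a product of two words in g and x: the only deviation from \<open>H\<close>
  is x^2 = P, and it contributes the terms recorded by \<open>h4_E\<close>.\<close>

private lemma io_mult:
  "io (single k a) \<otimes>\<^sub>B io (single k b) =
     io (single k a \<otimes>\<^sub>H single k b) \<oplus>\<^sub>B ev P \<otimes>\<^sub>B io (h4_E a b)"
proof -
  have gg: "g \<otimes>\<^sub>B g = \<one>\<^sub>B" and xx: "x \<otimes>\<^sub>B x = ev P" and xg: "x \<otimes>\<^sub>B g = \<ominus>\<^sub>B (g \<otimes>\<^sub>B x)"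
    using rels by (auto simp: ev_P)
  have gg': "g \<otimes>\<^sub>B (g \<otimes>\<^sub>B z) = z" if "z \<in> carrier B" for z
    using that gg by (simp add: amult_assoc [symmetric])
  have xg': "x \<otimes>\<^sub>B (g \<otimes>\<^sub>B z) = \<ominus>\<^sub>B (g \<otimes>\<^sub>B (x \<otimes>\<^sub>B z))" if "z \<in> carrier B" for z
    using that xg by (simp add: amult_assoc [symmetric] amult_neg_left)
  have gP: "g \<otimes>\<^sub>B ev P = ev P \<otimes>\<^sub>B g" by (rule ev_comm) simp
  have gP': "g \<otimes>\<^sub>B (ev P \<otimes>\<^sub>B z) = ev P \<otimes>\<^sub>B (g \<otimes>\<^sub>B z)" if "z \<in> carrier B" for z
    using that gP by (simp add: amult_assoc [symmetric])
  show ?thesis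
    by (cases a; cases b)
      (simp_all add: io_single h4_E_def io_neg io_zero gg xx xg gg' xg' gP gP' amult_assoc amult_neg_left amult_neg_right)
qed

text \<open>The map q \<otimes> u -> q(Y) u; its injectivity is the linear independence of the
  reduced words.\<close>

definition "Th = tlift (A_hopf k p \<alpha>) (\<lambda>q u. peval (A_hopf k p \<alpha>) (A_gen k p \<alpha> GenY) q \<otimes>\<^bsub>A_hopf k p \<alpha>\<^esub> io u)"

private lemma Th_bilin: "bilin PA H B (\<lambda>q u. ev q \<otimes>\<^sub>B io u)"
  by (rule bilin_hom_mult) (auto intro: alg_hom_lin [OF ev] io_lin)

private lemma Th_lin: "Th \<in> lin V0 B"
  unfolding Th_def by (rule tensor_lift_linear [OF _ _ _ Th_bilin]) auto

private lemma Th_pure: "q \<in> carrier PA ==> u \<in> carrier H ==> Th (pt q u) = ev q \<otimes>\<^sub>B io u"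
  unfolding Th_def by (rule tensor_lift_pure [OF _ _ _ Th_bilin]) auto

lemma Th_values:
  "q \<in> carrier PA ==> Th (pure k PA H q b1) = peval (A_hopf k p \<alpha>) (A_gen k p \<alpha> GenY) q"
  "Th (pure k PA H \<one>\<^sub>PA bg) = A_gen k p \<alpha> Geng" "Th (pure k PA H \<one>\<^sub>PA bx) = A_gen k p \<alpha> Genx"
  "q \<in> carrier PA ==> r \<in> carrier PA ==> u \<in> carrier H ==>
     peval (A_hopf k p \<alpha>) (A_gen k p \<alpha> GenY) q \<otimes>\<^bsub>A_hopf k p \<alpha>\<^esub> Th (pure k PA H r u) = Th (pure k PA H (q \<otimes>\<^sub>PA r) u)"
  by (simp_all add: Th_pure io_single alg_hom_one [OF ev] alg_hom_mult [OF ev] amult_assoc)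

subsection \<open>Linear independence\<close>

text \<open>The generators act on the tensor product of the polynomial algebra and \<open>H\<close> by operators that satisfy
  the relations; applying the resulting representation to the unit gives an inverse of \<open>Th\<close>.\<close>

private abbreviation "EV \<equiv> End_alg V0"
private definition "OM r = OP (\<lambda>q b. pt (r \<otimes>\<^sub>PA q) (single k b))"
private definition "Og = OP (\<lambda>q b. pt q (bg \<otimes>\<^sub>H single k b))"
text \<open>Left multiplication by x on the expected basis: the rules x g = -gx, x x = P and x (gx)
  = -P g dictate the four values.\<close>

private definition "Ox = OP (\<lambda>q b. case b of B1 => pt q bx | Bg => \<ominus>\<^sub>V0 pt q bgx
   | Bx => pt (P \<otimes>\<^sub>PA q) b1 | Bgx => \<ominus>\<^sub>V0 pt (P \<otimes>\<^sub>PA q) bg)"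

private lemma EK [simp]: "k_algebra k EV" by (rule End_kalg) simp

private lemma OM: "r \<in> carrier PA ==> OM r \<in> carrier EV"
    "r \<in> carrier PA ==> q \<in> carrier PA ==> OM r (pt q (single k b)) = pt (r \<otimes>\<^sub>PA q) (single k b)"
  unfolding OM_def
  by (rule OP; simp add: lin_pure_left lin_amult_right)+

private lemma Og: "Og \<in> carrier EV" "q \<in> carrier PA ==> Og (pt q (single k b)) = pt q (bg \<otimes>\<^sub>H single k b)"
  unfolding Og_def
  by (rule OP; simp add: lin_pure_left na_mult_closed [OF H4_na])+

private lemma Ox: "Ox \<in> carrier EV"
   "q \<in> carrier PA ==> Ox (pt q (single k b)) = (case b of B1 => pt q bx | Bg => \<ominus>\<^sub>V0 pt q bgx
   | Bx => pt (P \<otimes>\<^sub>PA q) b1 | Bgx => \<ominus>\<^sub>V0 pt (P \<otimes>\<^sub>PA q) bg)"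
proof -
  have "(\<lambda>q. case b of B1 => pt q bx | Bg => \<ominus>\<^sub>V0 pt q bgx
   | Bx => pt (P \<otimes>\<^sub>PA q) b1 | Bgx => \<ominus>\<^sub>V0 pt (P \<otimes>\<^sub>PA q) bg) \<in> lin PA V0" for b
    by (cases b) (simp_all add: lin_pure_left lin_uminus lin_amult_right)
  note O = OP [where \<gamma> = "\<lambda>q b. case b of B1 => pt q bx | Bg => \<ominus>\<^sub>V0 pt q bgx
   | Bx => pt (P \<otimes>\<^sub>PA q) b1 | Bgx => \<ominus>\<^sub>V0 pt (P \<otimes>\<^sub>PA q) bg", OF this]
  show "Ox \<in> carrier EV" unfolding Ox_def by (rule O(1))
  show "q \<in> carrier PA ==> Ox (pt q (single k b)) = (case b of B1 => pt q bx | Bg => \<ominus>\<^sub>V0 pt q bgx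
   | Bx => pt (P \<otimes>\<^sub>PA q) b1 | Bgx => \<ominus>\<^sub>V0 pt (P \<otimes>\<^sub>PA q) bg)"
    unfolding Ox_def by (rule O(2))
qed

private lemma O_neg: "f \<in> carrier EV ==> t \<in> carrier V0 ==> f (\<ominus>\<^sub>V0 t) = \<ominus>\<^sub>V0 f t"
  by (rule lin_neg [OF _ _ End_lin]) simp_all

private lemma OM_hom: "OM \<in> alg_hom PA EV"
proof (rule alg_homI, rule lin_mapsI)
  show "OM \<one>\<^sub>PA = \<one>\<^sub>EV"
    by (rule End_V0_eqI) (auto simp: OM End_apply)
  show "OM (q \<otimes>\<^sub>PA r) = OM q \<otimes>\<^sub>EV OM r" if "q \<in> carrier PA" "r \<in> carrier PA" for q r
    by (rule End_V0_eqI) (use that in \<open>auto simp: OM End_apply amult_assoc\<close>)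
  show "OM (q \<oplus>\<^sub>PA r) = OM q \<oplus>\<^sub>EV OM r" if "q \<in> carrier PA" "r \<in> carrier PA" for q r
    by (rule End_V0_eqI) (use that in \<open>auto simp: OM End_apply amult_add_left pure_add_left\<close>)
  show "OM (c \<odot>\<^sub>PA r) = c \<odot>\<^sub>EV OM r" if "c \<in> carrier k" "r \<in> carrier PA" for c r
    by (rule End_V0_eqI) (use that in \<open>auto simp: OM End_apply asmult_left pure_smult_left\<close>)
qed (rule OM)

private lemma O_rel: "A_rel \<alpha> EV (OM (single k 1)) Og Ox"
proof -
  let ?Y = "single k 1"
  have pp: "pp EV \<alpha> (OM ?Y) = OM P"
    using pp_alg_hom [OF PA_kalg EK OM_hom PA_single_closed \<alpha>, of 1] by simp
  have c: "Og \<in> carrier EV" "Ox \<in> carrier EV" "OM ?Y \<in> carrier EV" "OM P \<in> carrier EV"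
    by (auto simp: Og Ox OM)
  have lc: "P \<otimes>\<^sub>PA (?Y \<otimes>\<^sub>PA q) = ?Y \<otimes>\<^sub>PA (P \<otimes>\<^sub>PA q)" if "q \<in> carrier PA" for q
    using that PA_comm [of P ?Y] by (simp add: amult_assoc [symmetric])
  have E1: "Og \<otimes>\<^sub>EV Og = \<one>\<^sub>EV"
  proof (rule End_V0_eqI)
    fix q b assume "q \<in> carrier PA"
    then show "(Og \<otimes>\<^sub>EV Og) (pt q (single k b)) = \<one>\<^sub>EV (pt q (single k b))"
      by (cases b) (simp_all add: Og End_apply)
  qed (use c in simp_all)
  have E2: "Ox \<otimes>\<^sub>EV Ox = OM P"
  proof (rule End_V0_eqI)
    fix q b assume "q \<in> carrier PA"
    then show "(Ox \<otimes>\<^sub>EV Ox) (pt q (single k b)) = OM P (pt q (single k b))"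
      using c by (cases b) (simp_all add: Ox(2) OM(2) End_apply O_neg)
  qed (use c in simp_all)
  have E3: "Ox \<otimes>\<^sub>EV Og = \<ominus>\<^sub>EV (Og \<otimes>\<^sub>EV Ox)"
  proof (rule End_V0_eqI)
    fix q b assume "q \<in> carrier PA"
    then show "(Ox \<otimes>\<^sub>EV Og) (pt q (single k b)) = (\<ominus>\<^sub>EV (Og \<otimes>\<^sub>EV Ox)) (pt q (single k b))"
      using c by (cases b) (simp_all add: Ox(2) Og(2) End_apply End_neg_apply O_neg)
  qed (use c in simp_all)
  have E4: "Og \<otimes>\<^sub>EV OM ?Y = OM ?Y \<otimes>\<^sub>EV Og"
  proof (rule End_V0_eqI)
    fix q b assume "q \<in> carrier PA"
    then show "(Og \<otimes>\<^sub>EV OM ?Y) (pt q (single k b)) = (OM ?Y \<otimes>\<^sub>EV Og) (pt q (single k b))"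
      by (cases b) (simp_all add: Og(2) OM(2) End_apply)
  qed (use c in simp_all)
  have E5: "Ox \<otimes>\<^sub>EV OM ?Y = OM ?Y \<otimes>\<^sub>EV Ox"
  proof (rule End_V0_eqI)
    fix q b assume "q \<in> carrier PA"
    then show "(Ox \<otimes>\<^sub>EV OM ?Y) (pt q (single k b)) = (OM ?Y \<otimes>\<^sub>EV Ox) (pt q (single k b))"
      using c by (cases b) (simp_all add: Ox(2) OM(2) End_apply O_neg lc)
  qed (use c in simp_all)
  show ?thesis unfolding A_rel_def pp using c E1 E2 E3 E4 E5 by simp
qed

private definition "rep = A_lift EV (OM (single k 1)) Og Ox"

private lemma rep: "rep \<in> alg_hom B EV" "rep y = OM (single k 1)" "rep g = Og" "rep x = Ox"
  unfolding rep_def by (rule A_lift [OF \<alpha> EK O_rel])+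

definition "Xi z = rep z (pure k PA H \<one>\<^sub>PA b1)"

lemma Xi_lin: "Xi \<in> lin (A_hopf k p \<alpha>) V0"
proof (rule lin_mapsI)
  fix z assume z: "z \<in> carrier B"
  show "Xi z \<in> carrier V0"
    unfolding Xi_def using lin_closed [OF End_lin [OF alg_hom_closed [OF rep(1) z]]] by simp
qed (auto simp: Xi_def alg_hom_add [OF rep(1)] alg_hom_smult [OF rep(1)] End_apply)

lemma Xi_Th:
  assumes t: "t \<in> carrier V0"
  shows "Xi (Th t) = t"
proof (rule V0_lin_eqI [OF lin_comp [OF Xi_lin Th_lin] lin_id _ t])
  fix q b assume q: "q \<in> carrier PA"
  \<comment> \<open>Two algebra maps on k[Y] that agree on Y. It remains that the operator of each
    basis element of \<open>H\<close> sends the unit vector to that basis element.\<close>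
  have "rep (ev q) = OM q"
    by (rule generates_alg_hom_eq [OF PA_kalg EK PA_generates alg_hom_comp [OF rep(1) ev] OM_hom _ q])
      (simp add: ev_Y rep)
  moreover have "rep (io (single k b)) (pt \<one>\<^sub>PA b1) = pt \<one>\<^sub>PA (single k b)"
    by (cases b) (simp_all add: io_single rep alg_hom_one [OF rep(1)] alg_hom_mult [OF rep(1)] End_apply Og Ox)
  ultimately show "Xi (Th (pt q (single k b))) = pt q (single k b)"
    using q by (simp add: Xi_def Th_pure alg_hom_mult [OF rep(1)] End_apply OM)
qed

subsection \<open>The comparison map with crossed products\<close>

context
  fixes m
  assumes m: "bilin V0 V0 V0 m"
    and mf: "\<And>q r a b. q \<in> carrier PA ==> r \<in> carrier PA ==>
      m (pure k PA H q (single k a)) (pure k PA H r (single k b)) =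
        pure k PA H (q \<otimes>\<^sub>PA r) (single k a \<otimes>\<^sub>H single k b) \<oplus>\<^sub>V0
        pure k PA H ((q \<otimes>\<^sub>PA r) \<otimes>\<^sub>PA pp PA \<alpha> (single k 1)) (h4_E a b)"
begin

private abbreviation "C \<equiv> (tensor_hopf k PA H)\<lparr>mult := m\<rparr>"

text \<open>The formula for \<open>m\<close> is met by the crossed product with f(x, x) = P_\<alpha>
  (\<open>cocycle_mult\<close>) and, for \<alpha> = 0, by the tensor product algebra
  (\<open>tensor_Aut\<close>). As polynomials in Y commute with g and x, it matches
  \<open>io_mult\<close>.\<close>

lemma Th_mult:
  assumes s: "s \<in> carrier V0" and t: "t \<in> carrier V0"
  shows "Th (m s t) = Th s \<otimes>\<^bsub>A_hopf k p \<alpha>\<^esub> Th t"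
proof (rule V0_bilin_eqI [OF bilin_post [OF m Th_lin] bilin_hom_mult [OF _ Th_lin Th_lin] _ s t])
  fix q a r b assume q: "q \<in> carrier PA" and r: "r \<in> carrier PA"
  have c: "single k a \<otimes>\<^sub>H single k b \<in> carrier H" by (rule na_mult_closed) auto
  have "(ev q \<otimes>\<^sub>B io (single k a)) \<otimes>\<^sub>B (ev r \<otimes>\<^sub>B io (single k b)) =
     ev q \<otimes>\<^sub>B ((io (single k a) \<otimes>\<^sub>B ev r) \<otimes>\<^sub>B io (single k b))"
    using q r by (simp add: amult_assoc)
  also have "\<dots> = (ev q \<otimes>\<^sub>B ev r) \<otimes>\<^sub>B (io (single k a) \<otimes>\<^sub>B io (single k b))"
    using q r by (simp add: amult_assoc io_ev)
  also have "\<dots> = Th (m (pt q (single k a)) (pt r (single k b)))"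
    using q r c by (simp add: io_mult mf lin_add [OF Th_lin] Th_pure alg_hom_mult [OF ev] amult_add_right amult_assoc)
  finally show "Th (m (pt q (single k a)) (pt r (single k b))) = Th (pt q (single k a)) \<otimes>\<^sub>B Th (pt r (single k b))"
    using q r by (simp add: Th_pure)
qed simp

private lemma Th_one: "Th \<one>\<^sub>V0 = \<one>\<^sub>B"
  by (simp add: tensor_simps(5) H4_fields(5) Th_pure io_single alg_hom_one [OF ev])

text \<open>The image is closed under products by \<open>Th_mult\<close> and contains the three
  generators, hence is everything; \<open>Xi\<close> is a left inverse.\<close>

lemma Th_bij: "bij_betw Th (carrier V0) (carrier (A_hopf k p \<alpha>))"
proof -
  have "subalg (Th ` carrier V0) B"
    unfolding subalg_def
  proof (intro conjI ballI)
    show "submodule (Th ` carrier V0) k B"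
    proof (rule submoduleI')
      show "\<zero>\<^sub>B \<in> Th ` carrier V0"
        using lin_zero [OF _ _ Th_lin] by (intro image_eqI [of _ _ "\<zero>\<^sub>V0"]) auto
      show "a \<oplus>\<^sub>B b \<in> Th ` carrier V0" if "a \<in> Th ` carrier V0" "b \<in> Th ` carrier V0" for a b
        using that by (auto simp: lin_add [OF Th_lin, symmetric])
      show "c \<odot>\<^sub>B b \<in> Th ` carrier V0" if "c \<in> carrier k" "b \<in> Th ` carrier V0" for c b
        using that by (auto simp: lin_smult [OF Th_lin, symmetric])
    qed (auto simp: lin_closed [OF Th_lin])
    show "\<one>\<^sub>B \<in> Th ` carrier V0"
      using Th_one by (intro image_eqI [of _ _ "\<one>\<^sub>V0"]) (auto simp: tensor_simps(5) H4_fields(5))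
    fix a b assume "a \<in> Th ` carrier V0" "b \<in> Th ` carrier V0"
    then show "a \<otimes>\<^sub>B b \<in> Th ` carrier V0"
      by (auto simp: Th_mult [symmetric] bilin_closed [OF m])
  qed
  moreover have "{y, g, x} \<subseteq> Th ` carrier V0"
  proof -
    have "Th (pt (single k 1) b1) = y" "Th (pt \<one>\<^sub>PA bg) = g" "Th (pt \<one>\<^sub>PA bx) = x"
      by (simp_all add: Th_pure io_single ev_Y alg_hom_one [OF ev])
    then show ?thesis by (auto intro: image_eqI [OF sym])
  qed
  ultimately have "carrier B \<subseteq> Th ` carrier V0"
    using AH_generates [OF \<alpha>] unfolding generates_def by blast
  moreover have "inj_on Th (carrier V0)" by (rule inj_on_inverseI [where g = Xi]) (rule Xi_Th)
  ultimately show ?thesis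
    using lin_closed [OF Th_lin] by (auto simp: bij_betw_def)
qed

private lemma ev_hopf: "ev \<in> hopf_hom k PA B"
proof (rule hopf_hom_from_generators [OF PA_bialgebra AH_bialgebra [OF \<alpha>] PA_generates ev])
  fix h assume h: "h \<in> {single k (1::nat)}"
  have b: "bilin PA PA (tensor k B B) (\<lambda>h1 h2. pure k B B (ev h1) (ev h2))"
    by (rule bilin_pure_map) (auto intro: alg_hom_lin [OF ev])
  show "sweedler k PA (tensor k B B) (\<lambda>h1 h2. pure k B B (ev h1) (ev h2)) h = comult B (ev h)"
    using h AH_comult_Y [OF \<alpha>]
    by (simp add: sweedler_def PA_comult_Y tensor_lift_add b tensor_lift_pure ev_Y alg_hom_one [OF ev])
  show "counit B (ev h) = counit PA h"
    using h AH_counit_Y [OF \<alpha>] by (simp add: ev_Y PA_counit_vals)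
qed

private lemma io_comult:
  assumes u: "u \<in> carrier H"
  shows "sweedler k H (tensor k B B) (\<lambda>h1 h2. pure k B B (io h1) (io h2)) u = comult B (io u)"
    "counit B (io u) = counit H u"
proof -
  have bi: "bilin H H (tensor k B B) (\<lambda>h1 h2. pure k B B (io h1) (io h2))"
    by (rule bilin_pure_map) (auto intro: io_lin)
  note \<Delta> = AH_comult_hom [OF \<alpha>] and \<epsilon> = AH_counit_hom [OF \<alpha>]
  have TB: "module k (tensor k B B)" "k_algebra k (tensor k B B)" by auto
  note vals = AH_comult_g [OF \<alpha>] AH_comult_x [OF \<alpha>] alg_hom_one [OF \<Delta>] alg_hom_mult [OF \<Delta>] tensor_simps(5)
  have gg: "g \<otimes>\<^sub>B g = \<one>\<^sub>B" using rels by blast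
  show "sweedler k H (tensor k B B) (\<lambda>h1 h2. pure k B B (io h1) (io h2)) u = comult B (io u)"
  proof (rule H4_lin_eqI [OF sweedler_linear [OF H4_hopf_like TB(1) bi] lin_comp [OF alg_hom_lin [OF \<Delta>] io_lin] _ u])
    fix b
    show "sweedler k H (tensor k B B) (\<lambda>h1 h2. pure k B B (io h1) (io h2)) (single k b) = comult B (io (single k b))"
      by (cases b) (simp_all add: H4_sweedler [OF TB(1) bi] io_single vals amult_add_right tensor_mult_pure gg)
  qed
  show "counit B (io u) = counit H u"
  proof (rule H4_lin_eqI [OF lin_comp [OF alg_hom_lin [OF \<epsilon>] io_lin] _ _ u])
    show "counit H \<in> lin H (self_module k)" by (rule hopf_like_simps) simp
    show "counit B (io (single k b)) = counit H (single k b)" for b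
      by (cases b) (simp_all add: io_single alg_hom_one [OF \<epsilon>] alg_hom_mult [OF \<epsilon>] AH_counit_g [OF \<alpha>] AH_counit_x [OF \<alpha>])
  qed
qed

text \<open>\<open>Th\<close> is the product of the coalgebra maps \<open>ev\<close> and
  \<open>io\<close>, and \<Delta> is multiplicative on the presented algebra, so compatibility on q
  \<otimes> u reduces to that of the two factors.\<close>

lemma Th_hopf_hom: "Th \<in> hopf_hom k ((tensor_hopf k PA H)\<lparr>mult := m\<rparr>) (A_hopf k p \<alpha>)"
proof -
  let ?TB = "tensor k B B" and ?V2 = "tensor k V0 V0"
  note s = tensor_hopf_mult_pure [OF PA_hopf_like H4_hopf_like, where m = m]
  note c = tensor_hopf_comult_pure [OF PA_hopf_like H4_hopf_like]
  have TB: "module k ?TB" "k_algebra k ?TB" and V: "module k V0" "module k ?V2" by auto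
  have l: "Th \<in> lin C B" using Th_lin by (simp add: lin_maps_def)
  have a: "Th \<in> alg_hom C B" by (rule alg_homI [OF l]) (simp_all add: Th_mult Th_one)
  have bT: "bilin V0 V0 ?TB (\<lambda>s t. pure k B B (Th s) (Th t))"
    by (rule bilin_pure_map) (auto intro: Th_lin)
  define Th2 where "Th2 = tlift ?TB (\<lambda>s t. pure k B B (Th s) (Th t))"
  have Th2: "Th2 \<in> lin ?V2 ?TB" unfolding Th2_def by (rule tensor_lift_linear [OF V(1,1) TB(1) bT])
  have Th2p: "Th2 (pure k V0 V0 s t) = pure k B B (Th s) (Th t)" if "s \<in> carrier V0" "t \<in> carrier V0" for s t
    unfolding Th2_def by (rule tensor_lift_pure [OF V(1,1) TB(1) bT that])
  let ?e2 = "tlift ?TB (\<lambda>a b. pure k B B (ev a) (ev b))"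
  let ?i2 = "tlift ?TB (\<lambda>a b. pure k B B (io a) (io b))"
  have be: "bilin PA PA ?TB (\<lambda>a b. pure k B B (ev a) (ev b))" and bi: "bilin H H ?TB (\<lambda>a b. pure k B B (io a) (io b))"
    by (rule bilin_pure_map; simp add: alg_hom_lin [OF ev] io_lin)+
  have e2: "?e2 \<in> lin (tensor k PA PA) ?TB" and i2: "?i2 \<in> lin (tensor k H H) ?TB"
    using be bi TB by (auto intro!: tensor_lift_linear)
  note qb = quad_bilin [OF PA_hopf_like H4_hopf_like]
  \<comment> \<open>Under Th \<otimes> Th the interchange of middle factors becomes the product in
    the tensor square of the presented algebra.\<close>
  have key: "Th2 (quad PA H S T) = ?e2 S \<otimes>\<^sub>?TB ?i2 T"
    if S: "S \<in> carrier (tensor k PA PA)" and T: "T \<in> carrier (tensor k H H)" for S T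
  proof (rule tensor_lin_eqI [where \<phi> = "\<lambda>S. Th2 (quad PA H S T)" and \<psi> = "\<lambda>S. ?e2 S \<otimes>\<^sub>?TB ?i2 T" and U = ?TB, OF _ _ _ _ _ S])
    show "(\<lambda>S. Th2 (quad PA H S T)) \<in> lin (tensor k PA PA) ?TB"
      by (rule lin_comp [OF Th2 bilin_lin(2) [OF qb T]])
    show "(\<lambda>S. ?e2 S \<otimes>\<^sub>?TB ?i2 T) \<in> lin (tensor k PA PA) ?TB"
      by (rule lin_amult_left [OF _ e2]) (use TB lin_closed [OF i2 T] in auto)
    fix a1 a2 assume a: "a1 \<in> carrier PA" "a2 \<in> carrier PA"
    have pa: "pure k PA PA a1 a2 \<in> carrier (tensor k PA PA)" using a by simp
    show "Th2 (quad PA H (pure k PA PA a1 a2) T) = ?e2 (pure k PA PA a1 a2) \<otimes>\<^sub>?TB ?i2 T"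
    proof (rule tensor_lin_eqI [where \<phi> = "\<lambda>T. Th2 (quad PA H (pure k PA PA a1 a2) T)" and U = ?TB, OF _ _ _ _ _ T])
      show "(\<lambda>T. Th2 (quad PA H (pure k PA PA a1 a2) T)) \<in> lin (tensor k H H) ?TB"
        by (rule lin_comp [OF Th2 bilin_lin(1) [OF qb pa]])
      show "(\<lambda>T. ?e2 (pure k PA PA a1 a2) \<otimes>\<^sub>?TB ?i2 T) \<in> lin (tensor k H H) ?TB"
        by (rule lin_amult_right [OF _ i2]) (use TB lin_closed [OF e2 pa] in auto)
      fix h1 h2 assume h: "h1 \<in> carrier H" "h2 \<in> carrier H"
      show "Th2 (quad PA H (pure k PA PA a1 a2) (pure k H H h1 h2)) =
         ?e2 (pure k PA PA a1 a2) \<otimes>\<^sub>?TB ?i2 (pure k H H h1 h2)"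
        using a h TB
        by (simp add: quad_pure [OF PA_hopf_like H4_hopf_like] Th2p Th_pure tensor_lift_pure be bi tensor_mult_pure)
    qed auto
  qed auto
  have "coalgebra_map k C B Th"
    unfolding coalgebra_map_def
  proof (intro conjI ballI l)
    fix t assume "t \<in> carrier C"
    then have t: "t \<in> carrier V0" by simp
    note cl = tensor_hopf_coalgebra [OF PA_hopf_like H4_hopf_like]
    have "Th2 (comult (tensor_hopf k PA H) t) = comult B (Th t)"
    proof (rule tensor_lin_eqI [OF _ _ lin_comp [OF Th2 cl(1)] lin_comp [OF hopf_like_simps(3) [OF HB] Th_lin] _ t])
      fix q u assume q: "q \<in> carrier PA" and u: "u \<in> carrier H"
      have "Th2 (comult (tensor_hopf k PA H) (pt q u)) = ?e2 (comult PA q) \<otimes>\<^sub>?TB ?i2 (comult H u)"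
        unfolding c [OF q u] by (rule key) (use q u hopf_like_simps [OF PA_hopf_like] hopf_like_simps [OF H4_hopf_like] in auto)
      also have "\<dots> = comult B (ev q) \<otimes>\<^sub>?TB comult B (io u)"
        using io_comult(1) [OF u] hopf_hom_comult [OF ev_hopf q] by (simp add: sweedler_def)
      finally show "Th2 (comult (tensor_hopf k PA H) (pt q u)) = comult B (Th (pt q u))"
        using q u by (simp add: Th_pure alg_hom_mult [OF AH_comult_hom [OF \<alpha>]])
    qed auto
    then show "sweedler k C (tensor k B B) (\<lambda>h1 h2. pure k B B (Th h1) (Th h2)) t = comult B (Th t)"
      by (simp add: sweedler_def Th2_def)
    show "counit B (Th t) = counit C t"
    proof -
      have "counit B (Th t) = counit (tensor_hopf k PA H) t"
      proof (rule tensor_lin_eqI [OF _ _ lin_comp [OF hopf_like_simps(4) [OF HB] Th_lin] cl(2) _ t])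
        fix q u assume q: "q \<in> carrier PA" and u: "u \<in> carrier H"
        show "counit B (Th (pt q u)) = counit (tensor_hopf k PA H) (pt q u)"
          using q u io_comult(2) [OF u] hopf_hom_counit [OF ev_hopf q] alg_hom_mult [OF AH_counit_hom [OF \<alpha>]]
          by (simp add: Th_pure tensor_hopf_counit_pure [OF PA_hopf_like H4_hopf_like])
      qed auto
      then show ?thesis by simp
    qed
  qed
  with a show ?thesis by (simp add: hopf_hom_iff)
qed

text \<open>Even the associativity of \<open>m\<close> is obtained here, by transport along the
  inverse of an isomorphism onto the presented algebra.\<close>

lemma crossed_like_hopf: "hopf_algebra k ((tensor_hopf k PA H)\<lparr>mult := m\<rparr>)"
  and crossed_like_iso: "hopf_isomorphic k ((tensor_hopf k PA H)\<lparr>mult := m\<rparr>) (A_hopf k p \<alpha>)"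
proof -
  have hl: "hopf_like C" by (rule tensor_hopf_mult_hopf_like [OF PA_hopf_like H4_hopf_like m])
  have bij: "bij_betw Th (carrier C) (carrier B)" using Th_bij by simp
  show iso: "hopf_isomorphic k C B"
    unfolding hopf_isomorphic_def using Th_hopf_hom bij by blast
  then obtain \<psi> where "\<psi> \<in> hopf_hom k B C" "bij_betw \<psi> (carrier B) (carrier C)"
    using hopf_isomorphic_sym [OF hl HB] unfolding hopf_isomorphic_def by blast
  then show "hopf_algebra k C" by (rule hopf_algebra_transport [OF AH_hopf [OF \<alpha>] hl])
qed

end

end

end

context base_field
begin

section \<open>The multiplication of a crossed product\<close>

abbreviation "TH \<equiv> tensor_hopf k PA H"
abbreviation "pu \<equiv> pure k PA H"

lemma TH_fields [simp]:
  "carrier TH = carrier V0" "add TH = add V0" "zero TH = zero V0" "smult TH = smult V0" "one TH = one V0"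
  by (rule tensor_hopf_fields; simp)+

lemma TH_module [simp]: "module k TH"
  by (rule module_cong [of V0]) (simp_all add: same_module_def)

lemma lin_maps_TH [simp]: "lin Z TH = lin Z V0"
  by (simp add: lin_maps_def)

lemma bilin_TH [simp]: "bilin X Y TH \<beta> = bilin X Y V0 \<beta>"
  by (simp add: bilin_def)

lemma lin_sweedler_param:
  assumes K: "hopf_like K" and U: "module k U" and Z: "module k Z" and c: "c \<in> carrier K"
    and bil: "\<And>z. z \<in> carrier Z ==> bilin K K U (\<beta> z)"
    and lin: "\<And>v w. v \<in> carrier K ==> w \<in> carrier K ==> (\<lambda>z. \<beta> z v w) \<in> lin Z U"
  shows "(\<lambda>z. sweedler k K U (\<beta> z) c) \<in> lin Z U"
  unfolding sweedler_def
  by (rule lin_tensor_lift_param) (use hopf_like_simps [OF K] U Z c bil lin in auto)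

definition cm where
  "cm act f s t =
     tlift TH (\<lambda>a h. tlift TH (\<lambda>c g.
       sweedler3 k H TH (\<lambda>h1 h2 h3. sweedler k H TH (\<lambda>g1 g2.
         pu (a \<otimes>\<^sub>PA act (pure k H PA h1 c) \<otimes>\<^sub>PA f (pure k H H h2 g1)) (h3 \<otimes>\<^sub>H g2)) g) h) t) s"

lemma crossed_product_eq: "crossed_product k PA H act f = TH\<lparr>mult := cm act f\<rparr>"
  by (simp add: crossed_product_def Let_def cm_def [abs_def])

context
  fixes act :: "(((h4_basis => 'k) \<times> (nat => 'k)) => 'k) set => nat => 'k"
    and f :: "(((h4_basis => 'k) \<times> (h4_basis => 'k)) => 'k) set => nat => 'k"
  assumes act: "act \<in> lin (tensor k H PA) PA" and f: "f \<in> lin (tensor k H H) PA"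
begin

text \<open>The summand \<open>W\<close> and its successive Sweedler sums, innermost first:
  \<open>S1\<close> over g, \<open>S2\<close> over the last two components of h, \<open>S3\<close>
  over the first. Each must be linear in every argument before the next sum can be formed.\<close>

private definition "W a c h1 h2 h3 g1 g2 =
  pu (a \<otimes>\<^sub>PA act (pure k H PA h1 c) \<otimes>\<^sub>PA f (pure k H H h2 g1)) (h3 \<otimes>\<^sub>H g2)"
private definition "S1 a c g h1 h2 h3 = sweedler k H TH (\<lambda>g1 g2. W a c h1 h2 h3 g1 g2) g"
private definition "S2 a c g h1 d = sweedler k H TH (\<lambda>h2 h3. S1 a c g h1 h2 h3) d"
private definition "S3 a c g h = sweedler k H TH (\<lambda>h1 d. S2 a c g h1 d) h"

private lemma acl: "h \<in> carrier H ==> c \<in> carrier PA ==> act (pure k H PA h c) \<in> carrier PA"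
  and fcl: "h \<in> carrier H ==> g \<in> carrier H ==> f (pure k H H h g) \<in> carrier PA"
  using lin_closed [OF act] lin_closed [OF f] by simp_all

private lemmas mcl = na_mult_closed [OF H4_na]

private lemma W_lin:
  assumes "a \<in> carrier PA" "c \<in> carrier PA" "h1 \<in> carrier H" "h2 \<in> carrier H" "h3 \<in> carrier H"
    "g1 \<in> carrier H" "g2 \<in> carrier H"
  shows "(\<lambda>a. W a c h1 h2 h3 g1 g2) \<in> lin PA V0" "(\<lambda>c. W a c h1 h2 h3 g1 g2) \<in> lin PA V0"
    "(\<lambda>h1. W a c h1 h2 h3 g1 g2) \<in> lin H V0" "(\<lambda>h2. W a c h1 h2 h3 g1 g2) \<in> lin H V0"
    "(\<lambda>h3. W a c h1 h2 h3 g1 g2) \<in> lin H V0" "(\<lambda>g1. W a c h1 h2 h3 g1 g2) \<in> lin H V0"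
    "(\<lambda>g2. W a c h1 h2 h3 g1 g2) \<in> lin H V0"
  unfolding W_def
  by (intro lin_pure_left lin_pure_right lin_amult_left lin_amult_right lin_comp [OF act] lin_comp [OF f];
      use assms in \<open>simp add: acl fcl mcl\<close>)+

private lemma S1_bil:
  assumes "a \<in> carrier PA" "c \<in> carrier PA" "h1 \<in> carrier H" "h2 \<in> carrier H" "h3 \<in> carrier H"
  shows "bilin H H V0 (\<lambda>g1 g2. W a c h1 h2 h3 g1 g2)"
  by (rule bilinI; rule W_lin; use assms in simp)

private lemma S1_lin:
  assumes "a \<in> carrier PA" "c \<in> carrier PA" "h1 \<in> carrier H" "h2 \<in> carrier H" "h3 \<in> carrier H" "g \<in> carrier H"
  shows "(\<lambda>a. S1 a c g h1 h2 h3) \<in> lin PA V0" "(\<lambda>c. S1 a c g h1 h2 h3) \<in> lin PA V0"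
    "(\<lambda>h1. S1 a c g h1 h2 h3) \<in> lin H V0" "(\<lambda>h2. S1 a c g h1 h2 h3) \<in> lin H V0"
    "(\<lambda>h3. S1 a c g h1 h2 h3) \<in> lin H V0" "(\<lambda>g. S1 a c g h1 h2 h3) \<in> lin H V0"
  unfolding S1_def lin_maps_TH [symmetric]
  by (rule lin_sweedler_param sweedler_linear; use assms in \<open>simp add: S1_bil W_lin\<close>)+

private lemma S2_bil:
  assumes "a \<in> carrier PA" "c \<in> carrier PA" "h1 \<in> carrier H" "g \<in> carrier H"
  shows "bilin H H V0 (\<lambda>h2 h3. S1 a c g h1 h2 h3)"
  by (rule bilinI; rule S1_lin; use assms in simp)

private lemma S2_lin:
  assumes "a \<in> carrier PA" "c \<in> carrier PA" "h1 \<in> carrier H" "d \<in> carrier H" "g \<in> carrier H"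
  shows "(\<lambda>a. S2 a c g h1 d) \<in> lin PA V0" "(\<lambda>c. S2 a c g h1 d) \<in> lin PA V0"
    "(\<lambda>h1. S2 a c g h1 d) \<in> lin H V0" "(\<lambda>d. S2 a c g h1 d) \<in> lin H V0"
    "(\<lambda>g. S2 a c g h1 d) \<in> lin H V0"
  unfolding S2_def lin_maps_TH [symmetric]
  by (rule lin_sweedler_param sweedler_linear; use assms in \<open>simp add: S2_bil S1_lin\<close>)+

private lemma S3_bil:
  assumes "a \<in> carrier PA" "c \<in> carrier PA" "g \<in> carrier H"
  shows "bilin H H V0 (\<lambda>h1 d. S2 a c g h1 d)"
  by (rule bilinI; rule S2_lin; use assms in simp)

private lemma S3_lin:
  assumes "a \<in> carrier PA" "c \<in> carrier PA" "h \<in> carrier H" "g \<in> carrier H"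
  shows "(\<lambda>a. S3 a c g h) \<in> lin PA V0" "(\<lambda>c. S3 a c g h) \<in> lin PA V0"
    "(\<lambda>h. S3 a c g h) \<in> lin H V0" "(\<lambda>g. S3 a c g h) \<in> lin H V0"
  unfolding S3_def lin_maps_TH [symmetric]
  by (rule lin_sweedler_param sweedler_linear; use assms in \<open>simp add: S3_bil S2_lin\<close>)+

private lemma cm_eq: "cm act f s t = tlift TH (\<lambda>a h. tlift TH (\<lambda>c g. S3 a c g h) t) s"
  by (simp add: cm_def S3_def S2_def S1_def W_def sweedler3_def)

private lemma I_bil: "a \<in> carrier PA ==> h \<in> carrier H ==> bilin PA H V0 (\<lambda>c g. S3 a c g h)"
  by (rule bilinI; rule S3_lin; simp)

private lemma I_lin:
  "a \<in> carrier PA ==> h \<in> carrier H ==> tlift TH (\<lambda>c g. S3 a c g h) \<in> lin V0 V0"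
  unfolding lin_maps_TH [symmetric] by (rule tensor_lift_linear) (simp_all add: I_bil)

private lemma O_bil:
  assumes t: "t \<in> carrier V0"
  shows "bilin PA H V0 (\<lambda>a h. tlift TH (\<lambda>c g. S3 a c g h) t)"
  unfolding bilin_TH [symmetric]
  by (rule bilinI; rule lin_tensor_lift_param [OF _ _ _ _ t]; simp add: I_bil S3_lin)

lemma cm_bilin: "bilin V0 V0 V0 (cm act f)"
proof (rule bilinI)
  show "(\<lambda>s. cm act f s t) \<in> lin V0 V0" if "t \<in> carrier V0" for t
    unfolding cm_eq lin_maps_TH [symmetric] by (rule tensor_lift_linear) (simp_all add: O_bil that)
  show "(\<lambda>t. cm act f s t) \<in> lin V0 V0" if "s \<in> carrier V0" for s
    unfolding cm_eq lin_maps_TH [symmetric]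
    by (rule lin_tensor_lift_param [OF _ _ _ _ that])
      (simp_all add: O_bil I_lin)
qed

private lemma cm_pure:
  "a \<in> carrier PA ==> h \<in> carrier H ==> c \<in> carrier PA ==> g \<in> carrier H ==>
     cm act f (pu a h) (pu c g) = S3 a c g h"
  by (simp add: cm_eq tensor_lift_pure O_bil I_bil)

text \<open>Twofold comultiplication: x gives x \<otimes> 1 \<otimes> 1 + g \<otimes> x \<otimes> 1
  + g \<otimes> g \<otimes> x, and gx gives gx \<otimes> g \<otimes> g + 1 \<otimes> gx \<otimes> g
  + 1 \<otimes> 1 \<otimes> gx.\<close>

private lemma S_eval:
  assumes "a \<in> carrier PA" "c \<in> carrier PA" "g \<in> carrier H"
  shows "S3 a c g b1 = S1 a c g b1 b1 b1" "S3 a c g bg = S1 a c g bg bg bg"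
    "S3 a c g bx = S1 a c g bx b1 b1 \<oplus>\<^sub>V0 (S1 a c g bg bx b1 \<oplus>\<^sub>V0 S1 a c g bg bg bx)"
    "S3 a c g bgx = S1 a c g bgx bg bg \<oplus>\<^sub>V0 (S1 a c g b1 bgx bg \<oplus>\<^sub>V0 S1 a c g b1 b1 bgx)"
  using assms by (simp_all add: S3_def S2_def H4_sweedler [OF TH_module] S3_bil [unfolded S2_def] S2_bil)

private lemma S1_eval:
  assumes "a \<in> carrier PA" "c \<in> carrier PA" "h1 \<in> carrier H" "h2 \<in> carrier H" "h3 \<in> carrier H"
  shows "S1 a c b1 h1 h2 h3 = W a c h1 h2 h3 b1 b1" "S1 a c bg h1 h2 h3 = W a c h1 h2 h3 bg bg"
    "S1 a c bx h1 h2 h3 = W a c h1 h2 h3 bx b1 \<oplus>\<^sub>V0 W a c h1 h2 h3 bg bx"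
    "S1 a c bgx h1 h2 h3 = W a c h1 h2 h3 bgx bg \<oplus>\<^sub>V0 W a c h1 h2 h3 b1 bgx"
  using assms by (simp_all add: S1_def H4_sweedler [OF TH_module] S1_bil)

abbreviation "Ac b c \<equiv> act (pure k H PA (single k b) c)"
abbreviation "Fc a b \<equiv> f (pure k H H (single k a) (single k b))"

lemma Ac_closed: "c \<in> carrier PA ==> Ac b c \<in> carrier PA"
  and Fc_closed: "Fc a b \<in> carrier PA"
  by (simp_all add: acl fcl)

lemma cm_group_like_left:
  assumes "a \<in> carrier PA" "c \<in> carrier PA" and b: "b \<in> {B1, Bg}"
  shows "cm act f (pu a (single k b)) (pu c b1) = pu (a \<otimes>\<^sub>PA Ac b c \<otimes>\<^sub>PA Fc b B1) (single k b)"
    "cm act f (pu a (single k b)) (pu c bg) = pu (a \<otimes>\<^sub>PA Ac b c \<otimes>\<^sub>PA Fc b Bg) (single k b \<otimes>\<^sub>H bg)"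
    "cm act f (pu a (single k b)) (pu c bx) = pu (a \<otimes>\<^sub>PA Ac b c \<otimes>\<^sub>PA Fc b Bx) (single k b) \<oplus>\<^sub>V0
      pu (a \<otimes>\<^sub>PA Ac b c \<otimes>\<^sub>PA Fc b Bg) (single k b \<otimes>\<^sub>H bx)"
    "cm act f (pu a (single k b)) (pu c bgx) = pu (a \<otimes>\<^sub>PA Ac b c \<otimes>\<^sub>PA Fc b Bgx) (single k b \<otimes>\<^sub>H bg) \<oplus>\<^sub>V0
      pu (a \<otimes>\<^sub>PA Ac b c \<otimes>\<^sub>PA Fc b B1) (single k b \<otimes>\<^sub>H bgx)"
  using assms by (auto simp: cm_pure S_eval S1_eval W_def)

text \<open>The two cases share the shape \<Delta>(u) = u \<otimes> v + w \<otimes> u, with (u, v,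
  w) = (x, 1, g) or (gx, g, 1).\<close>

lemma cm_skew_left:
  assumes "a \<in> carrier PA" "c \<in> carrier PA" and b: "(u, v, w) \<in> {(Bx, B1, Bg), (Bgx, Bg, B1)}"
  shows "cm act f (pu a (single k u)) (pu c b1) =
      pu (a \<otimes>\<^sub>PA Ac u c \<otimes>\<^sub>PA Fc v B1) (single k v) \<oplus>\<^sub>V0
      (pu (a \<otimes>\<^sub>PA Ac w c \<otimes>\<^sub>PA Fc u B1) (single k v) \<oplus>\<^sub>V0 pu (a \<otimes>\<^sub>PA Ac w c \<otimes>\<^sub>PA Fc w B1) (single k u))"
    "cm act f (pu a (single k u)) (pu c bg) =
      pu (a \<otimes>\<^sub>PA Ac u c \<otimes>\<^sub>PA Fc v Bg) (single k v \<otimes>\<^sub>H bg) \<oplus>\<^sub>V0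
      (pu (a \<otimes>\<^sub>PA Ac w c \<otimes>\<^sub>PA Fc u Bg) (single k v \<otimes>\<^sub>H bg) \<oplus>\<^sub>V0 pu (a \<otimes>\<^sub>PA Ac w c \<otimes>\<^sub>PA Fc w Bg) (single k u \<otimes>\<^sub>H bg))"
    "cm act f (pu a (single k u)) (pu c bx) =
      (pu (a \<otimes>\<^sub>PA Ac u c \<otimes>\<^sub>PA Fc v Bx) (single k v) \<oplus>\<^sub>V0 pu (a \<otimes>\<^sub>PA Ac u c \<otimes>\<^sub>PA Fc v Bg) (single k v \<otimes>\<^sub>H bx)) \<oplus>\<^sub>V0
      ((pu (a \<otimes>\<^sub>PA Ac w c \<otimes>\<^sub>PA Fc u Bx) (single k v) \<oplus>\<^sub>V0 pu (a \<otimes>\<^sub>PA Ac w c \<otimes>\<^sub>PA Fc u Bg) (single k v \<otimes>\<^sub>H bx)) \<oplus>\<^sub>V0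
       (pu (a \<otimes>\<^sub>PA Ac w c \<otimes>\<^sub>PA Fc w Bx) (single k u) \<oplus>\<^sub>V0 pu (a \<otimes>\<^sub>PA Ac w c \<otimes>\<^sub>PA Fc w Bg) (single k u \<otimes>\<^sub>H bx)))"
    "cm act f (pu a (single k u)) (pu c bgx) =
      (pu (a \<otimes>\<^sub>PA Ac u c \<otimes>\<^sub>PA Fc v Bgx) (single k v \<otimes>\<^sub>H bg) \<oplus>\<^sub>V0 pu (a \<otimes>\<^sub>PA Ac u c \<otimes>\<^sub>PA Fc v B1) (single k v \<otimes>\<^sub>H bgx)) \<oplus>\<^sub>V0
      ((pu (a \<otimes>\<^sub>PA Ac w c \<otimes>\<^sub>PA Fc u Bgx) (single k v \<otimes>\<^sub>H bg) \<oplus>\<^sub>V0 pu (a \<otimes>\<^sub>PA Ac w c \<otimes>\<^sub>PA Fc u B1) (single k v \<otimes>\<^sub>H bgx)) \<oplus>\<^sub>V0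
       (pu (a \<otimes>\<^sub>PA Ac w c \<otimes>\<^sub>PA Fc w Bgx) (single k u \<otimes>\<^sub>H bg) \<oplus>\<^sub>V0 pu (a \<otimes>\<^sub>PA Ac w c \<otimes>\<^sub>PA Fc w B1) (single k u \<otimes>\<^sub>H bgx)))"
  using assms by (auto simp: cm_pure S_eval S1_eval W_def)

end

section \<open>Components in k[Y] of elements of k[Y] \<otimes> H\<close>

definition proj where "proj b = tlift PA (\<lambda>q u. u b \<odot>\<^sub>PA q)"

lemma proj_bilin: "bilin PA H PA (\<lambda>q u. u b \<odot>\<^sub>PA q)"
  by (intro bilinI lin_smult_left lin_smult_right H4_coord_lin lin_id) (auto simp: H4_carrier)

lemma proj_lin: "proj b \<in> lin V0 PA"
  unfolding proj_def by (rule tensor_lift_linear [OF _ _ _ proj_bilin]) auto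

lemma proj_pure: "q \<in> carrier PA ==> u \<in> carrier H ==> proj b (pu q u) = u b \<odot>\<^sub>PA q"
  unfolding proj_def by (rule tensor_lift_pure [OF _ _ _ proj_bilin]) auto

lemma proj_single: "q \<in> carrier PA ==> proj b (pu q (single k a)) = (if b = a then q else \<zero>\<^sub>PA)"
proof -
  have *: "single k a b = (if b = a then \<one> else \<zero>)" by (simp add: single_def)
  show "q \<in> carrier PA ==> ?thesis" by (simp add: proj_pure *)
qed

lemma proj_closed [simp]: "t \<in> carrier V0 ==> proj b t \<in> carrier PA"
  by (rule lin_closed [OF proj_lin])

lemma proj_add: "s \<in> carrier V0 ==> t \<in> carrier V0 ==> proj b (s \<oplus>\<^sub>V0 t) = proj b s \<oplus>\<^sub>PA proj b t"
  by (rule lin_add [OF proj_lin])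

lemma proj_neg: "s \<in> carrier V0 ==> proj b (\<ominus>\<^sub>V0 s) = \<ominus>\<^sub>PA proj b s"
  by (rule lin_neg [OF _ _ proj_lin]) simp_all

lemma proj_zero: "proj b \<zero>\<^sub>V0 = \<zero>\<^sub>PA"
  by (rule lin_zero [OF _ _ proj_lin]) simp_all

lemma pu_one: "\<one>\<^sub>V0 = pu \<one>\<^sub>PA b1"
  by (simp add: tensor_simps(5) H4_fields(5))

section \<open>Classification of the crossed systems\<close>

text \<open>This is id \<otimes> \<epsilon>, since the counit of \<open>H\<close> is 1 on 1 and g
  and 0 on x and gx.\<close>

definition pe where "pe t = proj B1 t \<oplus>\<^sub>PA proj Bg t"

lemma pe_lin: "pe \<in> lin V0 PA"
  unfolding pe_def [abs_def] by (rule lin_plus [OF _ proj_lin proj_lin]) simp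

abbreviation "V2 \<equiv> tensor k V0 V0"
abbreviation "pv \<equiv> pure k V0 V0"
abbreviation "ePA \<equiv> counit PA"

lemma ePA_lin: "ePA \<in> lin PA (self_module k)"
  by (rule alg_hom_lin [OF PA_counit_hom])

lemma ePA_closed [simp]: "q \<in> carrier PA ==> ePA q \<in> carrier k"
  using lin_closed [OF ePA_lin] by simp

lemma ePA_simps [simp]:
  "ePA \<one>\<^sub>PA = \<one>" "ePA \<zero>\<^sub>PA = \<zero>"
  "q \<in> carrier PA ==> r \<in> carrier PA ==> ePA (q \<otimes>\<^sub>PA r) = ePA q \<otimes> ePA r"
  "q \<in> carrier PA ==> r \<in> carrier PA ==> ePA (q \<oplus>\<^sub>PA r) = ePA q \<oplus> ePA r"
  using alg_hom_one [OF PA_counit_hom] alg_hom_mult [OF PA_counit_hom] alg_hom_add [OF PA_counit_hom]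
    lin_zero [OF _ _ ePA_lin] by simp_all

text \<open>On the first factor the counit of the component at b, on the second id \<otimes>
  \<epsilon>. Applied after \<Delta> it returns the component at b (\<open>lam_comult\<close>),
  which turns multiplicativity of \<Delta> into equations in k[Y].\<close>

definition lam where "lam b = tlift PA (\<lambda>s t. ePA (proj b s) \<odot>\<^sub>PA pe t)"

lemma lam_bilin: "bilin V0 V0 PA (\<lambda>s t. ePA (proj b s) \<odot>\<^sub>PA pe t)"
  by (intro bilinI lin_smult_left lin_smult_right pe_lin lin_comp [OF ePA_lin proj_lin])
    (auto intro: lin_closed [OF pe_lin])

lemma lam_lin: "lam b \<in> lin V2 PA"
  unfolding lam_def by (rule tensor_lift_linear [OF _ _ _ lam_bilin]) auto

lemma lam_pure: "s \<in> carrier V0 ==> t \<in> carrier V0 ==> lam b (pv s t) = ePA (proj b s) \<odot>\<^sub>PA pe t"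
  unfolding lam_def by (rule tensor_lift_pure [OF _ _ _ lam_bilin]) auto

definition ee where "ee = tlift PA (\<lambda>a b. ePA a \<odot>\<^sub>PA b)"

lemma ee_bilin: "bilin PA PA PA (\<lambda>a b. ePA a \<odot>\<^sub>PA b)"
  by (intro bilinI lin_smult_left lin_smult_right ePA_lin lin_id) auto

lemma ee_lin: "ee \<in> lin (tensor k PA PA) PA"
  unfolding ee_def by (rule tensor_lift_linear [OF _ _ _ ee_bilin]) auto

lemma ee_pure: "a \<in> carrier PA ==> b \<in> carrier PA ==> ee (pure k PA PA a b) = ePA a \<odot>\<^sub>PA b"
  unfolding ee_def by (rule tensor_lift_pure [OF _ _ _ ee_bilin]) auto

lemma ee_comult: "q \<in> carrier PA ==> ee (comult PA q) = q"
  using bialgebra.counit_left [OF PA_bialgebra] by (simp add: ee_def sweedler_def)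

lemmas qbil = quad_bilin [OF PA_hopf_like H4_hopf_like]
lemmas qpure = quad_pure [OF PA_hopf_like H4_hopf_like]
lemmas PA_comult_closed = hopf_like_simps(5) [OF PA_hopf_like]
lemmas TH_comult = tensor_hopf_comult_pure [OF PA_hopf_like H4_hopf_like]
lemmas TH_comult_lin = tensor_hopf_coalgebra(1) [OF PA_hopf_like H4_hopf_like]
lemmas TH_counit = tensor_hopf_counit_pure [OF PA_hopf_like H4_hopf_like]

lemma pe_pure: "q \<in> carrier PA ==> u \<in> carrier H ==> pe (pu q u) = counit H u \<odot>\<^sub>PA q"
  by (simp add: pe_def proj_pure H4_counit vsmult_add_left H4_carrier)

lemma lam_quad:
  assumes S: "S \<in> carrier (tensor k PA PA)" and h: "h1 \<in> carrier H" "h2 \<in> carrier H"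
  shows "lam b (quad PA H S (pure k H H h1 h2)) = (h1 b \<otimes> counit H h2) \<odot>\<^sub>PA ee S"
proof (rule tensor_lin_eqI [OF _ _ _ _ _ S])
  have c: "h1 b \<in> carrier k" "counit H h2 \<in> carrier k"
    using h hopf_like_simps(6) [OF H4_hopf_like] by (auto simp: H4_carrier)
  have ph: "pure k H H h1 h2 \<in> carrier (tensor k H H)" using h by simp
  show "(\<lambda>S. lam b (quad PA H S (pure k H H h1 h2))) \<in> lin (tensor k PA PA) PA"
    by (rule lin_comp [OF lam_lin bilin_lin(2) [OF qbil ph]])
  show "(\<lambda>S. (h1 b \<otimes> counit H h2) \<odot>\<^sub>PA ee S) \<in> lin (tensor k PA PA) PA"
    by (rule lin_smult_left [OF _ ee_lin]) (use c in auto)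
  fix a1 a2 assume a: "a1 \<in> carrier PA" "a2 \<in> carrier PA"
  have "ePA (proj b (pu a1 h1)) = h1 b \<otimes> ePA a1"
    using a h c lin_smult [OF ePA_lin] by (simp add: proj_pure)
  then show "lam b (quad PA H (pure k PA PA a1 a2) (pure k H H h1 h2)) =
      (h1 b \<otimes> counit H h2) \<odot>\<^sub>PA ee (pure k PA PA a1 a2)"
    using a h c by (simp add: qpure lam_pure pe_pure ee_pure vsmult_assoc [symmetric] m_ac)
qed simp_all

text \<open>The counit law in both factors: \<epsilon> \<otimes> id on k[Y], and id \<otimes>
  \<epsilon>, read at the coordinate b, on \<open>H\<close>.\<close>

lemma lam_comult:
  assumes t: "t \<in> carrier V0"
  shows "lam b (comult TH t) = proj b t"
proof (rule V0_lin_eqI [OF lin_comp [OF lam_lin TH_comult_lin] proj_lin _ t])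
  fix q a assume q: "q \<in> carrier PA"
  note c = PA_comult_closed [OF q]
  note ad = lin_add [OF bilin_lin(1) [OF qbil c]] lin_add [OF lam_lin]
  have cl: "quad PA H (comult PA q) (pure k H H u v) \<in> carrier V2" if "u \<in> carrier H" "v \<in> carrier H" for u v
    using bilin_closed [OF qbil c] that by simp
  have s: "single k a' b = (if b = a' then \<one> else \<zero>)" for a' by (simp add: single_def)
  show "lam b (comult TH (pu q (single k a))) = proj b (pu q (single k a))"
    using q c cl
    by (cases a) (simp_all add: TH_comult H4_comult_single h4_comult_def ad lam_quad proj_single ee_comult s)
qed

section \<open>Consequences of the Hopf axioms for a crossed system\<close>

context
  fixes act :: "(((h4_basis => 'k) \<times> (nat => 'k)) => 'k) set => nat => 'k"
    and f :: "(((h4_basis => 'k) \<times> (h4_basis => 'k)) => 'k) set => nat => 'k"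
  assumes cs: "(act, f) \<in> crossed_systems k PA H"
begin

private lemma act: "act \<in> lin (tensor k H PA) PA" and f: "f \<in> lin (tensor k H H) PA"
  using cs by (auto simp: crossed_systems_def weak_actions_def)

private abbreviation "E \<equiv> TH\<lparr>mult := cm act f\<rparr>"
private abbreviation "X \<equiv> cm act f"
private abbreviation "A \<equiv> \<lambda>b c. act (pure k H PA (single k b) c)"
private abbreviation "ff \<equiv> \<lambda>a b. f (pure k H H (single k a) (single k b))"

private lemma hopfE: "hopf_algebra k E"
  using cs by (simp add: crossed_systems_def crossed_product_eq)

private lemmas bialgE = hopf_bialg [OF hopfE]
private lemmas kalgE = bialg_kalg [OF bialgE]

private lemma A_one: "A B1 \<one>\<^sub>PA = \<one>\<^sub>PA" "A Bg \<one>\<^sub>PA = \<one>\<^sub>PA" "A Bx \<one>\<^sub>PA = \<zero>\<^sub>PA" "A Bgx \<one>\<^sub>PA = \<zero>\<^sub>PA"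
proof -
  have "act (pure k H PA h \<one>\<^sub>PA) = counit H h \<odot>\<^sub>PA \<one>\<^sub>PA" if "h \<in> carrier H" for h
    using cs that by (simp add: crossed_systems_def weak_actions_def)
  then show "A B1 \<one>\<^sub>PA = \<one>\<^sub>PA" "A Bg \<one>\<^sub>PA = \<one>\<^sub>PA" "A Bx \<one>\<^sub>PA = \<zero>\<^sub>PA" "A Bgx \<one>\<^sub>PA = \<zero>\<^sub>PA"
    by simp_all
qed

private lemma A_B1: "c \<in> carrier PA ==> A B1 c = c"
  using cs by (simp add: crossed_systems_def weak_actions_def H4_fields(5))

private lemmas Acl [simp] = Ac_closed [OF act f]
private lemmas ff_closed [simp] = Fc_closed [OF act f]

private lemma unit: "t \<in> carrier V0 ==> X (pu \<one>\<^sub>PA b1) t = t" "t \<in> carrier V0 ==> X t (pu \<one>\<^sub>PA b1) = t"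
  using aone_left [OF kalgE, of t] aone_right [OF kalgE, of t] by (simp_all add: pu_one)

private lemma assoc: "r \<in> carrier V0 ==> s \<in> carrier V0 ==> t \<in> carrier V0 ==> X (X r s) t = X r (X s t)"
  using amult_assoc [OF kalgE, of r s t] by simp

private lemma X_closed [simp]: "s \<in> carrier V0 ==> t \<in> carrier V0 ==> X s t \<in> carrier V0"
  using bilin_closed [OF cm_bilin [OF act f]] .

private lemma X_counit: "s \<in> carrier V0 ==> t \<in> carrier V0 ==> counit TH (X s t) = counit TH s \<otimes> counit TH t"
  using bialgebra.counit_mult [OF bialgE, of s t] by simp

private lemmas EE = tensor_hopf_mult_pure [OF PA_hopf_like H4_hopf_like, where m = X]

text \<open>The product on the tensor square of the crossed product, viewed as an operation on the
  plain space \<open>V2\<close>.\<close>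

private definition "mul2 S T = S \<otimes>\<^bsub>tensor k E E\<^esub> T"

private lemma X_comult: "s \<in> carrier V0 ==> t \<in> carrier V0 ==> comult TH (X s t) = mul2 (comult TH s) (comult TH t)"
  using bialgebra.comult_mult [OF bialgE, of s t] by (simp add: mul2_def)

private lemma mul2_pure:
  "s \<in> carrier V0 ==> t \<in> carrier V0 ==> s' \<in> carrier V0 ==> t' \<in> carrier V0 ==>
    mul2 (pv s t) (pv s' t') = pv (X s s') (X t t')"
  using tensor_mult_pure [OF kalg_na [OF kalgE] kalg_na [OF kalgE], of s t s' t'] by (simp add: mul2_def EE(2))

private lemma mul2_bilin: "bilin V2 V2 V2 mul2"
proof -
  have "bilin (tensor k E E) (tensor k E E) (tensor k E E) (monoid.mult (tensor k E E))"
    by (rule na_bilin) (simp add: kalgE)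
  then show ?thesis
    by (simp add: bilin_def lin_maps_def tensor_simps EE(3) mul2_def)
qed

private lemmas mul2_add = lin_add [OF bilin_lin(1) [OF mul2_bilin]] lin_add [OF bilin_lin(2) [OF mul2_bilin]]

text \<open>The normalisation f(h, 1) = f(1, h) = \<epsilon>(h) on the basis, read off from the unit
  laws of the crossed product.\<close>

private lemma f_units:
  "ff B1 B1 = \<one>\<^sub>PA" "ff Bg B1 = \<one>\<^sub>PA" "ff Bx B1 = \<zero>\<^sub>PA" "ff Bgx B1 = \<zero>\<^sub>PA"
  "ff B1 Bg = \<one>\<^sub>PA" "ff B1 Bx = \<zero>\<^sub>PA" "ff B1 Bgx = \<zero>\<^sub>PA"
proof -
  let ?o = "\<one>\<^sub>PA"
  note gl = cm_group_like_left [OF act f, of ?o ?o] and sk = cm_skew_left [OF act f, of ?o ?o]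
  show f1: "ff B1 B1 = ?o"
    using arg_cong [OF unit(2) [of "pu ?o b1"], of "proj B1"] gl(1) [of B1] by (simp add: A_one proj_single)
  show f2: "ff Bg B1 = ?o"
    using arg_cong [OF unit(2) [of "pu ?o bg"], of "proj Bg"] gl(1) [of Bg] by (simp add: A_one proj_single)
  show "ff Bx B1 = \<zero>\<^sub>PA"
    using arg_cong [OF unit(2) [of "pu ?o bx"], of "proj B1"] sk(1) [of Bx B1 Bg]
    by (simp add: A_one proj_single proj_add pure_zero)
  show "ff Bgx B1 = \<zero>\<^sub>PA"
    using arg_cong [OF unit(2) [of "pu ?o bgx"], of "proj Bg"] sk(1) [of Bgx Bg B1]
    by (simp add: A_one proj_single proj_add pure_zero)
  show "ff B1 Bg = ?o"
    using arg_cong [OF unit(1) [of "pu ?o bg"], of "proj Bg"] gl(2) [of B1] by (simp add: A_one proj_single)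
  show "ff B1 Bx = \<zero>\<^sub>PA"
    using arg_cong [OF unit(1) [of "pu ?o bx"], of "proj B1"] gl(3) [of B1]
    by (simp add: A_one proj_single proj_add)
  show "ff B1 Bgx = \<zero>\<^sub>PA"
    using arg_cong [OF unit(1) [of "pu ?o bgx"], of "proj Bg"] gl(4) [of B1]
    by (simp add: A_one proj_single proj_add)
qed

private lemma X_right_unit:
  assumes a: "a \<in> carrier PA"
  shows "X (pu \<one>\<^sub>PA b1) (pu a b1) = pu a b1" "X (pu \<one>\<^sub>PA bg) (pu a b1) = pu (A Bg a) bg"
    "X (pu \<one>\<^sub>PA bx) (pu a b1) = pu (A Bx a) b1 \<oplus>\<^sub>V0 pu (A Bg a) bx"
    "X (pu \<one>\<^sub>PA bgx) (pu a b1) = pu (A Bgx a) bg \<oplus>\<^sub>V0 pu a bgx"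
  using a cm_group_like_left(1) [OF act f, of "\<one>\<^sub>PA" a] cm_skew_left(1) [OF act f, of "\<one>\<^sub>PA" a]
  by (simp_all add: f_units A_B1 pure_zero)

private lemma A_counit: "a \<in> carrier PA ==> ePA (A Bg a) = ePA a"
  using X_counit [of "pu \<one>\<^sub>PA bg" "pu a b1"] by (simp add: X_right_unit TH_counit)

text \<open>A term s \<otimes> t is multiplied by \<Delta>(a). If the component at b of s c has
  counit \<kappa> \<epsilon>(c), the first tensor factor contributes \<kappa> \<epsilon>(a1), and
  the counit law restores a from the second.\<close>

private lemma key:
  assumes s: "s \<in> carrier V0" and t: "t \<in> carrier V0" and \<kappa>: "\<kappa> \<in> carrier k" and a: "a \<in> carrier PA"
    and hyp: "\<And>c. c \<in> carrier PA ==> ePA (proj b (X s (pu c b1))) = \<kappa> \<otimes> ePA c"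
  shows "lam b (mul2 (pv s t) (comult TH (pu a b1))) = \<kappa> \<odot>\<^sub>PA pe (X t (pu a b1))"
proof -
  have Xl: "(\<lambda>c. X t (pu c b1)) \<in> lin PA V0"
    by (rule lin_comp [OF bilin_lin(1) [OF cm_bilin [OF act f] t]]) (simp add: lin_pure_left)
  have pX: "(\<lambda>c. pe (X t (pu c b1))) \<in> lin PA PA" by (rule lin_comp [OF pe_lin Xl])
  have "lam b (mul2 (pv s t) (quad PA H S (pure k H H b1 b1))) = \<kappa> \<odot>\<^sub>PA pe (X t (pu (ee S) b1))"
    if S: "S \<in> carrier (tensor k PA PA)" for S
  proof (rule tensor_lin_eqI [where \<phi> = "\<lambda>S. lam b (mul2 (pv s t) (quad PA H S (pure k H H b1 b1)))"
        and \<psi> = "\<lambda>S. \<kappa> \<odot>\<^sub>PA pe (X t (pu (ee S) b1))" and U = PA, OF _ _ _ _ _ S])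
    show "(\<lambda>S. lam b (mul2 (pv s t) (quad PA H S (pure k H H b1 b1)))) \<in> lin (tensor k PA PA) PA"
      by (rule lin_comp [OF lam_lin lin_comp [OF bilin_lin(1) [OF mul2_bilin] bilin_lin(2) [OF qbil]]]) (use s t in auto)
    show "(\<lambda>S. \<kappa> \<odot>\<^sub>PA pe (X t (pu (ee S) b1))) \<in> lin (tensor k PA PA) PA"
      by (rule lin_smult_left [OF _ lin_comp [OF pX ee_lin] \<kappa>]) simp
    fix a1 a2 assume a12: "a1 \<in> carrier PA" "a2 \<in> carrier PA"
    then show "lam b (mul2 (pv s t) (quad PA H (pure k PA PA a1 a2) (pure k H H b1 b1))) =
      \<kappa> \<odot>\<^sub>PA pe (X t (pu (ee (pure k PA PA a1 a2)) b1))"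
      using s t \<kappa> lin_closed [OF pX a12(2)] lin_smult [OF pX _ a12(2)]
      by (simp add: qpure mul2_pure lam_pure hyp ee_pure vsmult_assoc)
  qed simp_all
  from this [OF PA_comult_closed [OF a]] show ?thesis
    using a by (simp add: TH_comult H4_comult_single h4_comult_def ee_comult)
qed

private lemma TH_comult_basis:
  "comult TH (pu \<one>\<^sub>PA b1) = pv (pu \<one>\<^sub>PA b1) (pu \<one>\<^sub>PA b1)"
  "comult TH (pu \<one>\<^sub>PA bg) = pv (pu \<one>\<^sub>PA bg) (pu \<one>\<^sub>PA bg)"
  "comult TH (pu \<one>\<^sub>PA bx) = pv (pu \<one>\<^sub>PA bx) (pu \<one>\<^sub>PA b1) \<oplus>\<^sub>V2 pv (pu \<one>\<^sub>PA bg) (pu \<one>\<^sub>PA bx)"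
  "comult TH (pu \<one>\<^sub>PA bgx) = pv (pu \<one>\<^sub>PA bgx) (pu \<one>\<^sub>PA bg) \<oplus>\<^sub>V2 pv (pu \<one>\<^sub>PA b1) (pu \<one>\<^sub>PA bgx)"
proof -
  have 1: "comult PA \<one>\<^sub>PA = pure k PA PA \<one>\<^sub>PA \<one>\<^sub>PA"
    using alg_hom_one [OF PA_comult_hom] by (simp add: tensor_simps(5))
  have "pure k PA PA \<one>\<^sub>PA \<one>\<^sub>PA \<in> carrier (tensor k PA PA)" by simp
  note ad = lin_add [OF bilin_lin(1) [OF qbil this]]
  show "comult TH (pu \<one>\<^sub>PA b1) = pv (pu \<one>\<^sub>PA b1) (pu \<one>\<^sub>PA b1)"
    "comult TH (pu \<one>\<^sub>PA bg) = pv (pu \<one>\<^sub>PA bg) (pu \<one>\<^sub>PA bg)"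
    "comult TH (pu \<one>\<^sub>PA bx) = pv (pu \<one>\<^sub>PA bx) (pu \<one>\<^sub>PA b1) \<oplus>\<^sub>V2 pv (pu \<one>\<^sub>PA bg) (pu \<one>\<^sub>PA bx)"
    "comult TH (pu \<one>\<^sub>PA bgx) = pv (pu \<one>\<^sub>PA bgx) (pu \<one>\<^sub>PA bg) \<oplus>\<^sub>V2 pv (pu \<one>\<^sub>PA b1) (pu \<one>\<^sub>PA bgx)"
    by (simp_all add: TH_comult 1 H4_comult_single h4_comult_def ad qpure)
qed

private lemma pu_closed: "a \<in> carrier PA ==> pu a (single k b) \<in> carrier V0" by simp

text \<open>Compatibility of the comultiplication with the product of a basis element of \<open>H\<close> and an element of
  \<open>A\<close> forces the action to be trivial; the component at \<open>b\<close> of the left tensor factor is extracted by \<open>lam b\<close>.\<close>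

private lemma A_trivial:
  assumes a: "a \<in> carrier PA"
  shows "A Bg a = a" "A Bx a = \<zero>\<^sub>PA" "A Bgx a = \<zero>\<^sub>PA"
proof -
  let ?o = "\<one>\<^sub>PA"
  have c: "comult TH (pu a b1) \<in> carrier V2" using lin_closed [OF TH_comult_lin] a by simp
  have mc: "mul2 (pv (pu ?o u) (pu ?o v)) (comult TH (pu a b1)) \<in> carrier V2" if "u \<in> carrier H" "v \<in> carrier H" for u v
    by (rule bilin_closed [OF mul2_bilin _ c]) (use that in simp)
  have x: "proj b (X (pu ?o bx) (pu a b1)) =
      lam b (mul2 (pv (pu ?o bx) (pu ?o b1)) (comult TH (pu a b1))) \<oplus>\<^sub>PA
      lam b (mul2 (pv (pu ?o bg) (pu ?o bx)) (comult TH (pu a b1)))" for b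
    unfolding lam_comult [symmetric, OF X_closed [OF pu_closed pu_closed, OF aone_closed [OF PA_kalg] a]]
    using a c mc by (simp add: X_comult TH_comult_basis mul2_add lin_add [OF lam_lin])
  have gx: "proj b (X (pu ?o bgx) (pu a b1)) =
      lam b (mul2 (pv (pu ?o bgx) (pu ?o bg)) (comult TH (pu a b1))) \<oplus>\<^sub>PA
      lam b (mul2 (pv (pu ?o b1) (pu ?o bgx)) (comult TH (pu a b1)))" for b
    unfolding lam_comult [symmetric, OF X_closed [OF pu_closed pu_closed, OF aone_closed [OF PA_kalg] a]]
    using a c mc by (simp add: X_comult TH_comult_basis mul2_add lin_add [OF lam_lin])
  \<comment> \<open>Here \<kappa> is 1 if b is the \<open>H\<close>-part of the left factor and 0
    otherwise.\<close>
  have k1: "lam Bx (mul2 (pv (pu ?o bx) (pu ?o b1)) (comult TH (pu a b1))) = \<one> \<odot>\<^sub>PA pe (X (pu ?o b1) (pu a b1))"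
    by (rule key) (use a in \<open>simp_all add: X_right_unit proj_add proj_single A_counit\<close>)
  have k2: "lam Bx (mul2 (pv (pu ?o bg) (pu ?o bx)) (comult TH (pu a b1))) = \<zero> \<odot>\<^sub>PA pe (X (pu ?o bx) (pu a b1))"
    by (rule key) (use a in \<open>simp_all add: X_right_unit proj_add proj_single A_counit\<close>)
  have k3: "lam Bg (mul2 (pv (pu ?o bx) (pu ?o b1)) (comult TH (pu a b1))) = \<zero> \<odot>\<^sub>PA pe (X (pu ?o b1) (pu a b1))"
    by (rule key) (use a in \<open>simp_all add: X_right_unit proj_add proj_single A_counit\<close>)
  have k4: "lam Bg (mul2 (pv (pu ?o bg) (pu ?o bx)) (comult TH (pu a b1))) = \<one> \<odot>\<^sub>PA pe (X (pu ?o bx) (pu a b1))"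
    by (rule key) (use a in \<open>simp_all add: X_right_unit proj_add proj_single A_counit\<close>)
  have k5: "lam B1 (mul2 (pv (pu ?o bgx) (pu ?o bg)) (comult TH (pu a b1))) = \<zero> \<odot>\<^sub>PA pe (X (pu ?o bg) (pu a b1))"
    by (rule key) (use a in \<open>simp_all add: X_right_unit proj_add proj_single A_counit\<close>)
  have k6: "lam B1 (mul2 (pv (pu ?o b1) (pu ?o bgx)) (comult TH (pu a b1))) = \<one> \<odot>\<^sub>PA pe (X (pu ?o bgx) (pu a b1))"
    by (rule key) (use a in \<open>simp_all add: X_right_unit proj_add proj_single A_counit\<close>)
  \<comment> \<open>The component at x of the product x a determines the action of g. The components
    of x a at g and of (gx) a at 1 are zero by the product formula, which kills the actions of x and
    gx.\<close>
  show "A Bg a = a"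
    using x [of Bx] unfolding k1 k2 using a by (simp add: X_right_unit proj_add proj_single pe_def)
  show "A Bx a = \<zero>\<^sub>PA"
    using x [of Bg] unfolding k3 k4 using a by (simp add: X_right_unit proj_add proj_single pe_def)
  show "A Bgx a = \<zero>\<^sub>PA"
    using gx [of B1] unfolding k5 k6 using a by (simp add: X_right_unit proj_add proj_single pe_def)
qed

private lemmas A_vals = A_B1 A_trivial
private lemmas gl = cm_group_like_left [OF act f, of "\<one>\<^sub>PA" "\<one>\<^sub>PA"]
private lemmas skx = cm_skew_left [OF act f, of "\<one>\<^sub>PA" "\<one>\<^sub>PA" Bx B1 Bg, simplified]
private lemmas skgx = cm_skew_left [OF act f, of "\<one>\<^sub>PA" "\<one>\<^sub>PA" Bgx Bg B1, simplified]
private lemmas vsimps = A_vals f_units pure_zero pure_neg_right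

private abbreviation "v b \<equiv> pu \<one>\<^sub>PA (single k b)"

private lemma Xgg: "X (v Bg) (v Bg) = pu (ff Bg Bg) b1"
  and Xgx: "X (v Bg) (v Bx) = pu (ff Bg Bx) bg \<oplus>\<^sub>V0 pu (ff Bg Bg) bgx"
  and Xggx: "X (v Bg) (v Bgx) = pu (ff Bg Bgx) b1 \<oplus>\<^sub>V0 v Bx"
  using gl(2-4) [of Bg] by (simp_all add: vsimps)

private lemma Xxg: "X (v Bx) (v Bg) = pu (ff Bx Bg) bg \<oplus>\<^sub>V0 \<ominus>\<^sub>V0 pu (ff Bg Bg) bgx"
  and Xgxg: "X (v Bgx) (v Bg) = pu (ff Bgx Bg) b1 \<oplus>\<^sub>V0 \<ominus>\<^sub>V0 v Bx"
  using skx(2) skgx(2) by (simp_all add: vsimps)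

text \<open>Multiplicativity of the counit: a factor x or gx makes \<epsilon> of the product zero,
  and of the product only the cocycle term is visible to \<epsilon>.\<close>

private lemma counit_zero: "ePA (ff Bg Bx) = \<zero>" "ePA (ff Bx Bg) = \<zero>" "ePA (ff Bg Bgx) = \<zero>" "ePA (ff Bgx Bg) = \<zero>"
proof -
  have l: "counit TH \<in> lin V0 (self_module k)"
    by (rule tensor_hopf_coalgebra(2) [OF PA_hopf_like H4_hopf_like])
  note a = lin_add [OF l, simplified] lin_neg [OF _ _ l]
  have n: "\<ominus>\<^bsub>self_module k\<^esub> \<zero> = \<zero>" using vneg_zero [OF module_self] by simp
  show "ePA (ff Bg Bx) = \<zero>"
    using X_counit [of "v Bg" "v Bx"] by (simp add: Xgx a TH_counit)
  show "ePA (ff Bx Bg) = \<zero>"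
    using X_counit [of "v Bx" "v Bg"] by (simp add: Xxg a TH_counit n)
  show "ePA (ff Bg Bgx) = \<zero>"
    using X_counit [of "v Bg" "v Bgx"] by (simp add: Xggx a TH_counit)
  show "ePA (ff Bgx Bg) = \<zero>"
    using X_counit [of "v Bgx" "v Bg"] by (simp add: Xgxg a TH_counit n)
qed

private lemma counit_one: "ePA (ff Bg Bg) = \<one>"
  using X_counit [of "v Bg" "v Bg"] by (simp add: Xgg TH_counit)

private lemmas ad = lin_add [OF lam_lin] mul2_add mul2_pure TH_comult_basis

private lemma lam_X: "s \<in> carrier V0 ==> t \<in> carrier V0 ==> proj b (X s t) = lam b (mul2 (comult TH s) (comult TH t))"
  by (simp add: lam_comult [symmetric] X_comult)

text \<open>Evaluated by \<open>lam\<close>, the product \<Delta>(g) \<Delta>(x) has the scalar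
  \<epsilon>(f(g, g)) = 1 at gx and \<epsilon>(f(g, x)) = 0 at g, whereas g x itself has f(g, g) and
  f(g, x) there. The next three lemmas argue in the same way.\<close>

private lemma f_gg: "ff Bg Bg = \<one>\<^sub>PA" and f_gx: "ff Bg Bx = \<zero>\<^sub>PA"
proof -
  show "ff Bg Bg = \<one>\<^sub>PA"
    using lam_X [of "v Bg" "v Bx" Bgx]
    by (simp add: ad lam_pure Xgx Xgg Xggx unit proj_add proj_single counit_zero counit_one pe_def)
  show "ff Bg Bx = \<zero>\<^sub>PA"
    using lam_X [of "v Bg" "v Bx" Bg]
    by (simp add: ad lam_pure Xgx Xgg Xggx unit proj_add proj_single counit_zero counit_one pe_def)
qed

private lemma f_xg: "ff Bx Bg = \<zero>\<^sub>PA"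
  using lam_X [of "v Bx" "v Bg" Bg]
  by (simp add: ad lam_pure Xxg Xgg unit proj_add proj_single proj_neg counit_zero counit_one pe_def)

private lemma f_ggx: "ff Bg Bgx = \<zero>\<^sub>PA"
  using lam_X [of "v Bg" "v Bgx" B1]
  by (simp add: ad lam_pure Xggx Xgg unit proj_add proj_single proj_neg counit_zero counit_one pe_def)

private lemma f_gxg: "ff Bgx Bg = \<zero>\<^sub>PA"
  using lam_X [of "v Bgx" "v Bg" B1]
  by (simp add: ad lam_pure Xgxg Xgg unit proj_add proj_single proj_neg counit_zero counit_one pe_def)

private lemmas f_zero = f_gg f_gx f_xg f_ggx f_gxg

private lemma Xxx: "X (v Bx) (v Bx) = pu (ff Bx Bx) b1"
  and Xxgx: "X (v Bx) (v Bgx) = pu (ff Bx Bgx) bg"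
  and Xgxx: "X (v Bgx) (v Bx) = pu (ff Bgx Bx) bg"
  and Xgxgx: "X (v Bgx) (v Bgx) = pu (ff Bgx Bgx) b1"
  using skx(3,4) skgx(3,4) by (simp_all add: vsimps f_zero)

private lemma Xg_mult: "a \<in> carrier PA ==> X (v Bg) (pu a b1) = pu a bg" "a \<in> carrier PA ==> X (v Bg) (pu a bg) = pu a b1"
  using cm_group_like_left(1,2) [OF act f, of "\<one>\<^sub>PA" a Bg] by (simp_all add: vsimps f_zero)

private lemma X_neg: "s \<in> carrier V0 ==> t \<in> carrier V0 ==> X (\<ominus>\<^sub>V0 s) t = \<ominus>\<^sub>V0 X s t"
  "s \<in> carrier V0 ==> t \<in> carrier V0 ==> X s (\<ominus>\<^sub>V0 t) = \<ominus>\<^sub>V0 X s t"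
  using lin_neg [OF _ _ bilin_lin(2) [OF cm_bilin [OF act f]]] lin_neg [OF _ _ bilin_lin(1) [OF cm_bilin [OF act f]]]
  by simp_all

text \<open>Associativity together with g x = gx and x g = -gx: (gx) x = g (x x), x (gx) = (x g) x
  and (gx)(gx) = g (x (gx)).\<close>

lemma crossed_system_cocycle:
  "ff Bgx Bx = ff Bx Bx" "ff Bx Bgx = \<ominus>\<^sub>PA ff Bx Bx" "ff Bgx Bgx = \<ominus>\<^sub>PA ff Bx Bx"
proof -
  have gx: "X (v Bg) (v Bx) = v Bgx" and xg: "X (v Bx) (v Bg) = \<ominus>\<^sub>V0 v Bgx"
    by (simp_all add: Xgx Xxg f_zero pure_zero)
  have "X (v Bgx) (v Bx) = X (v Bg) (X (v Bx) (v Bx))"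
    unfolding gx [symmetric] by (rule assoc) simp_all
  then have 1: "pu (ff Bgx Bx) bg = pu (ff Bx Bx) bg" by (simp add: Xgxx Xxx Xg_mult)
  show a: "ff Bgx Bx = ff Bx Bx"
    using arg_cong [OF 1, of "proj Bg"] by (simp add: proj_single)
  have "X (v Bx) (v Bgx) = X (X (v Bx) (v Bg)) (v Bx)"
    unfolding gx [symmetric] by (rule assoc [symmetric]) simp_all
  then have 2: "pu (ff Bx Bgx) bg = \<ominus>\<^sub>V0 pu (ff Bx Bx) bg"
    by (simp add: Xxgx xg X_neg Xgxx a)
  show b: "ff Bx Bgx = \<ominus>\<^sub>PA ff Bx Bx"
    using arg_cong [OF 2, of "proj Bg"] by (simp add: proj_single proj_neg)
  have "X (v Bgx) (v Bgx) = X (v Bg) (X (v Bx) (v Bgx))"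
    by (subst (1) gx [symmetric]) (rule assoc; simp)
  then have 3: "pu (ff Bgx Bgx) b1 = \<ominus>\<^sub>V0 pu (ff Bx Bx) b1"
    by (simp add: Xgxgx Xxgx b pure_neg_left X_neg Xg_mult)
  show "ff Bgx Bgx = \<ominus>\<^sub>PA ff Bx Bx"
    using arg_cong [OF 3, of "proj B1"] by (simp add: proj_single proj_neg)
qed

lemma crossed_system_values:
  "ff B1 B1 = \<one>\<^sub>PA" "ff Bg B1 = \<one>\<^sub>PA" "ff Bx B1 = \<zero>\<^sub>PA" "ff Bgx B1 = \<zero>\<^sub>PA"
  "ff B1 Bg = \<one>\<^sub>PA" "ff B1 Bx = \<zero>\<^sub>PA" "ff B1 Bgx = \<zero>\<^sub>PA"
  "ff Bg Bg = \<one>\<^sub>PA" "ff Bg Bx = \<zero>\<^sub>PA" "ff Bx Bg = \<zero>\<^sub>PA" "ff Bg Bgx = \<zero>\<^sub>PA" "ff Bgx Bg = \<zero>\<^sub>PA"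
  "a \<in> carrier PA ==> A B1 a = a" "a \<in> carrier PA ==> A Bg a = a"
  "a \<in> carrier PA ==> A Bx a = \<zero>\<^sub>PA" "a \<in> carrier PA ==> A Bgx a = \<zero>\<^sub>PA"
  by (simp_all add: f_units f_zero A_B1 A_trivial)

text \<open>In the crossed product x x is f(x, x) # 1. Of the four terms of \<Delta>(x)^2 the two
  mixed ones are killed by \<open>PP\<close>, which applies id \<otimes> \<epsilon> to both factors,
  because \<epsilon>(gx) = 0.\<close>

lemma crossed_system_primitive: "primitive k PA (ff Bx Bx)"
proof -
  let ?T = "tensor k PA PA"
  define PP where "PP = tlift ?T (\<lambda>s t. pure k PA PA (pe s) (pe t))"
  have bp: "bilin V0 V0 ?T (\<lambda>s t. pure k PA PA (pe s) (pe t))"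
    by (rule bilin_pure_map) (simp_all add: pe_lin)
  have PP: "PP \<in> lin V2 ?T" unfolding PP_def by (rule tensor_lift_linear [OF _ _ _ bp]) auto
  have PPp: "PP (pv s t) = pure k PA PA (pe s) (pe t)" if "s \<in> carrier V0" "t \<in> carrier V0" for s t
    unfolding PP_def by (rule tensor_lift_pure [OF _ _ _ bp]) (use that in auto)
  have q: "PP (quad PA H S (pure k H H b1 b1)) = S" if S: "S \<in> carrier ?T" for S
  proof (rule tensor_lin_eqI [where \<phi> = "\<lambda>S. PP (quad PA H S (pure k H H b1 b1))" and \<psi> = "\<lambda>S. S" and U = ?T, OF _ _ _ lin_id _ S])
    show "(\<lambda>S. PP (quad PA H S (pure k H H b1 b1))) \<in> lin ?T ?T"
      by (rule lin_comp [OF PP bilin_lin(2) [OF qbil]]) simp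
  qed (simp_all add: qpure PPp pe_pure)
  have "PP (comult TH (pu (ff Bx Bx) b1)) = comult PA (ff Bx Bx)"
    using PA_comult_closed by (simp add: TH_comult H4_comult_single h4_comult_def q)
  moreover have "comult TH (pu (ff Bx Bx) b1) = mul2 (comult TH (v Bx)) (comult TH (v Bx))"
    by (simp add: X_comult [symmetric] Xxx)
  moreover have "PP (mul2 (comult TH (v Bx)) (comult TH (v Bx))) =
      pure k PA PA (ff Bx Bx) \<one>\<^sub>PA \<oplus>\<^sub>?T pure k PA PA \<one>\<^sub>PA (ff Bx Bx)"
  proof -
    have z: "pe \<zero>\<^sub>V0 = \<zero>\<^sub>PA" by (rule lin_zero [OF _ _ pe_lin]) simp_all
    have "pe (X (v Bx) (v Bg)) = \<zero>\<^sub>PA" "pe (X (v Bg) (v Bx)) = \<zero>\<^sub>PA"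
      "pe (X (v Bx) (v Bx)) = ff Bx Bx" "pe (X (v Bg) (v Bg)) = \<one>\<^sub>PA"
      by (simp_all add: Xxg Xgx Xxx Xgg f_zero pe_def proj_add proj_neg proj_single)
    then show ?thesis
      by (simp add: mul2_add mul2_pure TH_comult_basis lin_add [OF PP] PPp unit pe_pure pure_zero)
  qed
  ultimately show ?thesis by (simp add: primitive_def)
qed

declare Acl [simp del] ff_closed [simp del] X_closed [simp del]

end

section \<open>The crossed systems with a prescribed polynomial P = f(x, x)\<close>

definition trivial_action where
  "trivial_action = restrict (tlift PA (\<lambda>h a. counit H h \<odot>\<^sub>PA a)) (carrier (tensor k H PA))"

text \<open>The values forced by \<open>crossed_system_values\<close> and
  \<open>crossed_system_cocycle\<close>.\<close>

definition cocycle_val where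
  "cocycle_val P a b = (case (a, b) of (Bx, Bx) => P | (Bgx, Bx) => P | (Bx, Bgx) => \<ominus>\<^sub>PA P | (Bgx, Bgx) => \<ominus>\<^sub>PA P
     | _ => if a \<in> {B1, Bg} \<and> b \<in> {B1, Bg} then \<one>\<^sub>PA else \<zero>\<^sub>PA)"

definition cocycle where
  "cocycle P = restrict (tlift PA (\<lambda>u v. h4_ext PA (\<lambda>a. h4_ext PA (cocycle_val P a) v) u)) (carrier (tensor k H H))"

lemma H4_counit_closed [simp]: "h \<in> carrier H ==> counit H h \<in> carrier k"
  by (rule hopf_like_simps(6) [OF H4_hopf_like])

lemma H4_counit_lin: "counit H \<in> lin H (self_module k)"
  by (rule hopf_like_simps(4) [OF H4_hopf_like])

lemma trivial_action:
  "trivial_action \<in> lin (tensor k H PA) PA" "trivial_action \<in> extensional (carrier (tensor k H PA))"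
  "h \<in> carrier H ==> a \<in> carrier PA ==> trivial_action (pure k H PA h a) = counit H h \<odot>\<^sub>PA a"
proof -
  have b: "bilin H PA PA (\<lambda>h a. counit H h \<odot>\<^sub>PA a)"
    by (intro bilinI lin_smult_left lin_smult_right lin_id H4_counit_lin) auto
  show "trivial_action \<in> lin (tensor k H PA) PA"
    unfolding trivial_action_def by (rule restrict_lin [OF _ tensor_lift_linear [OF _ _ _ b]]) simp_all
  show "trivial_action \<in> extensional (carrier (tensor k H PA))" by (simp add: trivial_action_def)
  show "h \<in> carrier H ==> a \<in> carrier PA ==> trivial_action (pure k H PA h a) = counit H h \<odot>\<^sub>PA a"
    by (simp add: trivial_action_def tensor_lift_pure b)
qed

lemma cocycle:
  assumes P: "P \<in> carrier PA"
  shows "cocycle P \<in> lin (tensor k H H) PA" "cocycle P \<in> extensional (carrier (tensor k H H))"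
    "cocycle P (pure k H H (single k a) (single k b)) = cocycle_val P a b"
proof -
  have c: "cocycle_val P a b \<in> carrier PA" for a b
    using P by (cases a; cases b) (simp_all add: cocycle_val_def)
  have b: "bilin H H PA (\<lambda>u v. h4_ext PA (\<lambda>a. h4_ext PA (cocycle_val P a) v) u)"
  proof (rule bilinI)
    show "(\<lambda>v. h4_ext PA (\<lambda>a. h4_ext PA (cocycle_val P a) v) u) \<in> lin H PA" if "u \<in> carrier H" for u
      by (rule h4_ext_param) (use that c in \<open>auto intro: h4_ext_linear(1)\<close>)
    show "(\<lambda>u. h4_ext PA (\<lambda>a. h4_ext PA (cocycle_val P a) v) u) \<in> lin H PA" if "v \<in> carrier H" for v
      by (rule h4_ext_linear(1)) (use that c in \<open>auto intro: lin_closed [OF h4_ext_linear(1)]\<close>)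
  qed
  show "cocycle P \<in> lin (tensor k H H) PA"
    unfolding cocycle_def by (rule restrict_lin [OF _ tensor_lift_linear [OF _ _ _ b]]) simp_all
  show "cocycle P \<in> extensional (carrier (tensor k H H))" by (simp add: cocycle_def)
  show "cocycle P (pure k H H (single k a) (single k b)) = cocycle_val P a b"
    using c by (simp add: cocycle_def tensor_lift_pure b h4_ext_linear(2))
qed

lemma trivial_action_eqI:
  assumes act: "act \<in> lin (tensor k H PA) PA" "act \<in> extensional (carrier (tensor k H PA))"
    and v: "\<And>b a. a \<in> carrier PA ==> act (pure k H PA (single k b) a) = (if b \<in> {B1, Bg} then a else \<zero>\<^sub>PA)"
  shows "act = trivial_action"
proof (rule extensionalityI [OF act(2) trivial_action(2)])
  fix t assume t: "t \<in> carrier (tensor k H PA)"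
  show "act t = trivial_action t"
  proof (rule tensor_lin_eqI [OF _ _ act(1) trivial_action(1) _ t])
    fix u a assume u: "u \<in> carrier H" and a: "a \<in> carrier PA"
    have l: "(\<lambda>u. pure k H PA u a) \<in> lin H (tensor k H PA)" by (rule bilin_lin(2) [OF bilin_pure]) (use a in auto)
    show "act (pure k H PA u a) = trivial_action (pure k H PA u a)"
    proof (rule H4_lin_eqI [OF lin_comp [OF act(1) l] lin_comp [OF trivial_action(1) l] _ u])
      show "act (pure k H PA (single k b) a) = trivial_action (pure k H PA (single k b) a)" for b
        using a by (cases b) (simp_all add: v trivial_action(3))
    qed
  qed simp_all
qed

text \<open>Linearity determines the map on the carrier by its sixteen values on pairs of basis
  elements, extensionality determines it elsewhere.\<close>

lemma cocycle_eqI: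
  assumes f: "f \<in> lin (tensor k H H) PA" "f \<in> extensional (carrier (tensor k H H))"
    and f': "f' \<in> lin (tensor k H H) PA" "f' \<in> extensional (carrier (tensor k H H))"
    and v: "\<And>a b. f (pure k H H (single k a) (single k b)) = f' (pure k H H (single k a) (single k b))"
  shows "f = f'"
proof (rule extensionalityI [OF f(2) f'(2)])
  fix t assume t: "t \<in> carrier (tensor k H H)"
  show "f t = f' t"
  proof (rule tensor_lin_eqI [OF _ _ f(1) f'(1) _ t])
    fix u w assume u: "u \<in> carrier H" and w: "w \<in> carrier H"
    have l: "(\<lambda>u. pure k H H u w) \<in> lin H (tensor k H H)" by (rule bilin_lin(2) [OF bilin_pure]) (use w in auto)
    have l': "(\<lambda>w. pure k H H (single k a) w) \<in> lin H (tensor k H H)" for a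
      by (rule bilin_lin(1) [OF bilin_pure]) auto
    show "f (pure k H H u w) = f' (pure k H H u w)"
      by (rule H4_lin_eqI [OF lin_comp [OF f(1) l] lin_comp [OF f'(1) l] _ u])
        (rule H4_lin_eqI [OF lin_comp [OF f(1) l'] lin_comp [OF f'(1) l'] v w])
  qed simp_all
qed

lemma trivial_action_weak: "trivial_action \<in> weak_actions k PA H"
proof -
  have "trivial_action (pure k H PA h (a \<otimes>\<^sub>PA b)) =
      sweedler k H PA (\<lambda>h1 h2. trivial_action (pure k H PA h1 a) \<otimes>\<^sub>PA trivial_action (pure k H PA h2 b)) h"
    if h: "h \<in> carrier H" and a: "a \<in> carrier PA" and b: "b \<in> carrier PA" for h a b
  proof -
    have bi: "bilin H H PA (\<lambda>h1 h2. trivial_action (pure k H PA h1 a) \<otimes>\<^sub>PA trivial_action (pure k H PA h2 b))"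
      by (rule bilin_hom_mult; (rule lin_comp [OF trivial_action(1) bilin_lin(2) [OF bilin_pure]])?) (use a b in auto)
    have l: "(\<lambda>u. pure k H PA u c) \<in> lin H (tensor k H PA)" if "c \<in> carrier PA" for c
      by (rule bilin_lin(2) [OF bilin_pure]) (use that in auto)
    show ?thesis
    proof (rule H4_lin_eqI [OF lin_comp [OF trivial_action(1) l] sweedler_linear [OF _ _ bi] _ h])
      fix c
      show "trivial_action (pure k H PA (single k c) (a \<otimes>\<^sub>PA b)) =
        sweedler k H PA (\<lambda>h1 h2. trivial_action (pure k H PA h1 a) \<otimes>\<^sub>PA trivial_action (pure k H PA h2 b)) (single k c)"
        using a b by (cases c) (simp_all add: H4_sweedler [OF _ bi] trivial_action(3))
    qed (use a b in simp_all)
  qed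
  moreover have "a \<in> carrier PA ==> trivial_action (pure k H PA \<one>\<^sub>H a) = a" for a
    by (simp add: H4_fields(5) trivial_action(3))
  ultimately show ?thesis
    by (simp add: weak_actions_def trivial_action)
qed

text \<open>The form of product required by the comparison map: \<open>cocycle_val\<close> deforms
  the product of \<open>H\<close> exactly by the terms of \<open>h4_E\<close>.\<close>

lemma cocycle_mult:
  assumes P: "P \<in> carrier PA" and q: "q \<in> carrier PA" and r: "r \<in> carrier PA"
  shows "cm trivial_action (cocycle P) (pu q (single k a)) (pu r (single k b)) =
     pu (q \<otimes>\<^sub>PA r) (single k a \<otimes>\<^sub>H single k b) \<oplus>\<^sub>V0 pu ((q \<otimes>\<^sub>PA r) \<otimes>\<^sub>PA P) (h4_E a b)"
proof -
  note gl = cm_group_like_left [OF trivial_action(1) cocycle(1) [OF P] q r]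
  note sk = cm_skew_left [OF trivial_action(1) cocycle(1) [OF P] q r, of Bx B1 Bg, simplified]
    cm_skew_left [OF trivial_action(1) cocycle(1) [OF P] q r, of Bgx Bg B1, simplified]
  note s = trivial_action(3) cocycle(3) [OF P] cocycle_val_def h4_E_def pure_zero pure_neg_right pure_neg_left amult_neg_right
  show ?thesis
    using P q r by (cases a; cases b) (simp_all add: gl sk s)
qed

end

context char_field
begin

abbreviation "ppY \<alpha> \<equiv> pp PA \<alpha> (single k 1)"

abbreviation "cocycle_of \<alpha> \<equiv> cocycle (ppY \<alpha>)"

abbreviation "CP \<alpha> \<equiv> crossed_product k PA H trivial_action (cocycle_of \<alpha>)"

lemma cocycle_crossed_system:
  assumes \<alpha>: "\<alpha> \<in> fin_seqs k"
  shows "(trivial_action, cocycle_of \<alpha>) \<in> crossed_systems k PA H" and "hopf_isomorphic k (CP \<alpha>) (A_hopf k p \<alpha>)"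
proof -
  have P: "ppY \<alpha> \<in> carrier PA" using \<alpha> by simp
  have m: "bilin V0 V0 V0 (cm trivial_action (cocycle_of \<alpha>))"
    by (rule cm_bilin [OF trivial_action(1) cocycle(1) [OF P]])
  have "hopf_algebra k (CP \<alpha>)"
    unfolding crossed_product_eq by (rule crossed_like_hopf [OF \<alpha> m cocycle_mult [OF P]])
  then show "(trivial_action, cocycle_of \<alpha>) \<in> crossed_systems k PA H"
    unfolding crossed_systems_def using trivial_action_weak cocycle(1,2) [OF P] by blast
  show "hopf_isomorphic k (CP \<alpha>) (A_hopf k p \<alpha>)"
    unfolding crossed_product_eq by (rule crossed_like_iso [OF \<alpha> m cocycle_mult [OF P]])
qed

lemma crossed_systems_eq: "crossed_systems k PA H = (\<lambda>\<alpha>. (trivial_action, cocycle_of \<alpha>)) ` fin_seqs k"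
proof (rule Set.set_eqI, rule iffI)
  fix z assume "z \<in> crossed_systems k PA H"
  moreover obtain act f where z: "z = (act, f)" by (cases z)
  ultimately have cs: "(act, f) \<in> crossed_systems k PA H" by simp
  then have act: "act \<in> lin (tensor k H PA) PA" "act \<in> extensional (carrier (tensor k H PA))"
    and f: "f \<in> lin (tensor k H H) PA" "f \<in> extensional (carrier (tensor k H H))"
    by (auto simp: crossed_systems_def weak_actions_def)
  obtain \<alpha> where \<alpha>: "\<alpha> \<in> fin_seqs k" and P: "f (pure k H H bx bx) = ppY \<alpha>"
    using PA_primitive_pp [OF crossed_system_primitive [OF cs]] by blast
  have Pc: "ppY \<alpha> \<in> carrier PA" using \<alpha> by simp
  note v = crossed_system_values [OF cs] crossed_system_cocycle [OF cs]
  have "act = trivial_action"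
  proof (rule trivial_action_eqI [OF act])
    show "act (pure k H PA (single k b) a) = (if b \<in> {B1, Bg} then a else \<zero>\<^sub>PA)" if "a \<in> carrier PA" for a b
      using that by (cases b) (simp_all add: v)
  qed
  moreover have "f = cocycle_of \<alpha>"
  proof (rule cocycle_eqI [OF f cocycle(1,2) [OF Pc]])
    show "f (pure k H H (single k a) (single k b)) = cocycle_of \<alpha> (pure k H H (single k a) (single k b))" for a b
      by (cases a; cases b) (simp_all add: v cocycle(3) [OF Pc] cocycle_val_def P)
  qed
  ultimately show "z \<in> (\<lambda>\<alpha>. (trivial_action, cocycle_of \<alpha>)) ` fin_seqs k" using z \<alpha> by blast
next
  show "z \<in> (\<lambda>\<alpha>. (trivial_action, cocycle_of \<alpha>)) ` fin_seqs k ==> z \<in> crossed_systems k PA H" for z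
    using cocycle_crossed_system(1) by blast
qed

text \<open>The value at (x, x) recovers the polynomial, and its coefficient at p^i recovers
  \<alpha>_i.\<close>

lemma cocycle_of_inj: "inj_on cocycle_of (fin_seqs k)"
proof (rule inj_onI)
  fix \<alpha> \<beta> assume \<alpha>: "\<alpha> \<in> fin_seqs k" and \<beta>: "\<beta> \<in> fin_seqs k" and eq: "cocycle_of \<alpha> = cocycle_of \<beta>"
  have *: "cocycle_of \<gamma> (pure k H H bx bx) = ppY \<gamma>" if "\<gamma> \<in> fin_seqs k" for \<gamma>
    using that by (simp add: cocycle(3) cocycle_val_def)
  have eq': "ppY \<alpha> = ppY \<beta>" by (rule trans [OF sym [OF * [OF \<alpha>, unfolded eq]] * [OF \<beta>]])
  show "\<alpha> = \<beta>"
    by (rule ext) (rule trans [OF sym [OF pp_coeff(1) [OF \<alpha>]] trans [OF fun_cong [OF eq'] pp_coeff(1) [OF \<beta>]]])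
qed

end

context base_field
begin

section \<open>Unitary cocentral maps and the equivalence of crossed systems\<close>

lemma H4_counit_mult:
  assumes u: "u \<in> carrier H" and v: "v \<in> carrier H"
  shows "counit H (u \<otimes>\<^sub>H v) = counit H u \<otimes> counit H v"
proof -
  note e = H4_counit_lin
  have n: "\<ominus>\<^bsub>self_module k\<^esub> \<zero> = \<zero>" using vneg_zero [OF module_self] by simp
  have z: "counit H \<zero>\<^sub>H = \<zero>" using lin_zero [OF _ _ e] by simp
  note m = na_bilin [OF H4_na]
  have s: "single k a \<in> carrier H" for a by simp
  show ?thesis
  proof (rule H4_lin_eqI [where \<phi> = "\<lambda>u. counit H (u \<otimes>\<^sub>H v)" and U = "self_module k", OF lin_comp [OF e bilin_lin(2) [OF m v]] _ _ u])
    show "(\<lambda>u. counit H u \<otimes> counit H v) \<in> lin H (self_module k)"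
      by (rule lin_mult_right [OF e]) (use v in simp)
    show "counit H (single k a \<otimes>\<^sub>H v) = counit H (single k a) \<otimes> counit H v" for a
    proof (rule H4_lin_eqI [where U = "self_module k", OF lin_comp [OF e bilin_lin(1) [OF m s]] lin_mult_left [OF e] _ v])
      show "counit H (single k a) \<in> carrier k" by simp
      show "counit H (single k a \<otimes>\<^sub>H single k b) = counit H (single k a) \<otimes> counit H (single k b)" for b
        by (cases a; cases b) (simp_all add: lin_neg [OF _ _ e] n z)
    qed
  qed
qed

text \<open>Removes from a Sweedler sum a component that enters only through the counit;
  \<open>H4_counit_right\<close> is the mirror image.\<close>

lemma H4_counit_left:
  assumes \<phi>: "\<phi> \<in> lin H U" and U: "module k U" and h: "h \<in> carrier H"
    and eq: "\<And>h1 h2. h1 \<in> carrier H ==> h2 \<in> carrier H ==> \<beta> h1 h2 = counit H h1 \<odot>\<^sub>U \<phi> h2"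
  shows "sweedler k H U \<beta> h = \<phi> h"
proof -
  have b: "bilin H H U (\<lambda>h1 h2. counit H h1 \<odot>\<^sub>U \<phi> h2)"
    by (intro bilinI lin_smult_left lin_smult_right H4_counit_lin \<phi>) (use U lin_closed [OF \<phi>] in auto)
  have "sweedler k H U (\<lambda>h1 h2. counit H h1 \<odot>\<^sub>U \<phi> h2) h = \<phi> h"
    by (rule H4_lin_eqI [OF sweedler_linear [OF H4_hopf_like U b] \<phi> _ h])
      (rename_tac b, case_tac b; use U lin_closed [OF \<phi>] in \<open>simp add: H4_sweedler [OF U b]\<close>)
  then show ?thesis using sweedler_cong [OF H4_hopf_like U b eq h] by simp
qed

lemma H4_counit_right:
  assumes \<phi>: "\<phi> \<in> lin H U" and U: "module k U" and h: "h \<in> carrier H"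
    and eq: "\<And>h1 h2. h1 \<in> carrier H ==> h2 \<in> carrier H ==> \<beta> h1 h2 = counit H h2 \<odot>\<^sub>U \<phi> h1"
  shows "sweedler k H U \<beta> h = \<phi> h"
proof -
  have b: "bilin H H U (\<lambda>h1 h2. counit H h2 \<odot>\<^sub>U \<phi> h1)"
    by (intro bilinI lin_smult_left lin_smult_right H4_counit_lin \<phi>) (use U lin_closed [OF \<phi>] in auto)
  have "sweedler k H U (\<lambda>h1 h2. counit H h2 \<odot>\<^sub>U \<phi> h1) h = \<phi> h"
    by (rule H4_lin_eqI [OF sweedler_linear [OF H4_hopf_like U b] \<phi> _ h])
      (rename_tac b, case_tac b; use U lin_closed [OF \<phi>] in \<open>simp add: H4_sweedler [OF U b]\<close>)
  then show ?thesis using sweedler_cong [OF H4_hopf_like U b eq h] by simp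
qed

text \<open>Cocentrality at x reads r(x) \<otimes> 1 + r(g) \<otimes> x = r(1) \<otimes> x + r(x)
  \<otimes> g; the coordinates at x and g give r(g) = 1 and r(x) = 0. The identity for gx, read at
  g, gives r(gx) = 0.\<close>

lemma unitary_cocentral_trivial:
  assumes r: "unitary_cocentral k H PA r" and h: "h \<in> carrier H"
  shows "r h = counit H h \<odot>\<^sub>PA \<one>\<^sub>PA"
proof -
  have rl: "r \<in> lin H PA" using r by (simp add: unitary_cocentral_def coalgebra_map_def)
  have b: "bilin H H V0 (\<lambda>h1 h2. pu (r h1) h2)" "bilin H H V0 (\<lambda>h1 h2. pu (r h2) h1)"
    by (intro bilinI lin_pure_left lin_pure_right lin_id rl; use lin_closed [OF rl] in simp)+
  have r1: "r b1 = \<one>\<^sub>PA" using r by (simp add: unitary_cocentral_def H4_fields(5))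
  have V: "module k V0" by simp
  have "sweedler k H V0 (\<lambda>h1 h2. pu (r h1) h2) (single k a) = sweedler k H V0 (\<lambda>h1 h2. pu (r h2) h1) (single k a)" for a
    using r by (simp add: unitary_cocentral_def)
  then have eq: "proj c (sweedler k H V0 (\<lambda>h1 h2. pu (r h1) h2) (single k a)) = proj c (sweedler k H V0 (\<lambda>h1 h2. pu (r h2) h1) (single k a))" for a c
    by simp
  have rc: "r (single k a) \<in> carrier PA" for a using lin_closed [OF rl] by simp
  note s = H4_sweedler [OF V b(1)] H4_sweedler [OF V b(2)] proj_add proj_single rc r1
  show ?thesis
  proof (rule H4_lin_eqI [OF rl lin_smult_right [OF _ H4_counit_lin] _ h])
    show "r (single k a) = counit H (single k a) \<odot>\<^sub>PA \<one>\<^sub>PA" for a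
    proof (cases a)
      case Bg show ?thesis using eq [of Bx Bx] by (simp add: s Bg)
    next
      case Bx show ?thesis using eq [of Bg Bx] by (simp add: s Bx)
    next
      case Bgx show ?thesis using eq [of Bg Bgx] by (simp add: s Bgx)
    qed (simp add: r1)
  qed simp_all
qed

lemma unitary_cocentral_counit: "unitary_cocentral k H PA (\<lambda>h. counit H h \<odot>\<^sub>PA \<one>\<^sub>PA)"
proof -
  let ?r = "\<lambda>h. counit H h \<odot>\<^sub>PA \<one>\<^sub>PA"
  have rl: "?r \<in> lin H PA" by (rule lin_smult_right [OF _ H4_counit_lin]) simp_all
  have b: "bilin H H V0 (\<lambda>h1 h2. pu (?r h1) h2)" "bilin H H V0 (\<lambda>h1 h2. pu (?r h2) h1)"
    by (intro bilinI lin_pure_left lin_pure_right lin_id rl; use lin_closed [OF rl] in simp)+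
  have b2: "bilin H H (tensor k PA PA) (\<lambda>h1 h2. pure k PA PA (?r h1) (?r h2))"
    by (rule bilin_pure_map [OF _ _ rl rl]) simp_all
  have V: "module k V0" "module k (tensor k PA PA)" by simp_all
  have o: "comult PA \<one>\<^sub>PA = pure k PA PA \<one>\<^sub>PA \<one>\<^sub>PA" using PA_one_group_like by (simp add: group_like_def)
  note c = hopf_like_simps(3) [OF PA_hopf_like]
  have d: "sweedler k H (tensor k PA PA) (\<lambda>h1 h2. pure k PA PA (?r h1) (?r h2)) h = comult PA (?r h)"
    if h: "h \<in> carrier H" for h
  proof (rule H4_lin_eqI [OF sweedler_linear [OF H4_hopf_like V(2) b2] lin_comp [OF c rl] _ h])
    show "sweedler k H (tensor k PA PA) (\<lambda>h1 h2. pure k PA PA (?r h1) (?r h2)) (single k a) = comult PA (?r (single k a))" for a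
      by (cases a) (simp_all add: H4_sweedler [OF V(2) b2] o pure_zero lin_zero [OF _ _ c])
  qed
  have e: "sweedler k H V0 (\<lambda>h1 h2. pu (?r h1) h2) h = sweedler k H V0 (\<lambda>h1 h2. pu (?r h2) h1) h"
    if h: "h \<in> carrier H" for h
  proof (rule H4_lin_eqI [OF sweedler_linear [OF H4_hopf_like V(1) b(1)] sweedler_linear [OF H4_hopf_like V(1) b(2)] _ h])
    show "sweedler k H V0 (\<lambda>h1 h2. pu (?r h1) h2) (single k a) = sweedler k H V0 (\<lambda>h1 h2. pu (?r h2) h1) (single k a)" for a
      by (cases a) (simp_all add: H4_sweedler [OF V(1) b(1)] H4_sweedler [OF V(1) b(2)] pure_zero)
  qed
  have "counit PA (?r h) = counit H h" if "h \<in> carrier H" for h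
    using that lin_smult [OF ePA_lin, of "counit H h" "\<one>\<^sub>PA"] by simp
  then show ?thesis
    using rl d e by (simp add: unitary_cocentral_def coalgebra_map_def H4_fields(5))
qed

context
  fixes r assumes r: "\<And>h. h \<in> carrier H ==> r h = counit H h \<odot>\<^sub>PA \<one>\<^sub>PA"
begin

lemma trivial_twist_action:
  assumes h: "h \<in> carrier H" and a: "a \<in> carrier PA"
  shows "sweedler3 k H PA (\<lambda>h1 h2 h3. r h1 \<otimes>\<^sub>PA trivial_action (pure k H PA h2 a) \<otimes>\<^sub>PA antipode k PA (r h3)) h =
    trivial_action (pure k H PA h a)"
proof -
  have S: "antipode k PA (c \<odot>\<^sub>PA \<one>\<^sub>PA) = c \<odot>\<^sub>PA \<one>\<^sub>PA" if "c \<in> carrier k" for c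
    using that antipode_is_antipode [OF PA_hopf] antipode_one [OF PA_hopf] lin_smult [of "antipode k PA" PA PA c "\<one>\<^sub>PA"]
    by (simp add: is_antipode_def)
  have l: "(\<lambda>x. counit H x \<odot>\<^sub>PA a) \<in> lin H PA" by (rule lin_smult_right [OF _ H4_counit_lin a]) simp
  have *: "sweedler k H PA (\<lambda>h2 h3. r h1 \<otimes>\<^sub>PA trivial_action (pure k H PA h2 a) \<otimes>\<^sub>PA antipode k PA (r h3)) d =
      counit H h1 \<odot>\<^sub>PA (counit H d \<odot>\<^sub>PA a)" if "h1 \<in> carrier H" "d \<in> carrier H" for h1 d
    by (rule H4_counit_right [OF lin_smult_left [OF _ l] _ that(2)])
      (use that a in \<open>simp_all add: r S trivial_action(3) asmult_left asmult_right vsmult_assoc [symmetric] m_ac\<close>)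
  show ?thesis
    unfolding sweedler3_def trivial_action(3) [OF h a]
    by (rule H4_counit_left [OF l _ h *]) simp_all
qed

text \<open>As r is the counit times 1, every component except h3 and g2 enters through a counit;
  these components are removed one by one, from the innermost sum outwards.\<close>

lemma trivial_twist_cocycle:
  assumes h: "h \<in> carrier H" and g: "g \<in> carrier H" and f: "f \<in> lin (tensor k H H) PA"
  shows "sweedler4 k H PA (\<lambda>h1 h2 h3 h4. sweedler3 k H PA (\<lambda>g1 g2 g3.
      r h1 \<otimes>\<^sub>PA trivial_action (pure k H PA h2 (r g1)) \<otimes>\<^sub>PA f (pure k H H h3 g2)
        \<otimes>\<^sub>PA antipode k PA (r (h4 \<otimes>\<^sub>H g3))) g) h = f (pure k H H h g)"
proof -
  have S: "antipode k PA (c \<odot>\<^sub>PA \<one>\<^sub>PA) = c \<odot>\<^sub>PA \<one>\<^sub>PA" if "c \<in> carrier k" for c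
    using that antipode_is_antipode [OF PA_hopf] antipode_one [OF PA_hopf] lin_smult [of "antipode k PA" PA PA c "\<one>\<^sub>PA"]
    by (simp add: is_antipode_def)
  have fc: "f (pure k H H u v) \<in> carrier PA" if "u \<in> carrier H" "v \<in> carrier H" for u v
    using lin_closed [OF f] that by simp
  have fl: "(\<lambda>u. f (pure k H H u g)) \<in> lin H PA"
    by (rule lin_comp [OF f bilin_lin(2) [OF bilin_pure]]) (use g in auto)
  have fr: "(\<lambda>v. f (pure k H H u v)) \<in> lin H PA" if "u \<in> carrier H" for u
    by (rule lin_comp [OF f bilin_lin(1) [OF bilin_pure]]) (use that in auto)
  have mc: "u \<otimes>\<^sub>H v \<in> carrier H" if "u \<in> carrier H" "v \<in> carrier H" for u v
    using na_mult_closed [OF H4_na] that by simp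
  let ?i = "\<lambda>h1 h2 h3 h4 g1 g2 g3. r h1 \<otimes>\<^sub>PA trivial_action (pure k H PA h2 (r g1)) \<otimes>\<^sub>PA f (pure k H H h3 g2)
        \<otimes>\<^sub>PA antipode k PA (r (h4 \<otimes>\<^sub>H g3))"
  note s = r S trivial_action(3) asmult_left asmult_right vsmult_assoc [symmetric] m_ac mc fc H4_counit_mult
  have 1: "sweedler k H PA (\<lambda>g2 g3. ?i h1 h2 h3 h4 g1 g2 g3) d =
      counit H g1 \<odot>\<^sub>PA (counit H h4 \<odot>\<^sub>PA (counit H h2 \<odot>\<^sub>PA (counit H h1 \<odot>\<^sub>PA f (pure k H H h3 d))))"
    if c: "h1 \<in> carrier H" "h2 \<in> carrier H" "h3 \<in> carrier H" "h4 \<in> carrier H" "g1 \<in> carrier H" "d \<in> carrier H"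
    for h1 h2 h3 h4 g1 d
    by (rule H4_counit_right [OF _ _ c(6)])
      (use c in \<open>simp_all add: s lin_smult_left fr\<close>)
  have 2: "sweedler3 k H PA (\<lambda>g1 g2 g3. ?i h1 h2 h3 h4 g1 g2 g3) g =
      counit H h4 \<odot>\<^sub>PA (counit H h2 \<odot>\<^sub>PA (counit H h1 \<odot>\<^sub>PA f (pure k H H h3 g)))"
    if c: "h1 \<in> carrier H" "h2 \<in> carrier H" "h3 \<in> carrier H" "h4 \<in> carrier H" for h1 h2 h3 h4
    unfolding sweedler3_def
    by (rule H4_counit_left [OF _ _ g 1]) (use c in \<open>simp_all add: lin_smult_left fr\<close>)
  let ?G = "\<lambda>h1 h2 h3 h4. sweedler3 k H PA (\<lambda>g1 g2 g3. ?i h1 h2 h3 h4 g1 g2 g3) g"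
  have 3: "sweedler k H PA (\<lambda>h3 h4. ?G h1 h2 h3 h4) d =
      counit H h2 \<odot>\<^sub>PA (counit H h1 \<odot>\<^sub>PA f (pure k H H d g))"
    if c: "h1 \<in> carrier H" "h2 \<in> carrier H" "d \<in> carrier H" for h1 h2 d
    by (rule H4_counit_right [OF _ _ c(3) 2]) (use c in \<open>simp_all add: lin_smult_left fl\<close>)
  have 4: "sweedler3 k H PA (\<lambda>h2 h3 h4. ?G h1 h2 h3 h4) d = counit H h1 \<odot>\<^sub>PA f (pure k H H d g)"
    if c: "h1 \<in> carrier H" "d \<in> carrier H" for h1 d
    unfolding sweedler3_def [where \<beta> = "\<lambda>h2 h3 h4. ?G h1 h2 h3 h4"]
    by (rule H4_counit_left [OF _ _ c(2) 3]) (use c in \<open>simp_all add: lin_smult_left fl\<close>)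
  show ?thesis
    unfolding sweedler4_def
    by (rule H4_counit_left [OF fl _ h 4]) simp_all
qed

end

end

context char_field
begin

lemma crossed_equiv_eq: "crossed_equiv k PA H = Id_on (crossed_systems k PA H)"
proof (rule Set.set_eqI, rule iffI)
  fix z assume z: "z \<in> crossed_equiv k PA H"
  obtain act f act' f' where z4: "z = ((act, f), (act', f'))" by (cases z) auto
  have cs: "(act, f) \<in> crossed_systems k PA H" "(act', f') \<in> crossed_systems k PA H"
    using z unfolding z4 crossed_equiv_def by auto
  have act: "act = trivial_action" "act' = trivial_action"
    using cs unfolding crossed_systems_eq by auto
  have f: "f \<in> lin (tensor k H H) PA" "f \<in> extensional (carrier (tensor k H H))"
    and f': "f' \<in> lin (tensor k H H) PA" "f' \<in> extensional (carrier (tensor k H H))"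
    using cs unfolding crossed_systems_def by auto
  from z obtain r where r: "unitary_cocentral k H PA r"
    and eq: "\<forall>h \<in> carrier H. \<forall>g \<in> carrier H. f' (pure k H H h g) =
      sweedler4 k H PA (\<lambda>h1 h2 h3 h4. sweedler3 k H PA (\<lambda>g1 g2 g3.
        r h1 \<otimes>\<^sub>PA trivial_action (pure k H PA h2 (r g1)) \<otimes>\<^sub>PA f (pure k H H h3 g2)
          \<otimes>\<^sub>PA antipode k PA (r (h4 \<otimes>\<^sub>H g3))) g) h"
    unfolding z4 crossed_equiv_def act by blast
  have "f' (pure k H H (single k a) (single k b)) = f (pure k H H (single k a) (single k b))" for a b
    by (rule trans [OF bspec [OF bspec [OF eq H4_single] H4_single]
          trivial_twist_cocycle [OF unitary_cocentral_trivial [OF r] H4_single H4_single f(1)]])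
  then have "f' = f" by (rule cocycle_eqI [OF f' f])
  then show "z \<in> Id_on (crossed_systems k PA H)" using cs act z4 by auto
next
  fix z assume "z \<in> Id_on (crossed_systems k PA H)"
  then obtain act f where z: "z = ((act, f), (act, f))" and cs: "(act, f) \<in> crossed_systems k PA H" by auto
  have act: "act = trivial_action" using cs unfolding crossed_systems_eq by auto
  have f: "f \<in> lin (tensor k H H) PA" using cs unfolding crossed_systems_def by auto
  let ?r = "\<lambda>h. counit H h \<odot>\<^sub>PA \<one>\<^sub>PA"
  show "z \<in> crossed_equiv k PA H"
    unfolding z crossed_equiv_def act mem_Collect_eq prod.case
  proof (intro conjI exI [of _ ?r] ballI)
    show "unitary_cocentral k H PA ?r" by (rule unitary_cocentral_counit)
    show "trivial_action (pure k H PA h a) = sweedler3 k H PA (\<lambda>h1 h2 h3. ?r h1 \<otimes>\<^sub>PA trivial_action (pure k H PA h2 a)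
        \<otimes>\<^sub>PA antipode k PA (?r h3)) h" if "h \<in> carrier H" "a \<in> carrier PA" for h a
      by (rule trivial_twist_action [symmetric, OF refl that])
    show "f (pure k H H h g) = sweedler4 k H PA (\<lambda>h1 h2 h3 h4. sweedler3 k H PA (\<lambda>g1 g2 g3.
        ?r h1 \<otimes>\<^sub>PA trivial_action (pure k H PA h2 (?r g1)) \<otimes>\<^sub>PA f (pure k H H h3 g2)
          \<otimes>\<^sub>PA antipode k PA (?r (h4 \<otimes>\<^sub>H g3))) g) h" if "h \<in> carrier H" "g \<in> carrier H" for h g
      by (rule trivial_twist_cocycle [symmetric, OF refl that f])
  qed (use cs act in auto)
qed

lemma H2_bij: "\<exists>\<Psi>. bij_betw \<Psi> (H2 k H PA) (fin_seqs k)"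
proof -
  have H: "H2 k H PA = (\<lambda>\<alpha>. {(trivial_action, cocycle_of \<alpha>)}) ` fin_seqs k"
    unfolding H2_def crossed_equiv_eq quotient_def crossed_systems_eq by (auto simp: Id_on_def)
  have "inj_on (\<lambda>\<alpha>. {(trivial_action, cocycle_of \<alpha>)}) (fin_seqs k)"
    using cocycle_of_inj unfolding inj_on_def by blast
  then have "bij_betw (\<lambda>\<alpha>. {(trivial_action, cocycle_of \<alpha>)}) (fin_seqs k) (H2 k H PA)"
    unfolding bij_betw_def H by blast
  then show ?thesis using bij_betw_inv by blast
qed

end

context base_field
begin

section \<open>Group-like and primitive elements\<close>

lemma PA_lin_combination_const:
  assumes q: "q \<in> carrier PA" and z: "\<And>n. n > 0 ==> q n = \<zero>"
  shows "q = q 0 \<odot>\<^sub>PA \<one>\<^sub>PA"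
proof
  fix n
  have "(q 0 \<odot>\<^sub>PA \<one>\<^sub>PA) n = q 0 \<otimes> single k 0 n"
    using q PA_coeff(2) [of "q 0" "\<one>\<^sub>PA" n] by (simp add: PA_ops(2))
  then show "q n = (q 0 \<odot>\<^sub>PA \<one>\<^sub>PA) n"
    using q z [of n] by (cases "n = 0") (simp_all add: single_def)
qed

text \<open>If q has degree m > 0, the coordinate (m, m) of q \<otimes> q is the nonzero square of
  the leading coefficient, while that of \<Delta>(q) is zero because 2m exceeds the degree. The
  constant that remains is idempotent.\<close>

lemma PA_group_like_cases:
  assumes q: "group_like k PA q"
  shows "q = \<zero>\<^sub>PA \<or> q = \<one>\<^sub>PA"
proof -
  have qc: "q \<in> carrier PA" and \<Delta>: "comult PA q = pure k PA PA q q" using q by (simp_all add: group_like_def)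
  have eq: "nk ((i + j) choose i) \<otimes> q (i + j) = q i \<otimes> q j" for i j
    using cc_comult [OF qc, of i j] cc_pure [OF qc qc, of i j] by (simp add: \<Delta>)
  have z: "q n = \<zero>" if n: "n > 0" for n
  proof (rule ccontr)
    assume nz: "q n \<noteq> \<zero>"
    have fin: "finite {n. q n \<noteq> \<zero>}" using qc by (simp add: PA_carrier free_space_simps)
    define m where "m = Max {n. q n \<noteq> \<zero>}"
    have m: "q m \<noteq> \<zero>" "n \<le> m" using Max_in [OF fin] Max_ge [OF fin] nz by (auto simp: m_def)
    have "\<not> m + m \<le> m" using n m by simp
    then have "q (m + m) = \<zero>" using Max_ge [OF fin, of "m + m"] by (auto simp: m_def)
    then have "q m \<otimes> q m = \<zero>" using eq [of m m] by simp
    then show False using m qc integral by (meson PA_coeff_closed)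
  qed
  have "q 0 = q 0 \<otimes> q 0" using eq [of 0 0] qc by simp
  then have "q 0 = \<zero> \<or> q 0 = \<one>" using qc by (metis PA_coeff_closed m_lcancel one_closed r_one)
  moreover have "q = q 0 \<odot>\<^sub>PA \<one>\<^sub>PA" using PA_lin_combination_const [OF qc z] .
  ultimately show ?thesis by (metis vsmult_null [OF kalg_module [OF PA_kalg]] vsmult_one [OF kalg_module [OF PA_kalg]] aone_closed [OF PA_kalg])
qed

text \<open>The component at a pair (b, c) of basis elements in the square of k[Y] \<otimes> H, an
  element of k[Y] \<otimes> k[Y].\<close>

definition comp2 where
  "comp2 b c = tlift (tensor k PA PA) (\<lambda>s t. pure k PA PA (proj b s) (proj c t))"

lemma comp2_bilin: "bilin V0 V0 (tensor k PA PA) (\<lambda>s t. pure k PA PA (proj b s) (proj c t))"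
  by (rule bilin_pure_map) (simp_all add: proj_lin)

lemma comp2_lin: "comp2 b c \<in> lin V2 (tensor k PA PA)"
  unfolding comp2_def by (rule tensor_lift_linear [OF _ _ _ comp2_bilin]) auto

lemma comp2_pure: "s \<in> carrier V0 ==> t \<in> carrier V0 ==> comp2 b c (pv s t) = pure k PA PA (proj b s) (proj c t)"
  unfolding comp2_def by (rule tensor_lift_pure [OF _ _ _ comp2_bilin]) auto

lemma comp2_quad:
  assumes S: "S \<in> carrier (tensor k PA PA)" and h: "h1 \<in> carrier H" "h2 \<in> carrier H"
  shows "comp2 b c (quad PA H S (pure k H H h1 h2)) = (h1 b \<otimes> h2 c) \<odot>\<^bsub>tensor k PA PA\<^esub> S"
proof (rule tensor_lin_eqI [OF _ _ _ _ _ S])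
  have ph: "pure k H H h1 h2 \<in> carrier (tensor k H H)" using h by simp
  have hc: "h1 b \<in> carrier k" "h2 c \<in> carrier k" using h by (auto simp: H4_carrier)
  show "(\<lambda>S. comp2 b c (quad PA H S (pure k H H h1 h2))) \<in> lin (tensor k PA PA) (tensor k PA PA)"
    by (rule lin_comp [OF comp2_lin bilin_lin(2) [OF qbil ph]])
  show "(\<lambda>S. (h1 b \<otimes> h2 c) \<odot>\<^bsub>tensor k PA PA\<^esub> S) \<in> lin (tensor k PA PA) (tensor k PA PA)"
    by (rule lin_smult_left) (use hc in simp_all)
  fix a1 a2 assume a: "a1 \<in> carrier PA" "a2 \<in> carrier PA"
  show "comp2 b c (quad PA H (pure k PA PA a1 a2) (pure k H H h1 h2)) =
      (h1 b \<otimes> h2 c) \<odot>\<^bsub>tensor k PA PA\<^esub> pure k PA PA a1 a2"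
    using a h hc by (simp add: qpure comp2_pure proj_pure pure_smult_left pure_smult_right vsmult_assoc [symmetric] m_ac)
qed simp_all

text \<open>The pairs with nonzero value are the terms b \<otimes> c that occur in the
  comultiplications of 1, g, x and gx.\<close>

lemma comp2_comult:
  assumes t: "t \<in> carrier V0"
  shows "comp2 b c (comult TH t) = (case (b, c) of
      (B1, B1) => comult PA (proj B1 t) | (Bg, Bg) => comult PA (proj Bg t)
    | (Bx, B1) => comult PA (proj Bx t) | (Bg, Bx) => comult PA (proj Bx t)
    | (Bgx, Bg) => comult PA (proj Bgx t) | (B1, Bgx) => comult PA (proj Bgx t)
    | _ => \<zero>\<^bsub>tensor k PA PA\<^esub>)" (is "_ = ?R t")
proof (rule V0_lin_eqI [OF lin_comp [OF comp2_lin TH_comult_lin] _ _ t])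
  note cl = hopf_like_simps(3) [OF PA_hopf_like]
  show "?R \<in> lin V0 (tensor k PA PA)"
    by (cases b; cases c) (auto intro: lin_comp [OF cl proj_lin] lin_const_zero)
  fix q a assume q: "q \<in> carrier PA"
  note c0 = PA_comult_closed [OF q]
  note ad = lin_add [OF bilin_lin(1) [OF qbil c0]] lin_add [OF comp2_lin]
  have cl0: "quad PA H (comult PA q) (pure k H H u v) \<in> carrier V2" if "u \<in> carrier H" "v \<in> carrier H" for u v
    using bilin_closed [OF qbil c0] that by simp
  have s: "single k a' b' = (if b' = a' then \<one> else \<zero>)" for a' b' :: h4_basis by (simp add: single_def)
  show "comp2 b c (comult TH (pu q (single k a))) = ?R (pu q (single k a))"
    using q c0 cl0
    by (cases a; cases b; cases c)
      (simp_all add: TH_comult H4_comult_single h4_comult_def ad comp2_quad proj_single s lin_zero [OF _ _ cl])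
qed

lemma V0_expand:
  assumes t: "t \<in> carrier V0"
  shows "t = pu (proj B1 t) b1 \<oplus>\<^sub>V0 (pu (proj Bg t) bg \<oplus>\<^sub>V0 (pu (proj Bx t) bx \<oplus>\<^sub>V0 pu (proj Bgx t) bgx))"
proof (rule V0_lin_eqI [where \<phi> = "\<lambda>t. t", OF lin_id _ _ t])
  show "(\<lambda>t. pu (proj B1 t) b1 \<oplus>\<^sub>V0 (pu (proj Bg t) bg \<oplus>\<^sub>V0 (pu (proj Bx t) bx \<oplus>\<^sub>V0 pu (proj Bgx t) bgx))) \<in> lin V0 V0"
    by (intro lin_plus lin_pure_left proj_lin) simp_all
  show "pu q (single k b) = pu (proj B1 (pu q (single k b))) b1 \<oplus>\<^sub>V0 (pu (proj Bg (pu q (single k b))) bg \<oplus>\<^sub>V0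
      (pu (proj Bx (pu q (single k b))) bx \<oplus>\<^sub>V0 pu (proj Bgx (pu q (single k b))) bgx))" if "q \<in> carrier PA" for q b
    using that by (cases b) (simp_all add: proj_single pure_zero)
qed

lemma PA_comult_zeroD:
  assumes q: "q \<in> carrier PA" and z: "comult PA q = \<zero>\<^bsub>tensor k PA PA\<^esub>"
  shows "q = \<zero>\<^sub>PA"
proof -
  have "ee \<zero>\<^bsub>tensor k PA PA\<^esub> = \<zero>\<^sub>PA" by (rule lin_zero [OF _ _ ee_lin]) simp_all
  then show ?thesis using ee_comult [OF q] z by simp
qed

text \<open>The coordinates (0, n) and (n, 0) of \<Delta>(q) both equal \<open>q n\<close>, and for
  n > 0 one of them vanishes on the other side.\<close>

lemma PA_comult_const:
  assumes q: "q \<in> carrier PA" and e: "comult PA q = pure k PA PA q \<one>\<^sub>PA \<or> comult PA q = pure k PA PA \<one>\<^sub>PA q"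
  shows "q = q 0 \<odot>\<^sub>PA \<one>\<^sub>PA"
proof (rule PA_lin_combination_const [OF q])
  fix n :: nat assume n: "n > 0"
  have 1: "cc (comult PA q) (0, n) = q n" "cc (comult PA q) (n, 0) = q n"
    using cc_comult [OF q] q by simp_all
  have "cc (pure k PA PA q \<one>\<^sub>PA) (0, n) = \<zero>" "cc (pure k PA PA \<one>\<^sub>PA q) (n, 0) = \<zero>"
    using n q by (simp_all add: cc_pure) (simp_all add: PA_ops(2) single_def)
  with 1 e show "q n = \<zero>" by auto
qed

lemma pure_PA_zeroD:
  assumes q: "q \<in> carrier PA" and r: "r \<in> carrier PA" and z: "pure k PA PA q r = \<zero>\<^bsub>tensor k PA PA\<^esub>"
  shows "q = \<zero>\<^sub>PA \<or> r = \<zero>\<^sub>PA"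
proof (rule ccontr)
  assume "\<not> ?thesis"
  then obtain i j where n: "q i \<noteq> \<zero>" "r j \<noteq> \<zero>" by (auto simp: PA_ops(1) fun_eq_iff)
  have "q i \<otimes> r j = \<zero>"
    using cc_pure [OF q r, of i j] lin_zero [OF _ _ cc_linear] by (simp add: z free_space_simps)
  then show False using n q r integral by (meson PA_coeff_closed)
qed

text \<open>The pairs (1, g), (x, x) and (gx, gx) occur in no comultiplication of a basis element,
  so these components of t \<otimes> t vanish, and with each of them one of its factors.\<close>

lemma TH_group_like:
  assumes t: "t \<in> carrier V0" and \<Delta>: "comult TH t = pv t t"
  shows "t = \<zero>\<^sub>V0 \<or> t = pu \<one>\<^sub>PA b1 \<or> t = pu \<one>\<^sub>PA bg"
proof -
  have e: "pure k PA PA (proj b t) (proj c t) = comp2 b c (comult TH t)" for b c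
    using t by (simp add: \<Delta> comp2_pure)
  note e = e [unfolded comp2_comult [OF t]]
  have p: "proj b t \<in> carrier PA" for b using t by simp
  have g: "group_like k PA (proj B1 t)" "group_like k PA (proj Bg t)"
    unfolding group_like_def using p e [of B1 B1] e [of Bg Bg] by (simp_all only: prod.case h4_basis.case simp_thms)
  have "pure k PA PA (proj B1 t) (proj Bg t) = \<zero>\<^bsub>tensor k PA PA\<^esub>"
    "pure k PA PA (proj Bx t) (proj Bx t) = \<zero>\<^bsub>tensor k PA PA\<^esub>"
    "pure k PA PA (proj Bgx t) (proj Bgx t) = \<zero>\<^bsub>tensor k PA PA\<^esub>"
    by (simp_all only: e prod.case h4_basis.case)
  then have z: "proj B1 t = \<zero>\<^sub>PA \<or> proj Bg t = \<zero>\<^sub>PA" "proj Bx t = \<zero>\<^sub>PA" "proj Bgx t = \<zero>\<^sub>PA"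
    using pure_PA_zeroD [OF p p] by blast+
  have t': "t = pu (proj B1 t) b1 \<oplus>\<^sub>V0 pu (proj Bg t) bg"
    using V0_expand [OF t] p by (simp add: z(2,3) pure_zero)
  consider "proj B1 t = \<zero>\<^sub>PA" "proj Bg t = \<zero>\<^sub>PA" | "proj B1 t = \<one>\<^sub>PA" "proj Bg t = \<zero>\<^sub>PA"
    | "proj B1 t = \<zero>\<^sub>PA" "proj Bg t = \<one>\<^sub>PA"
    using PA_group_like_cases [OF g(1)] PA_group_like_cases [OF g(2)] z(1) by blast
  then show ?thesis
    by cases (use t' in \<open>simp_all add: pure_zero\<close>)
qed

lemma TH_primitive:
  assumes t: "t \<in> carrier V0" and \<Delta>: "comult TH t = pv t (pu \<one>\<^sub>PA b1) \<oplus>\<^sub>V2 pv (pu \<one>\<^sub>PA b1) t"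
  shows "primitive k PA (proj B1 t)" "t = pu (proj B1 t) b1"
proof -
  have "comp2 b c (comult TH t) = pure k PA PA (proj b t) (if c = B1 then \<one>\<^sub>PA else \<zero>\<^sub>PA) \<oplus>\<^bsub>tensor k PA PA\<^esub>
      pure k PA PA (if b = B1 then \<one>\<^sub>PA else \<zero>\<^sub>PA) (proj c t)" for b c
    using t by (simp add: \<Delta> lin_add [OF comp2_lin] comp2_pure proj_single)
  note e = this [unfolded comp2_comult [OF t]]
  show "primitive k PA (proj B1 t)"
    using e [of B1 B1] t by (simp add: primitive_def)
  have z: "proj Bg t = \<zero>\<^sub>PA"
    by (rule PA_comult_zeroD [OF proj_closed [OF t]]) (use e [of Bg Bg] t in \<open>simp add: pure_zero\<close>)
  have "proj Bx t = \<zero>\<^sub>PA" "proj Bgx t = \<zero>\<^sub>PA"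
    by (rule PA_comult_zeroD [OF proj_closed [OF t]]; use e [of Bg Bx] e [of Bgx Bg] t z in \<open>simp add: pure_zero\<close>)+
  with z show "t = pu (proj B1 t) b1" using V0_expand [OF t] t by (simp add: pure_zero)
qed

lemma TH_skew_primitive:
  assumes t: "t \<in> carrier V0" and \<Delta>: "comult TH t = pv t (pu \<one>\<^sub>PA b1) \<oplus>\<^sub>V2 pv (pu \<one>\<^sub>PA bg) t"
  shows "\<exists>c \<in> carrier k. \<exists>d \<in> carrier k. t = c \<odot>\<^sub>V0 (pu \<one>\<^sub>PA b1 \<oplus>\<^sub>V0 \<ominus>\<^sub>V0 pu \<one>\<^sub>PA bg) \<oplus>\<^sub>V0 d \<odot>\<^sub>V0 pu \<one>\<^sub>PA bx"
proof -
  have "comp2 b c (comult TH t) = pure k PA PA (proj b t) (if c = B1 then \<one>\<^sub>PA else \<zero>\<^sub>PA) \<oplus>\<^bsub>tensor k PA PA\<^esub>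
      pure k PA PA (if b = Bg then \<one>\<^sub>PA else \<zero>\<^sub>PA) (proj c t)" for b c
    using t by (simp add: \<Delta> lin_add [OF comp2_lin] comp2_pure proj_single)
  note e = this [unfolded comp2_comult [OF t]]
  have p: "proj b t \<in> carrier PA" for b using t by simp
  let ?c = "proj B1 t 0" and ?d = "proj Bx t 0" and ?g = "proj Bg t 0"
  have c: "?c \<in> carrier k" "?d \<in> carrier k" "?g \<in> carrier k" using p by simp_all
  have 1: "proj B1 t = ?c \<odot>\<^sub>PA \<one>\<^sub>PA" by (rule PA_comult_const [OF p]) (use e [of B1 B1] p in \<open>simp add: pure_zero\<close>)
  have g: "proj Bg t = ?g \<odot>\<^sub>PA \<one>\<^sub>PA" by (rule PA_comult_const [OF p]) (use e [of Bg Bg] p in \<open>simp add: pure_zero\<close>)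
  have x: "proj Bx t = ?d \<odot>\<^sub>PA \<one>\<^sub>PA" by (rule PA_comult_const [OF p]) (use e [of Bx B1] p in \<open>simp add: pure_zero\<close>)
  have gx: "proj Bgx t = \<zero>\<^sub>PA" by (rule PA_comult_zeroD [OF p]) (use e [of B1 Bgx] p in \<open>simp add: pure_zero\<close>)
  \<comment> \<open>The pair (g, 1) does not occur in \<Delta>, so the constants of t at 1 and at g
    are opposite; this produces the multiple of 1 - g.\<close>
  have "pure k PA PA (proj Bg t) \<one>\<^sub>PA \<oplus>\<^bsub>tensor k PA PA\<^esub> pure k PA PA \<one>\<^sub>PA (proj B1 t) = \<zero>\<^bsub>tensor k PA PA\<^esub>"
    using e [of Bg B1] by simp
  then have "cc (pure k PA PA (proj Bg t) \<one>\<^sub>PA \<oplus>\<^bsub>tensor k PA PA\<^esub> pure k PA PA \<one>\<^sub>PA (proj B1 t)) (0, 0) = \<zero>"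
    using lin_zero [OF _ _ cc_linear] by (simp add: free_space_simps)
  then have "?g \<oplus> ?c = \<zero>" using p c by (simp add: cc_add cc_pure) (simp add: PA_ops(2) single_def)
  then have gc: "?g = \<ominus> ?c" using c by (metis minus_equality)
  have "t = ?c \<odot>\<^sub>V0 (pu \<one>\<^sub>PA b1 \<oplus>\<^sub>V0 \<ominus>\<^sub>V0 pu \<one>\<^sub>PA bg) \<oplus>\<^sub>V0 ?d \<odot>\<^sub>V0 pu \<one>\<^sub>PA bx"
    by (subst V0_expand [OF t], subst 1, subst g, subst x)
      (use c in \<open>simp add: gx gc pure_zero pure_smult_left pure_neg_left vsmult_add vsmult_neg_left vsmult_neg vadd_assoc\<close>)
  with c show ?thesis by blast
qed

end

context char_field
begin

section \<open>Group-like and primitive elements of the presented algebra\<close>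

lemma Th_crossed_product:
  assumes \<alpha>: "\<alpha> \<in> fin_seqs k"
  shows "Th \<alpha> \<in> hopf_hom k (CP \<alpha>) (AH \<alpha>)" "bij_betw (Th \<alpha>) (carrier (CP \<alpha>)) (carrier (AH \<alpha>))" "hopf_like (CP \<alpha>)"
proof -
  have P: "ppY \<alpha> \<in> carrier PA" using \<alpha> by simp
  have m: "bilin V0 V0 V0 (cm trivial_action (cocycle_of \<alpha>))"
    by (rule cm_bilin [OF trivial_action(1) cocycle(1) [OF P]])
  show "Th \<alpha> \<in> hopf_hom k (CP \<alpha>) (AH \<alpha>)"
    unfolding crossed_product_eq by (rule Th_hopf_hom [OF \<alpha> m cocycle_mult [OF P]])
  show "bij_betw (Th \<alpha>) (carrier (CP \<alpha>)) (carrier (AH \<alpha>))"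
    by (simp add: crossed_product_eq) (rule Th_bij [OF \<alpha> m cocycle_mult [OF P]])
  show "hopf_like (CP \<alpha>)"
    unfolding crossed_product_eq by (rule tensor_hopf_mult_hopf_like [OF PA_hopf_like H4_hopf_like m])
qed

context
  fixes \<alpha> assumes \<alpha>: "\<alpha> \<in> fin_seqs k"
begin

private lemmas K [simp] = AH_kalg [OF \<alpha>]
private lemmas C [simp] = AH_closed [OF \<alpha>]

private lemma H [simp]: "hopf_like (AH \<alpha>)"
  by (rule hopf_like_hopf [OF AH_hopf [OF \<alpha>]])

private lemma Th_linear: "Th \<alpha> \<in> lin V0 (AH \<alpha>)"
  using alg_hom_lin [OF hopf_hom_alg [OF Th_crossed_product(1) [OF \<alpha>]]]
  by (simp add: lin_maps_def crossed_product_eq)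

text \<open>Moves a special element through the inverse of \<open>Th\<close> to k[Y] \<otimes> H,
  where the comultiplication is that of the tensor product and the preceding classification
  applies.\<close>

private lemma pull_back:
  fixes z defines "t \<equiv> inv_into (carrier V0) (Th \<alpha>) z"
  assumes z: "z \<in> carrier (AH \<alpha>)"
  shows "t \<in> carrier V0" "z = Th \<alpha> t" "group_like k (AH \<alpha>) z ==> comult TH t = pv t t"
    "primitive k (AH \<alpha>) z ==> comult TH t = pv t (pu \<one>\<^sub>PA b1) \<oplus>\<^sub>V2 pv (pu \<one>\<^sub>PA b1) t"
    "skew_primitive k (AH \<alpha>) (Ag \<alpha>) z ==> comult TH t = pv t (pu \<one>\<^sub>PA b1) \<oplus>\<^sub>V2 pv (pu \<one>\<^sub>PA bg) t"
proof -
  let ?\<psi> = "inv_into (carrier (CP \<alpha>)) (Th \<alpha>)"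
  note T = Th_crossed_product [OF \<alpha>]
  have c: "carrier (CP \<alpha>) = carrier V0" by (simp add: crossed_product_eq)
  have s: "comult (CP \<alpha>) = comult TH" "one (CP \<alpha>) = pu \<one>\<^sub>PA b1" "pure k (CP \<alpha>) (CP \<alpha>) = pv" "add (tensor k (CP \<alpha>) (CP \<alpha>)) = add V2"
    unfolding crossed_product_eq
    using tensor_hopf_mult_pure(2,6) [OF PA_hopf_like H4_hopf_like] by (simp_all add: pu_one)
  have \<psi>: "?\<psi> \<in> hopf_hom k (AH \<alpha>) (CP \<alpha>)"
    by (rule hopf_hom_inv [OF T(3) _ T(1,2)]) simp
  have t: "t = ?\<psi> z" by (simp add: t_def c)
  show "t \<in> carrier V0" "z = Th \<alpha> t"
    using z T(2) unfolding t_def c by (auto simp: bij_betw_def inv_into_into f_inv_into_f)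
  have g: "?\<psi> (Ag \<alpha>) = pu \<one>\<^sub>PA bg"
  proof -
    have "pu \<one>\<^sub>PA bg \<in> carrier (CP \<alpha>)" by (simp add: c)
    then show ?thesis using bij_betw_inv_into_left [OF T(2)] Th_values(2) [OF \<alpha>] by metis
  qed
  show "comult TH t = pv t t" if "group_like k (AH \<alpha>) z"
    using hopf_hom_group_like [OF H T(3) \<psi> that] by (simp add: group_like_def s t)
  show "comult TH t = pv t (pu \<one>\<^sub>PA b1) \<oplus>\<^sub>V2 pv (pu \<one>\<^sub>PA b1) t" if "primitive k (AH \<alpha>) z"
    using hopf_hom_primitive [OF H T(3) \<psi> that] by (simp add: primitive_def s t)
  show "comult TH t = pv t (pu \<one>\<^sub>PA b1) \<oplus>\<^sub>V2 pv (pu \<one>\<^sub>PA bg) t" if "skew_primitive k (AH \<alpha>) (Ag \<alpha>) z"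
    using hopf_hom_skew_primitive [OF H T(3) \<psi> that] by (simp add: skew_primitive_def s t g)
qed

private lemma one_value: "Th \<alpha> (pu \<one>\<^sub>PA b1) = \<one>\<^bsub>AH \<alpha>\<^esub>"
  using Th_values(1) [OF \<alpha>, of "\<one>\<^sub>PA"] alg_hom_one [OF peval_hom(1) [OF K C(1)]] by simp

lemma AH_group_like_cases:
  assumes "group_like k (AH \<alpha>) z"
  shows "z = \<zero>\<^bsub>AH \<alpha>\<^esub> \<or> z = \<one>\<^bsub>AH \<alpha>\<^esub> \<or> z = Ag \<alpha>"
proof -
  have z: "z \<in> carrier (AH \<alpha>)" using assms by (simp add: group_like_def)
  show ?thesis
    using TH_group_like [OF pull_back(1) [OF z] pull_back(3) [OF z assms]] pull_back(2) [OF z]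
      Th_values(2) [OF \<alpha>] one_value lin_zero [OF _ _ Th_linear] by auto
qed

lemma AH_primitive_form:
  assumes "primitive k (AH \<alpha>) z"
  shows "\<exists>q. primitive k PA q \<and> z = peval (AH \<alpha>) (AY \<alpha>) q"
proof -
  have z: "z \<in> carrier (AH \<alpha>)" using assms by (simp add: primitive_def)
  note q = TH_primitive [OF pull_back(1) [OF z] pull_back(4) [OF z assms]]
  show ?thesis
    using q pull_back(2) [OF z] Th_values(1) [OF \<alpha>] proj_closed [OF pull_back(1) [OF z]] by metis
qed

lemma AH_skew_primitive_form:
  assumes "skew_primitive k (AH \<alpha>) (Ag \<alpha>) z"
  shows "\<exists>c \<in> carrier k. \<exists>d \<in> carrier k. z = c \<odot>\<^bsub>AH \<alpha>\<^esub> (\<one>\<^bsub>AH \<alpha>\<^esub> \<oplus>\<^bsub>AH \<alpha>\<^esub> \<ominus>\<^bsub>AH \<alpha>\<^esub> Ag \<alpha>) \<oplus>\<^bsub>AH \<alpha>\<^esub> d \<odot>\<^bsub>AH \<alpha>\<^esub> Ax \<alpha>"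
proof -
  have z: "z \<in> carrier (AH \<alpha>)" using assms by (simp add: skew_primitive_def)
  obtain c d where cd: "c \<in> carrier k" "d \<in> carrier k"
    and t: "inv_into (carrier V0) (Th \<alpha>) z = c \<odot>\<^sub>V0 (pu \<one>\<^sub>PA b1 \<oplus>\<^sub>V0 \<ominus>\<^sub>V0 pu \<one>\<^sub>PA bg) \<oplus>\<^sub>V0 d \<odot>\<^sub>V0 pu \<one>\<^sub>PA bx"
    using TH_skew_primitive [OF pull_back(1) [OF z] pull_back(5) [OF z assms]] by blast
  have "z = c \<odot>\<^bsub>AH \<alpha>\<^esub> (\<one>\<^bsub>AH \<alpha>\<^esub> \<oplus>\<^bsub>AH \<alpha>\<^esub> \<ominus>\<^bsub>AH \<alpha>\<^esub> Ag \<alpha>) \<oplus>\<^bsub>AH \<alpha>\<^esub> d \<odot>\<^bsub>AH \<alpha>\<^esub> Ax \<alpha>"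
    using pull_back(2) [OF z] cd Th_values(2,3) [OF \<alpha>]
    by (simp add: t lin_add [OF Th_linear] lin_smult [OF Th_linear] lin_neg [OF _ _ Th_linear] one_value)
  with cd show ?thesis by blast
qed

lemma Xi_values:
  "q \<in> carrier PA ==> Xi \<alpha> (peval (AH \<alpha>) (AY \<alpha>) q) = pu q b1" "Xi \<alpha> (Ag \<alpha>) = pu \<one>\<^sub>PA bg" "Xi \<alpha> (Ax \<alpha>) = pu \<one>\<^sub>PA bx"
  "Xi \<alpha> \<one>\<^bsub>AH \<alpha>\<^esub> = pu \<one>\<^sub>PA b1"
proof -
  have c: "q \<in> carrier PA ==> pu q (single k b) \<in> carrier V0" for q b by simp
  show "q \<in> carrier PA ==> Xi \<alpha> (peval (AH \<alpha>) (AY \<alpha>) q) = pu q b1"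
    using Xi_Th [OF \<alpha> c] by (simp only: Th_values(1) [OF \<alpha>, symmetric])
  show "Xi \<alpha> (Ag \<alpha>) = pu \<one>\<^sub>PA bg" "Xi \<alpha> (Ax \<alpha>) = pu \<one>\<^sub>PA bx" "Xi \<alpha> \<one>\<^bsub>AH \<alpha>\<^esub> = pu \<one>\<^sub>PA b1"
    unfolding Th_values(2,3) [OF \<alpha>, symmetric] one_value [symmetric] by (rule Xi_Th [OF \<alpha> c]; simp)+
qed

lemma AH_peval_inj:
  assumes "q \<in> carrier PA" "r \<in> carrier PA" "peval (AH \<alpha>) (AY \<alpha>) q = peval (AH \<alpha>) (AY \<alpha>) r"
  shows "q = r"
proof -
  have "pu q b1 = pu r b1" using Xi_values(1) [OF assms(1)] Xi_values(1) [OF assms(2)] by (simp only: assms(3))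
  then have "proj B1 (pu q b1) = proj B1 (pu r b1)" by (simp only:)
  then show ?thesis using assms(1,2) by (simp only: proj_single refl if_True)
qed

lemma AH_scale_inj:
  assumes "c \<in> carrier k" "d \<in> carrier k"
  shows "c \<odot>\<^bsub>AH \<alpha>\<^esub> AY \<alpha> = d \<odot>\<^bsub>AH \<alpha>\<^esub> AY \<alpha> ==> c = d" "c \<odot>\<^bsub>AH \<alpha>\<^esub> Ax \<alpha> = d \<odot>\<^bsub>AH \<alpha>\<^esub> Ax \<alpha> ==> c = d"
    "c \<odot>\<^bsub>AH \<alpha>\<^esub> (\<one>\<^bsub>AH \<alpha>\<^esub> \<oplus>\<^bsub>AH \<alpha>\<^esub> \<ominus>\<^bsub>AH \<alpha>\<^esub> Ag \<alpha>) = d \<odot>\<^bsub>AH \<alpha>\<^esub> (\<one>\<^bsub>AH \<alpha>\<^esub> \<oplus>\<^bsub>AH \<alpha>\<^esub> \<ominus>\<^bsub>AH \<alpha>\<^esub> Ag \<alpha>) ==> c = d"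
proof -
  have Y: "Xi \<alpha> (AY \<alpha>) = pu (single k 1) b1"
    using Xi_values(1) [of "single k 1"] peval_hom(2) [OF K C(1), of 1] by simp
  note l = lin_smult [OF Xi_lin [OF \<alpha>]] lin_add [OF Xi_lin [OF \<alpha>]] lin_neg [OF _ _ Xi_lin [OF \<alpha>]]
  define ev where "ev b n z = proj b (Xi \<alpha> z) n" for b z and n :: nat
  have e: "ev B1 1 (c \<odot>\<^bsub>AH \<alpha>\<^esub> AY \<alpha>) = c" "ev Bx 0 (c \<odot>\<^bsub>AH \<alpha>\<^esub> Ax \<alpha>) = c"
    "ev B1 0 (c \<odot>\<^bsub>AH \<alpha>\<^esub> (\<one>\<^bsub>AH \<alpha>\<^esub> \<oplus>\<^bsub>AH \<alpha>\<^esub> \<ominus>\<^bsub>AH \<alpha>\<^esub> Ag \<alpha>)) = c" if c: "c \<in> carrier k" for c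
    using c by (simp_all add: ev_def l Y Xi_values lin_smult [OF proj_lin] proj_single proj_add proj_neg PA_coeff(2) [where n = 1] PA_coeff(2) [where n = 0])
      (simp_all add: PA_ops(2) single_def)
  show "c \<odot>\<^bsub>AH \<alpha>\<^esub> AY \<alpha> = d \<odot>\<^bsub>AH \<alpha>\<^esub> AY \<alpha> ==> c = d" "c \<odot>\<^bsub>AH \<alpha>\<^esub> Ax \<alpha> = d \<odot>\<^bsub>AH \<alpha>\<^esub> Ax \<alpha> ==> c = d"
    "c \<odot>\<^bsub>AH \<alpha>\<^esub> (\<one>\<^bsub>AH \<alpha>\<^esub> \<oplus>\<^bsub>AH \<alpha>\<^esub> \<ominus>\<^bsub>AH \<alpha>\<^esub> Ag \<alpha>) = d \<odot>\<^bsub>AH \<alpha>\<^esub> (\<one>\<^bsub>AH \<alpha>\<^esub> \<oplus>\<^bsub>AH \<alpha>\<^esub> \<ominus>\<^bsub>AH \<alpha>\<^esub> Ag \<alpha>) ==> c = d"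
    using e [OF assms(1)] e [OF assms(2)] by metis+
qed

lemma AH_nonzero: "Ag \<alpha> \<noteq> \<zero>\<^bsub>AH \<alpha>\<^esub>" "Ag \<alpha> \<noteq> \<one>\<^bsub>AH \<alpha>\<^esub>"
proof -
  have "proj Bg (Xi \<alpha> (Ag \<alpha>)) = \<one>\<^sub>PA" "proj Bg (Xi \<alpha> \<one>\<^bsub>AH \<alpha>\<^esub>) = \<zero>\<^sub>PA" "proj Bg (Xi \<alpha> \<zero>\<^bsub>AH \<alpha>\<^esub>) = \<zero>\<^sub>PA"
    by (simp_all add: Xi_values proj_single lin_zero [OF _ _ Xi_lin [OF \<alpha>]] proj_zero)
  moreover have "\<one>\<^sub>PA \<noteq> \<zero>\<^sub>PA" using ePA_simps(1,2) by (metis one_not_zero)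
  ultimately show "Ag \<alpha> \<noteq> \<zero>\<^bsub>AH \<alpha>\<^esub>" "Ag \<alpha> \<noteq> \<one>\<^bsub>AH \<alpha>\<^esub>" by metis+
qed

text \<open>The components at 1 of finitely many elements involve finitely many powers of Y, so some
  Y^N has coefficient zero on their whole span.\<close>

lemma AH_infinite_dimensional: "\<not> finite_dimensional k (AH \<alpha>)"
proof
  assume "finite_dimensional k (AH \<alpha>)"
  then obtain S where S: "finite S" "S \<subseteq> carrier (AH \<alpha>)" "lin_span k (AH \<alpha>) S = carrier (AH \<alpha>)"
    by (auto simp: finite_dimensional_def)
  define L where "L z = proj B1 (Xi \<alpha> z)" for z
  have L: "L \<in> lin (AH \<alpha>) PA" unfolding L_def [abs_def] by (rule lin_comp [OF proj_lin Xi_lin [OF \<alpha>]])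
  have f: "finite (\<Union>z \<in> S. {n. L z n \<noteq> \<zero>})"
    using S lin_closed [OF L] by (auto simp: PA_carrier free_space_simps)
  then obtain N where N: "\<And>z. z \<in> S ==> L z N = \<zero>"
    using ex_new_if_finite [OF infinite_UNIV_nat f] by blast
  have l: "(\<lambda>z. L z N) \<in> lin (AH \<alpha>) (self_module k)"
    by (rule lin_mapsI) (use lin_closed [OF L] in \<open>simp_all add: lin_add [OF L] lin_smult [OF L] PA_coeff\<close>)
  have "submodule {z \<in> carrier (AH \<alpha>). L z N = \<zero>\<^bsub>self_module k\<^esub>} k (AH \<alpha>)"
    by (rule submodule_kernel [OF _ module_self l]) simp
  moreover have "S \<subseteq> {z \<in> carrier (AH \<alpha>). L z N = \<zero>\<^bsub>self_module k\<^esub>}" using N S by auto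
  ultimately have "carrier (AH \<alpha>) \<subseteq> {z \<in> carrier (AH \<alpha>). L z N = \<zero>\<^bsub>self_module k\<^esub>}"
    using lin_span_minimal unfolding S(3) [symmetric] by blast
  moreover have "peval (AH \<alpha>) (AY \<alpha>) (single k N) \<in> carrier (AH \<alpha>)"
    by (rule alg_hom_closed [OF peval_hom(1)]) simp_all
  ultimately have "L (peval (AH \<alpha>) (AY \<alpha>) (single k N)) N = \<zero>" by auto
  then show False by (simp add: L_def Xi_values proj_single) (simp add: single_def)
qed

end

end

context base_field
begin

lemma smult_pow:
  assumes B: "k_algebra k B" and y: "y \<in> carrier B" and c: "c \<in> carrier k"
  shows "(c \<odot>\<^sub>B y) [^]\<^bsub>B\<^esub> (n::nat) = (c [^] n) \<odot>\<^sub>B (y [^]\<^bsub>B\<^esub> n)"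
proof (induction n)
  case 0
  then show ?case using B by simp
next
  case (Suc n)
  have p: "y [^]\<^bsub>B\<^esub> n \<in> carrier B" using monoid.nat_pow_closed [OF kalg_monoid [OF B] y] .
  show ?case
    using B y c p by (simp add: Suc asmult_left asmult_right vsmult_assoc [symmetric] m_comm)
qed

end

context char_field
begin

section \<open>Isomorphisms and automorphisms\<close>

text \<open>The condition for Y -> a Y, g -> g, x -> b x to respect the relation for x^2: it equates
  P_\<alpha>(a Y) and b^2 P_\<beta>(Y) coefficient by coefficient.\<close>

definition scalable where
  "scalable \<alpha> \<beta> a b \<longleftrightarrow> a \<in> Units k \<and> b \<in> Units k \<and> (\<forall>i. a [^] (p ^ i) \<otimes> \<alpha> i = b [^] (2::nat) \<otimes> \<beta> i)"

lemma pp_scale: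
  assumes B: "k_algebra k B" and y: "y \<in> carrier B" and \<alpha>: "\<alpha> \<in> fin_seqs k" and a: "a \<in> carrier k"
  shows "(\<lambda>i. a [^] (p ^ i) \<otimes> \<alpha> i) \<in> fin_seqs k" "pp B \<alpha> (a \<odot>\<^sub>B y) = pp B (\<lambda>i. a [^] (p ^ i) \<otimes> \<alpha> i) y"
proof -
  let ?S = "{i. \<alpha> i \<noteq> \<zero>}"
  have c: "\<alpha> i \<in> carrier k" for i using \<alpha> by (simp add: fin_seqs_def)
  have S: "finite ?S" "{i. a [^] (p ^ i) \<otimes> \<alpha> i \<noteq> \<zero>} \<subseteq> ?S" using \<alpha> a by (auto simp: fin_seqs_def)
  show f: "(\<lambda>i. a [^] (p ^ i) \<otimes> \<alpha> i) \<in> fin_seqs k"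
    using finite_subset [OF S(2,1)] a c by (simp add: fin_seqs_def)
  have yp: "y [^]\<^bsub>B\<^esub> (n::nat) \<in> carrier B" for n using monoid.nat_pow_closed [OF kalg_monoid [OF B] y] .
  have M: "module k B" using B by simp
  have "pp B (\<lambda>i. a [^] (p ^ i) \<otimes> \<alpha> i) y = (\<Oplus>\<^sub>B i \<in> ?S. (a [^] (p ^ i) \<otimes> \<alpha> i) \<odot>\<^sub>B y [^]\<^bsub>B\<^esub> (p ^ i))"
    unfolding pp_def
    by (rule lin_ext_superset [OF M f [unfolded fin_seqs_carrier] _ S]) (use yp in auto)
  also have "\<dots> = (\<Oplus>\<^sub>B i \<in> ?S. \<alpha> i \<odot>\<^sub>B (a \<odot>\<^sub>B y) [^]\<^bsub>B\<^esub> (p ^ i))"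
    by (rule vfinsum_cong) (use M B y a c yp in \<open>simp_all add: smult_pow [OF B y a] vsmult_assoc [symmetric] m_comm\<close>)
  finally show "pp B \<alpha> (a \<odot>\<^sub>B y) = pp B (\<lambda>i. a [^] (p ^ i) \<otimes> \<alpha> i) y"
    by (simp only: pp_def lin_ext_def)
qed

lemma pp_smult:
  assumes B: "k_algebra k B" and y: "y \<in> carrier B" and \<beta>: "\<beta> \<in> fin_seqs k" and c: "c \<in> carrier k"
  shows "(\<lambda>i. c \<otimes> \<beta> i) \<in> fin_seqs k" "pp B (\<lambda>i. c \<otimes> \<beta> i) y = c \<odot>\<^sub>B pp B \<beta> y"
proof -
  have f: "\<beta> \<in> carrier (free_space k UNIV)" using \<beta> by (simp add: fin_seqs_carrier)
  have s: "c \<odot>\<^bsub>free_space k UNIV\<^esub> \<beta> = (\<lambda>i. c \<otimes> \<beta> i)" by (simp add: free_space_simps)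
  show "(\<lambda>i. c \<otimes> \<beta> i) \<in> fin_seqs k"
    using vsmult_closed [OF free_space_module c f] by (simp only: s fin_seqs_carrier)
  show "pp B (\<lambda>i. c \<otimes> \<beta> i) y = c \<odot>\<^sub>B pp B \<beta> y"
    using lin_smult [OF pp_linear [OF B y] c f] by (simp only: s)
qed

lemma pp_inject:
  assumes "\<alpha> \<in> fin_seqs k" "\<beta> \<in> fin_seqs k" "\<gamma> \<in> fin_seqs k" "pp (AH \<alpha>) \<beta> (AY \<alpha>) = pp (AH \<alpha>) \<gamma> (AY \<alpha>)"
  shows "\<beta> = \<gamma>"
proof -
  note \<alpha> = assms(1)
  have "peval (AH \<alpha>) (AY \<alpha>) (ppY \<beta>) = peval (AH \<alpha>) (AY \<alpha>) (ppY \<gamma>)"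
    using assms(4) by (simp only: peval_pp [OF AH_kalg [OF \<alpha>] AH_closed(1) [OF \<alpha>] assms(2)] peval_pp [OF AH_kalg [OF \<alpha>] AH_closed(1) [OF \<alpha>] assms(3)])
  then have e: "ppY \<beta> = ppY \<gamma>" by (rule AH_peval_inj [OF \<alpha>, rotated -1]) (use assms in simp_all)
  show ?thesis
    by (rule ext) (rule trans [OF sym [OF pp_coeff(1) [OF assms(2)]] trans [OF fun_cong [OF e] pp_coeff(1) [OF assms(3)]]])
qed

definition scale where
  "scale \<beta> a b = A_lift (AH \<beta>) (a \<odot>\<^bsub>AH \<beta>\<^esub> AY \<beta>) (Ag \<beta>) (b \<odot>\<^bsub>AH \<beta>\<^esub> Ax \<beta>)"

lemma scale:
  assumes \<alpha>: "\<alpha> \<in> fin_seqs k" and \<beta>: "\<beta> \<in> fin_seqs k" and s: "scalable \<alpha> \<beta> a b"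
  shows "scale \<beta> a b \<in> hopf_hom k (AH \<alpha>) (AH \<beta>)" "scale \<beta> a b (AY \<alpha>) = a \<odot>\<^bsub>AH \<beta>\<^esub> AY \<beta>"
    "scale \<beta> a b (Ag \<alpha>) = Ag \<beta>" "scale \<beta> a b (Ax \<alpha>) = b \<odot>\<^bsub>AH \<beta>\<^esub> Ax \<beta>"
proof -
  let ?B = "AH \<beta>" and ?\<phi> = "scale \<beta> a b"
  have B: "k_algebra k ?B" using AH_kalg [OF \<beta>] .
  have M: "module k ?B" using B by simp
  note C = AH_closed [OF \<beta>]
  have ab: "a \<in> carrier k" "b \<in> carrier k" and eq: "(\<lambda>i. a [^] (p ^ i) \<otimes> \<alpha> i) = (\<lambda>i. b [^] (2::nat) \<otimes> \<beta> i)"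
    using s by (auto simp: scalable_def)
  have b2: "b [^] (2::nat) = b \<otimes> b" using ab by (simp add: numeral_2_eq_2)
  note rel = AH_rels [OF \<beta>]
  have pp: "pp ?B \<alpha> (a \<odot>\<^sub>?B AY \<beta>) = (b \<otimes> b) \<odot>\<^sub>?B pp ?B \<beta> (AY \<beta>)"
    unfolding pp_scale(2) [OF B C(1) \<alpha> ab(1)] eq b2 by (rule pp_smult(2) [OF B C(1) \<beta>]) (use ab in simp)
  have xx: "(b \<odot>\<^sub>?B Ax \<beta>) \<otimes>\<^sub>?B (b \<odot>\<^sub>?B Ax \<beta>) = pp ?B \<alpha> (a \<odot>\<^sub>?B AY \<beta>)"
    unfolding pp using B M C ab \<beta> rel by (simp add: asmult_left asmult_right vsmult_assoc)
  have r: "A_rel \<alpha> ?B (a \<odot>\<^sub>?B AY \<beta>) (Ag \<beta>) (b \<odot>\<^sub>?B Ax \<beta>)"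
    unfolding A_rel_def using B M C ab rel xx
    by (simp add: asmult_left asmult_right vsmult_neg vsmult_assoc [symmetric] m_comm)
  note L = A_lift [OF \<alpha> B r, folded scale_def]
  show v: "?\<phi> (AY \<alpha>) = a \<odot>\<^sub>?B AY \<beta>" "?\<phi> (Ag \<alpha>) = Ag \<beta>" "?\<phi> (Ax \<alpha>) = b \<odot>\<^sub>?B Ax \<beta>"
    using L(2-4) .
  have A: "k_algebra k (AH \<alpha>)" using AH_kalg [OF \<alpha>] .
  note CA = AH_closed [OF \<alpha>]
  have bT: "bilin (AH \<alpha>) (AH \<alpha>) (tensor k ?B ?B) (\<lambda>h1 h2. pure k ?B ?B (?\<phi> h1) (?\<phi> h2))"
    by (rule bilin_pure_map) (use M alg_hom_lin [OF L(1)] in auto)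
  have mods: "module k (AH \<alpha>)" "module k (tensor k ?B ?B)" using A M by simp_all
  note tl = tensor_lift_add [OF mods(1,1,2) bT] tensor_lift_pure [OF mods(1,1,2) bT]
  note \<Delta> = alg_hom_lin [OF AH_comult_hom [OF \<beta>]]
  note \<epsilon> = alg_hom_lin [OF AH_counit_hom [OF \<beta>]]
  show "?\<phi> \<in> hopf_hom k (AH \<alpha>) ?B"
  proof (rule hopf_hom_from_generators [OF AH_bialgebra [OF \<alpha>] AH_bialgebra [OF \<beta>] AH_generates [OF \<alpha>] L(1)])
    fix h assume "h \<in> {AY \<alpha>, Ag \<alpha>, Ax \<alpha>}"
    then consider "h = AY \<alpha>" | "h = Ag \<alpha>" | "h = Ax \<alpha>" by blast
    then show "sweedler k (AH \<alpha>) (tensor k ?B ?B) (\<lambda>h1 h2. pure k ?B ?B (?\<phi> h1) (?\<phi> h2)) h = comult ?B (?\<phi> h)"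
      by cases (use A B M CA C ab in \<open>simp_all add: sweedler_def AH_comult_Y [OF \<alpha>] AH_comult_g [OF \<alpha>] AH_comult_x [OF \<alpha>] tl v
          alg_hom_one [OF L(1)] lin_smult [OF \<Delta>] AH_comult_Y [OF \<beta>] AH_comult_g [OF \<beta>] AH_comult_x [OF \<beta>]
          vsmult_add pure_smult_left pure_smult_right\<close>)
    show "counit ?B (?\<phi> h) = counit (AH \<alpha>) h"
      using \<open>h \<in> {AY \<alpha>, Ag \<alpha>, Ax \<alpha>}\<close> C ab
      by (auto simp: v lin_smult [OF \<epsilon>] AH_counit_Y AH_counit_g AH_counit_x \<alpha> \<beta>)
  qed
qed

lemma AH_hom_eqI:
  assumes \<alpha>: "\<alpha> \<in> fin_seqs k" and \<beta>: "\<beta> \<in> fin_seqs k"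
    and \<phi>: "\<phi> \<in> alg_hom (AH \<alpha>) (AH \<beta>)" and \<psi>: "\<psi> \<in> alg_hom (AH \<alpha>) (AH \<beta>)"
    and eq: "\<phi> (AY \<alpha>) = \<psi> (AY \<alpha>)" "\<phi> (Ag \<alpha>) = \<psi> (Ag \<alpha>)" "\<phi> (Ax \<alpha>) = \<psi> (Ax \<alpha>)" and z: "z \<in> carrier (AH \<alpha>)"
  shows "\<phi> z = \<psi> z"
  by (rule generates_alg_hom_eq [OF AH_kalg [OF \<alpha>] AH_kalg [OF \<beta>] AH_generates [OF \<alpha>] \<phi> \<psi> _ z]) (use eq in auto)

lemma scale_comp:
  assumes \<alpha>: "\<alpha> \<in> fin_seqs k" and \<beta>: "\<beta> \<in> fin_seqs k" and \<gamma>: "\<gamma> \<in> fin_seqs k"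
    and s: "scalable \<alpha> \<beta> a b" and s': "scalable \<beta> \<gamma> a' b'" and s'': "scalable \<alpha> \<gamma> (a \<otimes> a') (b \<otimes> b')"
    and z: "z \<in> carrier (AH \<alpha>)"
  shows "scale \<gamma> a' b' (scale \<beta> a b z) = scale \<gamma> (a \<otimes> a') (b \<otimes> b') z"
proof -
  note S = scale [OF \<alpha> \<beta> s] and S' = scale [OF \<beta> \<gamma> s'] and S'' = scale [OF \<alpha> \<gamma> s'']
  note l = alg_hom_lin [OF hopf_hom_alg [OF S'(1)]]
  have c: "a \<in> carrier k" "b \<in> carrier k" "a' \<in> carrier k" "b' \<in> carrier k"
    using s s' by (auto simp: scalable_def)
  have M: "module k (AH \<gamma>)" using AH_kalg [OF \<gamma>] by simp
  show ?thesis
    by (rule AH_hom_eqI [OF \<alpha> \<gamma> alg_hom_comp [OF hopf_hom_alg [OF S'(1)] hopf_hom_alg [OF S(1)]] hopf_hom_alg [OF S''(1)] _ _ _ z])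
      (use c M AH_closed [OF \<beta>] AH_closed [OF \<gamma>] in \<open>simp_all add: S S' S'' lin_smult [OF l] vsmult_assoc\<close>)
qed

lemma scale_id:
  assumes \<alpha>: "\<alpha> \<in> fin_seqs k" and z: "z \<in> carrier (AH \<alpha>)"
  shows "scalable \<alpha> \<alpha> \<one> \<one>" "scale \<alpha> \<one> \<one> z = z"
proof -
  show s: "scalable \<alpha> \<alpha> \<one> \<one>" using \<alpha> by (simp add: scalable_def)
  note S = scale [OF \<alpha> \<alpha> s]
  show "scale \<alpha> \<one> \<one> z = z"
    by (rule AH_hom_eqI [OF \<alpha> \<alpha> hopf_hom_alg [OF S(1)] alg_hom_id _ _ _ z])
      (use AH_kalg [OF \<alpha>] AH_closed [OF \<alpha>] in \<open>simp_all add: S\<close>)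
qed

lemma scalable_inv:
  assumes \<alpha>: "\<alpha> \<in> fin_seqs k" and \<beta>: "\<beta> \<in> fin_seqs k" and s: "scalable \<alpha> \<beta> a b"
  shows "scalable \<beta> \<alpha> (inv a) (inv b)"
proof -
  have u: "a \<in> Units k" "b \<in> Units k" and eq: "\<And>i. a [^] (p ^ i) \<otimes> \<alpha> i = b [^] (2::nat) \<otimes> \<beta> i"
    using s by (auto simp: scalable_def)
  have c: "a \<in> carrier k" "b \<in> carrier k" "inv a \<in> carrier k" "inv b \<in> carrier k" using u by auto
  have d: "\<alpha> i \<in> carrier k" "\<beta> i \<in> carrier k" for i using \<alpha> \<beta> by (simp_all add: fin_seqs_def)
  have ip: "inv x [^] n \<otimes> x [^] n = \<one>" if "x \<in> Units k" for x and n :: nat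
    using that nat_pow_distrib [of "inv x" x n] by (simp add: Units_closed)
  have "inv a [^] (p ^ i) \<otimes> \<beta> i = inv b [^] (2::nat) \<otimes> \<alpha> i" for i
  proof -
    let ?A = "inv a [^] (p ^ i)" and ?B = "inv b [^] (2::nat)" and ?a = "a [^] (p ^ i)" and ?b = "b [^] (2::nat)"
    have cl: "?A \<in> carrier k" "?B \<in> carrier k" "?a \<in> carrier k" "?b \<in> carrier k" using c by simp_all
    have "?A \<otimes> \<beta> i = ?A \<otimes> ((?B \<otimes> ?b) \<otimes> \<beta> i)" using cl d by (simp add: ip [OF u(2)])
    also have "\<dots> = ?A \<otimes> (?B \<otimes> (?a \<otimes> \<alpha> i))" using cl d by (simp add: m_assoc eq)
    also have "\<dots> = (?A \<otimes> ?a) \<otimes> (?B \<otimes> \<alpha> i)" using cl d by (simp add: m_ac)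
    also have "\<dots> = ?B \<otimes> \<alpha> i" using cl d by (simp add: ip [OF u(1)])
    finally show ?thesis .
  qed
  then show ?thesis using u by (simp add: scalable_def)
qed

lemma scale_bij:
  assumes \<alpha>: "\<alpha> \<in> fin_seqs k" and \<beta>: "\<beta> \<in> fin_seqs k" and s: "scalable \<alpha> \<beta> a b"
  shows "bij_betw (scale \<beta> a b) (carrier (AH \<alpha>)) (carrier (AH \<beta>))"
proof -
  have s': "scalable \<beta> \<alpha> (inv a) (inv b)" by (rule scalable_inv [OF \<alpha> \<beta> s])
  have u: "a \<in> Units k" "b \<in> Units k" using s by (auto simp: scalable_def)
  have o: "a \<otimes> inv a = \<one>" "b \<otimes> inv b = \<one>" "inv a \<otimes> a = \<one>" "inv b \<otimes> b = \<one>" using u by simp_all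
  show ?thesis
  proof (rule bij_betw_byWitness [where f' = "scale \<alpha> (inv a) (inv b)"])
    show "\<forall>z \<in> carrier (AH \<alpha>). scale \<alpha> (inv a) (inv b) (scale \<beta> a b z) = z"
      using scale_comp [OF \<alpha> \<beta> \<alpha> s s'] scale_id [OF \<alpha>] by (simp add: o)
    show "\<forall>z \<in> carrier (AH \<beta>). scale \<beta> a b (scale \<alpha> (inv a) (inv b) z) = z"
      using scale_comp [OF \<beta> \<alpha> \<beta> s' s] scale_id [OF \<beta>] by (simp add: o)
  qed (use alg_hom_closed [OF hopf_hom_alg [OF scale(1) [OF \<alpha> \<beta> s]]] alg_hom_closed [OF hopf_hom_alg [OF scale(1) [OF \<beta> \<alpha> s']]] in auto)
qed

lemma AH_iso_form:
  assumes \<alpha>: "\<alpha> \<in> fin_seqs k" and \<beta>: "\<beta> \<in> fin_seqs k" and \<phi>: "\<phi> \<in> hopf_hom k (AH \<alpha>) (AH \<beta>)"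
    and bij: "bij_betw \<phi> (carrier (AH \<alpha>)) (carrier (AH \<beta>))"
  shows "\<exists>a b. scalable \<alpha> \<beta> a b \<and> (\<forall>z \<in> carrier (AH \<alpha>). \<phi> z = scale \<beta> a b z)"
proof -
  let ?A = "AH \<alpha>" and ?B = "AH \<beta>"
  note A = AH_kalg [OF \<alpha>] and B = AH_kalg [OF \<beta>] and CA = AH_closed [OF \<alpha>] and CB = AH_closed [OF \<beta>]
  have M: "module k ?A" "module k ?B" using A B by simp_all
  have hA: "hopf_like ?A" and hB: "hopf_like ?B" using hopf_like_hopf AH_hopf \<alpha> \<beta> by blast+
  note h = hopf_hom_alg [OF \<phi>]
  note l = alg_hom_lin [OF h]
  have inj: "inj_on \<phi> (carrier ?A)" using bij by (simp add: bij_betw_def)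
  note neq = inj_on_contraD [OF inj]
  have z: "\<zero>\<^sub>?A \<in> carrier ?A" "\<one>\<^sub>?A \<in> carrier ?A" using M A by simp_all
  have g: "\<phi> (Ag \<alpha>) = Ag \<beta>"
    using AH_group_like_cases [OF \<beta> hopf_hom_group_like [OF hA hB \<phi> AH_group_like [OF \<alpha>]]]
      neq [OF AH_nonzero(1) [OF \<alpha>] CA(2) z(1)] neq [OF AH_nonzero(2) [OF \<alpha>] CA(2) z(2)]
      lin_zero [OF M l] alg_hom_one [OF h] by auto
  obtain c d where cd: "c \<in> carrier k" "d \<in> carrier k"
    and x: "\<phi> (Ax \<alpha>) = c \<odot>\<^sub>?B (\<one>\<^sub>?B \<oplus>\<^sub>?B \<ominus>\<^sub>?B Ag \<beta>) \<oplus>\<^sub>?B d \<odot>\<^sub>?B Ax \<beta>"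
    using AH_skew_primitive_form [OF \<beta> hopf_hom_skew_primitive [OF hA hB \<phi> AH_skew_primitive [OF \<alpha>] CA(2), unfolded g]] by blast
  \<comment> \<open>Both (1 - g) g and g (1 - g) equal -(1 - g), whereas x g = -gx. Comparing
    \<phi>(x) g with -g \<phi>(x) leaves -c (1 - g) = c (1 - g).\<close>
  have c0: "c = \<zero>"
  proof -
    define w u where "w = \<one>\<^sub>?B \<oplus>\<^sub>?B \<ominus>\<^sub>?B Ag \<beta>" and "u = d \<odot>\<^sub>?B (Ag \<beta> \<otimes>\<^sub>?B Ax \<beta>)"
    have w: "w \<in> carrier ?B" and u: "u \<in> carrier ?B" using B M CB cd by (simp_all add: w_def u_def)
    have gg: "Ag \<beta> \<otimes>\<^sub>?B Ag \<beta> = \<one>\<^sub>?B" and xg: "Ax \<beta> \<otimes>\<^sub>?B Ag \<beta> = \<ominus>\<^sub>?B (Ag \<beta> \<otimes>\<^sub>?B Ax \<beta>)"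
      using AH_rels [OF \<beta>] by auto
    have wg: "w \<otimes>\<^sub>?B Ag \<beta> = \<ominus>\<^sub>?B w" "Ag \<beta> \<otimes>\<^sub>?B w = \<ominus>\<^sub>?B w"
      using B M CB gg by (simp_all add: w_def amult_add_left amult_add_right amult_neg_left amult_neg_right vneg_add vadd_comm)
    have "\<phi> (Ax \<alpha>) \<otimes>\<^sub>?B Ag \<beta> = \<phi> (Ax \<alpha> \<otimes>\<^sub>?A Ag \<alpha>)"
      using alg_hom_mult [OF h CA(3,2)] by (simp add: g)
    also have "\<dots> = \<ominus>\<^sub>?B (Ag \<beta> \<otimes>\<^sub>?B \<phi> (Ax \<alpha>))"
      using AH_rels [OF \<alpha>] A CA alg_hom_mult [OF h CA(2,3)] lin_neg [OF M l] by (simp add: g)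
    finally have "\<ominus>\<^sub>?B (c \<odot>\<^sub>?B w) \<oplus>\<^sub>?B \<ominus>\<^sub>?B u = c \<odot>\<^sub>?B w \<oplus>\<^sub>?B \<ominus>\<^sub>?B u"
      unfolding x [folded w_def] using B M CB cd w u
      by (simp add: amult_add_left amult_add_right asmult_left asmult_right wg xg vsmult_neg vneg_add u_def)
    from arg_cong [OF this, of "\<lambda>z. z \<oplus>\<^sub>?B u"] have "\<ominus>\<^sub>?B (c \<odot>\<^sub>?B w) = c \<odot>\<^sub>?B w"
      using M(2) w u cd by (simp add: vadd_assoc)
    then have "(\<ominus> c) \<odot>\<^sub>?B w = c \<odot>\<^sub>?B w" using M w cd by (simp add: vsmult_neg_left)
    then have "\<ominus> c = c" using AH_scale_inj(3) [OF \<beta> a_inv_closed [OF cd(1)] cd(1)] unfolding w_def by blast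
    then have "c \<oplus> c = \<zero>" using cd l_neg by metis
    then show ?thesis using double_zero cd by blast
  qed
  have x': "\<phi> (Ax \<alpha>) = d \<odot>\<^sub>?B Ax \<beta>" unfolding x c0 using B M CB cd by simp
  have "Ax \<alpha> \<noteq> \<zero>\<^sub>?A"
    using AH_scale_inj(2) [OF \<alpha> one_closed zero_closed] M CA by auto
  then have "d \<noteq> \<zero>" using neq [OF _ CA(3) z(1)] x' lin_zero [OF M l] M CB by auto
  then have dU: "d \<in> Units k" using cd field_Units by auto
  let ?\<psi> = "inv_into (carrier ?A) \<phi>"
  have \<psi>: "?\<psi> \<in> hopf_hom k ?B ?A" by (rule hopf_hom_inv [OF hA M(2) \<phi> bij])
  obtain q where q: "primitive k PA q" and y: "\<phi> (AY \<alpha>) = peval ?B (AY \<beta>) q"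
    using AH_primitive_form [OF \<beta> hopf_hom_primitive [OF hA hB \<phi> AH_primitive [OF \<alpha>]]] by blast
  obtain r where r: "primitive k PA r" and y': "?\<psi> (AY \<beta>) = peval ?A (AY \<alpha>) r"
    using AH_primitive_form [OF \<alpha> hopf_hom_primitive [OF hB hA \<psi> AH_primitive [OF \<beta>]]] by blast
  have qc: "q \<in> carrier PA" "r \<in> carrier PA" using q r by (simp_all add: primitive_def)
  obtain r' where r': "r' \<in> carrier PA" "r = single k 1 \<otimes>\<^sub>PA r'"
    using PA_shift [OF qc(2) PA_primitive_coeff(1) [OF r]] by blast
  note pA = peval_hom [OF A CA(1)] and pB = peval_hom [OF B CB(1)] and pP = peval_hom [OF PA_kalg qc(1)]
  have p1: "single k 1 \<in> carrier PA" by simp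
  have n1: "w [^]\<^bsub>D\<^esub> (1::nat) = w" if "k_algebra k D" "w \<in> carrier D" for w and D :: "('k, 'z, 'n) module_scheme"
    using that monoid.nat_pow_eone [OF kalg_monoid [OF that(1)]] by blast
  have pP1: "peval PA q (single k 1) = q" unfolding pP(2) by (rule n1 [OF PA_kalg qc(1)])
  have pA1: "peval ?A (AY \<alpha>) (single k 1) = AY \<alpha>" unfolding pA(2) using A CA by simp
  have pB1: "peval ?B (AY \<beta>) (single k 1) = AY \<beta>" unfolding pB(2) using B CB by simp
  \<comment> \<open>Since \<phi>(Y) = q(Y), on polynomials in Y the map \<phi> is substitution of q.
    With r taken from the inverse isomorphism this gives r(q(Y)) = Y.\<close>
  have "\<phi> (peval ?A (AY \<alpha>) r) = peval ?B (AY \<beta>) (peval PA q r)"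
    by (rule generates_alg_hom_eq [OF PA_kalg B PA_generates alg_hom_comp [OF h pA(1)] alg_hom_comp [OF pB(1) pP(1)] _ qc(2)])
      (auto simp: pA1 pP1 y)
  moreover have "\<phi> (?\<psi> (AY \<beta>)) = AY \<beta>"
    using bij CB by (simp add: bij_betw_def f_inv_into_f)
  ultimately have "peval ?B (AY \<beta>) (peval PA q r) = peval ?B (AY \<beta>) (single k 1)" by (simp only: y' pB1)
  then have "peval PA q r = single k 1"
    by (rule AH_peval_inj [OF \<beta> alg_hom_closed [OF pP(1) qc(2)] p1])
  \<comment> \<open>From r = Y r' it follows that q times r'(q) is Y, so q divides Y.\<close>
  then have "q \<otimes>\<^sub>PA peval PA q r' = single k 1"
    using alg_hom_mult [OF pP(1) p1 r'(1)] by (simp only: r'(2) pP1)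
  then obtain a where a: "a \<in> Units k" "q = a \<odot>\<^sub>PA single k 1"
    using PA_factor_Y [OF qc(1) alg_hom_closed [OF pP(1) r'(1)] _ PA_primitive_coeff(1) [OF q]] by blast
  have ac: "a \<in> carrier k" using a by blast
  have y'': "\<phi> (AY \<alpha>) = a \<odot>\<^sub>?B AY \<beta>"
    unfolding y a(2) using lin_smult [OF alg_hom_lin [OF pB(1)] ac p1] by (simp only: pB1)
  \<comment> \<open>The image of x^2 computed twice, as P_\<alpha>(a Y) and as (d x)^2 = d^2
    P_\<beta>(Y).\<close>
  have "scalable \<alpha> \<beta> a d"
  proof -
    have d2: "d [^] (2::nat) = d \<otimes> d" using cd by (simp add: numeral_2_eq_2)
    have "pp ?B (\<lambda>i. a [^] (p ^ i) \<otimes> \<alpha> i) (AY \<beta>) = pp ?B \<alpha> (a \<odot>\<^sub>?B AY \<beta>)"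
      using pp_scale(2) [OF B CB(1) \<alpha> ac] by simp
    also have "\<dots> = \<phi> (pp ?A \<alpha> (AY \<alpha>))"
      using pp_alg_hom [OF A B h CA(1) \<alpha>] by (simp only: y'')
    also have "\<dots> = \<phi> (Ax \<alpha>) \<otimes>\<^sub>?B \<phi> (Ax \<alpha>)"
      using AH_rels [OF \<alpha>] alg_hom_mult [OF h CA(3,3)] by simp
    also have "\<dots> = (d \<otimes> d) \<odot>\<^sub>?B pp ?B \<beta> (AY \<beta>)"
      unfolding x' using AH_rels [OF \<beta>] B M CB cd \<beta> by (simp add: asmult_left asmult_right vsmult_assoc)
    also have "\<dots> = pp ?B (\<lambda>i. d [^] (2::nat) \<otimes> \<beta> i) (AY \<beta>)"
      unfolding d2 by (rule pp_smult(2) [OF B CB(1) \<beta>, symmetric]) (use cd in simp)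
    finally have "(\<lambda>i. a [^] (p ^ i) \<otimes> \<alpha> i) = (\<lambda>i. d [^] (2::nat) \<otimes> \<beta> i)"
      by (rule pp_inject [OF \<beta> pp_scale(1) [OF B CB(1) \<alpha> ac] pp_smult(1) [OF B CB(1) \<beta> nat_pow_closed [OF cd(2)]]])
    then show ?thesis using a dU by (auto simp: scalable_def dest: fun_cong)
  qed
  moreover from this have "\<phi> z = scale \<beta> a d z" if "z \<in> carrier ?A" for z
    by (intro AH_hom_eqI [OF \<alpha> \<beta> h hopf_hom_alg [OF scale(1) [OF \<alpha> \<beta>]] _ _ _ that])
      (simp_all add: scale [OF \<alpha> \<beta>] y'' g x')
  ultimately show ?thesis by blast
qed

lemma AH_isomorphic_iff:
  assumes \<alpha>: "\<alpha> \<in> fin_seqs k" and \<beta>: "\<beta> \<in> fin_seqs k"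
  shows "hopf_isomorphic k (AH \<alpha>) (AH \<beta>) \<longleftrightarrow> (\<alpha>, \<beta>) \<in> seq_equiv k p"
proof
  assume "hopf_isomorphic k (AH \<alpha>) (AH \<beta>)"
  then obtain a b where "scalable \<alpha> \<beta> a b" unfolding hopf_isomorphic_def using AH_iso_form [OF \<alpha> \<beta>] by blast
  then show "(\<alpha>, \<beta>) \<in> seq_equiv k p" using \<alpha> \<beta> by (auto simp: seq_equiv_def scalable_def)
next
  assume "(\<alpha>, \<beta>) \<in> seq_equiv k p"
  then obtain a b where s: "scalable \<alpha> \<beta> a b" by (auto simp: seq_equiv_def scalable_def)
  then show "hopf_isomorphic k (AH \<alpha>) (AH \<beta>)"
    unfolding hopf_isomorphic_def using scale(1) [OF \<alpha> \<beta> s] scale_bij [OF \<alpha> \<beta> s] by blast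
qed

lemma AH_hopf_like: "\<alpha> \<in> fin_seqs k ==> hopf_like (AH \<alpha>)"
  by (rule hopf_like_hopf [OF AH_hopf])

text \<open>Isomorphism of the presented Hopf algebras is reflexive, symmetric and transitive, and
  \<open>AH_isomorphic_iff\<close> identifies it with \<open>seq_equiv\<close>.\<close>

lemma seq_equiv_equiv: "equiv (fin_seqs k) (seq_equiv k p)"
proof (rule equivI)
  show "seq_equiv k p \<subseteq> fin_seqs k \<times> fin_seqs k" by (auto simp: seq_equiv_def)
  show "refl_on (fin_seqs k) (seq_equiv k p)"
    by (rule refl_onI) (use AH_isomorphic_iff hopf_isomorphic_refl AH_hopf_like in blast)
  show "sym (seq_equiv k p)"
  proof (rule symI)
    fix \<alpha> \<beta> assume ab: "(\<alpha>, \<beta>) \<in> seq_equiv k p"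
    then have "\<alpha> \<in> fin_seqs k" "\<beta> \<in> fin_seqs k" by (auto simp: seq_equiv_def)
    with ab show "(\<beta>, \<alpha>) \<in> seq_equiv k p"
      using AH_isomorphic_iff hopf_isomorphic_sym AH_hopf_like by blast
  qed
  show "trans (seq_equiv k p)"
  proof (rule transI)
    fix \<alpha> \<beta> \<gamma> assume ab: "(\<alpha>, \<beta>) \<in> seq_equiv k p" "(\<beta>, \<gamma>) \<in> seq_equiv k p"
    then have "\<alpha> \<in> fin_seqs k" "\<beta> \<in> fin_seqs k" "\<gamma> \<in> fin_seqs k" by (auto simp: seq_equiv_def)
    with ab show "(\<alpha>, \<gamma>) \<in> seq_equiv k p"
      using AH_isomorphic_iff hopf_isomorphic_trans [OF AH_hopf_like AH_hopf_like AH_hopf_like] by blast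
  qed
qed

end

text \<open>Inverse images under c turn the classes of \<open>s\<close> into those of
  \<open>r\<close>; surjectivity of c makes a class recoverable from its inverse image.\<close>

lemma quotient_bij:
  assumes c: "c ` A = B" and r: "equiv A r" and s: "s \<subseteq> B \<times> B"
    and eq: "\<And>x y. x \<in> A ==> y \<in> A ==> (c x, c y) \<in> s \<longleftrightarrow> (x, y) \<in> r"
  shows "\<exists>\<Phi>. bij_betw \<Phi> (B // s) (A // r)"
proof -
  let ?\<Phi> = "\<lambda>X. {x \<in> A. c x \<in> X}"
  have v: "?\<Phi> (s `` {c x}) = r `` {x}" if "x \<in> A" for x
    using that eq equiv_type [OF r] by auto
  have "inj_on ?\<Phi> (B // s)"
  proof (rule inj_onI)
    fix X X' assume X: "X \<in> B // s" "X' \<in> B // s" and e: "?\<Phi> X = ?\<Phi> X'"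
    have "c ` ?\<Phi> Z = Z" if "Z \<in> B // s" for Z
      using that s c by (auto simp: quotient_def)
    from this [OF X(1)] this [OF X(2)] show "X = X'" unfolding e by simp
  qed
  moreover have "?\<Phi> ` (B // s) = A // r"
  proof -
    have "?\<Phi> ` (B // s) = (\<lambda>x. ?\<Phi> (s `` {c x})) ` A" unfolding quotient_def c [symmetric] by blast
    also have "\<dots> = (\<lambda>x. r `` {x}) ` A" using v by (rule image_cong [OF refl])
    finally show ?thesis by (simp add: quotient_def UNION_singleton_eq_range)
  qed
  ultimately show ?thesis by (auto simp: bij_betw_def)
qed

text \<open>Exhibits the tensor product Hopf algebra as a record with replaced product, the form in
  which the comparison map is stated.\<close>

lemma hopf_mult_update: "T\<lparr>mult := monoid.mult T\<rparr> = (T :: ('k, 'a) hopf)"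
  by (cases T) simp

section \<open>Automorphism groups and isomorphism types\<close>

context char_field
begin

abbreviation "UU \<equiv> units_of k \<times>\<times> units_of k"

lemma UU_group: "group UU"
  by (rule DirProd_group) (rule units_group)+

text \<open>Where \<alpha>_i = 0 the equation in \<open>scalable\<close> is void; elsewhere
  \<alpha>_i can be cancelled.\<close>

lemma G_set_scalable: "\<alpha> \<in> fin_seqs k ==> (a, b) \<in> G_set k p \<alpha> \<longleftrightarrow> scalable \<alpha> \<alpha> a b"
proof -
  assume \<alpha>: "\<alpha> \<in> fin_seqs k"
  then have c: "\<alpha> i \<in> carrier k" for i by (simp add: fin_seqs_def)
  have "(\<alpha> i \<noteq> \<zero> \<longrightarrow> a [^] (p ^ i) = b [^] (2::nat)) \<longleftrightarrow> a [^] (p ^ i) \<otimes> \<alpha> i = b [^] (2::nat) \<otimes> \<alpha> i"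
    if "a \<in> carrier k" "b \<in> carrier k" for i
    using that c [of i] m_rcancel [of "\<alpha> i" "a [^] (p ^ i)" "b [^] (2::nat)"] by (cases "\<alpha> i = \<zero>") simp_all
  then show ?thesis
    unfolding G_set_def scalable_def by (auto simp: Units_closed)
qed

lemma scalable_mult:
  assumes \<alpha>: "\<alpha> \<in> fin_seqs k" and \<beta>: "\<beta> \<in> fin_seqs k" and \<gamma>: "\<gamma> \<in> fin_seqs k"
    and s: "scalable \<alpha> \<beta> a b" and s': "scalable \<beta> \<gamma> a' b'"
  shows "scalable \<alpha> \<gamma> (a \<otimes> a') (b \<otimes> b')"
proof -
  have u: "a \<in> Units k" "b \<in> Units k" "a' \<in> Units k" "b' \<in> Units k"
    and eq: "\<And>i. a [^] (p ^ i) \<otimes> \<alpha> i = b [^] (2::nat) \<otimes> \<beta> i" "\<And>i. a' [^] (p ^ i) \<otimes> \<beta> i = b' [^] (2::nat) \<otimes> \<gamma> i"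
    using s s' by (auto simp: scalable_def)
  have c: "a \<in> carrier k" "b \<in> carrier k" "a' \<in> carrier k" "b' \<in> carrier k" using u by auto
  have d: "\<alpha> i \<in> carrier k" "\<beta> i \<in> carrier k" "\<gamma> i \<in> carrier k" for i using \<alpha> \<beta> \<gamma> by (simp_all add: fin_seqs_def)
  have "(a \<otimes> a') [^] (p ^ i) \<otimes> \<alpha> i = (b \<otimes> b') [^] (2::nat) \<otimes> \<gamma> i" for i
  proof -
    have "(a \<otimes> a') [^] (p ^ i) \<otimes> \<alpha> i = a' [^] (p ^ i) \<otimes> (a [^] (p ^ i) \<otimes> \<alpha> i)"
      using c d by (simp add: nat_pow_distrib m_ac)
    also have "\<dots> = b [^] (2::nat) \<otimes> (a' [^] (p ^ i) \<otimes> \<beta> i)" using c d by (simp add: eq(1) m_ac)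
    also have "\<dots> = (b \<otimes> b') [^] (2::nat) \<otimes> \<gamma> i" using c d by (simp add: eq(2) nat_pow_distrib m_ac)
    finally show ?thesis .
  qed
  then show ?thesis using u by (simp add: scalable_def)
qed

lemma UU_mult: "(a, b) \<otimes>\<^sub>UU (a', b') = (a \<otimes> a', b \<otimes> b')"
  by (simp add: DirProd_def units_of_def)

lemma G_set_subgroup:
  assumes \<alpha>: "\<alpha> \<in> fin_seqs k"
  shows "subgroup (G_set k p \<alpha>) UU"
proof (rule group.subgroupI [OF UU_group])
  show "G_set k p \<alpha> \<subseteq> carrier UU" by (auto simp: UU_mult units_of_carrier units_of_mult G_set_def)
  show "G_set k p \<alpha> \<noteq> {}" using G_set_scalable [OF \<alpha>, of \<one> \<one>] \<alpha> by (auto simp: scalable_def)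
  fix z assume z: "z \<in> G_set k p \<alpha>"
  obtain a b where ab: "z = (a, b)" by (cases z)
  have u: "a \<in> Units k" "b \<in> Units k" using z by (auto simp: ab G_set_def)
  have "inv\<^bsub>UU\<^esub> z = (inv a, inv b)"
    using inv_DirProd [OF units_group units_group] u by (simp add: ab units_of_inv units_of_carrier)
  then show "inv\<^bsub>UU\<^esub> z \<in> G_set k p \<alpha>"
    using z scalable_inv [OF \<alpha> \<alpha>] by (simp add: ab G_set_scalable [OF \<alpha>])
  fix z' assume z': "z' \<in> G_set k p \<alpha>"
  then show "z \<otimes>\<^sub>UU z' \<in> G_set k p \<alpha>"
    using z scalable_mult [OF \<alpha> \<alpha> \<alpha>] by (cases z') (simp add: ab UU_mult units_of_carrier units_of_mult G_set_scalable [OF \<alpha>])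
qed

lemma AH_Aut:
  assumes \<alpha>: "\<alpha> \<in> fin_seqs k"
  shows "hopf_Aut k (AH \<alpha>) \<cong> UU \<lparr>carrier := G_set k p \<alpha>\<rparr>"
proof -
  let ?A = "AH \<alpha>" and ?G = "UU \<lparr>carrier := G_set k p \<alpha>\<rparr>"
  let ?F = "\<lambda>(a, b). restrict (scale \<alpha> a b) (carrier ?A)"
  have M: "module k ?A" using AH_kalg [OF \<alpha>] by simp
  note C = AH_closed [OF \<alpha>] and hA = AH_hopf_like [OF \<alpha>]
  have F: "?F (a, b) \<in> carrier (hopf_Aut k ?A)" if s: "scalable \<alpha> \<alpha> a b" for a b
  proof -
    have "restrict (scale \<alpha> a b) (carrier ?A) \<in> hopf_hom k ?A ?A"
      by (rule hopf_hom_cong [OF hA M scale(1) [OF \<alpha> \<alpha> s]]) simp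
    moreover have "bij_betw (restrict (scale \<alpha> a b) (carrier ?A)) (carrier ?A) (carrier ?A)"
      using scale_bij [OF \<alpha> \<alpha> s] by (simp cong: bij_betw_cong)
    ultimately show ?thesis by (simp add: hopf_Aut_simps Bij_iff)
  qed
  have "?F \<in> iso ?G (hopf_Aut k ?A)"
    unfolding iso_def mem_Collect_eq
  proof (intro conjI)
    show "?F \<in> hom ?G (hopf_Aut k ?A)"
    proof (rule homI)
      fix z assume "z \<in> carrier ?G"
      then show "?F z \<in> carrier (hopf_Aut k ?A)" using F by (cases z) (simp add: G_set_scalable [OF \<alpha>])
    next
      fix z z' assume z: "z \<in> carrier ?G" "z' \<in> carrier ?G"
      obtain a b a' b' where ab: "z = (a, b)" "z' = (a', b')" by (cases z, cases z')
      have s: "scalable \<alpha> \<alpha> a b" "scalable \<alpha> \<alpha> a' b'" using z by (simp_all add: ab G_set_scalable [OF \<alpha>])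
      have c: "a \<in> carrier k" "b \<in> carrier k" "a' \<in> carrier k" "b' \<in> carrier k"
        using s by (auto simp: scalable_def)
      note s' = scalable_mult [OF \<alpha> \<alpha> \<alpha> s(2,1)]
      note cl = alg_hom_closed [OF hopf_hom_alg [OF scale(1) [OF \<alpha> \<alpha> s(2)]]]
      \<comment> \<open>Composition reverses the order of the parameters; commutativity of k makes
        \<open>?F\<close> a homomorphism nevertheless.\<close>
      have "?F (z \<otimes>\<^sub>?G z') = restrict (scale \<alpha> (a' \<otimes> a) (b' \<otimes> b)) (carrier ?A)"
        using c by (simp add: ab UU_mult units_of_carrier units_of_mult m_comm)
      also have "\<dots> = compose (carrier ?A) (?F z) (?F z')"
        using scale_comp [OF \<alpha> \<alpha> \<alpha> s(2,1) s'] cl by (auto simp: ab compose_def restrict_def fun_eq_iff)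
      also have "\<dots> = ?F z \<otimes>\<^bsub>hopf_Aut k ?A\<^esub> ?F z'"
        by (rule hopf_Aut_simps(2) [symmetric]) (use F [OF s(1)] F [OF s(2)] in \<open>simp_all add: ab\<close>)
      finally show "?F (z \<otimes>\<^sub>?G z') = ?F z \<otimes>\<^bsub>hopf_Aut k ?A\<^esub> ?F z'" .
    qed
    have "inj_on ?F (carrier ?G)"
    proof (rule inj_onI)
      fix z z' assume z: "z \<in> carrier ?G" "z' \<in> carrier ?G" and e: "?F z = ?F z'"
      obtain a b a' b' where ab: "z = (a, b)" "z' = (a', b')" by (cases z, cases z')
      have s: "scalable \<alpha> \<alpha> a b" "scalable \<alpha> \<alpha> a' b'" using z by (simp_all add: ab G_set_scalable [OF \<alpha>])
      have c: "a \<in> carrier k" "b \<in> carrier k" "a' \<in> carrier k" "b' \<in> carrier k"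
        using s by (auto simp: scalable_def)
      have e': "scale \<alpha> a b w = scale \<alpha> a' b' w" if "w \<in> carrier ?A" for w
        using fun_cong [OF e, of w] that by (simp add: ab)
      have "a = a'" by (rule AH_scale_inj(1) [OF \<alpha> c(1,3)]) (use e' [OF C(1)] in \<open>simp add: scale [OF \<alpha> \<alpha>] s\<close>)
      moreover have "b = b'" by (rule AH_scale_inj(2) [OF \<alpha> c(2,4)]) (use e' [OF C(3)] in \<open>simp add: scale [OF \<alpha> \<alpha>] s\<close>)
      ultimately show "z = z'" by (simp add: ab)
    qed
    moreover have "?F ` carrier ?G = carrier (hopf_Aut k ?A)"
    proof
      show "?F ` carrier ?G \<subseteq> carrier (hopf_Aut k ?A)" using F by (auto simp: G_set_scalable [OF \<alpha>])
      show "carrier (hopf_Aut k ?A) \<subseteq> ?F ` carrier ?G"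
      proof
        fix \<phi> assume "\<phi> \<in> carrier (hopf_Aut k ?A)"
        then have \<phi>: "\<phi> \<in> hopf_hom k ?A ?A" "\<phi> \<in> extensional (carrier ?A)" "bij_betw \<phi> (carrier ?A) (carrier ?A)"
          by (auto simp: hopf_Aut_simps Bij_iff)
        obtain a b where s: "scalable \<alpha> \<alpha> a b" and e: "\<And>z. z \<in> carrier ?A ==> \<phi> z = scale \<alpha> a b z"
          using AH_iso_form [OF \<alpha> \<alpha> \<phi>(1,3)] by blast
        have "\<phi> = ?F (a, b)"
          by (rule extensionalityI [OF \<phi>(2)]) (use e in simp_all)
        then show "\<phi> \<in> ?F ` carrier ?G" using s by (intro image_eqI [of _ _ "(a, b)"]) (simp_all add: G_set_scalable [OF \<alpha>])
      qed
    qed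
    ultimately show "bij_betw ?F (carrier ?G) (carrier (hopf_Aut k ?A))" by (simp add: bij_betw_def)
  qed
  then have "?G \<cong> hopf_Aut k ?A" by (auto simp: is_iso_def)
  moreover have "group ?G" by (rule group.subgroup_imp_group [OF UU_group G_set_subgroup [OF \<alpha>]])
  ultimately show ?thesis by (simp add: group.iso_sym)
qed

text \<open>The tensor product is the case \<alpha> = 0: then P = 0, the deformation terms vanish,
  and the condition defining \<open>G_set\<close> is empty.\<close>

lemma tensor_Aut: "hopf_Aut k (tensor_hopf k PA H) \<cong> UU"
proof -
  let ?z = "\<lambda>i::nat. \<zero>"
  have z: "?z \<in> fin_seqs k" by (simp add: fin_seqs_def)
  have P: "ppY ?z = \<zero>\<^sub>PA"
    unfolding pp_def lin_ext_def using vfinsum_empty [OF kalg_module [OF PA_kalg]] by simp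
  have na: "na_algebra V0" by (rule tensor_na) simp_all
  have eq: "TH\<lparr>mult := monoid.mult V0\<rparr> = TH"
    unfolding tensor_hopf_fields(6) [OF PA_hopf_like H4_hopf_like, symmetric] by (rule hopf_mult_update)
  have mf: "pu q (single k a) \<otimes>\<^sub>V0 pu r (single k b) = pu (q \<otimes>\<^sub>PA r) (single k a \<otimes>\<^sub>H single k b) \<oplus>\<^sub>V0
      pu ((q \<otimes>\<^sub>PA r) \<otimes>\<^sub>PA ppY ?z) (h4_E a b)" if "q \<in> carrier PA" "r \<in> carrier PA" for q r a b
    unfolding P using that na_mult_closed [OF H4_na H4_single H4_single]
    by (simp add: tensor_mult_pure pure_zero)
  have iso: "hopf_isomorphic k (TH\<lparr>mult := monoid.mult V0\<rparr>) (AH ?z)"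
    by (rule crossed_like_iso [OF z na_bilin [OF na] mf])
  have hT: "hopf_like (TH\<lparr>mult := monoid.mult V0\<rparr>)"
    by (rule tensor_hopf_mult_hopf_like [OF PA_hopf_like H4_hopf_like na_bilin [OF na]])
  have "G_set k p ?z = carrier UU" by (auto simp: G_set_def UU_mult units_of_carrier units_of_mult)
  then have "UU\<lparr>carrier := G_set k p ?z\<rparr> = UU" by simp
  then show ?thesis
    using iso_trans [OF hopf_Aut_iso [OF hT AH_hopf_like [OF z] iso] AH_Aut [OF z]] unfolding eq by simp
qed

lemma crossed_product_isomorphic_iff:
  fixes E :: "('k, 'e) hopf"
  assumes E: "hopf_algebra k E"
  shows "(\<exists>act f. (act, f) \<in> crossed_systems k PA H \<and> hopf_isomorphic k E (crossed_product k PA H act f)) \<longleftrightarrow>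
    (\<exists>\<alpha> \<in> fin_seqs k. hopf_isomorphic k E (AH \<alpha>))"
proof -
  note hE = hopf_like_hopf [OF E]
  have "hopf_isomorphic k E (CP \<alpha>) \<longleftrightarrow> hopf_isomorphic k E (AH \<alpha>)" if \<alpha>: "\<alpha> \<in> fin_seqs k" for \<alpha>
    using hopf_isomorphic_trans [OF hE Th_crossed_product(3) [OF \<alpha>] AH_hopf_like [OF \<alpha>] _ cocycle_crossed_system(2) [OF \<alpha>]]
      hopf_isomorphic_trans [OF hE AH_hopf_like [OF \<alpha>] Th_crossed_product(3) [OF \<alpha>] _
        hopf_isomorphic_sym [OF Th_crossed_product(3) [OF \<alpha>] AH_hopf_like [OF \<alpha>] cocycle_crossed_system(2) [OF \<alpha>]]]
    by blast
  then show ?thesis unfolding crossed_systems_eq by blast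
qed

lemma Crp_bij: "\<exists>\<Phi>. bij_betw \<Phi> (Crp k H PA) (fin_seqs k // seq_equiv k p)"
proof -
  have c: "CP ` fin_seqs k = crossed_products k PA H"
    unfolding crossed_products_def crossed_systems_eq by blast
  let ?s = "{(E, F). E \<in> crossed_products k PA H \<and> F \<in> crossed_products k PA H \<and> hopf_isomorphic k E F}"
  show ?thesis
    unfolding Crp_def
  proof (rule quotient_bij [OF c seq_equiv_equiv])
    show "?s \<subseteq> crossed_products k PA H \<times> crossed_products k PA H" by blast
    fix \<alpha> \<beta> assume \<alpha>: "\<alpha> \<in> fin_seqs k" and \<beta>: "\<beta> \<in> fin_seqs k"
    note h = Th_crossed_product(3) [OF \<alpha>] Th_crossed_product(3) [OF \<beta>] AH_hopf_like [OF \<alpha>] AH_hopf_like [OF \<beta>]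
    note i = cocycle_crossed_system(2) [OF \<alpha>] cocycle_crossed_system(2) [OF \<beta>]
    have "hopf_isomorphic k (CP \<alpha>) (CP \<beta>) \<longleftrightarrow> hopf_isomorphic k (AH \<alpha>) (AH \<beta>)"
    proof
      assume "hopf_isomorphic k (CP \<alpha>) (CP \<beta>)"
      then show "hopf_isomorphic k (AH \<alpha>) (AH \<beta>)"
        using hopf_isomorphic_trans [OF h(3,1,4) hopf_isomorphic_sym [OF h(1,3) i(1)] hopf_isomorphic_trans [OF h(1,2,4) _ i(2)]]
        by blast
    next
      assume "hopf_isomorphic k (AH \<alpha>) (AH \<beta>)"
      then show "hopf_isomorphic k (CP \<alpha>) (CP \<beta>)"
        using hopf_isomorphic_trans [OF h(1,3,2) i(1) hopf_isomorphic_trans [OF h(3,4,2) _ hopf_isomorphic_sym [OF h(2,4) i(2)]]]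
        by blast
    qed
    then show "(CP \<alpha>, CP \<beta>) \<in> ?s \<longleftrightarrow> (\<alpha>, \<beta>) \<in> seq_equiv k p"
      using \<alpha> \<beta> c AH_isomorphic_iff [OF \<alpha> \<beta>] by blast
  qed
qed

end

theorem proposition4p3:
  fixes k :: "('k, 'm) ring_scheme" and p :: nat
  assumes "field k" and "ring_char k = p" and "p \<ge> 3"
  shows
    \<comment> \<open>(1)\<close>
    "(\<forall>\<alpha> \<in> fin_seqs k.
        hopf_algebra k (A_hopf k p \<alpha>) \<and>
        \<not> finite_dimensional k (A_hopf k p \<alpha>) \<and>
        primitive k (A_hopf k p \<alpha>) (A_gen k p \<alpha> GenY) \<and>
        group_like k (A_hopf k p \<alpha>) (A_gen k p \<alpha> Geng) \<and>
        skew_primitive k (A_hopf k p \<alpha>) (A_gen k p \<alpha> Geng) (A_gen k p \<alpha> Genx))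
     \<and> (\<forall>E :: ('k, 'e) hopf. hopf_algebra k E \<longrightarrow>
          ((\<exists>act f. (act, f) \<in> crossed_systems k (poly_hopf k) (H4 k) \<and>
              hopf_isomorphic k E (crossed_product k (poly_hopf k) (H4 k) act f))
           \<longleftrightarrow> (\<exists>\<alpha> \<in> fin_seqs k. hopf_isomorphic k E (A_hopf k p \<alpha>))))
     \<and> hopf_Aut k (tensor_hopf k (poly_hopf k) (H4 k)) \<cong> units_of k \<times>\<times> units_of k
     \<and> (\<forall>\<alpha> \<in> fin_seqs k - {\<lambda>i. \<zero>\<^bsub>k\<^esub>}.
          subgroup (G_set k p \<alpha>) (units_of k \<times>\<times> units_of k) \<and>
          hopf_Aut k (A_hopf k p \<alpha>) \<cong> (units_of k \<times>\<times> units_of k) \<lparr>carrier := G_set k p \<alpha>\<rparr>)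
     \<comment> \<open>(2)\<close>
     \<and> equiv (fin_seqs k) (seq_equiv k p)
     \<and> (\<exists>\<Phi>. bij_betw \<Phi> (Crp k (H4 k) (poly_hopf k)) (fin_seqs k // seq_equiv k p))
     \<comment> \<open>(3)\<close>
     \<and> (\<exists>\<Psi>. bij_betw \<Psi> (H2 k (H4 k) (poly_hopf k)) (fin_seqs k))"
proof -
  interpret char_field k p
    using assms by (simp add: char_field_def base_field_def char_field_axioms_def)
  show ?thesis
    using AH_hopf AH_infinite_dimensional AH_primitive AH_group_like AH_skew_primitive
      crossed_product_isomorphic_iff tensor_Aut G_set_subgroup AH_Aut seq_equiv_equiv Crp_bij H2_bij
    by blast
qed

end
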